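(* Let $c>0$ and let $G_n=G(n,c/n)$ be the binomial random graph on vertex set $\{1,\dots,n\}$ in which each of the $\binom{n}{2}$ possible edges is present independently with probability $c/n$. For every first order sentence $\phi$ in the language of graphs, let $p_c(\phi)=\lim_{n\to\infty}\mathbf{P}(G_n\models\phi)$ (this limit exists), let $L_c=\{p_c(\phi)\colon \phi \text{ a first order sentence}\}$, and let $\overline{L_c}$ be its closure in $[0,1]$. Let $c_0\approx 0.93$ be the unique positive solution of $$e^{\frac{c}{2}+\frac{c^2}{4}}\sqrt{1-c}=\frac12 .$$ Then for every $c>0$ the set $\overline{L_c}$ is a finite union of closed intervals. Moreover: (1) $\overline{L_c}=[0,1]$ for $c\ge c_0$; (2) $\overline{L_c}$ has at least one gap for $0<c<c_0$, i.e. there exist $a<b$ in $[0,1]$ with $\overline{L_c}\cap[a,b]=\emptyset$.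
   Context: The first order (FO) language of graphs is first order logic with a binary adjacency relation $E(x,y)$, assumed symmetric and antireflexive. A sentence is a FO formula without free variables; $G\models\phi$ means that $G$ satisfies $\phi$. *)

theory Defs
  imports "HOL-Probability.Probability"
begin

text \<open>Variables are named by natural numbers; the remaining connectives and the universal
  quantifier are definable from the ones given here.\<close>

datatype fo =
    Eq nat nat
  | Adj nat nat
  | Neg fo
  | Conj fo fo
  | Ex nat fo

fun free_vars :: "fo \<Rightarrow> nat set" where
  "free_vars (Eq x y) = {x, y}"
| "free_vars (Adj x y) = {x, y}"
| "free_vars (Neg \<phi>) = free_vars \<phi>"
| "free_vars (Conj \<phi> \<psi>) = free_vars \<phi> \<union> free_vars \<psi>"
| "free_vars (Ex x \<phi>) = free_vars \<phi> - {x}"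

definition sentence :: "fo \<Rightarrow> bool" where
  "sentence \<phi> \<longleftrightarrow> free_vars \<phi> = {}"

fun sat :: "'v set \<Rightarrow> ('v \<Rightarrow> 'v \<Rightarrow> bool) \<Rightarrow> (nat \<Rightarrow> 'v) \<Rightarrow> fo \<Rightarrow> bool" where
  "sat V R \<rho> (Eq x y) \<longleftrightarrow> \<rho> x = \<rho> y"
| "sat V R \<rho> (Adj x y) \<longleftrightarrow> R (\<rho> x) (\<rho> y)"
| "sat V R \<rho> (Neg \<phi>) \<longleftrightarrow> \<not> sat V R \<rho> \<phi>"
| "sat V R \<rho> (Conj \<phi> \<psi>) \<longleftrightarrow> sat V R \<rho> \<phi> \<and> sat V R \<rho> \<psi>"
| "sat V R \<rho> (Ex x \<phi>) \<longleftrightarrow> (\<exists>v\<in>V. sat V R (\<rho>(x := v)) \<phi>)"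

text \<open>A graph is given by its vertex set and its set of edges, an edge being a two-element set of
  vertices; the induced adjacency relation is then symmetric and irreflexive. For a sentence the
  assignment is irrelevant, so quantifying over all of them does not affect the meaning.\<close>

definition models :: "'v set \<Rightarrow> 'v set set \<Rightarrow> fo \<Rightarrow> bool" where
  "models V E \<phi> \<longleftrightarrow> (\<forall>\<rho>. sat V (\<lambda>u v. {u, v} \<in> E) \<rho> \<phi>)"

definition potential_edges :: "nat \<Rightarrow> nat set set" where
  "potential_edges n = {e. e \<subseteq> {1..n} \<and> card e = 2}"

text \<open>The distribution of the edge set of $G(n,p)$. The parameter of \<^const>\<open>bernoulli_pmf\<close> is
  truncated to $[0,1]$, which for $p = c/n$ matters only for the finitely many $n < c$.\<close>

definition random_graph :: "nat \<Rightarrow> real \<Rightarrow> nat set set pmf" where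
  "random_graph n p =
     map_pmf (\<lambda>f. {e. f e}) (Pi_pmf (potential_edges n) False (\<lambda>_. bernoulli_pmf p))"

definition prob_models :: "real \<Rightarrow> fo \<Rightarrow> nat \<Rightarrow> real" where
  "prob_models c \<phi> n =
     measure_pmf.prob (random_graph n (c / real n)) {E. models {1..n} E \<phi>}"

definition limit_prob :: "real \<Rightarrow> fo \<Rightarrow> real" where
  "limit_prob c \<phi> = lim (prob_models c \<phi>)"

definition limit_probs :: "real \<Rightarrow> real set" where
  "limit_probs c = {limit_prob c \<phi> |\<phi>. sentence \<phi>}"

text \<open>In HOL the square root of a negative real is negative, so no spurious solutions arise
  for arguments above 1.\<close>

definition threshold_eq :: "real \<Rightarrow> bool" where
  "threshold_eq c \<longleftrightarrow> exp (c / 2 + c\<^sup>2 / 4) * sqrt (1 - c) = 1 / 2"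

definition c\<^sub>0 :: real where
  "c\<^sub>0 = (THE c. 0 < c \<and> threshold_eq c)"

definition finite_union_closed_intervals :: "real set \<Rightarrow> bool" where
  "finite_union_closed_intervals S \<longleftrightarrow>
     (\<exists>\<I>. finite \<I> \<and> (\<forall>I\<in>\<I>. \<exists>a b. a < b \<and> I = {a..b}) \<and> S = \<Union>\<I>)"

end

theory Submission
  imports Defs
begin

text \<open>Fix \<open>K\<close> and \<open>r\<close> and call the graph induced on the vertices within distance \<open>r\<close> of the circuits
  of length at most \<open>K\<close> the core. With high probability the core is a disjoint union of unicyclic
  graphs, all bounded neighbourhoods away from it are trees, and every bounded tree occurs many times;
  hence an Ehrenfeucht--Fraisse argument shows that a sentence is decided by the isomorphism type of
  the core for suitable \<open>K\<close> and \<open>r\<close>. Conversely every isomorphism type of a core is defined by a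
  sentence. The number of short circuits is asymptotically Poisson, and each core has a limiting
  probability; tightness makes these add up to 1.

  For \<open>c \<ge> 1\<close> the Poisson means are unbounded in \<open>K\<close>, so all atoms become small and finite unions of
  them are dense in \<open>[0, 1]\<close>. For \<open>c < 1\<close> letting \<open>K\<close> and \<open>r\<close> grow gives a discrete limit law on
  disjoint unions of unicyclic graphs \<open>H\<close>: an isomorphism class on \<open>m\<close> vertices has weight
  \<open>p x\<^sup>m / |Aut H|\<close> with \<open>x = c e\<^sup>-\<^sup>c\<close> and \<open>p = e\<^bsup>c/2 + c\<^sup>2/4\<^esup> \<surd>(1 - c)\<close>, and the closure of the limit
  probabilities is the set of all subset sums of these weights. Kakeya's condition, that a weight is at
  most the sum of the smaller ones, holds for all but finitely many weights, and for all of them iff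
  \<open>p \<le> 1 / 2\<close>; if \<open>p > 1 / 2\<close>, the empty graph leaves a gap around \<open>1 / 2\<close>.\<close>

section \<open>Neighbourhoods, circuits and cores\<close>

text \<open>Circuits are defined by edge density instead of closed walks because every event to be
  excluded then has one form, a bounded vertex set with too many edges, and a single first moment
  bound disposes of all of them. The obstacle is the order of limits. A sentence sees the core only
  for fixed \<open>K\<close> and \<open>r\<close>, so the number of vertices goes to infinity first,
  the core size is truncated by Markov's inequality, and \<open>K\<close> and \<open>r\<close> grow
  only afterwards, in the limit law. For \<open>c < 1\<close> this works because
  \<open>tail_const\<close> is at most \<open>1 / (1 - c)\<^sup>2\<close> uniformly in both. For the
  same reason finite sums of limiting weights are only shown to lie in the closure. The number of
  unicyclic unions on m vertices is never computed. Kakeya's condition uses only that this number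
  divided by m! is nondecreasing from m = 1 on and unbounded. Unboundedness comes from varying c:
  the weights sum to 1 for every c < 1 and x stays at most 1/e, while p tends to 0 as c tends to 1.
  If p \<le> 1/2, monotonicity reduces the condition to the level of the empty graph, where it reads
  p \<le> 1 - p.\<close>

definition pairs :: "'a set \<Rightarrow> 'a set set" where
  "pairs V = {e. e \<subseteq> V \<and> card e = 2}"

definition induced :: "'a set set \<Rightarrow> 'a set \<Rightarrow> 'a set set" where
  "induced E S = {e \<in> E. e \<subseteq> S}"

definition simple :: "'a set set \<Rightarrow> bool" where
  "simple E \<longleftrightarrow> (\<forall>e\<in>E. card e = 2)"

abbreviation img :: "('a \<Rightarrow> 'b) \<Rightarrow> 'a set set \<Rightarrow> 'b set set" where
  "img f E \<equiv> (`) f ` E"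

text \<open>In a simple graph the sets satisfying this predicate are the vertex sets of the induced
  cycles: minimality forces every vertex to have degree two.\<close>

definition circuit :: "'a set set \<Rightarrow> 'a set \<Rightarrow> bool" where
  "circuit E S \<longleftrightarrow> finite S \<and> S \<noteq> {} \<and> card S \<le> card (induced E S) \<and>
     (\<forall>T. T \<subset> S \<and> T \<noteq> {} \<longrightarrow> card (induced E T) < card T)"

definition short_circuits :: "nat \<Rightarrow> 'a set set \<Rightarrow> 'a set set" where
  "short_circuits K E = {S. circuit E S \<and> card S \<le> K}"

definition cyc :: "nat \<Rightarrow> 'a set set \<Rightarrow> 'a set" where
  "cyc K E = \<Union>(short_circuits K E)"

primrec nbhd :: "'a set set \<Rightarrow> nat \<Rightarrow> 'a set \<Rightarrow> 'a set" where
  "nbhd E 0 S = S"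
| "nbhd E (Suc k) S = nbhd E k S \<union> {v. \<exists>u\<in>nbhd E k S. {u, v} \<in> E}"

definition core_verts :: "nat \<Rightarrow> nat \<Rightarrow> 'a set set \<Rightarrow> 'a set" where
  "core_verts K r E = nbhd E r (cyc K E)"

definition core :: "nat \<Rightarrow> nat \<Rightarrow> 'a set set \<Rightarrow> 'a set set" where
  "core K r E = induced E (core_verts K r E)"

lemma potential_edges_eq_pairs: "potential_edges n = pairs {1..n}"
  by (simp add: potential_edges_def pairs_def)

lemma finite_pairs [simp]: "finite V \<Longrightarrow> finite (pairs V)"
  by (rule finite_subset[of _ "Pow V"]) (auto simp: pairs_def)

lemma card_pairs: "finite V \<Longrightarrow> card (pairs V) = card V choose 2"
  unfolding pairs_def using n_subsets by blast

lemma simple_pairs: "E \<subseteq> pairs V \<Longrightarrow> simple E"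
  by (auto simp: simple_def pairs_def)

lemma simple_induced: "simple E \<Longrightarrow> simple (induced E S)"
  by (auto simp: simple_def induced_def)

lemma finite_induced [simp]: "finite S \<Longrightarrow> finite (induced E S)"
  by (rule finite_subset[of _ "Pow S"]) (auto simp: induced_def)

lemma induced_induced: "S \<subseteq> W \<Longrightarrow> induced (induced E W) S = induced E S"
  by (auto simp: induced_def)

lemma induced_empty: "simple E \<Longrightarrow> induced E {} = {}"
  by (auto simp: induced_def simple_def)

lemma induced_all: "E \<subseteq> pairs V \<Longrightarrow> induced E V = E"
  by (auto simp: induced_def pairs_def)

lemma induced_eq_Int_pairs: "simple E \<Longrightarrow> induced E W = E \<inter> pairs W"
  by (auto simp: induced_def simple_def pairs_def)

lemma induced_pairs: "simple E \<Longrightarrow> induced E W \<subseteq> pairs W"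
  by (auto simp: induced_def simple_def pairs_def)

lemma simple_edge_neq: "simple E \<Longrightarrow> {u, v} \<in> E \<Longrightarrow> u \<noteq> v"
  by (auto simp: simple_def)

section \<open>Relabelling vertices\<close>

lemma inj_image: "bij f \<Longrightarrow> inj ((`) f)"
  by (simp add: bij_def inj_on_def inj_image_eq_iff)

lemma card_img: "bij f \<Longrightarrow> card (img f E) = card E"
  by (meson card_image inj_image inj_on_subset subset_UNIV)

lemma card_image_bij: "bij f \<Longrightarrow> card (f ` S) = card S"
  by (meson bij_def card_image inj_on_subset subset_UNIV)

lemma img_mem_iff: "bij f \<Longrightarrow> f ` e \<in> img f E \<longleftrightarrow> e \<in> E"
  by (simp add: inj_image inj_image_mem_iff)

lemma img_pair_mem_iff: "bij f \<Longrightarrow> {f u, f v} \<in> img f E \<longleftrightarrow> {u, v} \<in> E"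
  using img_mem_iff[of f "{u, v}" E] by simp

lemma img_induced: "bij f \<Longrightarrow> induced (img f E) (f ` S) = img f (induced E S)"
  unfolding induced_def by (auto simp: bij_def inj_image_subset_iff)

lemma img_pairs: "bij f \<Longrightarrow> img f (pairs V) = pairs (f ` V)"
proof -
  assume f: "bij f"
  have "e \<in> img f (pairs V)" if e: "e \<in> pairs (f ` V)" for e
  proof -
    obtain T where "T \<subseteq> V" "e = f ` T"
      using e by (metis (no_types, lifting) pairs_def mem_Collect_eq subset_imageE)
    then show ?thesis using e f by (auto simp: pairs_def card_image_bij)
  qed
  then show ?thesis using f by (auto simp: pairs_def card_image_bij)
qed

lemma img_subset_pairs: "bij f \<Longrightarrow> img f E \<subseteq> pairs (f ` V) \<longleftrightarrow> E \<subseteq> pairs V"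
  by (metis img_pairs inj_image inj_image_subset_iff)

lemma img_id: "img id E = E"
  by simp

lemma img_comp: "img (g \<circ> f) E = img g (img f E)"
  by (auto simp: image_comp)

lemma img_inv: "bij f \<Longrightarrow> img (inv f) (img f E) = E"
  unfolding image_image by (simp add: bij_def image_inv_f_f)

lemma inv_image_bij: "bij f \<Longrightarrow> inv f ` (f ` S) = S"
  by (simp add: bij_def image_inv_f_f)

lemma circuit_img_aux:
  assumes f: "bij f" and c: "circuit E S"
  shows "circuit (img f E) (f ` S)"
  unfolding circuit_def
proof (intro conjI allI impI)
  fix T assume T: "T \<subset> f ` S \<and> T \<noteq> {}"
  then obtain T' where T': "T' \<subseteq> S" "T = f ` T'" by (auto simp: subset_image_iff psubset_eq)
  with T have "T' \<subset> S" "T' \<noteq> {}" by auto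
  with c have "card (induced E T') < card T'" by (auto simp: circuit_def)
  then show "card (induced (img f E) T) < card T"
    using f T' by (simp add: img_induced card_img card_image_bij)
qed (use assms in \<open>auto simp: circuit_def img_induced card_img card_image_bij\<close>)

lemma circuit_img: "bij f \<Longrightarrow> circuit (img f E) (f ` S) \<longleftrightarrow> circuit E S"
  using circuit_img_aux[of f E S] circuit_img_aux[of "inv f" "img f E" "f ` S"]
  by (auto simp: img_inv inv_image_bij bij_imp_bij_inv)

lemma short_circuits_img:
  assumes f: "bij f"
  shows "short_circuits K (img f E) = img f (short_circuits K E)"
proof -
  have "S \<in> img f (short_circuits K E)" if "S \<in> short_circuits K (img f E)" for S
  proof -
    have S: "S = f ` (inv f ` S)" using f by (simp add: bij_def image_f_inv_f)
    then have "inv f ` S \<in> short_circuits K E"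
      using that circuit_img[OF f, of E "inv f ` S"] card_image_bij[OF f, of "inv f ` S"]
      by (simp add: short_circuits_def)
    then show ?thesis using S by blast
  qed
  then show ?thesis
    using f by (auto simp: short_circuits_def circuit_img card_image_bij)
qed

lemma cyc_img: "bij f \<Longrightarrow> cyc K (img f E) = f ` cyc K E"
  by (simp add: cyc_def short_circuits_img image_Union)

lemma nbhd_img: "bij f \<Longrightarrow> nbhd (img f E) k (f ` S) = f ` nbhd E k S"
proof (induction k)
  case (Suc k)
  have "{v. \<exists>u\<in>f ` nbhd E k S. {u, v} \<in> img f E} = f ` {v. \<exists>u\<in>nbhd E k S. {u, v} \<in> E}"
  proof (intro set_eqI iffI)
    fix v assume "v \<in> {v. \<exists>u\<in>f ` nbhd E k S. {u, v} \<in> img f E}"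
    then obtain u where u: "u \<in> nbhd E k S" "{f u, v} \<in> img f E" by auto
    obtain v' where "v = f v'" using Suc.prems by (metis bij_pointE)
    with u Suc.prems show "v \<in> f ` {v. \<exists>u\<in>nbhd E k S. {u, v} \<in> E}"
      by (auto simp: img_pair_mem_iff)
  qed (use Suc.prems in \<open>auto simp: img_pair_mem_iff\<close>)
  with Suc show ?case by (simp add: image_Un)
qed simp

lemma core_verts_img: "bij f \<Longrightarrow> core_verts K r (img f E) = f ` core_verts K r E"
  by (simp add: core_verts_def cyc_img nbhd_img)

section \<open>Locality of balls, circuits and cores\<close>

lemma nbhd_mono: "S \<subseteq> T \<Longrightarrow> nbhd E k S \<subseteq> nbhd E k T"
  by (induction k) auto

lemma nbhd_mono_edges: "E \<subseteq> F \<Longrightarrow> nbhd E k S \<subseteq> nbhd F k S"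
  by (induction k) auto

lemma nbhd_increasing: "j \<le> k \<Longrightarrow> nbhd E j S \<subseteq> nbhd E k S"
  by (rule lift_Suc_mono_le[of "\<lambda>k. nbhd E k S"]) auto

lemma subset_nbhd: "S \<subseteq> nbhd E k S"
  using nbhd_increasing[of 0 k E S] by simp

lemma nbhd_Un: "nbhd E k (S \<union> T) = nbhd E k S \<union> nbhd E k T"
  by (induction k) auto

lemma nbhd_empty [simp]: "nbhd E k {} = {}"
  by (induction k) auto

lemma nbhd_add: "nbhd E (j + k) S = nbhd E j (nbhd E k S)"
  by (induction j) auto

lemma nbhd_sym:
  assumes "v \<in> nbhd E k S"
  shows "\<exists>u\<in>S. u \<in> nbhd E k {v}"
  using assms
proof (induction k arbitrary: v)
  case (Suc k)
  show ?case
  proof (cases "v \<in> nbhd E k S")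
    case True
    then show ?thesis using Suc.IH[of v] by auto
  next
    case False
    with Suc.prems obtain w where w: "w \<in> nbhd E k S" "{w, v} \<in> E" by auto
    from Suc.IH[OF w(1)] obtain u where u: "u \<in> S" "u \<in> nbhd E k {w}" by blast
    have "{w} \<subseteq> nbhd E 1 {v}" using w(2) by (auto simp: insert_commute)
    then have "nbhd E k {w} \<subseteq> nbhd E k (nbhd E 1 {v})" by (rule nbhd_mono)
    then show ?thesis using u nbhd_add[of E k 1 "{v}"] by auto
  qed
qed auto

lemma nbhd_subset_verts: "S \<subseteq> V \<Longrightarrow> E \<subseteq> pairs V \<Longrightarrow> nbhd E k S \<subseteq> V"
  by (induction k) (auto simp: pairs_def)

lemma nbhd_induced: "nbhd E k S \<subseteq> W \<Longrightarrow> nbhd (induced E W) k S = nbhd E k S"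
proof (induction k)
  case (Suc k)
  then have IH: "nbhd (induced E W) k S = nbhd E k S" by auto
  have "{u, v} \<in> induced E W \<longleftrightarrow> {u, v} \<in> E" if "u \<in> nbhd E k S" for u v
    using Suc.prems that by (auto simp: induced_def)
  with IH show ?case by auto
qed simp

lemma nbhd_closed:
  assumes "\<And>u v. u \<in> W \<Longrightarrow> {u, v} \<in> E \<Longrightarrow> v \<in> W" "S \<subseteq> W"
  shows "nbhd E k S \<subseteq> W"
proof (induction k)
  case (Suc k)
  have "v \<in> W" if v: "v \<in> nbhd E (Suc k) S" for v
  proof (cases "v \<in> nbhd E k S")
    case True
    then show ?thesis by (rule subsetD[OF Suc.IH])
  next
    case False
    with v obtain u where "u \<in> nbhd E k S" "{u, v} \<in> E" by auto
    then show ?thesis by (intro assms(1)[of u v] subsetD[OF Suc.IH])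
  qed
  then show ?case by (rule subsetI)
qed (use assms(2) in simp)

text \<open>Vertices of \<open>S\<close> lying on no edge could be dropped without losing an edge,
  against minimality.\<close>

lemma circuit_subset:
  assumes "simple E" "circuit E S"
  shows "S \<subseteq> \<Union>E"
proof (rule ccontr)
  assume "\<not> S \<subseteq> \<Union>E"
  then have T: "S \<inter> \<Union>E \<subset> S" by auto
  have eq: "induced E (S \<inter> \<Union>E) = induced E S" by (auto simp: induced_def)
  have "finite S" using assms(2) by (simp add: circuit_def)
  then have "card (S \<inter> \<Union>E) < card S" using T by (rule psubset_card_mono)
  moreover have "card (induced E S) \<ge> card S" using assms(2) by (simp add: circuit_def)
  ultimately show False
  proof (cases "S \<inter> \<Union>E = {}")
    case True
    then have "induced E S = {}" using eq induced_empty[OF assms(1)] by simp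
    then have "card S = 0" using assms(2) by (simp add: circuit_def)
    then show False using assms(2) \<open>finite S\<close> by (simp add: circuit_def)
  next
    case False
    then have "card (induced E (S \<inter> \<Union>E)) < card (S \<inter> \<Union>E)" using T assms(2) by (simp add: circuit_def)
    then show False using eq \<open>card (S \<inter> \<Union>E) < card S\<close> \<open>card (induced E S) \<ge> card S\<close> by simp
  qed
qed

lemma circuit_induced: "S \<subseteq> W \<Longrightarrow> circuit (induced E W) S \<longleftrightarrow> circuit E S"
proof -
  assume S: "S \<subseteq> W"
  have a: "induced (induced E W) T = induced E T" if "T \<subset> S" for T
    using that S by (intro induced_induced) auto
  have b: "induced (induced E W) S = induced E S"
    using S by (intro induced_induced)
  have "(T \<subset> S \<and> T \<noteq> {} \<longrightarrow> card (induced (induced E W) T) < card T) \<longleftrightarrow>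
      (T \<subset> S \<and> T \<noteq> {} \<longrightarrow> card (induced E T) < card T)" for T
    by (cases "T \<subset> S") (simp_all only: a simp_thms)
  then show ?thesis unfolding circuit_def b by presburger
qed

lemma short_circuits_induced:
  assumes "simple E"
  shows "short_circuits K (induced E W) = {S \<in> short_circuits K E. S \<subseteq> W}"
proof -
  have "S \<subseteq> W" if "circuit (induced E W) S" for S
    using circuit_subset[OF simple_induced[OF assms] that] by (auto simp: induced_def)
  then have "circuit (induced E W) S \<longleftrightarrow> circuit E S \<and> S \<subseteq> W" for S
    using circuit_induced[of S W E] by blast
  then show ?thesis by (auto simp: short_circuits_def)
qed

lemma cyc_subset_verts: "E \<subseteq> pairs V \<Longrightarrow> cyc K E \<subseteq> V"
proof -
  assume E: "E \<subseteq> pairs V"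
  then have "\<Union>E \<subseteq> V" by (auto simp: pairs_def)
  then show ?thesis
    using circuit_subset[OF simple_pairs[OF E]] unfolding cyc_def short_circuits_def by blast
qed

lemma short_circuits_subset_Pow: "E \<subseteq> pairs V \<Longrightarrow> short_circuits K E \<subseteq> Pow V"
  using cyc_subset_verts[of E V K] by (auto simp: cyc_def)

lemma finite_short_circuits: "E \<subseteq> pairs V \<Longrightarrow> finite V \<Longrightarrow> finite (short_circuits K E)"
  by (rule finite_subset[OF short_circuits_subset_Pow]) auto

lemma core_verts_subset: "E \<subseteq> pairs V \<Longrightarrow> core_verts K r E \<subseteq> V"
  by (simp add: core_verts_def cyc_subset_verts nbhd_subset_verts)

lemma cyc_mono: "K \<le> L \<Longrightarrow> cyc K E \<subseteq> cyc L E"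
  by (auto simp: cyc_def short_circuits_def)

lemma cyc_induced:
  assumes "simple E" "cyc K E \<subseteq> W"
  shows "cyc K (induced E W) = cyc K E"
proof -
  have "{S \<in> short_circuits K E. S \<subseteq> W} = short_circuits K E"
    using assms(2) by (auto simp: cyc_def)
  then show ?thesis by (simp add: cyc_def short_circuits_induced[OF assms(1)])
qed

text \<open>The short circuits and the balls around them survive the restriction to the core. Hence
  the edges of a core determine its vertices, and an isomorphism type of cores can be treated as a
  family of edge sets.\<close>

lemma core_verts_core:
  assumes "simple E"
  shows "core_verts K r (core K r E) = core_verts K r E"
proof -
  have "cyc K E \<subseteq> core_verts K r E" by (simp add: core_verts_def subset_nbhd)
  then have "cyc K (core K r E) = cyc K E" by (simp add: core_def cyc_induced assms)
  then have "core_verts K r (core K r E) = nbhd (core K r E) r (cyc K E)"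
    by (simp add: core_verts_def)
  also have "\<dots> = nbhd E r (cyc K E)"
    unfolding core_def by (rule nbhd_induced) (simp add: core_verts_def)
  finally show ?thesis by (simp add: core_verts_def)
qed

text \<open>The key to computing the law of the core: whether \<open>H\<close> is the core of \<open>E\<close> is decided by the
  edges meeting the interior of \<open>H\<close> or contained in \<open>W\<close>, up to the absence of further short
  circuits.\<close>

lemma core_eq_iff:
  assumes E: "simple E" and H: "core_verts K (Suc r) H = W"
  shows "core_verts K (Suc r) E = W \<and> core K (Suc r) E = H \<longleftrightarrow>
    induced E W = H \<and> (\<forall>u\<in>core_verts K r H. \<forall>v. {u, v} \<in> E \<longrightarrow> v \<in> W) \<and>
    (\<forall>S\<in>short_circuits K E. S \<subseteq> W)"
proof
  assume L: "core_verts K (Suc r) E = W \<and> core K (Suc r) E = H"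
  have 1: "induced E W = H" using L by (auto simp: core_def)
  have 2: "cyc K E \<subseteq> W" using L subset_nbhd[of "cyc K E" E "Suc r"] by (auto simp: core_verts_def)
  then have c: "cyc K H = cyc K E" using cyc_induced[OF E] 1 by blast
  have "nbhd E r (cyc K E) \<subseteq> W" using L unfolding core_verts_def by auto
  then have "nbhd H r (cyc K H) = nbhd E r (cyc K E)" using nbhd_induced[of E r "cyc K E" W] 1 c by simp
  then show "induced E W = H \<and> (\<forall>u\<in>core_verts K r H. \<forall>v. {u, v} \<in> E \<longrightarrow> v \<in> W) \<and>
    (\<forall>S\<in>short_circuits K E. S \<subseteq> W)"
    using 1 2 L unfolding core_verts_def cyc_def by auto
next
  assume R: "induced E W = H \<and> (\<forall>u\<in>core_verts K r H. \<forall>v. {u, v} \<in> E \<longrightarrow> v \<in> W) \<and>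
    (\<forall>S\<in>short_circuits K E. S \<subseteq> W)"
  have c: "cyc K H = cyc K E" using cyc_induced[OF E, of K W] R by (simp add: cyc_def Sup_le_iff)
  \<comment> \<open>Edges of \<open>E\<close> at interior vertices stay in \<open>W\<close>, so the
    balls of \<open>E\<close> and of \<open>H\<close> grow alike. Controlling vertices at distance
    at most \<open>r\<close> already determines the ball of radius \<open>Suc r\<close>.\<close>
  have n: "nbhd E k (cyc K E) = nbhd H k (cyc K E)" if "k \<le> Suc r" for k
    using that
  proof (induction k)
    case (Suc k)
    have sub: "nbhd H k (cyc K E) \<subseteq> nbhd H r (cyc K E)" using Suc.prems by (intro nbhd_increasing) auto
    have W: "nbhd H r (cyc K E) \<subseteq> W" using H c unfolding core_verts_def by auto
    have "{u, v} \<in> E \<longleftrightarrow> {u, v} \<in> H" if u: "u \<in> nbhd H k (cyc K E)" for u v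
    proof
      assume e: "{u, v} \<in> E"
      have "u \<in> core_verts K r H" using u sub c by (auto simp: core_verts_def)
      then have "v \<in> W" "u \<in> W" using R e W u sub by blast+
      then show "{u, v} \<in> H" using R e by (auto simp: induced_def)
    qed (use R in \<open>auto simp: induced_def\<close>)
    with Suc show ?case by auto
  qed simp
  have "core_verts K (Suc r) E = W" using n[of "Suc r"] H c by (simp add: core_verts_def)
  with R show "core_verts K (Suc r) E = W \<and> core K (Suc r) E = H" by (simp add: core_def)
qed

section \<open>Edge density of circuits and cores\<close>

text \<open>Supermodularity of the edge count: the gain consists of the edges between the two
  differences.\<close>

lemma card_induced_Un:
  assumes "finite A" "finite B"
  shows "card (induced E A) + card (induced E B) \<le> card (induced E (A \<union> B)) + card (induced E (A \<inter> B))"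
proof -
  have "card (induced E A) + card (induced E B) =
      card (induced E A \<union> induced E B) + card (induced E A \<inter> induced E B)"
    by (intro card_Un_Int finite_induced assms)
  moreover have "induced E A \<inter> induced E B = induced E (A \<inter> B)" by (auto simp: induced_def)
  moreover have "card (induced E A \<union> induced E B) \<le> card (induced E (A \<union> B))"
    using assms by (intro card_mono) (auto simp: induced_def)
  ultimately show ?thesis by simp
qed

text \<open>When a circuit \<open>M\<close> not contained in the union is added, the overlap is a
  proper subset of \<open>M\<close>. By minimality it spans no more edges than it has vertices, and
  supermodularity preserves the balance.\<close>

lemma card_Union_circuits_le:
  assumes "simple E" "finite \<S>" "\<And>S. S \<in> \<S> \<Longrightarrow> circuit E S"
  shows "card (\<Union>\<S>) \<le> card (induced E (\<Union>\<S>))"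
  using assms(2,3)
proof (induction \<S> rule: finite_induct)
  case (insert M \<S>)
  let ?A = "\<Union>\<S>"
  have IH: "card ?A \<le> card (induced E ?A)" and M: "circuit E M" using insert by auto
  have fin: "finite ?A" "finite M" using insert by (auto simp: circuit_def)
  have cM: "card M \<le> card (induced E M)" using M by (simp add: circuit_def)
  have "card (M \<union> ?A) \<le> card (induced E (M \<union> ?A))"
  proof (cases "M \<subseteq> ?A")
    case True
    then show ?thesis using IH by (simp add: Un_absorb1)
  next
    case False
    have "card (induced E (M \<inter> ?A)) \<le> card (M \<inter> ?A)"
    proof (cases "M \<inter> ?A = {}")
      case True
      then show ?thesis by (simp add: induced_empty assms(1))
    next
      case nonempty: False
      moreover have "M \<inter> ?A \<subset> M" using False by auto
      ultimately have "card (induced E (M \<inter> ?A)) < card (M \<inter> ?A)" using M by (simp add: circuit_def)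
      then show ?thesis by simp
    qed
    moreover have "card M + card ?A = card (M \<union> ?A) + card (M \<inter> ?A)"
      by (rule card_Un_Int[OF fin(2,1)])
    moreover note card_induced_Un[OF fin(2,1), of E]
    ultimately show ?thesis using IH cM by linarith
  qed
  then show ?case by simp
qed (simp add: induced_empty assms(1))

text \<open>Each vertex of the next layer brings its own edge into the previous ball.\<close>

lemma card_nbhd_le:
  assumes "simple E" "finite (nbhd E k S)" "card S \<le> card (induced E S)"
  shows "card (nbhd E k S) \<le> card (induced E (nbhd E k S))"
  using assms(2)
proof (induction k)
  case (Suc k)
  let ?B = "nbhd E k S" and ?B' = "nbhd E (Suc k) S"
  have finB: "finite ?B" "finite ?B'" using Suc.prems by auto
  have IH: "card ?B \<le> card (induced E ?B)" using Suc finB by auto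
  have "\<exists>u. u \<in> ?B \<and> {u, v} \<in> E" if "v \<in> ?B' - ?B" for v using that by auto
  then obtain u where u: "\<And>v. v \<in> ?B' - ?B \<Longrightarrow> u v \<in> ?B \<and> {u v, v} \<in> E" by metis
  let ?g = "\<lambda>v. {u v, v}"
  have "inj_on ?g (?B' - ?B)"
  proof (rule inj_onI)
    fix v w assume vw: "v \<in> ?B' - ?B" "w \<in> ?B' - ?B" "{u v, v} = {u w, w}"
    then show "v = w" using u[of v] u[of w] by (auto simp: doubleton_eq_iff)
  qed
  then have c: "card (?g ` (?B' - ?B)) = card (?B' - ?B)" by (rule card_image)
  have "?g ` (?B' - ?B) \<inter> induced E ?B = {}" by (auto simp: induced_def)
  then have "card (?g ` (?B' - ?B) \<union> induced E ?B) = card (?B' - ?B) + card (induced E ?B)"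
    using c finB by (subst card_Un_disjoint) auto
  moreover have "card (?g ` (?B' - ?B) \<union> induced E ?B) \<le> card (induced E ?B')"
  proof (rule card_mono)
    show "?g ` (?B' - ?B) \<union> induced E ?B \<subseteq> induced E ?B'"
      using u by (auto simp: induced_def)
  qed (use finB in simp)
  moreover have "card ?B' = card (?B' - ?B) + card ?B"
  proof -
    have "?B \<subseteq> ?B'" by auto
    then show ?thesis using finB by (metis card_Diff_subset card_mono le_add_diff_inverse2)
  qed
  ultimately show ?case using IH by linarith
qed (use assms in simp)

text \<open>One half of the equality of vertex and edge numbers in a core. The other half fails only
  on an event of vanishing probability.\<close>

lemma card_core_verts_le:
  assumes "E \<subseteq> pairs V" "finite V"
  shows "card (core_verts K r E) \<le> card (core K r E)"
proof -
  have "finite (core_verts K r E)" using core_verts_subset[OF assms(1)] assms(2) finite_subset by blast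
  then show ?thesis
    using card_nbhd_le[OF simple_pairs[OF assms(1)], of r "cyc K E"]
      card_Union_circuits_le[OF simple_pairs[OF assms(1)] finite_short_circuits[OF assms, of K]]
    by (simp add: core_def core_verts_def cyc_def short_circuits_def)
qed

text \<open>Descent to a minimal nonempty subset of this density.\<close>

lemma dense_contains_circuit:
  assumes "finite S" "S \<noteq> {}" "card S \<le> card (induced E S)"
  shows "\<exists>T\<subseteq>S. circuit E T"
  using assms
proof (induction "card S" arbitrary: S rule: less_induct)
  case less
  show ?case
  proof (cases "circuit E S")
    case False
    then obtain T where T: "T \<subset> S" "T \<noteq> {}" "card T \<le> card (induced E T)"
      using less.prems by (auto simp: circuit_def not_less)
    then have "card T < card S" using less.prems by (auto intro: psubset_card_mono)
    then obtain U where "U \<subseteq> T" "circuit E U" using less.hyps[of T] T less.prems finite_subset by blast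
    then show ?thesis using T by blast
  qed auto
qed

text \<open>Only bijections of the whole vertex type are used as isomorphisms; on a countably infinite
  type every bijection between finite sets extends to one.\<close>

lemma extend_to_bij:
  fixes g :: "nat \<Rightarrow> nat"
  assumes "finite A" "inj_on g A"
  shows "\<exists>f. bij f \<and> (\<forall>x\<in>A. f x = g x)"
proof -
  have "infinite (- A)" "infinite (- (g ` A))" using assms by (auto simp: finite_compl)
  then have "bij_betw (to_nat_on (- A)) (- A) UNIV"
    and "bij_betw (from_nat_into (- (g ` A))) UNIV (- (g ` A))"
    by (auto intro: to_nat_on_infinite bij_betw_from_nat_into)
  then obtain h where h: "bij_betw h (- A) (- (g ` A))"
    using bij_betw_trans by blast
  let ?f = "\<lambda>x. if x \<in> A then g x else h x"
  have "bij_betw ?f (A \<union> - A) (g ` A \<union> - (g ` A))"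
  proof (rule bij_betw_combine)
    show "bij_betw ?f A (g ` A)" using assms(2) by (simp add: bij_betw_def inj_on_def)
    show "bij_betw ?f (- A) (- (g ` A))" using h by (rule bij_betw_cong[THEN iffD1, rotated]) auto
  qed auto
  then have "bij ?f" by simp
  then show ?thesis by (intro exI[of _ ?f]) auto
qed

lemma ex_bij_image:
  fixes A B :: "nat set"
  assumes "finite A" "finite B" "card A = card B"
  shows "\<exists>f. bij f \<and> f ` A = B"
proof -
  obtain g where g: "bij_betw g A B" using assms finite_same_card_bij by blast
  obtain f where "bij f" "\<forall>x\<in>A. f x = g x"
    using extend_to_bij[OF assms(1)] g by (metis bij_betw_def)
  then show ?thesis using g by (metis bij_betw_def image_cong)
qed

section \<open>Local types and the Ehrenfeucht--Fraisse game\<close>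

definition eq_pattern :: "(nat \<rightharpoonup> 'a) \<Rightarrow> (nat \<times> nat) set" where
  "eq_pattern a = {(i, k). \<exists>u. a i = Some u \<and> a k = Some u}"

definition adj_pattern :: "'a set set \<Rightarrow> (nat \<rightharpoonup> 'a) \<Rightarrow> (nat \<times> nat) set" where
  "adj_pattern E a = {(i, k). \<exists>u v. a i = Some u \<and> a k = Some v \<and> {u, v} \<in> E}"

text \<open>The type of a tuple \<open>a\<close> for a game with \<open>j\<close> rounds left in which the move made when \<open>j\<close> rounds
  remain afterwards gets index \<open>j\<close> and must be played within distance \<open>2 ^ j\<close> of the base set \<open>S\<close> and
  of the earlier moves. Types are coded as natural numbers.\<close>

primrec lty :: "nat \<Rightarrow> 'a set set \<Rightarrow> 'a set \<Rightarrow> (nat \<rightharpoonup> 'a) \<Rightarrow> nat" where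
  "lty 0 E S a = prod_encode (set_encode (prod_encode ` eq_pattern a),
     set_encode (prod_encode ` adj_pattern E a))"
| "lty (Suc j) E S a = prod_encode (lty j E S a,
     set_encode ((\<lambda>b. lty j E S (a(j \<mapsto> b))) ` nbhd E (2 ^ j) (S \<union> ran a)))"

lemma eq_pattern_subset: "eq_pattern a \<subseteq> dom a \<times> dom a"
  by (auto simp: eq_pattern_def)

lemma adj_pattern_subset: "adj_pattern E a \<subseteq> dom a \<times> dom a"
  by (auto simp: adj_pattern_def)

text \<open>\<open>set_encode\<close> sends every infinite set to 0, so the coding is faithful only
  because the possible types form a finite set. Their number is bounded in terms of the positions in
  use, whatever the graph and the base set.\<close>

lemma finite_lty_values: "finite D \<Longrightarrow> finite {lty j E S a |E S a. dom a \<subseteq> D}"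
proof (induction j arbitrary: D)
  case 0
  have "{lty 0 E S a |(E :: 'a set set) S a. dom a \<subseteq> D} \<subseteq>
      (\<lambda>(X, Y). prod_encode (set_encode (prod_encode ` X), set_encode (prod_encode ` Y))) `
        (Pow (D \<times> D) \<times> Pow (D \<times> D))"
  proof
    fix x assume "x \<in> {lty 0 E S a |(E :: 'a set set) S a. dom a \<subseteq> D}"
    then obtain E :: "'a set set" and S a where x: "x = lty 0 E S a" "dom a \<subseteq> D" by blast
    have "eq_pattern a \<subseteq> D \<times> D" "adj_pattern E a \<subseteq> D \<times> D"
      using eq_pattern_subset[of a] adj_pattern_subset[of E a] x(2) by blast+
    then show "x \<in> (\<lambda>(X, Y). prod_encode (set_encode (prod_encode ` X), set_encode (prod_encode ` Y))) `
        (Pow (D \<times> D) \<times> Pow (D \<times> D))"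
      unfolding x(1) by (intro image_eqI[of _ _ "(eq_pattern a, adj_pattern E a)"]) auto
  qed
  moreover have "finite (Pow (D \<times> D) \<times> Pow (D \<times> D))" using 0 by simp
  ultimately show ?case using finite_surj by blast
next
  case (Suc j)
  let ?F = "{lty j E S a |(E :: 'a set set) S a. dom a \<subseteq> D}"
  let ?F' = "{lty j E S a |(E :: 'a set set) S a. dom a \<subseteq> insert j D}"
  have "{lty (Suc j) E S a |(E :: 'a set set) S a. dom a \<subseteq> D} \<subseteq>
      (\<lambda>(x, Y). prod_encode (x, set_encode Y)) ` (?F \<times> Pow ?F')"
  proof
    fix x assume "x \<in> {lty (Suc j) E S a |(E :: 'a set set) S a. dom a \<subseteq> D}"
    then obtain E :: "'a set set" and S a where x: "x = lty (Suc j) E S a" "dom a \<subseteq> D" by blast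
    let ?Y = "(\<lambda>b. lty j E S (a(j \<mapsto> b))) ` nbhd E (2 ^ j) (S \<union> ran a)"
    have "lty j E S (a(j \<mapsto> b)) \<in> ?F'" for b
    proof -
      have "dom (a(j \<mapsto> b)) \<subseteq> insert j D" using x(2) by auto
      then show ?thesis by blast
    qed
    then have "(lty j E S a, ?Y) \<in> ?F \<times> Pow ?F'" using x(2) by blast
    then show "x \<in> (\<lambda>(x, Y). prod_encode (x, set_encode Y)) ` (?F \<times> Pow ?F')"
      unfolding x(1) by (intro image_eqI[of _ _ "(lty j E S a, ?Y)"]) simp_all
  qed
  moreover have "finite (?F \<times> Pow ?F')" using Suc by simp
  ultimately show ?case using finite_surj by blast
qed

lemma finite_lty_image:
  fixes E :: "'a set set"
  assumes fin: "finite (dom a)"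
  shows "finite ((\<lambda>b. lty j E S (a(j \<mapsto> b))) ` B)"
proof (rule finite_subset)
  show "(\<lambda>b. lty j E S (a(j \<mapsto> b))) ` B \<subseteq>
      {lty j E S a' |(E :: 'a set set) S a'. dom a' \<subseteq> insert j (dom a)}"
  proof (rule image_subsetI)
    fix b
    have "dom (a(j \<mapsto> b)) \<subseteq> insert j (dom a)" by auto
    then show "lty j E S (a(j \<mapsto> b)) \<in>
      {lty j E S a' |(E :: 'a set set) S a'. dom a' \<subseteq> insert j (dom a)}" by blast
  qed
  show "finite {lty j E S a' |(E :: 'a set set) S a'. dom a' \<subseteq> insert j (dom a)}"
    by (rule finite_lty_values) (simp only: finite_insert fin)
qed

lemma lty_Suc_eq_iff:
  assumes "finite (dom a)" "finite (dom a')"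
  shows "lty (Suc j) E S a = lty (Suc j) E' S' a' \<longleftrightarrow> lty j E S a = lty j E' S' a' \<and>
    (\<lambda>b. lty j E S (a(j \<mapsto> b))) ` nbhd E (2 ^ j) (S \<union> ran a) =
    (\<lambda>b. lty j E' S' (a'(j \<mapsto> b))) ` nbhd E' (2 ^ j) (S' \<union> ran a')"
  unfolding lty.simps prod_encode_eq prod.inject
    set_encode_eq[OF finite_lty_image[OF assms(1)] finite_lty_image[OF assms(2)]] ..

lemma lty_0_eq_iff:
  assumes "finite (dom a)" "finite (dom a')"
  shows "lty 0 E S a = lty 0 E' S' a' \<longleftrightarrow>
    eq_pattern a = eq_pattern a' \<and> adj_pattern E a = adj_pattern E' a'"
proof -
  have "finite (eq_pattern a)" "finite (adj_pattern E a)" "finite (eq_pattern a')" "finite (adj_pattern E' a')"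
    by (rule finite_subset[OF eq_pattern_subset] finite_subset[OF adj_pattern_subset],
        intro finite_SigmaI assms)+
  then show ?thesis
    by (simp add: set_encode_eq inj_image_eq_iff[OF inj_prod_encode])
qed

lemma lty_eq_mono:
  assumes "lty j E S a = lty j E' S' a'" "i \<le> j" "finite (dom a)" "finite (dom a')"
  shows "lty i E S a = lty i E' S' a'"
  using assms(2,1)
proof (induction rule: dec_induct)
  case (step n)
  then show ?case unfolding lty_Suc_eq_iff[OF assms(3,4)] by simp
qed simp

lemma lty_eq_patterns:
  assumes "lty j E S a = lty j E' S' a'" "finite (dom a)" "finite (dom a')"
  shows "eq_pattern a = eq_pattern a'" "adj_pattern E a = adj_pattern E' a'"
  using lty_eq_mono[OF assms(1) le0 assms(2,3)] unfolding lty_0_eq_iff[OF assms(2,3)] by simp_all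

lemma eq_pattern_dom: "eq_pattern a = eq_pattern a' \<Longrightarrow> dom a = dom a'"
proof -
  assume "eq_pattern a = eq_pattern a'"
  then have "(i, i) \<in> eq_pattern a \<longleftrightarrow> (i, i) \<in> eq_pattern a'" for i by simp
  then show ?thesis by (auto simp: eq_pattern_def)
qed

lemma ran_upd_subset: "ran (a(j \<mapsto> b)) \<subseteq> insert b (ran a)"
  by (auto simp: ran_def)

lemma nbhd_upd_subset:
  assumes "b \<in> nbhd E d (S \<union> ran a)"
  shows "nbhd E k (S \<union> ran (a(j \<mapsto> b))) \<subseteq> nbhd E (k + d) (S \<union> ran a)"
proof -
  have "S \<union> ran (a(j \<mapsto> b)) \<subseteq> nbhd E d (S \<union> ran a)"
    using ran_upd_subset[of a j b] subset_nbhd[of "S \<union> ran a" E d] assms by blast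
  then show ?thesis unfolding nbhd_add by (rule nbhd_mono)
qed

text \<open>The moves of the remaining \<open>j\<close> rounds reach distances
  \<open>2 ^ (j - 1)\<close>, ..., \<open>2\<close>, \<open>1\<close> one after another, which add
  up to \<open>2 ^ j - 1\<close>.\<close>

lemma lty_induced:
  assumes "nbhd E (2 ^ j - 1) (S \<union> ran a) \<subseteq> W"
  shows "lty j (induced E W) S a = lty j E S a"
  using assms
proof (induction j arbitrary: a)
  case 0
  have "adj_pattern (induced E W) a = adj_pattern E a"
  proof -
    have "{u, v} \<in> induced E W \<longleftrightarrow> {u, v} \<in> E" if "a i = Some u" "a k = Some v" for i k u v
      using 0 that by (auto simp: induced_def ran_def)
    then show ?thesis unfolding adj_pattern_def by blast
  qed
  then show ?case by simp
next
  case (Suc j)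
  have pow: "2 ^ Suc j - 1 = (2 ^ j - 1) + (2 ^ j :: nat)" by simp
  have le: "2 ^ j \<le> 2 ^ Suc j - (1 :: nat)" "2 ^ j - 1 \<le> 2 ^ Suc j - (1 :: nat)"
    unfolding pow by simp_all
  have "nbhd E (2 ^ j) (S \<union> ran a) \<subseteq> W" by (rule subset_trans[OF nbhd_increasing[OF le(1)] Suc.prems])
  then have n: "nbhd (induced E W) (2 ^ j) (S \<union> ran a) = nbhd E (2 ^ j) (S \<union> ran a)"
    by (rule nbhd_induced)
  have "lty j (induced E W) S (a(j \<mapsto> b)) = lty j E S (a(j \<mapsto> b))"
    if "b \<in> nbhd E (2 ^ j) (S \<union> ran a)" for b
    using nbhd_upd_subset[OF that, of "2 ^ j - 1" j] Suc.prems
    unfolding pow by (intro Suc.IH) blast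
  moreover have "lty j (induced E W) S a = lty j E S a"
    by (rule Suc.IH[OF subset_trans[OF nbhd_increasing[OF le(2)] Suc.prems]])
  ultimately show ?case unfolding lty.simps n by (simp cong: image_cong)
qed

lemma lty_img:
  assumes f: "bij f"
  shows "lty j (img f E) (f ` S) (map_option f \<circ> a) = lty j E S a"
proof (induction j arbitrary: a)
  case 0
  have inj: "f u = f v \<longleftrightarrow> u = v" for u v using f by (simp add: bij_def inj_eq)
  have "eq_pattern (map_option f \<circ> a) = eq_pattern a"
    by (auto simp: eq_pattern_def inj)
  moreover have "adj_pattern F (map_option f \<circ> a) =
      {(i, k). \<exists>u v. a i = Some u \<and> a k = Some v \<and> {f u, f v} \<in> F}" for F
    by (auto simp: adj_pattern_def)
  then have "adj_pattern (img f E) (map_option f \<circ> a) = adj_pattern E a"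
    by (simp only: img_pair_mem_iff[OF f] adj_pattern_def)
  ultimately show ?case unfolding lty.simps by (simp only:)
next
  case (Suc j)
  have r: "f ` S \<union> ran (map_option f \<circ> a) = f ` (S \<union> ran a)"
    by (simp add: image_Un ran_map_option comp_def)
  have u: "(map_option f \<circ> a)(j \<mapsto> f b) = map_option f \<circ> (a(j \<mapsto> b))" for b by auto
  show ?case
    unfolding lty.simps r nbhd_img[OF f] image_image u Suc.IH ..
qed

lemma map_add_eq_Some_iff:
  "dom p \<inter> dom q = {} \<Longrightarrow> (p ++ q) i = Some u \<longleftrightarrow> p i = Some u \<or> q i = Some u"
  by (cases "p i"; cases "q i") (auto simp: map_add_def dom_def)

text \<open>Two tuples that are far apart are played independently: \<open>p\<close> near the base
  set, \<open>q\<close> with no base set at all. The required separation halves in every round,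
  since \<open>2 ^ Suc j = 2 ^ j + 2 ^ j\<close>: a move within \<open>2 ^ j\<close> of
  \<open>S\<close> and \<open>p\<close> still leaves distance \<open>2 ^ j\<close> to
  \<open>q\<close>, and a move near \<open>q\<close> stays away from \<open>S\<close> and
  \<open>p\<close>. The domain condition keeps the index \<open>j\<close> of the next move
  fresh.\<close>

lemma lty_compose:
  fixes E E' :: "'a set set" and p q p' q' :: "nat \<rightharpoonup> 'a"
  assumes "dom p \<inter> dom q = {}" "(dom p \<union> dom q) \<inter> {..<j} = {}"
    and "finite (dom p)" "finite (dom q)" "finite (dom p')" "finite (dom q')"
    and "ran q \<inter> nbhd E (2 ^ j) (S \<union> ran p) = {}" "ran q' \<inter> nbhd E' (2 ^ j) (S' \<union> ran p') = {}"
    and "lty j E S p = lty j E' S' p'" "lty j E {} q = lty j E' {} q'"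
  shows "lty j E S (p ++ q) = lty j E' S' (p' ++ q')"
  using assms
proof (induction j arbitrary: E S p q E' S' p' q')
  case (0 E S p q E' S' p' q')
  have pat: "eq_pattern p = eq_pattern p'" "adj_pattern E p = adj_pattern E' p'"
    "eq_pattern q = eq_pattern q'" "adj_pattern E q = adj_pattern E' q'"
    using lty_eq_patterns[OF 0(9) 0(3,5)] lty_eq_patterns[OF 0(10) 0(4,6)] by auto
  have dom: "dom p = dom p'" "dom q = dom q'" using pat eq_pattern_dom by blast+
  have cross: "u \<noteq> v \<and> {u, v} \<notin> E \<and> {v, u} \<notin> E"
    if "ran q \<inter> nbhd E (2 ^ 0) (S \<union> ran p) = {}" "p i = Some u" "q k = Some v"
    for E :: "'a set set" and S p q i k u v
  proof -
    have "u \<in> ran p" "v \<in> ran q" using that(2,3) by (auto simp: ran_def)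
    moreover from this have "v \<notin> nbhd E 1 (S \<union> ran p)" using that(1) by auto
    ultimately show ?thesis by (auto simp: insert_commute)
  qed
  have E1: "eq_pattern (p ++ q) = eq_pattern p \<union> eq_pattern q"
    if "dom p \<inter> dom q = {}" "ran q \<inter> nbhd E (2 ^ 0) (S \<union> ran p) = {}"
    for E :: "'a set set" and S p q
    unfolding eq_pattern_def map_add_eq_Some_iff[OF that(1)] using cross[OF that(2)] by blast
  have A1: "adj_pattern E (p ++ q) = adj_pattern E p \<union> adj_pattern E q"
    if "dom p \<inter> dom q = {}" "ran q \<inter> nbhd E (2 ^ 0) (S \<union> ran p) = {}"
    for E :: "'a set set" and S p q
    unfolding adj_pattern_def map_add_eq_Some_iff[OF that(1)] using cross[OF that(2)] by blast
  have E2: "eq_pattern (p' ++ q') = eq_pattern p' \<union> eq_pattern q'"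
    using E1[of p' q' E' S'] 0(1,8) dom by simp
  have A2: "adj_pattern E' (p' ++ q') = adj_pattern E' p' \<union> adj_pattern E' q'"
    using A1[of p' q' E' S'] 0(1,8) dom by simp
  show ?case unfolding lty.simps E1[OF 0(1,7)] A1[OF 0(1,7)] E2 A2 pat ..
next
  case (Suc j E S p q E' S' p' q')
  note prems = Suc.prems
  have dom: "dom p = dom p'" "dom q = dom q'"
    using lty_eq_patterns[OF prems(9) prems(3,5)] lty_eq_patterns[OF prems(10) prems(4,6)]
      eq_pattern_dom by blast+
  \<comment> \<open>Stated for arbitrary graphs and tuples, so that the reverse inclusion follows by
    exchanging the two sides.\<close>
  have incl: "(\<lambda>b. lty j E S ((p ++ q)(j \<mapsto> b))) ` nbhd E (2 ^ j) (S \<union> ran (p ++ q)) \<subseteq>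
      (\<lambda>b. lty j E' S' ((p' ++ q')(j \<mapsto> b))) ` nbhd E' (2 ^ j) (S' \<union> ran (p' ++ q'))"
    if h: "dom p \<inter> dom q = {}" "(dom p \<union> dom q) \<inter> {..<Suc j} = {}"
      "finite (dom p)" "finite (dom q)" "finite (dom p')" "finite (dom q')"
      "ran q \<inter> nbhd E (2 ^ Suc j) (S \<union> ran p) = {}"
      "ran q' \<inter> nbhd E' (2 ^ Suc j) (S' \<union> ran p') = {}"
      "lty (Suc j) E S p = lty (Suc j) E' S' p'" "lty (Suc j) E {} q = lty (Suc j) E' {} q'"
      "dom p = dom p'" "dom q = dom q'"
    for p q p' q' :: "nat \<rightharpoonup> 'a" and E S E' S'
  proof (rule image_subsetI)
    fix b assume b: "b \<in> nbhd E (2 ^ j) (S \<union> ran (p ++ q))"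
    have fin_upd: "finite (dom (x(j \<mapsto> y)))" if "finite (dom x)" for x :: "nat \<rightharpoonup> 'a" and y
      using that by (simp only: dom_fun_upd option.distinct if_False finite_insert)
    have j: "j \<notin> dom p" "j \<notin> dom q" using h(2) by auto
    have ind: "(insert j (dom p) \<union> dom q) \<inter> {..<j} = {}" "(dom p \<union> insert j (dom q)) \<inter> {..<j} = {}"
      using h(2) by (auto simp: less_Suc_eq)
    have rans: "ran (p ++ q) = ran p \<union> ran q" "ran (p' ++ q') = ran p' \<union> ran q'"
      using h(1,11,12) by (simp_all add: ran_map_add)
    have pow: "2 ^ Suc j = 2 ^ j + (2 ^ j :: nat)" by simp
    have sep: "ran q \<inter> nbhd E (2 ^ j) (S \<union> ran p) = {}" "ran q' \<inter> nbhd E' (2 ^ j) (S' \<union> ran p') = {}"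
      using h(7,8) nbhd_increasing[of "2 ^ j" "2 ^ Suc j" E "S \<union> ran p"]
        nbhd_increasing[of "2 ^ j" "2 ^ Suc j" E' "S' \<union> ran p'"] by auto
    have low: "lty j E S p = lty j E' S' p'" "lty j E {} q = lty j E' {} q'"
      using h(9,10) lty_Suc_eq_iff h(3-6) by blast+
    from b rans consider (p) "b \<in> nbhd E (2 ^ j) (S \<union> ran p)" | (q) "b \<in> nbhd E (2 ^ j) ({} \<union> ran q)"
      by (auto simp: nbhd_Un Un_assoc)
    then show "lty j E S ((p ++ q)(j \<mapsto> b)) \<in>
        (\<lambda>b. lty j E' S' ((p' ++ q')(j \<mapsto> b))) ` nbhd E' (2 ^ j) (S' \<union> ran (p' ++ q'))"
    proof cases
      case p
      then have "lty j E S (p(j \<mapsto> b)) \<in> (\<lambda>b. lty j E' S' (p'(j \<mapsto> b))) ` nbhd E' (2 ^ j) (S' \<union> ran p')"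
        using h(9) lty_Suc_eq_iff[OF h(3,5), of j E S E' S'] by blast
      then obtain b' where b': "b' \<in> nbhd E' (2 ^ j) (S' \<union> ran p')"
          "lty j E S (p(j \<mapsto> b)) = lty j E' S' (p'(j \<mapsto> b'))" by blast
      have "lty j E S (p(j \<mapsto> b) ++ q) = lty j E' S' (p'(j \<mapsto> b') ++ q')"
      proof (rule Suc.IH)
        show "ran q \<inter> nbhd E (2 ^ j) (S \<union> ran (p(j \<mapsto> b))) = {}"
          using nbhd_upd_subset[OF p, of "2 ^ j" j] h(7) unfolding pow by blast
        show "ran q' \<inter> nbhd E' (2 ^ j) (S' \<union> ran (p'(j \<mapsto> b'))) = {}"
          using nbhd_upd_subset[OF b'(1), of "2 ^ j" j] h(8) unfolding pow by blast
        show "dom (p(j \<mapsto> b)) \<inter> dom q = {}" using h(1) j by auto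
        show "(dom (p(j \<mapsto> b)) \<union> dom q) \<inter> {..<j} = {}" using ind(1) by simp
        show "lty j E S (p(j \<mapsto> b)) = lty j E' S' (p'(j \<mapsto> b'))" by (rule b'(2))
        show "lty j E {} q = lty j E' {} q'" by (rule low(2))
      qed (rule h fin_upd[OF h(3)] fin_upd[OF h(4)] fin_upd[OF h(5)] fin_upd[OF h(6)])+
      moreover have "p(j \<mapsto> b) ++ q = (p ++ q)(j \<mapsto> b)" "p'(j \<mapsto> b') ++ q' = (p' ++ q')(j \<mapsto> b')"
        using j(2) h(12) by (intro map_add_upd_left; simp only:)+
      ultimately have "lty j E S ((p ++ q)(j \<mapsto> b)) = lty j E' S' ((p' ++ q')(j \<mapsto> b'))" by (simp only:)
      moreover have "b' \<in> nbhd E' (2 ^ j) (S' \<union> ran (p' ++ q'))"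
        using b'(1) nbhd_mono[of "S' \<union> ran p'" "S' \<union> ran (p' ++ q')"] rans by blast
      ultimately show ?thesis by (rule image_eqI)
    next
      case q
      then have "lty j E {} (q(j \<mapsto> b)) \<in> (\<lambda>b. lty j E' {} (q'(j \<mapsto> b))) ` nbhd E' (2 ^ j) ({} \<union> ran q')"
        using h(10) lty_Suc_eq_iff[OF h(4,6), of j E "{}" E' "{}"] by blast
      then obtain b' where b': "b' \<in> nbhd E' (2 ^ j) ({} \<union> ran q')"
          "lty j E {} (q(j \<mapsto> b)) = lty j E' {} (q'(j \<mapsto> b'))" by blast
      \<comment> \<open>Otherwise going back from \<open>b\<close> to a vertex of \<open>R\<close>
        would bring that vertex within \<open>2 ^ j + 2 ^ j\<close> of \<open>T\<close>.\<close>
      have far: "b \<notin> nbhd E (2 ^ j) T" if R: "b \<in> nbhd E (2 ^ j) ({} \<union> R)" "R \<inter> nbhd E (2 ^ Suc j) T = {}"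
        for E :: "'a set set" and b R T
      proof
        assume bT: "b \<in> nbhd E (2 ^ j) T"
        obtain u where u: "u \<in> R" "u \<in> nbhd E (2 ^ j) {b}" using nbhd_sym[OF R(1)] by auto
        then have "u \<in> nbhd E (2 ^ j) (nbhd E (2 ^ j) T)" using nbhd_mono[of "{b}"] bT by blast
        then show False using u(1) R(2) unfolding pow nbhd_add by blast
      qed
      have "lty j E S (p ++ q(j \<mapsto> b)) = lty j E' S' (p' ++ q'(j \<mapsto> b'))"
      proof (rule Suc.IH)
        show "ran (q(j \<mapsto> b)) \<inter> nbhd E (2 ^ j) (S \<union> ran p) = {}"
          using ran_upd_subset[of q j b] sep far[OF q h(7)] by blast
        show "ran (q'(j \<mapsto> b')) \<inter> nbhd E' (2 ^ j) (S' \<union> ran p') = {}"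
          using ran_upd_subset[of q' j b'] sep far[OF b'(1) h(8)] by blast
        show "dom p \<inter> dom (q(j \<mapsto> b)) = {}" using h(1) j by auto
        show "(dom p \<union> dom (q(j \<mapsto> b))) \<inter> {..<j} = {}" using ind(2) by simp
        show "lty j E {} (q(j \<mapsto> b)) = lty j E' {} (q'(j \<mapsto> b'))" by (rule b'(2))
        show "lty j E S p = lty j E' S' p'" by (rule low(1))
      qed (rule h fin_upd[OF h(3)] fin_upd[OF h(4)] fin_upd[OF h(5)] fin_upd[OF h(6)])+
      then have "lty j E S ((p ++ q)(j \<mapsto> b)) = lty j E' S' ((p' ++ q')(j \<mapsto> b'))"
        by (simp only: map_add_upd)
      moreover have "b' \<in> nbhd E' (2 ^ j) (S' \<union> ran (p' ++ q'))"
        using b'(1) nbhd_mono[of "{} \<union> ran q'" "S' \<union> ran (p' ++ q')"] rans by blast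
      ultimately show ?thesis by (rule image_eqI)
    qed
  qed
  have "lty j E S (p ++ q) = lty j E' S' (p' ++ q')"
  proof (rule Suc.IH)
    show "ran q \<inter> nbhd E (2 ^ j) (S \<union> ran p) = {}" "ran q' \<inter> nbhd E' (2 ^ j) (S' \<union> ran p') = {}"
      using prems(7,8) nbhd_increasing[of "2 ^ j" "2 ^ Suc j" E "S \<union> ran p"]
        nbhd_increasing[of "2 ^ j" "2 ^ Suc j" E' "S' \<union> ran p'"] by auto
    show "lty j E S p = lty j E' S' p'" "lty j E {} q = lty j E' {} q'"
      using prems(3-6,9,10) lty_Suc_eq_iff by blast+
    show "dom p \<inter> dom q = {}" by (rule prems(1))
    show "(dom p \<union> dom q) \<inter> {..<j} = {}" using prems(2) by auto
  qed (rule prems)+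
  moreover have "(\<lambda>b. lty j E S ((p ++ q)(j \<mapsto> b))) ` nbhd E (2 ^ j) (S \<union> ran (p ++ q)) =
      (\<lambda>b. lty j E' S' ((p' ++ q')(j \<mapsto> b))) ` nbhd E' (2 ^ j) (S' \<union> ran (p' ++ q'))"
  proof (rule equalityI[OF incl[OF prems dom] incl])
    show "dom p' \<inter> dom q' = {}" "(dom p' \<union> dom q') \<inter> {..<Suc j} = {}"
      using prems(1,2) unfolding dom .
  qed (rule prems dom[symmetric] prems(9)[symmetric] prems(10)[symmetric])+
  ultimately show ?case unfolding lty.simps by (simp only:)
qed

section \<open>Trees and rich graphs\<close>

text \<open>Finite trees in the language of densities and cuts: the third clause excludes circuits,
  the fourth is connectedness. Both are the forms in which the properties are obtained and
  consumed.\<close>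

definition treelike :: "'a set \<Rightarrow> 'a set set \<Rightarrow> bool" where
  "treelike W T \<longleftrightarrow> finite W \<and> W \<noteq> {} \<and> T \<subseteq> pairs W \<and>
     (\<forall>S\<subseteq>W. S \<noteq> {} \<longrightarrow> card (induced T S) < card S) \<and>
     (\<forall>S. S \<subset> W \<and> S \<noteq> {} \<longrightarrow> (\<exists>u\<in>S. \<exists>v\<in>W - S. {u, v} \<in> T))"

text \<open>Every vertex of the ball other than the centre chooses a parent one step closer to the centre.
  An edge not joining a vertex to its parent would close a short circuit.\<close>

lemma treelike_nbhd:
  assumes E: "simple E" and fin: "finite (nbhd E \<rho> {b})"
    and no: "\<And>S. S \<subseteq> nbhd E \<rho> {b} \<Longrightarrow> circuit E S \<Longrightarrow> 2 * \<rho> + 1 < card S"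
  shows "treelike (nbhd E \<rho> {b}) (induced E (nbhd E \<rho> {b}))"
proof -
  define B where "B = nbhd E \<rho> {b}"
  define lev where "lev v = (LEAST k. v \<in> nbhd E k {b})" for v
  have lev: "v \<in> nbhd E (lev v) {b}" "lev v \<le> \<rho>" if "v \<in> B" for v
    using that LeastI[of "\<lambda>k. v \<in> nbhd E k {b}" \<rho>] Least_le[of "\<lambda>k. v \<in> nbhd E k {b}" \<rho>]
    by (auto simp: B_def lev_def)
  have lev_le: "lev v \<le> k" if "v \<in> nbhd E k {b}" for v k
    unfolding lev_def using that by (rule Least_le)
  have bB: "b \<in> B" using subset_nbhd[of "{b}" E \<rho>] by (simp add: B_def)
  have "\<exists>u\<in>B. lev u < lev v \<and> {u, v} \<in> E" if v: "v \<in> B" "v \<noteq> b" for v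
  proof -
    obtain k where k: "lev v = Suc k" using lev(1)[OF v(1)] v(2) by (cases "lev v") auto
    have "v \<notin> nbhd E k {b}" using lev_le[of v k] k by auto
    then obtain u where u: "u \<in> nbhd E k {b}" "{u, v} \<in> E" using lev(1)[OF v(1)] k by auto
    have "u \<in> B" using u(1) nbhd_increasing[of k \<rho> E "{b}"] lev(2)[OF v(1)] k by (auto simp: B_def)
    moreover have "lev u < lev v" using lev_le[OF u(1)] k by simp
    ultimately show ?thesis using u(2) by blast
  qed
  then obtain par where par: "par v \<in> B" "lev (par v) < lev v" "{par v, v} \<in> E" if "v \<in> B" "v \<noteq> b" for v
    by metis
  \<comment> \<open>\<open>A\<close> is the chain of ancestors from \<open>v\<close> to the centre:
    closed under parents, with at most one vertex per level.\<close>
  have anc: "\<exists>A\<subseteq>B. v \<in> A \<and> b \<in> A \<and> card A \<le> lev v + 1 \<and> (\<forall>w\<in>A. w \<noteq> b \<longrightarrow> par w \<in> A)"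
    if "v \<in> B" for v
    using that
  proof (induction "lev v" arbitrary: v rule: less_induct)
    case less
    show ?case
    proof (cases "v = b")
      case True
      then show ?thesis using less.prems by (intro exI[of _ "{b}"]) auto
    next
      case False
      note pv = par[OF less.prems False]
      obtain A where A: "A \<subseteq> B" "par v \<in> A" "b \<in> A" "card A \<le> lev (par v) + 1" "\<forall>w\<in>A. w \<noteq> b \<longrightarrow> par w \<in> A"
        using less.hyps[OF pv(2,1)] by blast
      have "card (insert v A) \<le> lev v + 1" using A(4) pv(2) card_insert_le_m1[of "Suc (lev v)" A v] by linarith
      then show ?thesis using A less.prems by (intro exI[of _ "insert v A"]) auto
    qed
  qed
  have inj: "inj_on (\<lambda>w. {w, par w}) (B - {b})"
  proof (rule inj_onI)
    fix w x assume h: "w \<in> B - {b}" "x \<in> B - {b}" "{w, par w} = {x, par x}"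
    then show "w = x" using par(2)[of w] par(2)[of x] by (auto simp: doubleton_eq_iff)
  qed
  have edge: "v \<noteq> b \<and> u = par v" if uv: "u \<in> B" "v \<in> B" "{u, v} \<in> E" "lev u \<le> lev v" for u v
  proof (rule ccontr)
    assume neg: "\<not> (v \<noteq> b \<and> u = par v)"
    have ne: "u \<noteq> v" using simple_edge_neq[OF E uv(3)] .
    have lb: "lev b = 0" using lev_le[of b 0] by simp
    have "v \<noteq> b"
    proof
      assume "v = b"
      then have "lev u = 0" using uv(4) lb by simp
      then have "u = b" using lev(1)[OF uv(1)] by simp
      then show False using \<open>v = b\<close> ne by simp
    qed
    with neg have np: "u \<noteq> par v" by blast
    obtain A1 where A1: "A1 \<subseteq> B" "u \<in> A1" "b \<in> A1" "card A1 \<le> lev u + 1" "\<forall>w\<in>A1. w \<noteq> b \<longrightarrow> par w \<in> A1"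
      using anc[OF uv(1)] by blast
    obtain A2 where A2: "A2 \<subseteq> B" "v \<in> A2" "b \<in> A2" "card A2 \<le> lev v + 1" "\<forall>w\<in>A2. w \<noteq> b \<longrightarrow> par w \<in> A2"
      using anc[OF uv(2)] by blast
    \<comment> \<open>The two chains share \<open>b\<close>, so \<open>A\<close> has at most
      \<open>2 * \<rho> + 1\<close> vertices. Its \<open>card A - 1\<close> parent edges together
      with the extra edge \<open>{u, v}\<close> make it dense, and the circuit it contains is too
      short.\<close>
    define A where "A = A1 \<union> A2"
    have finA: "finite A1" "finite A2" "finite A"
      using A1(1) A2(1) fin finite_subset by (auto simp: A_def B_def)
    have "card A1 + card A2 = card A + card (A1 \<inter> A2)" unfolding A_def by (rule card_Un_Int[OF finA(1,2)])
    moreover have "card (A1 \<inter> A2) \<ge> 1"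
    proof -
      have "A1 \<inter> A2 \<noteq> {}" using A1(3) A2(3) by auto
      then show ?thesis using finA(1) by (simp add: Suc_le_eq card_gt_0_iff)
    qed
    ultimately have cA: "card A \<le> 2 * \<rho> + 1"
      using A1(4) A2(4) lev(2)[OF uv(1)] lev(2)[OF uv(2)] by linarith
    let ?g = "\<lambda>w. {w, par w}"
    have sub: "insert {u, v} (?g ` (A - {b})) \<subseteq> induced E A"
    proof -
      have "?g w \<in> induced E A" if "w \<in> A - {b}" for w
        using that par(3)[of w] A1 A2 by (auto simp: induced_def A_def insert_commute)
      then show ?thesis using uv(3) A1(2) A2(2) by (auto simp: induced_def A_def)
    qed
    have notin: "{u, v} \<notin> ?g ` (A - {b})"
    proof
      assume "{u, v} \<in> ?g ` (A - {b})"
      then obtain w where w: "w \<in> A" "w \<noteq> b" "{u, v} = {w, par w}" by auto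
      then have "w \<in> B" using A1(1) A2(1) by (auto simp: A_def)
      then have "lev (par w) < lev w" using par(2) w(2) by blast
      then show False using w(3) uv(4) np by (auto simp: doubleton_eq_iff)
    qed
    have "inj_on ?g (A - {b})" using inj by (rule inj_on_subset) (use A1(1) A2(1) in \<open>auto simp: A_def\<close>)
    then have "card (?g ` (A - {b})) = card A - 1"
      using finA A1(3) by (simp add: card_image A_def)
    moreover have "card A \<ge> 1" using finA A1(3) by (auto simp: A_def Suc_le_eq card_gt_0_iff)
    ultimately have "card (insert {u, v} (?g ` (A - {b}))) = card A"
      using notin finA by simp
    then have "card A \<le> card (induced E A)"
      using card_mono[OF finite_induced[OF finA(3)] sub] by (simp only:)
    then obtain T where T: "T \<subseteq> A" "circuit E T"
      using dense_contains_circuit[of A E] finA(3) A1(3) by (auto simp: A_def)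
    have "T \<subseteq> nbhd E \<rho> {b}" using T(1) A1(1) A2(1) by (auto simp: A_def B_def)
    then have "2 * \<rho> + 1 < card T" using no T(2) by blast
    moreover have "card T \<le> card A" using T(1) finA(3) by (simp add: card_mono)
    ultimately show False using cA by linarith
  qed
  have finB: "finite B" using fin by (simp add: B_def)
  have min_lev: "\<exists>s\<in>S. \<forall>x\<in>S. lev s \<le> lev x" if "finite S" "S \<noteq> {}" for S
  proof -
    have "Min (lev ` S) \<in> lev ` S" using that by (intro Min_in) auto
    then obtain s where "s \<in> S" "lev s = Min (lev ` S)" by auto
    then show ?thesis using that(1) by (metis Min_le finite_imageI imageI)
  qed
  \<comment> \<open>Each edge inside \<open>S\<close> joins a vertex to its parent, and the child is
    never a vertex \<open>s\<close> of least level, so mapping children to edges covers everything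
    from \<open>S - {s}\<close>.\<close>
  have sparse: "card (induced (induced E B) S) < card S" if S: "S \<subseteq> B" "S \<noteq> {}" for S
  proof -
    have finS: "finite S" using S(1) finB by (rule finite_subset)
    obtain s where s: "s \<in> S" "\<forall>x\<in>S. lev s \<le> lev x"
      using min_lev[OF finS S(2)] by blast
    have "induced E S \<subseteq> (\<lambda>w. {w, par w}) ` (S - {s})"
    proof
      fix e assume e: "e \<in> induced E S"
      then have "card e = 2" using E by (auto simp: simple_def induced_def)
      then obtain x y where xy: "e = {x, y}" by (auto simp: card_2_iff)
      then have "\<exists>u v. e = {u, v} \<and> lev u \<le> lev v" by (metis insert_commute linear)
      then obtain u v where uv: "e = {u, v}" "lev u \<le> lev v" by blast
      then have inS: "u \<in> S" "v \<in> S" "{u, v} \<in> E" using e by (auto simp: induced_def)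
      then have "v \<noteq> b \<and> u = par v" using edge[of u v] uv S(1) by blast
      moreover from this have "lev u < lev v" using par(2)[of v] inS S(1) by auto
      then have "v \<noteq> s" using s(2) inS(1) by auto
      ultimately show "e \<in> (\<lambda>w. {w, par w}) ` (S - {s})" using uv(1) inS by auto
    qed
    then have "card (induced E S) \<le> card (S - {s})"
      using finS by (meson card_image_le card_mono finite_Diff finite_imageI le_trans)
    also have "\<dots> < card S" using finS s(1) by (rule card_Diff1_less)
    finally show ?thesis using S(1) by (simp add: induced_induced)
  qed
  \<comment> \<open>On the side of the cut that avoids the centre, a vertex of least level has its
    parent on the other side.\<close>
  have conn: "\<exists>u\<in>S. \<exists>v\<in>B - S. {u, v} \<in> induced E B" if S: "S \<subset> B" "S \<noteq> {}" for S
  proof (cases "b \<in> S")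
    case True
    have "finite (B - S)" "B - S \<noteq> {}" using finB S by auto
    then obtain v where v: "v \<in> B - S" "\<forall>x\<in>B - S. lev v \<le> lev x"
      using min_lev by blast
    then have "v \<noteq> b" "v \<in> B" using True by auto
    note pv = par[OF this(2,1)]
    have "par v \<notin> B - S" using v(2) pv(2) by (metis leD)
    then have "par v \<in> S" using pv(1) v(1) by blast
    then show ?thesis using pv v by (intro bexI[of _ "par v"] bexI[of _ v]) (auto simp: induced_def)
  next
    case False
    have "finite S" using S(1) finB by (intro finite_subset[of S B]) auto
    then obtain v where v: "v \<in> S" "\<forall>x\<in>S. lev v \<le> lev x"
      using min_lev S(2) by blast
    have "v \<noteq> b" "v \<in> B" using v False S by auto
    note pv = par[OF this(2,1)]
    have "par v \<notin> S" using pv(2) v(2) by (metis leD)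
    then show ?thesis using pv v S
      by (intro bexI[of _ v] bexI[of _ "par v"]) (auto simp: induced_def insert_commute)
  qed
  show ?thesis
    unfolding treelike_def B_def[symmetric]
    using finB bB sparse conn induced_pairs[OF E, of B] by blast
qed

definition isolated :: "'a set set \<Rightarrow> 'a set \<Rightarrow> bool" where
  "isolated E W \<longleftrightarrow> (\<forall>u\<in>W. \<forall>v. {u, v} \<in> E \<longrightarrow> v \<in> W)"

definition tree_types :: "nat \<Rightarrow> nat set" where
  "tree_types j = {lty j T {} [j \<mapsto> b] |W (T :: nat set set) b. treelike W T \<and> b \<in> W}"

text \<open>\<open>Suc q\<close> disjoint copies are demanded because a game of \<open>q\<close>
  rounds marks at most \<open>q\<close> vertices, so one copy is always untouched. The copies are
  isolated, hence automatically far from all circuits and marked vertices elsewhere.\<close>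

definition rich :: "nat \<Rightarrow> nat set \<Rightarrow> nat set set \<Rightarrow> bool" where
  "rich q V E \<longleftrightarrow> (\<forall>j<q. \<forall>\<tau>\<in>tree_types j. \<exists>\<W>. card \<W> = Suc q \<and> disjoint \<W> \<and>
     (\<forall>W\<in>\<W>. W \<subseteq> V \<and> isolated E W \<and> treelike W (induced E W) \<and>
       (\<exists>b\<in>W. lty j (induced E W) {} [j \<mapsto> b] = \<tau>)))"

lemma finite_tree_types: "finite (tree_types j)"
proof (rule finite_subset)
  show "tree_types j \<subseteq> {lty j E S a |(E :: nat set set) S a. dom a \<subseteq> {j}}"
  proof
    fix x assume "x \<in> tree_types j"
    then obtain T :: "nat set set" and b where "x = lty j T {} [j \<mapsto> b]" by (auto simp: tree_types_def)
    moreover have "dom [j \<mapsto> b] \<subseteq> {j}" by simp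
    ultimately show "x \<in> {lty j E S a |(E :: nat set set) S a. dom a \<subseteq> {j}}" by blast
  qed
qed (simp add: finite_lty_values)

lemma isolated_compl: "isolated E W \<Longrightarrow> isolated E (- W)"
  unfolding isolated_def by (metis Compl_iff insert_commute)

lemma nbhd_isolated: "isolated E W \<Longrightarrow> S \<subseteq> W \<Longrightarrow> nbhd E k S \<subseteq> W"
  by (rule nbhd_closed) (auto simp: isolated_def)

text \<open>Inside \<open>W\<close> there are too few edges for a circuit. One that also leaves
  \<open>W\<close> would split into two proper parts with no edge between them, each spanning fewer
  edges than vertices by minimality.\<close>

lemma circuit_isolated_treelike:
  assumes "simple E" "isolated E W" "treelike W (induced E W)" "circuit E T"
  shows "T \<inter> W = {}"
proof (rule ccontr)
  assume ne: "T \<inter> W \<noteq> {}"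
  have fin: "finite T" and cT: "card T \<le> card (induced E T)" using assms(4) by (auto simp: circuit_def)
  show False
  proof (cases "T \<subseteq> W")
    case True
    then have "card (induced E T) < card T"
      using assms(3) ne by (auto simp: treelike_def induced_induced)
    then show False using cT by simp
  next
    case False
    have min: "card (induced E X) < card X" if "X \<subset> T" "X \<noteq> {}" for X
      using assms(4) that by (simp add: circuit_def)
    have "card (induced E (T \<inter> W)) < card (T \<inter> W)" "card (induced E (T - W)) < card (T - W)"
      using False ne by (intro min; blast)+
    moreover have "induced E T \<subseteq> induced E (T \<inter> W) \<union> induced E (T - W)"
    proof
      fix e assume e: "e \<in> induced E T"
      then obtain x y where "e = {x, y}" using assms(1) by (auto simp: simple_def induced_def card_2_iff)
      then show "e \<in> induced E (T \<inter> W) \<union> induced E (T - W)"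
        using e assms(2) unfolding isolated_def induced_def by (auto simp: insert_commute)
    qed
    then have "card (induced E T) \<le> card (induced E (T \<inter> W) \<union> induced E (T - W))"
      using fin by (intro card_mono) auto
    moreover note card_Un_le[of "induced E (T \<inter> W)" "induced E (T - W)"]
    moreover have "card T = card (T \<inter> W) + card (T - W)"
      using card_Un_disjoint[of "T \<inter> W" "T - W"] fin by (simp add: Int_Diff_Un Int_Diff_disjoint)
    ultimately show False using cT by linarith
  qed
qed

text \<open>The forth step of the game. A move near the circuits or the earlier moves is answered by
  equality of types. The ball around any other vertex is a tree, so its type is a tree type.
  Richness provides an untouched tree component with a vertex of that type, and
  \<open>lty_compose\<close> combines the answer with the earlier moves.\<close>

lemma lty_forth:
  fixes E E' :: "nat set set"
  assumes E: "E \<subseteq> pairs V" "finite V" and E': "E' \<subseteq> pairs V'" "rich q V' E'"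
    and j: "j < q" and K: "2 ^ Suc q \<le> K" and b: "b \<in> V"
    and dom: "dom a \<subseteq> {Suc j..<q}" and fin': "finite (dom a')" and ran': "ran a' \<subseteq> V'"
    and eq: "lty (Suc j) E (cyc K E) a = lty (Suc j) E' (cyc K E') a'"
  shows "\<exists>b'\<in>V'. lty j E (cyc K E) (a(j \<mapsto> b)) = lty j E' (cyc K E') (a'(j \<mapsto> b'))"
proof -
  let ?S = "cyc K E" and ?S' = "cyc K E'"
  have fin: "finite (dom a)" by (rule finite_subset[OF dom finite_atLeastLessThan])
  have sE: "simple E" "simple E'" by (rule simple_pairs[OF E(1)], rule simple_pairs[OF E'(1)])
  show ?thesis
  proof (cases "b \<in> nbhd E (2 ^ j) (?S \<union> ran a)")
    case True
    then have "lty j E ?S (a(j \<mapsto> b)) \<in> (\<lambda>b. lty j E' ?S' (a'(j \<mapsto> b))) ` nbhd E' (2 ^ j) (?S' \<union> ran a')"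
      using eq unfolding lty_Suc_eq_iff[OF fin fin'] by blast
    moreover have "nbhd E' (2 ^ j) (?S' \<union> ran a') \<subseteq> V'"
      using cyc_subset_verts[OF E'(1), of K] ran' by (intro nbhd_subset_verts[OF _ E'(1)]) auto
    ultimately show ?thesis by blast
  next
    case far: False
    define B where "B = nbhd E (2 ^ j - 1) {b}"
    have "treelike B (induced E B)" unfolding B_def
    proof (rule treelike_nbhd[OF sE(1)])
      show "finite (nbhd E (2 ^ j - 1) {b})"
        using b by (intro finite_subset[OF nbhd_subset_verts[OF _ E(1)] E(2)]) simp
    next
      fix T assume T: "T \<subseteq> nbhd E (2 ^ j - 1) {b}" "circuit E T"
      \<comment> \<open>A circuit violating this has at most \<open>2 ^ Suc j \<le> K\<close>
        vertices, hence lies in \<open>cyc K E\<close> and puts \<open>b\<close> near it. This is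
        the origin of the bound \<open>2 ^ Suc q \<le> K\<close>.\<close>
      show "2 * (2 ^ j - 1) + 1 < card T"
      proof (rule ccontr)
        assume "\<not> 2 * (2 ^ j - 1) + 1 < card T"
        moreover have "2 * (2 ^ j - 1) + 1 \<le> (2 :: nat) ^ Suc j"
          using one_le_power[of "2 :: nat" j] by (simp only: power_Suc) linarith
        moreover have "(2 :: nat) ^ Suc j \<le> 2 ^ Suc q" using j by (intro power_increasing) auto
        ultimately have "card T \<le> K" using K by linarith
        then have TS: "T \<subseteq> ?S" using T(2) by (auto simp: cyc_def short_circuits_def)
        obtain t where t: "t \<in> T" using T(2) by (auto simp: circuit_def)
        then have "b \<in> nbhd E (2 ^ j - 1) {t}" using nbhd_sym[of t E "2 ^ j - 1" "{b}"] T(1) by auto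
        then have "b \<in> nbhd E (2 ^ j - 1) (?S \<union> ran a)" using nbhd_mono[of "{t}" "?S \<union> ran a"] t TS by blast
        then show False using far nbhd_increasing[of "2 ^ j - 1" "2 ^ j" E "?S \<union> ran a"] by auto
      qed
    qed
    moreover have "b \<in> B" using subset_nbhd[of "{b}"] by (auto simp: B_def)
    moreover have l1: "lty j (induced E B) {} [j \<mapsto> b] = lty j E {} [j \<mapsto> b]"
      by (rule lty_induced) (simp add: B_def)
    ultimately have "lty j E {} [j \<mapsto> b] \<in> tree_types j"
      unfolding tree_types_def mem_Collect_eq
      by (intro exI[of _ B] exI[of _ "induced E B"] exI[of _ b]) simp
    then obtain \<W> where W: "card \<W> = Suc q" "disjoint \<W>" "\<forall>W\<in>\<W>. W \<subseteq> V' \<and> isolated E' W \<and>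
        treelike W (induced E' W) \<and> (\<exists>b'\<in>W. lty j (induced E' W) {} [j \<mapsto> b'] = lty j E {} [j \<mapsto> b])"
      using E'(2) j unfolding rich_def by blast
    have "\<exists>W\<in>\<W>. W \<inter> ran a' = {}"
    proof (rule ccontr)
      assume "\<not> ?thesis"
      then have "\<forall>W. \<exists>x. W \<in> \<W> \<longrightarrow> x \<in> W \<inter> ran a'" by auto
      then obtain g where g: "\<And>W. W \<in> \<W> \<Longrightarrow> g W \<in> W \<inter> ran a'" by meson
      have "inj_on g \<W>"
      proof (rule inj_onI)
        fix W1 W2 assume h: "W1 \<in> \<W>" "W2 \<in> \<W>" "g W1 = g W2"
        then have "g W1 \<in> W1 \<inter> W2" using g[of W1] g[of W2] by auto
        then show "W1 = W2" using disjointD[OF W(2) h(1,2)] by auto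
      qed
      moreover have "finite (ran a')" using fin' by (rule finite_ran)
      ultimately have "card \<W> \<le> card (ran a')" using g by (metis Int_iff card_inj_on_le image_subsetI)
      also have "ran a' = (\<lambda>i. the (a' i)) ` dom a'" by (force simp: ran_def dom_def image_iff)
      also have "card \<dots> \<le> card (dom a')" using fin' by (rule card_image_le)
      also have "dom a' = dom a"
        using lty_eq_patterns(1)[OF eq fin fin'] eq_pattern_dom by metis
      also have "card (dom a) \<le> card {Suc j..<q}" using dom by (intro card_mono) auto
      also have "\<dots> \<le> q" by simp
      finally show False using W(1) by simp
    qed
    then obtain W where W': "W \<in> \<W>" "W \<inter> ran a' = {}" by blast
    note WW = bspec[OF W(3) W'(1)]
    then have iso: "isolated E' W" and WV: "W \<subseteq> V'" and tree: "treelike W (induced E' W)"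
      by (simp_all only:)
    obtain b' where b': "b' \<in> W" "lty j (induced E' W) {} [j \<mapsto> b'] = lty j E {} [j \<mapsto> b]"
      using WW by (elim conjE bexE) (rule that)
    have "W \<inter> ?S' = {}"
      using circuit_isolated_treelike[OF sE(2) iso tree] by (auto simp: cyc_def short_circuits_def)
    then have "nbhd E' (2 ^ j) (?S' \<union> ran a') \<subseteq> - W"
      using W'(2) by (intro nbhd_isolated isolated_compl iso) auto
    then have far': "b' \<notin> nbhd E' (2 ^ j) (?S' \<union> ran a')" using b'(1) by blast
    have "lty j (induced E' W) {} [j \<mapsto> b'] = lty j E' {} [j \<mapsto> b']"
      using b'(1) by (intro lty_induced nbhd_isolated iso) auto
    then have l2: "lty j E {} [j \<mapsto> b] = lty j E' {} [j \<mapsto> b']" using b'(2) by simp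
    have "lty j E ?S (a ++ [j \<mapsto> b]) = lty j E' ?S' (a' ++ [j \<mapsto> b'])"
    proof (rule lty_compose)
      show "lty j E ?S a = lty j E' ?S' a'" using eq unfolding lty_Suc_eq_iff[OF fin fin'] by blast
      show "dom a \<inter> dom [j \<mapsto> b] = {}" "(dom a \<union> dom [j \<mapsto> b]) \<inter> {..<j} = {}" using dom by auto
      show "ran [j \<mapsto> b] \<inter> nbhd E (2 ^ j) (?S \<union> ran a) = {}" using far by simp
      show "ran [j \<mapsto> b'] \<inter> nbhd E' (2 ^ j) (?S' \<union> ran a') = {}" using far' by simp
      show "lty j E {} [j \<mapsto> b] = lty j E' {} [j \<mapsto> b']" by (rule l2)
      show "finite (dom [j \<mapsto> b])" "finite (dom [j \<mapsto> b'])" by simp_all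
    qed (rule fin fin')+
    then have "lty j E ?S (a(j \<mapsto> b)) = lty j E' ?S' (a'(j \<mapsto> b'))"
      by (simp only: map_add_upd map_add_empty)
    then show ?thesis using b'(1) WV by blast
  qed
qed

section \<open>Sentences of bounded quantifier rank\<close>

fun qrank :: "fo \<Rightarrow> nat" where
  "qrank (Eq x y) = 0"
| "qrank (Adj x y) = 0"
| "qrank (Neg \<phi>) = qrank \<phi>"
| "qrank (Conj \<phi> \<psi>) = max (qrank \<phi>) (qrank \<psi>)"
| "qrank (Ex x \<phi>) = Suc (qrank \<phi>)"

text \<open>The tuples record all moves, and the assignments only have to point into them. A
  variable that is quantified again leaves its old move in the tuple; the next index is still fresh
  because all used ones are larger.\<close>

lemma sat_eq_if_lty_eq:
  fixes E E' :: "nat set set"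
  assumes E: "E \<subseteq> pairs V" "finite V" "rich q V E" and E': "E' \<subseteq> pairs V'" "finite V'" "rich q V' E'"
    and K: "2 ^ Suc q \<le> K"
  assumes "qrank \<phi> \<le> j" "j \<le> q" "dom a \<subseteq> {j..<q}" "ran a \<subseteq> V" "ran a' \<subseteq> V'" "dom a' = dom a"
    and "lty j E (cyc K E) a = lty j E' (cyc K E') a'"
    and "\<forall>x\<in>free_vars \<phi>. \<exists>i. a i = Some (\<rho> x) \<and> a' i = Some (\<rho>' x)"
  shows "sat V (\<lambda>u v. {u, v} \<in> E) \<rho> \<phi> \<longleftrightarrow> sat V' (\<lambda>u v. {u, v} \<in> E') \<rho>' \<phi>"
  using assms(8-)
proof (induction \<phi> arbitrary: j a a' \<rho> \<rho>')
  case (Eq x y)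
  have fin: "finite (dom a)" "finite (dom a')"
    unfolding Eq.prems(6) by (rule finite_subset[OF Eq.prems(3) finite_atLeastLessThan])+
  obtain i k where ik: "a i = Some (\<rho> x)" "a' i = Some (\<rho>' x)" "a k = Some (\<rho> y)" "a' k = Some (\<rho>' y)"
    using Eq.prems(8) by auto
  have "(i, k) \<in> eq_pattern a \<longleftrightarrow> (i, k) \<in> eq_pattern a'"
    using lty_eq_patterns(1)[OF Eq.prems(7) fin] by simp
  then show ?case unfolding eq_pattern_def by (simp add: ik eq_commute)
next
  case (Adj x y)
  have fin: "finite (dom a)" "finite (dom a')"
    unfolding Adj.prems(6) by (rule finite_subset[OF Adj.prems(3) finite_atLeastLessThan])+
  obtain i k where ik: "a i = Some (\<rho> x)" "a' i = Some (\<rho>' x)" "a k = Some (\<rho> y)" "a' k = Some (\<rho>' y)"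
    using Adj.prems(8) by auto
  have "(i, k) \<in> adj_pattern E a \<longleftrightarrow> (i, k) \<in> adj_pattern E' a'"
    using lty_eq_patterns(2)[OF Adj.prems(7) fin] by simp
  then show ?case using ik by (auto simp: adj_pattern_def)
next
  case (Neg \<phi>)
  have "sat V (\<lambda>u v. {u, v} \<in> E) \<rho> \<phi> \<longleftrightarrow> sat V' (\<lambda>u v. {u, v} \<in> E') \<rho>' \<phi>"
    by (rule Neg.IH[OF _ Neg.prems(2-7)]) (use Neg.prems(1,8) in simp_all)
  then show ?case by simp
next
  case (Conj \<phi> \<psi>)
  have "sat V (\<lambda>u v. {u, v} \<in> E) \<rho> \<phi> \<longleftrightarrow> sat V' (\<lambda>u v. {u, v} \<in> E') \<rho>' \<phi>"
    by (rule Conj.IH(1)[OF _ Conj.prems(2-7)]) (use Conj.prems(1,8) in simp_all)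
  moreover have "sat V (\<lambda>u v. {u, v} \<in> E) \<rho> \<psi> \<longleftrightarrow> sat V' (\<lambda>u v. {u, v} \<in> E') \<rho>' \<psi>"
    by (rule Conj.IH(2)[OF _ Conj.prems(2-7)]) (use Conj.prems(1,8) in simp_all)
  ultimately show ?case by simp
next
  case (Ex x \<phi>)
  obtain j0 where j0: "j = Suc j0" "qrank \<phi> \<le> j0" using Ex.prems(1) by (cases j) auto
  have fin: "finite (dom a)" "finite (dom a')"
    unfolding Ex.prems(6) by (rule finite_subset[OF Ex.prems(3) finite_atLeastLessThan])+
  have dom: "dom a \<subseteq> {Suc j0..<q}" "dom a' \<subseteq> {Suc j0..<q}" using Ex.prems(3,6) j0 by auto
  have step: "sat V (\<lambda>u v. {u, v} \<in> E) (\<rho>(x := b)) \<phi> \<longleftrightarrow> sat V' (\<lambda>u v. {u, v} \<in> E') (\<rho>'(x := b')) \<phi>"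
    if b: "b \<in> V" "b' \<in> V'" "lty j0 E (cyc K E) (a(j0 \<mapsto> b)) = lty j0 E' (cyc K E') (a'(j0 \<mapsto> b'))" for b b'
  proof (rule Ex.IH[OF j0(2)])
    show "j0 \<le> q" using Ex.prems(2) j0 by simp
    show "dom (a(j0 \<mapsto> b)) \<subseteq> {j0..<q}" using dom Ex.prems(2) j0 by auto
    show "ran (a(j0 \<mapsto> b)) \<subseteq> V" using ran_upd_subset[of a j0 b] Ex.prems(4) b by blast
    show "ran (a'(j0 \<mapsto> b')) \<subseteq> V'" using ran_upd_subset[of a' j0 b'] Ex.prems(5) b by blast
    show "dom (a'(j0 \<mapsto> b')) = dom (a(j0 \<mapsto> b))" using Ex.prems(6) by simp
    show "\<forall>y\<in>free_vars \<phi>. \<exists>i. (a(j0 \<mapsto> b)) i = Some ((\<rho>(x := b)) y) \<and> (a'(j0 \<mapsto> b')) i = Some ((\<rho>'(x := b')) y)"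
    proof
      fix y assume y: "y \<in> free_vars \<phi>"
      show "\<exists>i. (a(j0 \<mapsto> b)) i = Some ((\<rho>(x := b)) y) \<and> (a'(j0 \<mapsto> b')) i = Some ((\<rho>'(x := b')) y)"
      proof (cases "y = x")
        case True
        then show ?thesis by (intro exI[of _ j0]) simp
      next
        case False
        then obtain i where i: "a i = Some (\<rho> y)" "a' i = Some (\<rho>' y)" using Ex.prems(8) y by auto
        then have "i \<noteq> j0" using dom(1) by (auto simp: dom_def)
        then show ?thesis using i False by (intro exI[of _ i]) simp
      qed
    qed
    show "lty j0 E (cyc K E) (a(j0 \<mapsto> b)) = lty j0 E' (cyc K E') (a'(j0 \<mapsto> b'))" by (rule b(3))
  qed
  have jq: "j0 < q" using Ex.prems(2) j0 by simp
  have eq: "lty (Suc j0) E (cyc K E) a = lty (Suc j0) E' (cyc K E') a'" using Ex.prems(7) j0 by simp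
  show ?case
  proof
    assume "sat V (\<lambda>u v. {u, v} \<in> E) \<rho> (fo.Ex x \<phi>)"
    then obtain b where b: "b \<in> V" "sat V (\<lambda>u v. {u, v} \<in> E) (\<rho>(x := b)) \<phi>" by auto
    then obtain b' where "b' \<in> V'" "lty j0 E (cyc K E) (a(j0 \<mapsto> b)) = lty j0 E' (cyc K E') (a'(j0 \<mapsto> b'))"
      using lty_forth[OF E(1,2) E'(1,3) jq K b(1) dom(1) fin(2) Ex.prems(5) eq] by blast
    then show "sat V' (\<lambda>u v. {u, v} \<in> E') \<rho>' (fo.Ex x \<phi>)" using step[of b b'] b by auto
  next
    assume "sat V' (\<lambda>u v. {u, v} \<in> E') \<rho>' (fo.Ex x \<phi>)"
    then obtain b' where b': "b' \<in> V'" "sat V' (\<lambda>u v. {u, v} \<in> E') (\<rho>'(x := b')) \<phi>" by auto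
    then obtain b where "b \<in> V" "lty j0 E' (cyc K E') (a'(j0 \<mapsto> b')) = lty j0 E (cyc K E) (a(j0 \<mapsto> b))"
      using lty_forth[OF E'(1,2) E(1,3) jq K b'(1) dom(2) fin(1) Ex.prems(4) eq[symmetric]] by blast
    then show "sat V (\<lambda>u v. {u, v} \<in> E) \<rho> (fo.Ex x \<phi>)" using step[of b b'] b' by auto
  qed
qed

definition gtype :: "nat \<Rightarrow> nat \<Rightarrow> 'a set set \<Rightarrow> nat" where
  "gtype q K E = lty q E (cyc K E) Map.empty"

theorem models_eq_if_gtype_eq:
  fixes E E' :: "nat set set"
  assumes "E \<subseteq> pairs V" "finite V" "rich q V E" "E' \<subseteq> pairs V'" "finite V'" "rich q V' E'"
    and "2 ^ Suc q \<le> K" "qrank \<phi> \<le> q" "sentence \<phi>" "gtype q K E = gtype q K E'"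
  shows "models V E \<phi> \<longleftrightarrow> models V' E' \<phi>"
proof -
  have "sat V (\<lambda>u v. {u, v} \<in> E) \<rho> \<phi> \<longleftrightarrow> sat V' (\<lambda>u v. {u, v} \<in> E') \<rho>' \<phi>" for \<rho> \<rho>'
    using assms by (intro sat_eq_if_lty_eq[where q = q and K = K and j = q and a = Map.empty and a' = Map.empty])
      (auto simp: gtype_def sentence_def)
  then show ?thesis unfolding models_def by blast
qed

lemma gtype_img: "bij f \<Longrightarrow> gtype q K (img f E) = gtype q K E"
  using lty_img[of f q E "cyc K E" Map.empty] by (simp add: gtype_def cyc_img comp_def)

lemma gtype_induced:
  assumes "simple E" "nbhd E (2 ^ q - 1) (cyc K E) \<subseteq> W"
  shows "gtype q K (induced E W) = gtype q K E"
proof -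
  have "cyc K E \<subseteq> W" using assms(2) subset_nbhd[of "cyc K E"] by blast
  then have "cyc K (induced E W) = cyc K E" by (rule cyc_induced[OF assms(1)])
  then show ?thesis using assms(2) by (simp add: gtype_def lty_induced)
qed

text \<open>The core may be taken with larger parameters than the sentence requires. This freedom is
  what lets both parameters go to infinity for a fixed sentence.\<close>

lemma gtype_core:
  assumes "simple E" "K \<le> L" "2 ^ q \<le> r"
  shows "gtype q K (core L r E) = gtype q K E"
  unfolding core_def
proof (rule gtype_induced[OF assms(1)])
  have "nbhd E (2 ^ q - 1) (cyc K E) \<subseteq> nbhd E (2 ^ q - 1) (cyc L E)"
    by (intro nbhd_mono cyc_mono assms)
  also have "\<dots> \<subseteq> nbhd E r (cyc L E)" using assms(3) by (intro nbhd_increasing) auto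
  finally show "nbhd E (2 ^ q - 1) (cyc K E) \<subseteq> core_verts L r E" by (simp add: core_verts_def)
qed

section \<open>Independent edges\<close>

text \<open>The random edge set in elementary form, as a weight on subsets of a finite set.
  Estimates become manipulations of finite sums, and \<open>prob_Pi_bernoulli\<close> is the bridge
  to the measure.\<close>

definition gweight :: "'e set \<Rightarrow> real \<Rightarrow> 'e set \<Rightarrow> real" where
  "gweight X p E = p ^ card E * (1 - p) ^ card (X - E)"

definition gexp :: "'e set \<Rightarrow> real \<Rightarrow> ('e set \<Rightarrow> real) \<Rightarrow> real" where
  "gexp X p f = (\<Sum>E\<in>Pow X. gweight X p E * f E)"

definition gprob :: "'e set \<Rightarrow> real \<Rightarrow> ('e set \<Rightarrow> bool) \<Rightarrow> real" where
  "gprob X p Q = gexp X p (\<lambda>E. of_bool (Q E))"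

lemma gweight_nonneg: "0 \<le> p \<Longrightarrow> p \<le> 1 \<Longrightarrow> 0 \<le> gweight X p E"
  by (simp add: gweight_def)

lemma gexp_cong: "(\<And>E. E \<subseteq> X \<Longrightarrow> f E = g E) \<Longrightarrow> gexp X p f = gexp X p g"
  unfolding gexp_def by (intro sum.cong) auto

lemma gprob_cong: "(\<And>E. E \<subseteq> X \<Longrightarrow> Q E \<longleftrightarrow> R E) \<Longrightarrow> gprob X p Q = gprob X p R"
  unfolding gprob_def by (intro gexp_cong) auto

lemma gexp_mono:
  "0 \<le> p \<Longrightarrow> p \<le> 1 \<Longrightarrow> (\<And>E. E \<subseteq> X \<Longrightarrow> f E \<le> g E) \<Longrightarrow> gexp X p f \<le> gexp X p g"
  unfolding gexp_def by (intro sum_mono mult_left_mono) (auto simp: gweight_nonneg)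

lemma gprob_mono:
  "0 \<le> p \<Longrightarrow> p \<le> 1 \<Longrightarrow> (\<And>E. E \<subseteq> X \<Longrightarrow> Q E \<Longrightarrow> R E) \<Longrightarrow> gprob X p Q \<le> gprob X p R"
  unfolding gprob_def by (intro gexp_mono) auto

lemma gexp_add: "gexp X p (\<lambda>E. f E + g E) = gexp X p f + gexp X p g"
  by (simp add: gexp_def algebra_simps sum.distrib)

lemma gexp_cmult: "gexp X p (\<lambda>E. a * f E) = a * gexp X p f"
  by (simp add: gexp_def sum_distrib_left algebra_simps)

lemma gexp_diff: "gexp X p (\<lambda>E. f E - g E) = gexp X p f - gexp X p g"
  by (simp add: gexp_def algebra_simps sum_subtractf)

lemma gexp_sum: "gexp X p (\<lambda>E. \<Sum>i\<in>I. f i E) = (\<Sum>i\<in>I. gexp X p (f i))"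
  unfolding gexp_def sum_distrib_left by (rule sum.swap)

lemma gexp_nonneg: "0 \<le> p \<Longrightarrow> p \<le> 1 \<Longrightarrow> (\<And>E. E \<subseteq> X \<Longrightarrow> 0 \<le> f E) \<Longrightarrow> 0 \<le> gexp X p f"
  unfolding gexp_def by (intro sum_nonneg mult_nonneg_nonneg) (auto simp: gweight_nonneg)

lemma gexp_abs_le:
  assumes "0 \<le> p" "p \<le> 1"
  shows "\<bar>gexp X p f\<bar> \<le> gexp X p (\<lambda>E. \<bar>f E\<bar>)"
proof -
  have "\<bar>gexp X p f\<bar> \<le> (\<Sum>E\<in>Pow X. \<bar>gweight X p E * f E\<bar>)" unfolding gexp_def by (rule sum_abs)
  also have "\<dots> = gexp X p (\<lambda>E. \<bar>f E\<bar>)"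
    unfolding gexp_def using assms by (intro sum.cong) (simp_all add: abs_mult gweight_nonneg)
  finally show ?thesis .
qed

text \<open>The weight of \<open>E\<close> is the product of the weights of its traces on
  \<open>X\<close> and \<open>Y\<close>, so the sum over \<open>E\<close> factors.\<close>

lemma gexp_indep:
  assumes "finite X" "finite Y" "X \<inter> Y = {}"
  shows "gexp (X \<union> Y) p (\<lambda>E. f (E \<inter> X) * g (E \<inter> Y)) = gexp X p f * gexp Y p g"
proof -
  have "gexp (X \<union> Y) p (\<lambda>E. f (E \<inter> X) * g (E \<inter> Y)) =
      (\<Sum>(A, B)\<in>Pow X \<times> Pow Y. gweight X p A * f A * (gweight Y p B * g B))"
    unfolding gexp_def
  proof (rule sum.reindex_bij_witness[where j = "\<lambda>E. (E \<inter> X, E \<inter> Y)" and i = "\<lambda>(A, B). A \<union> B"])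
    fix E assume "E \<in> Pow (X \<union> Y)"
    then have E: "E = (E \<inter> X) \<union> (E \<inter> Y)" by auto
    have fin: "finite (E \<inter> X)" "finite (E \<inter> Y)" using assms by auto
    have "card E = card (E \<inter> X) + card (E \<inter> Y)"
      using card_Un_disjoint[OF fin] assms(3) E by auto
    moreover have "X \<union> Y - E = (X - E \<inter> X) \<union> (Y - E \<inter> Y)" using assms(3) by auto
    then have "card (X \<union> Y - E) = card (X - E \<inter> X) + card (Y - E \<inter> Y)"
      using card_Un_disjoint[of "X - E \<inter> X" "Y - E \<inter> Y"] assms by auto
    ultimately have "gweight (X \<union> Y) p E = gweight X p (E \<inter> X) * gweight Y p (E \<inter> Y)"
      by (simp add: gweight_def power_add)
    then show "(case (E \<inter> X, E \<inter> Y) of (A, B) \<Rightarrow> gweight X p A * f A * (gweight Y p B * g B)) =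
        gweight (X \<union> Y) p E * (f (E \<inter> X) * g (E \<inter> Y))" by simp
  qed (use assms(3) in auto)
  also have "\<dots> = gexp X p f * gexp Y p g"
    by (simp add: gexp_def sum_product sum.cartesian_product)
  finally show ?thesis .
qed

lemma gexp_one: "finite X \<Longrightarrow> gexp X p (\<lambda>_. 1) = 1"
proof (induction X rule: finite_induct)
  case empty
  then show ?case by (simp add: gexp_def gweight_def)
next
  case (insert x X)
  have "Pow {x} = {{}, {x}}" by auto
  then have "gexp {x} p (\<lambda>_. 1) = 1" by (simp add: gexp_def gweight_def)
  then show ?case using gexp_indep[of "{x}" X p "\<lambda>_. 1" "\<lambda>_. 1"] insert by simp
qed

lemma gexp_restrict:
  assumes "finite X" "Y \<subseteq> X"
  shows "gexp X p (\<lambda>E. f (E \<inter> Y)) = gexp Y p f"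
proof -
  have "Y \<union> (X - Y) = X" using assms(2) by auto
  moreover have "finite Y" by (rule finite_subset[OF assms(2,1)])
  ultimately show ?thesis
    using gexp_indep[of Y "X - Y" p f "\<lambda>_. 1"] assms(1) by (simp add: gexp_one)
qed

lemma gprob_True: "finite X \<Longrightarrow> gprob X p (\<lambda>_. True) = 1"
  by (simp add: gprob_def gexp_one)

lemma gprob_nonneg: "0 \<le> p \<Longrightarrow> p \<le> 1 \<Longrightarrow> 0 \<le> gprob X p Q"
  unfolding gprob_def by (rule gexp_nonneg) auto

lemma gprob_le_1: "finite X \<Longrightarrow> 0 \<le> p \<Longrightarrow> p \<le> 1 \<Longrightarrow> gprob X p Q \<le> 1"
  using gprob_mono[of p X Q "\<lambda>_. True"] by (simp add: gprob_True)

lemma gprob_not: "finite X \<Longrightarrow> gprob X p (\<lambda>E. \<not> Q E) = 1 - gprob X p Q"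
  using gexp_diff[of X p "\<lambda>_. 1" "\<lambda>E. of_bool (Q E)"]
  by (simp add: gprob_def gexp_one of_bool_not_iff)

lemma gprob_Un_le:
  "0 \<le> p \<Longrightarrow> p \<le> 1 \<Longrightarrow> gprob X p (\<lambda>E. Q E \<or> R E) \<le> gprob X p Q + gprob X p R"
  unfolding gprob_def gexp_add[symmetric] by (rule gexp_mono) (auto simp: of_bool_def)

lemma gprob_Bex_le:
  assumes "finite I" "0 \<le> p" "p \<le> 1"
  shows "gprob X p (\<lambda>E. \<exists>i\<in>I. Q i E) \<le> (\<Sum>i\<in>I. gprob X p (Q i))"
  unfolding gprob_def gexp_sum[symmetric]
proof (rule gexp_mono[OF assms(2,3)])
  fix E
  show "of_bool (\<exists>i\<in>I. Q i E) \<le> (\<Sum>i\<in>I. of_bool (Q i E) :: real)"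
  proof (cases "\<exists>i\<in>I. Q i E")
    case True
    then obtain i where "i \<in> I" "Q i E" by blast
    then show ?thesis using member_le_sum[of i I "\<lambda>i. of_bool (Q i E) :: real"] assms(1) True by auto
  qed (simp add: sum_nonneg)
qed

lemma gprob_disjoint_Bex:
  assumes "finite I" "\<And>E i j. E \<subseteq> X \<Longrightarrow> i \<in> I \<Longrightarrow> j \<in> I \<Longrightarrow> Q i E \<Longrightarrow> Q j E \<Longrightarrow> i = j"
  shows "gprob X p (\<lambda>E. \<exists>i\<in>I. Q i E) = (\<Sum>i\<in>I. gprob X p (Q i))"
  unfolding gprob_def gexp_sum[symmetric]
proof (rule gexp_cong)
  fix E assume E: "E \<subseteq> X"
  show "of_bool (\<exists>i\<in>I. Q i E) = (\<Sum>i\<in>I. of_bool (Q i E) :: real)"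
  proof (cases "\<exists>i\<in>I. Q i E")
    case True
    then obtain i where i: "i \<in> I" "Q i E" by blast
    have "(\<Sum>j\<in>I. of_bool (Q j E) :: real) = (\<Sum>j\<in>I. if j = i then 1 else 0)"
      using i assms(2)[OF E] by (intro sum.cong) auto
    then show ?thesis using True i assms(1) by simp
  qed simp
qed

lemma gprob_diff_le:
  assumes "0 \<le> p" "p \<le> 1" "\<And>E. E \<subseteq> X \<Longrightarrow> \<not> B E \<Longrightarrow> Q E \<longleftrightarrow> R E"
  shows "\<bar>gprob X p Q - gprob X p R\<bar> \<le> gprob X p B"
proof -
  have "\<bar>gprob X p Q - gprob X p R\<bar> \<le> gexp X p (\<lambda>E. \<bar>of_bool (Q E) - of_bool (R E)\<bar>)"
    unfolding gprob_def gexp_diff[symmetric] by (rule gexp_abs_le[OF assms(1,2)])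
  also have "\<dots> \<le> gprob X p B"
    unfolding gprob_def by (rule gexp_mono[OF assms(1,2)]) (use assms(3) in \<open>auto simp: of_bool_def\<close>)
  finally show ?thesis .
qed

lemma gprob_Markov:
  assumes "0 \<le> p" "p \<le> 1" "0 < a" "\<And>E. E \<subseteq> X \<Longrightarrow> 0 \<le> f E"
  shows "gprob X p (\<lambda>E. a \<le> f E) \<le> gexp X p f / a"
proof -
  have "a * gprob X p (\<lambda>E. a \<le> f E) \<le> gexp X p f"
    unfolding gprob_def gexp_cmult[symmetric]
    by (rule gexp_mono[OF assms(1,2)]) (use assms(3,4) in auto)
  then show ?thesis using assms(3) by (simp add: field_simps)
qed

text \<open>The form in which independence is used throughout: a prescribed pattern on
  \<open>Z\<close> splits off as a factor from any event about the edges outside \<open>Z\<close>.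
  It replaces conditioning.\<close>

lemma gprob_pattern:
  assumes "finite X" "Z \<subseteq> X" "H \<subseteq> Z"
  shows "gprob X p (\<lambda>E. E \<inter> Z = H \<and> Q (E - Z)) =
    p ^ card H * (1 - p) ^ card (Z - H) * gprob X p (\<lambda>E. Q (E - Z))"
proof -
  have fin: "finite Z" "finite (X - Z)"
    by (rule finite_subset[OF assms(2,1)], rule finite_Diff[OF assms(1)])
  have XZ: "Z \<union> (X - Z) = X" using assms by auto
  have E: "E - Z = E \<inter> (X - Z)" if "E \<subseteq> X" for E using that by auto
  have "gprob X p (\<lambda>E. E \<inter> Z = H \<and> Q (E - Z)) =
      gexp X p (\<lambda>E. of_bool (E \<inter> Z = H) * of_bool (Q (E \<inter> (X - Z))))"
    unfolding gprob_def by (rule gexp_cong) (drule E, simp only: of_bool_conj)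
  also have "\<dots> = gexp Z p (\<lambda>A. of_bool (A = H)) * gexp (X - Z) p (\<lambda>A. of_bool (Q A))"
    using gexp_indep[OF fin, of p "\<lambda>A. of_bool (A = H)" "\<lambda>A. of_bool (Q A)"] unfolding XZ
    by (rule trans) auto
  also have "gexp Z p (\<lambda>A. of_bool (A = H)) = gweight Z p H"
  proof -
    have "gexp Z p (\<lambda>A. of_bool (A = H)) = (\<Sum>A\<in>Pow Z. if A = H then gweight Z p H else 0)"
      unfolding gexp_def by (intro sum.cong) auto
    then show ?thesis using fin(1) assms(3) by simp
  qed
  also have "gexp (X - Z) p (\<lambda>A. of_bool (Q A)) = gprob X p (\<lambda>E. Q (E - Z))"
  proof -
    have "gprob X p (\<lambda>E. Q (E - Z)) = gexp X p (\<lambda>E. of_bool (Q (E \<inter> (X - Z))))"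
      unfolding gprob_def by (rule gexp_cong) (drule E, simp only: of_bool_conj)
    also have "\<dots> = gexp (X - Z) p (\<lambda>A. of_bool (Q A))"
      by (rule gexp_restrict[OF assms(1)]) auto
    finally show ?thesis by simp
  qed
  finally show ?thesis by (simp add: gweight_def)
qed

lemma gprob_pattern':
  assumes "finite X" "Z \<subseteq> X" "H \<subseteq> Z"
  shows "gprob X p (\<lambda>E. E \<inter> Z = H) = p ^ card H * (1 - p) ^ card (Z - H)"
  using gprob_pattern[OF assms, of p "\<lambda>_. True"] by (simp add: gprob_True assms)

lemma gprob_superset:
  assumes "finite X" "F \<subseteq> X"
  shows "gprob X p (\<lambda>E. F \<subseteq> E) = p ^ card F"
proof -
  have "gprob X p (\<lambda>E. F \<subseteq> E) = gprob X p (\<lambda>E. E \<inter> F = F)"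
    by (rule gprob_cong) auto
  then show ?thesis using gprob_pattern'[OF assms(1,2), of F p] by simp
qed

section \<open>From the random graph to finite sums\<close>

lemma prob_Pi_bernoulli:
  assumes "0 \<le> p" "p \<le> 1" and finA: "finite A"
  shows "measure_pmf.prob (map_pmf (\<lambda>f. {e. f e}) (Pi_pmf A False (\<lambda>_. bernoulli_pmf p))) {E. Q E} =
    gprob A p Q"
proof -
  let ?P = "Pi_pmf A False (\<lambda>_. bernoulli_pmf p)"
  let ?h = "\<lambda>E e. e \<in> E"
  have pmf: "pmf ?P (?h E) = gweight A p E" if "E \<subseteq> A" for E
  proof -
    have "pmf ?P (?h E) = (\<Prod>e\<in>A. if e \<in> E then p else 1 - p)"
      using that assms by (subst pmf_Pi'[OF finA]) (auto intro!: prod.cong)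
    also have "\<dots> = p ^ card (A \<inter> {e. e \<in> E}) * (1 - p) ^ card (A \<inter> - {e. e \<in> E})"
      by (simp only: prod.If_cases[OF finA] prod_constant)
    also have "A \<inter> {e. e \<in> E} = E" using that by auto
    also have "A \<inter> - {e. e \<in> E} = A - E" by auto
    finally show ?thesis by (simp add: gweight_def)
  qed
  have supp: "set_pmf ?P \<subseteq> ?h ` Pow A"
  proof
    fix f assume "f \<in> set_pmf ?P"
    then have "f \<in> PiE_dflt A False (\<lambda>_. set_pmf (bernoulli_pmf p))"
      using set_Pi_pmf_subset'[OF finA, of False "\<lambda>_. bernoulli_pmf p"] by auto
    then have "{e. f e} \<subseteq> A" by (auto simp: PiE_dflt_def)
    moreover have "f = ?h {e. f e}" by simp
    ultimately show "f \<in> ?h ` Pow A" by blast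
  qed
  have inj: "inj_on ?h {E \<in> Pow A. Q E}" by (rule inj_onI) (metis Collect_mem_eq)
  have "measure_pmf.prob (map_pmf (\<lambda>f. {e. f e}) ?P) {E. Q E} = measure_pmf.prob ?P {f. Q {e. f e}}"
    by (simp add: measure_map_pmf vimage_def)
  also have "\<dots> = measure_pmf.prob ?P ({f. Q {e. f e}} \<inter> ?h ` Pow A)"
    using supp by (intro measure_prob_cong_0) (auto simp: set_pmf_iff)
  also have "\<dots> = sum (pmf ?P) ({f. Q {e. f e}} \<inter> ?h ` Pow A)"
    by (rule measure_measure_pmf_finite) (simp add: finA)
  also have "{f. Q {e. f e}} \<inter> ?h ` Pow A = ?h ` {E \<in> Pow A. Q E}" by auto
  also have "sum (pmf ?P) (?h ` {E \<in> Pow A. Q E}) = (\<Sum>E\<in>{E \<in> Pow A. Q E}. pmf ?P (?h E))"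
    unfolding sum.reindex[OF inj] o_def ..
  also have "\<dots> = (\<Sum>E\<in>{E \<in> Pow A. Q E}. gweight A p E)"
    by (rule sum.cong) (auto simp: pmf)
  also have "\<dots> = gprob A p Q"
    unfolding gprob_def gexp_def using finA
    by (intro sum.mono_neutral_cong_left) auto
  finally show ?thesis .
qed

definition rg_prob :: "real \<Rightarrow> nat \<Rightarrow> (nat set set \<Rightarrow> bool) \<Rightarrow> real" where
  "rg_prob c n Q = gprob (pairs {1..n}) (c / real n) Q"

lemma prob_models_eq_rg_prob:
  assumes "0 < c" "c \<le> real n"
  shows "prob_models c \<phi> n = rg_prob c n (\<lambda>E. models {1..n} E \<phi>)"
  unfolding prob_models_def rg_prob_def random_graph_def potential_edges_eq_pairs
  using assms by (intro prob_Pi_bernoulli) auto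

lemma edge_prob_bounds:
  assumes "0 < c" "c \<le> real n"
  shows "0 \<le> c / real n" "c / real n \<le> 1" "0 < real n"
  using assms by auto

lemma eventually_c_le: "eventually (\<lambda>n. c \<le> real n) sequentially"
  by (rule filterlim_at_top[THEN iffD1, rule_format, OF filterlim_real_sequentially])

text \<open>The single first moment estimate behind all "negligible" events: a bounded set of vertices
  that, apart from \<open>W\<close>, spans more edges than it has vertices.\<close>

definition fm_const :: "nat \<Rightarrow> nat \<Rightarrow> real \<Rightarrow> real" where
  "fm_const w K c = 2 ^ w * 2 ^ (2 ^ K) * (real K + 1) * (1 + c) ^ (K + 1)"

lemma fm_const_nonneg: "0 < c \<Longrightarrow> 0 \<le> fm_const w K c"
  by (simp add: fm_const_def)

lemma rg_prob_excess_le: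
  assumes c: "0 < c" "c \<le> real n" and W: "W \<subseteq> {1..n}" and Y: "Y \<subseteq> pairs {1..n}"
  shows "rg_prob c n (\<lambda>E. \<exists>M. M \<subseteq> {1..n} \<and> card M \<le> K \<and> card (M - W) + 1 \<le> card (induced (E \<inter> Y) M))
    \<le> fm_const (card W) K c / real n"
proof -
  let ?V = "{1..n}" and ?p = "c / real n"
  note p = edge_prob_bounds[OF c]
  define \<M> where "\<M> = {M. M \<subseteq> ?V \<and> card M \<le> K}"
  \<comment> \<open>A crude bound for the number of edge sets inside one \<open>M\<close>: its edges
    are among at most \<open>2 ^ K\<close> subsets of \<open>M\<close>.\<close>
  define C where "C = (2 :: real) ^ (2 ^ K)"
  have Cp: "0 \<le> C * ?p ^ k" for k
    unfolding C_def by (intro mult_nonneg_nonneg zero_le_power p(1)) simp_all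
  have fin\<M>: "finite \<M>" unfolding \<M>_def by (rule finite_subset[of _ "Pow ?V"]) auto
  have finW: "finite W" by (rule finite_subset[OF W]) simp
  have one: "gprob (pairs ?V) ?p (\<lambda>E. card (M - W) + 1 \<le> card (induced (E \<inter> Y) M)) \<le> C * ?p ^ (card (M - W) + 1)"
    if M: "M \<in> \<M>" for M
  proof -
    let ?s = "card (M - W) + 1"
    define \<F> where "\<F> = {F. F \<subseteq> induced Y M \<and> card F = ?s}"
    have finM: "finite M" using M by (intro finite_subset[of M ?V]) (auto simp: \<M>_def)
    have fin: "finite (induced Y M)" using finM by simp
    have fin\<F>: "finite \<F>" unfolding \<F>_def by (rule finite_subset[of _ "Pow (induced Y M)"]) (use fin in auto)
    have "gprob (pairs ?V) ?p (\<lambda>E. ?s \<le> card (induced (E \<inter> Y) M)) \<le> gprob (pairs ?V) ?p (\<lambda>E. \<exists>F\<in>\<F>. F \<subseteq> E)"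
    proof (rule gprob_mono[OF p(1,2)])
      fix E assume "?s \<le> card (induced (E \<inter> Y) M)"
      then obtain F where F: "F \<subseteq> induced (E \<inter> Y) M" "card F = ?s"
        by (metis obtain_subset_with_card_n)
      then have "F \<in> \<F>" "F \<subseteq> E" by (auto simp: \<F>_def induced_def)
      then show "\<exists>F\<in>\<F>. F \<subseteq> E" by blast
    qed
    also have "\<dots> \<le> (\<Sum>F\<in>\<F>. gprob (pairs ?V) ?p (\<lambda>E. F \<subseteq> E))"
      by (rule gprob_Bex_le[OF fin\<F> p(1,2)])
    also have "\<dots> = (\<Sum>F\<in>\<F>. ?p ^ ?s)"
    proof (rule sum.cong[OF refl])
      fix F assume F: "F \<in> \<F>"
      then have "F \<subseteq> pairs ?V" using Y by (auto simp: \<F>_def induced_def)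
      then show "gprob (pairs ?V) ?p (\<lambda>E. F \<subseteq> E) = ?p ^ ?s" using F by (simp add: gprob_superset \<F>_def)
    qed
    also have "\<dots> = real (card \<F>) * ?p ^ ?s" by simp
    also have "\<dots> \<le> C * ?p ^ ?s"
    proof (rule mult_right_mono)
      have "card \<F> \<le> card (Pow (induced Y M))" unfolding \<F>_def by (rule card_mono) (use fin in auto)
      also have "\<dots> = 2 ^ card (induced Y M)" using fin by (rule card_Pow)
      also have "\<dots> \<le> 2 ^ (2 ^ K)"
      proof (rule power_increasing)
        have "card (induced Y M) \<le> card (Pow M)" by (rule card_mono) (use finM in \<open>auto simp: induced_def\<close>)
        also have "\<dots> = 2 ^ card M" using finM by (rule card_Pow)
        also have "\<dots> \<le> 2 ^ K" using M by (intro power_increasing) (auto simp: \<M>_def)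
        finally show "card (induced Y M) \<le> 2 ^ K" .
      qed simp
      finally have "card \<F> \<le> 2 ^ (2 ^ K)" .
      then have "real (card \<F>) \<le> real (2 ^ (2 ^ K))" by (rule of_nat_mono)
      then show "real (card \<F>) \<le> C" by (simp add: C_def)
    qed (rule zero_le_power[OF p(1)])
    finally show ?thesis .
  qed
  have "rg_prob c n (\<lambda>E. \<exists>M. M \<subseteq> ?V \<and> card M \<le> K \<and> card (M - W) + 1 \<le> card (induced (E \<inter> Y) M)) =
      gprob (pairs ?V) ?p (\<lambda>E. \<exists>M\<in>\<M>. card (M - W) + 1 \<le> card (induced (E \<inter> Y) M))"
    unfolding rg_prob_def \<M>_def by (rule gprob_cong) auto
  also have "\<dots> \<le> (\<Sum>M\<in>\<M>. gprob (pairs ?V) ?p (\<lambda>E. card (M - W) + 1 \<le> card (induced (E \<inter> Y) M)))"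
    by (rule gprob_Bex_le[OF fin\<M> p(1,2)])
  also have "\<dots> \<le> (\<Sum>M\<in>\<M>. C * ?p ^ (card (M - W) + 1))" by (rule sum_mono) (rule one)
  \<comment> \<open>Vertices inside \<open>W\<close> are free of charge: there are at most
    \<open>2 ^ card W\<close> choices for \<open>M \<inter> W\<close>. The \<open>s\<close> vertices
    outside cost \<open>n ^ s\<close> choices against \<open>p ^ (s + 1)\<close>, which leaves order
    \<open>1 / n\<close>.\<close>
  also have "\<dots> = (\<Sum>(D, T)\<in>(\<lambda>M. (M \<inter> W, M - W)) ` \<M>. C * ?p ^ (card T + 1))"
  proof -
    have "inj_on (\<lambda>M. (M \<inter> W, M - W)) \<M>" by (rule inj_onI) blast
    then show ?thesis by (subst sum.reindex) (auto simp: o_def)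
  qed
  also have "\<dots> \<le> (\<Sum>(D, T)\<in>Pow W \<times> \<M>. C * ?p ^ (card T + 1))"
  proof (rule sum_mono2)
    show "finite (Pow W \<times> \<M>)" using finW fin\<M> by simp
    show "(\<lambda>M. (M \<inter> W, M - W)) ` \<M> \<subseteq> Pow W \<times> \<M>"
    proof -
      have "card (M - W) \<le> K" if "M \<subseteq> ?V" "card M \<le> K" for M
        by (rule le_trans[OF card_mono[OF finite_subset[OF that(1) finite_atLeastAtMost]] that(2)]) auto
      then show ?thesis by (auto simp: \<M>_def)
    qed
    show "0 \<le> (case b of (D, T) \<Rightarrow> C * ?p ^ (card T + 1))" for b by (cases b) (simp only: prod.case Cp)
  qed
  also have "\<dots> = 2 ^ card W * (\<Sum>T\<in>\<M>. C * ?p ^ (card T + 1))"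
    by (simp add: sum.cartesian_product[symmetric] card_Pow finW)
  also have "(\<Sum>T\<in>\<M>. C * ?p ^ (card T + 1)) = (\<Sum>s\<le>K. \<Sum>T\<in>{T \<in> \<M>. card T = s}. C * ?p ^ (card T + 1))"
    by (rule sum.group[symmetric]) (use fin\<M> in \<open>auto simp: \<M>_def\<close>)
  also have "\<dots> \<le> (\<Sum>s\<le>K. C * (1 + c) ^ (K + 1) / real n)"
  proof (rule sum_mono)
    fix s assume s: "s \<in> {..K}"
    have "{T \<in> \<M>. card T = s} = {T. T \<subseteq> ?V \<and> card T = s}" using s by (auto simp: \<M>_def)
    then have "card {T \<in> \<M>. card T = s} = n choose s" using n_subsets[of ?V s] by simp
    then have "(\<Sum>T\<in>{T \<in> \<M>. card T = s}. C * ?p ^ (card T + 1)) = real (n choose s) * (C * ?p ^ (s + 1))"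
      by simp
    also have "\<dots> \<le> real n ^ s * (C * ?p ^ (s + 1))"
    proof (rule mult_right_mono)
      have "n choose s \<le> n ^ s"
      proof (cases "s \<le> n")
        case True then show ?thesis by (rule binomial_le_pow)
      qed (simp add: binomial_eq_0)
      then have "real (n choose s) \<le> real (n ^ s)" by (rule of_nat_mono)
      then show "real (n choose s) \<le> real n ^ s" by simp
    qed (rule Cp)
    also have "\<dots> = C * c ^ (s + 1) / real n" using p(3) by (simp add: field_simps power_divide)
    also have "c ^ (s + 1) \<le> (1 + c) ^ (K + 1)"
    proof -
      have "c ^ (s + 1) \<le> (1 + c) ^ (s + 1)" using c by (intro power_mono) auto
      also have "\<dots> \<le> (1 + c) ^ (K + 1)" using c s by (intro power_increasing) auto
      finally show ?thesis .
    qed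
    then have "C * c ^ (s + 1) / real n \<le> C * (1 + c) ^ (K + 1) / real n"
      using p by (intro divide_right_mono mult_left_mono) (auto simp: C_def)
    finally show "(\<Sum>T\<in>{T \<in> \<M>. card T = s}. C * ?p ^ (card T + 1)) \<le> C * (1 + c) ^ (K + 1) / real n" .
  qed
  also have "\<dots> = (real K + 1) * (C * (1 + c) ^ (K + 1) / real n)" by (simp add: algebra_simps)
  finally show ?thesis by (simp add: fm_const_def C_def algebra_simps)
qed

section \<open>The number of short circuits and the law of the core\<close>

lemma choose_power_tendsto: "(\<lambda>n. real (n choose k) * (c / real n) ^ k) \<longlonglongrightarrow> c ^ k / fact k"
proof -
  have "(\<lambda>n. c ^ k / fact k * (\<Prod>i=0..<k. (real n - real i) / real n)) \<longlonglongrightarrow> c ^ k / fact k * (\<Prod>i=0..<k. 1)"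
  proof (intro tendsto_mult tendsto_const tendsto_prod)
    fix i
    have "(\<lambda>n. 1 - real i / real n) \<longlonglongrightarrow> 1 - 0"
      by (intro tendsto_diff tendsto_const tendsto_divide_0[OF tendsto_const] filterlim_real_at_infinity_sequentially)
    moreover have "eventually (\<lambda>n. 1 - real i / real n = (real n - real i) / real n) sequentially"
      using eventually_gt_at_top[of 0] by eventually_elim (simp add: field_simps)
    ultimately show "(\<lambda>n. (real n - real i) / real n) \<longlonglongrightarrow> 1"
      using Lim_transform_eventually by fastforce
  qed
  moreover have "eventually (\<lambda>n. c ^ k / fact k * (\<Prod>i=0..<k. (real n - real i) / real n) =
      real (n choose k) * (c / real n) ^ k) sequentially"
    using eventually_gt_at_top[of 0]
    by eventually_elim
      (simp add: binomial_gbinomial gbinomial_prod_rev prod_dividef power_divide)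
  ultimately show ?thesis using Lim_transform_eventually by fastforce
qed

lemma choose_power_le:
  assumes "0 < c" "0 < real n"
  shows "real (n choose k) * (c / real n) ^ k \<le> c ^ k / fact k"
proof -
  have "(n choose k) * fact k \<le> n ^ k" by (rule binomial_fact_pow)
  then have "real (n choose k) * fact k \<le> real n ^ k"
    by (metis of_nat_fact of_nat_le_iff of_nat_mult of_nat_power)
  then have "real (n choose k) * fact k * c ^ k \<le> real n ^ k * c ^ k"
    using assms by (intro mult_right_mono) auto
  then show ?thesis using assms by (simp add: power_divide field_simps)
qed

lemma one_minus_power_tendsto: "(\<lambda>n. (1 - c / real n) ^ k) \<longlonglongrightarrow> 1"
proof -
  have "(\<lambda>n. (1 - c / real n) ^ k) \<longlonglongrightarrow> (1 - 0) ^ k"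
    by (intro tendsto_power tendsto_diff tendsto_const tendsto_divide_0[OF tendsto_const]
        filterlim_real_at_infinity_sequentially)
  then show ?thesis by simp
qed

text \<open>\<open>a * (n - m)\<close> counts the forbidden edges from \<open>a\<close> vertices of
  an \<open>m\<close>-set to its complement. Every factor \<open>exp (- c)\<close> in the limit law
  arises here; the bounded number \<open>b\<close> of further absent edges has no effect in the
  limit.\<close>

lemma one_minus_power_diff_tendsto: "(\<lambda>n. (1 - c / real n) ^ (b + a * (n - m))) \<longlonglongrightarrow> exp (- c * real a)"
proof -
  have "(\<lambda>n. (1 + (- c) / real n) ^ n) \<longlonglongrightarrow> exp (- c)" by (rule tendsto_exp_limit_sequentially)
  then have "(\<lambda>n. (1 - c / real n) ^ b * ((1 - c / real n) ^ n / (1 - c / real n) ^ m) ^ a) \<longlonglongrightarrow>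
      1 * (exp (- c) / 1) ^ a"
    by (intro tendsto_mult tendsto_power tendsto_divide one_minus_power_tendsto) auto
  moreover have "eventually (\<lambda>n. (1 - c / real n) ^ b * ((1 - c / real n) ^ n / (1 - c / real n) ^ m) ^ a =
      (1 - c / real n) ^ (b + a * (n - m))) sequentially"
    using eventually_c_le[of "c + 1"] eventually_ge_at_top[of m] eventually_gt_at_top[of 0]
  proof eventually_elim
    case (elim n)
    then have "1 - c / real n \<noteq> 0" by (simp add: field_simps)
    then show ?case using elim by (simp add: power_add power_diff power_mult mult.commute[of a])
  qed
  ultimately have "(\<lambda>n. (1 - c / real n) ^ (b + a * (n - m))) \<longlonglongrightarrow> 1 * (exp (- c) / 1) ^ a"
    by (rule Lim_transform_eventually)
  then show ?thesis by (simp add: exp_of_nat2_mult[symmetric] mult.commute)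
qed

lemma tendsto_approx:
  fixes x :: "nat \<Rightarrow> real"
  assumes "\<And>e. 0 < e \<Longrightarrow> \<exists>y l. y \<longlonglongrightarrow> l \<and> \<bar>l - L\<bar> \<le> e \<and> eventually (\<lambda>n. \<bar>x n - y n\<bar> \<le> e) sequentially"
  shows "x \<longlonglongrightarrow> L"
proof (rule tendstoI)
  fix e :: real assume "0 < e"
  then obtain y l where y: "y \<longlonglongrightarrow> l" "\<bar>l - L\<bar> \<le> e / 4" "eventually (\<lambda>n. \<bar>x n - y n\<bar> \<le> e / 4) sequentially"
    using assms[of "e / 4"] by auto
  have "eventually (\<lambda>n. dist (y n) l < e / 4) sequentially"
    using \<open>0 < e\<close> by (intro tendstoD[OF y(1)]) simp
  then show "eventually (\<lambda>n. dist (x n) L < e) sequentially"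
    using y(3)
  proof eventually_elim
    case (elim n)
    then show ?case using y(2) \<open>0 < e\<close> unfolding dist_real_def by linarith
  qed
qed

lemma const_over_n_tendsto: "(\<lambda>n. C / real n) \<longlonglongrightarrow> 0"
  by (intro tendsto_divide_0[OF tendsto_const] filterlim_real_at_infinity_sequentially)

lemma img_bij_betw:
  assumes f: "bij f" and P: "\<And>H. P (f ` A) (img f H) \<longleftrightarrow> P A H"
  shows "bij_betw (img f) {H. H \<subseteq> pairs A \<and> P A H} {H. H \<subseteq> pairs (f ` A) \<and> P (f ` A) H}"
  unfolding bij_betw_def
proof
  show "inj_on (img f) {H. H \<subseteq> pairs A \<and> P A H}"
    by (rule inj_onI, drule arg_cong[where f = "img (inv f)"], simp only: img_inv[OF f])
  show "img f ` {H. H \<subseteq> pairs A \<and> P A H} = {H. H \<subseteq> pairs (f ` A) \<and> P (f ` A) H}"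
  proof (intro equalityI subsetI)
    fix H assume H: "H \<in> {H. H \<subseteq> pairs (f ` A) \<and> P (f ` A) H}"
    let ?H = "img (inv f) H"
    have e: "img f ?H = H" using img_inv[OF bij_imp_bij_inv[OF f], of H] f by (simp add: inv_inv_eq)
    then have "?H \<subseteq> pairs A" using H img_subset_pairs[OF f, of ?H A] by simp
    moreover have "P A ?H" using P[of ?H] H e by simp
    ultimately have "?H \<in> {H. H \<subseteq> pairs A \<and> P A H}" by simp
    then show "H \<in> img f ` {H. H \<subseteq> pairs A \<and> P A H}" by (intro image_eqI[where x = ?H and f = "img f"] e[symmetric])
  next
    fix H assume "H \<in> img f ` {H. H \<subseteq> pairs A \<and> P A H}"
    then obtain G where "H = img f G" "G \<subseteq> pairs A" "P A G" by blast
    then show "H \<in> {H. H \<subseteq> pairs (f ` A) \<and> P (f ` A) H}" using P img_subset_pairs[OF f] by simp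
  qed
qed

section \<open>Labelled cycles and patterns near a fixed set\<close>

text \<open>Equality of the two counts is built in, which fixes the probability of such a pattern;
  circuits with surplus edges are absorbed into the negligible events.\<close>

definition circuits_on :: "'a set \<Rightarrow> 'a set set set" where
  "circuits_on M = {F. F \<subseteq> pairs M \<and> card F = card M \<and> circuit F M}"

definition ncirc :: "nat \<Rightarrow> nat" where
  "ncirc k = card (circuits_on {1..k})"

definition circ_mean :: "real \<Rightarrow> nat \<Rightarrow> real" where
  "circ_mean c K = (\<Sum>k\<le>K. c ^ k * real (ncirc k) / fact k)"

lemma circ_mean_nonneg: "0 < c \<Longrightarrow> 0 \<le> circ_mean c K"
  unfolding circ_mean_def by (intro sum_nonneg) simp

lemma finite_circuits_on: "finite M \<Longrightarrow> finite (circuits_on M)"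
  by (rule finite_subset[of _ "Pow (pairs M)"]) (auto simp: circuits_on_def)

lemma card_circuits_on:
  fixes M :: "nat set"
  assumes "finite M"
  shows "card (circuits_on M) = ncirc (card M)"
proof -
  obtain f where f: "bij f" "f ` {1..card M} = M" using ex_bij_image[of "{1..card M}" M] assms by auto
  have "bij_betw (img f) (circuits_on {1..card M}) (circuits_on (f ` {1..card M}))"
    unfolding circuits_on_def by (rule img_bij_betw[OF f(1)]) (simp add: card_img circuit_img card_image_bij f(1))
  then show ?thesis unfolding f(2) ncirc_def by (simp add: bij_betw_same_card)
qed

lemma circuit_iff_circuits_on:
  assumes "simple E" "finite M"
  shows "induced E M \<in> circuits_on M \<longleftrightarrow> circuit E M \<and> card (induced E M) \<le> card M"
proof -
  have "circuit (induced E M) M \<longleftrightarrow> circuit E M" by (rule circuit_induced) simp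
  moreover have "circuit E M \<Longrightarrow> card M \<le> card (induced E M)" by (simp add: circuit_def)
  ultimately show ?thesis using induced_pairs[OF assms(1), of M] by (auto simp: circuits_on_def)
qed

lemma circuit_contains_circuits_on:
  assumes "simple E" "circuit E M"
  shows "\<exists>F\<in>circuits_on M. F \<subseteq> E"
proof -
  have M: "finite M" "M \<noteq> {}" "card M \<le> card (induced E M)"
    "\<And>T. T \<subset> M \<Longrightarrow> T \<noteq> {} \<Longrightarrow> card (induced E T) < card T" using assms(2) by (auto simp: circuit_def)
  obtain F where F: "F \<subseteq> induced E M" "card F = card M"
    using M(3) by (metis obtain_subset_with_card_n)
  have FM: "F \<subseteq> pairs M" using F(1) induced_pairs[OF assms(1), of M] by auto
  have "circuit F M" unfolding circuit_def
  proof (intro conjI allI impI)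
    show "card M \<le> card (induced F M)" using F(2) FM by (simp add: induced_all)
    fix T assume T: "T \<subset> M \<and> T \<noteq> {}"
    have "induced F T \<subseteq> induced E T" using F(1) by (auto simp: induced_def)
    then have "card (induced F T) \<le> card (induced E T)"
      using T M(1) by (intro card_mono finite_induced) (auto intro: finite_subset)
    then show "card (induced F T) < card T" using M(4)[of T] T by linarith
  qed (use M in auto)
  then show ?thesis using F FM by (auto simp: circuits_on_def induced_def)
qed

lemma circuit_diff:
  assumes "\<And>e. e \<in> Z \<Longrightarrow> e \<inter> W \<noteq> {}" "M \<inter> W = {}"
  shows "circuit (E - Z) M \<longleftrightarrow> circuit E M"
proof -
  have "induced (E - Z) M = induced E M" using assms by (auto simp: induced_def)
  then show ?thesis using circuit_induced[of M M "E - Z"] circuit_induced[of M M E] by simp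
qed

lemma fm_const_mono: "0 < c \<Longrightarrow> w \<le> w' \<Longrightarrow> fm_const w K c \<le> fm_const w' K c"
  unfolding fm_const_def by (intro mult_right_mono power_increasing) auto

lemma rg_prob_bounds:
  assumes "0 < c" "c \<le> real n"
  shows "0 \<le> rg_prob c n Q" "rg_prob c n Q \<le> 1"
  unfolding rg_prob_def using edge_prob_bounds[OF assms]
  by (auto intro: gprob_nonneg gprob_le_1)

text \<open>A prescribed pattern \<open>H\<close> on the edges \<open>Z\<close> near \<open>W\<close> is asymptotically independent of the short
  circuits.\<close>

lemma rg_pattern_estimate:
  assumes c: "0 < c" "c \<le> real n" and W: "W \<subseteq> {1..n}"
    and Z: "Z \<subseteq> pairs {1..n}" "\<And>e. e \<in> Z \<Longrightarrow> e \<inter> W \<noteq> {}" and H: "H \<subseteq> Z"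
    and Q: "\<And>E. E \<subseteq> pairs {1..n} \<Longrightarrow> E \<inter> Z = H \<Longrightarrow>
      \<not> (\<exists>M. M \<subseteq> {1..n} \<and> card M \<le> K \<and> card (M - W) + 1 \<le> card (induced (E - Z) M)) \<Longrightarrow>
      Q E \<longleftrightarrow> S {M \<in> short_circuits K E. M \<inter> W = {}}"
  shows "\<bar>rg_prob c n (\<lambda>E. E \<inter> Z = H \<and> Q E) -
      (c / n) ^ card H * (1 - c / n) ^ card (Z - H) * rg_prob c n (\<lambda>E. S (short_circuits K E))\<bar>
    \<le> (c / n) ^ card H * (1 - c / n) ^ card (Z - H) * (2 * fm_const (card W) K c / n)"
proof -
  define V where "V = {1..n}"
  define p where "p = c / real n"
  define a where "a = p ^ card H * (1 - p) ^ card (Z - H)"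
  define bad where "bad G \<longleftrightarrow> (\<exists>M. M \<subseteq> V \<and> card M \<le> K \<and> card (M - W) + 1 \<le> card (induced G M))" for G
  define out where "out E = {M \<in> short_circuits K E. M \<inter> W = {}}" for E
  note p = edge_prob_bounds[OF c, folded p_def]
  have a0: "0 \<le> a" unfolding a_def using p by (intro mult_nonneg_nonneg zero_le_power) auto
  have finX: "finite (pairs V)" by (simp add: V_def)
  have rg: "rg_prob c n R = gprob (pairs V) p R" for R by (simp add: rg_prob_def V_def p_def)
  note ZV = Z(1)[folded V_def]
  have out: "out (E - Z) = out E" for E
    unfolding out_def short_circuits_def using circuit_diff[OF Z(2)] by blast
  \<comment> \<open>The bad event looks only at edges outside \<open>Z\<close>, so it is independent
    of the pattern and its probability carries the weight \<open>a\<close> of the pattern. Errors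
    proportional to \<open>a\<close> can later be summed over all patterns and positions.\<close>
  have "\<bar>gprob (pairs V) p (\<lambda>E. E \<inter> Z = H \<and> Q E) - gprob (pairs V) p (\<lambda>E. E \<inter> Z = H \<and> S (out (E - Z)))\<bar>
      \<le> gprob (pairs V) p (\<lambda>E. E \<inter> Z = H \<and> bad (E - Z))"
  proof (rule gprob_diff_le[OF p(1,2)])
    fix E assume E: "E \<subseteq> pairs V" "\<not> (E \<inter> Z = H \<and> bad (E - Z))"
    show "E \<inter> Z = H \<and> Q E \<longleftrightarrow> E \<inter> Z = H \<and> S (out (E - Z))"
    proof (cases "E \<inter> Z = H")
      case True
      then have "Q E \<longleftrightarrow> S (out E)"
        using Q[of E] E unfolding bad_def V_def out_def by blast
      then show ?thesis unfolding out by simp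
    qed simp
  qed
  also have "\<dots> = a * gprob (pairs V) p (\<lambda>E. bad (E - Z))"
    unfolding a_def by (rule gprob_pattern[OF finX ZV H])
  also have "gprob (pairs V) p (\<lambda>E. bad (E - Z)) \<le> fm_const (card W) K c / n"
  proof -
    have "gprob (pairs V) p (\<lambda>E. bad (E - Z)) = rg_prob c n (\<lambda>E. \<exists>M. M \<subseteq> {1..n} \<and> card M \<le> K \<and>
        card (M - W) + 1 \<le> card (induced (E \<inter> (pairs {1..n} - Z)) M))"
      unfolding rg
    proof (rule gprob_cong)
      fix E assume "E \<subseteq> pairs V"
      then have "E - Z = E \<inter> (pairs {1..n} - Z)" by (auto simp: V_def)
      then show "bad (E - Z) \<longleftrightarrow> (\<exists>M. M \<subseteq> {1..n} \<and> card M \<le> K \<and>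
        card (M - W) + 1 \<le> card (induced (E \<inter> (pairs {1..n} - Z)) M))"
        unfolding bad_def V_def by (simp only:)
    qed
    also have "\<dots> \<le> fm_const (card W) K c / n" by (rule rg_prob_excess_le[OF c W]) auto
    finally show ?thesis .
  qed
  finally have 1: "\<bar>gprob (pairs V) p (\<lambda>E. E \<inter> Z = H \<and> Q E) - gprob (pairs V) p (\<lambda>E. E \<inter> Z = H \<and> S (out (E - Z)))\<bar>
      \<le> a * (fm_const (card W) K c / n)" using a0 by (meson mult_left_mono order_trans)
  have 2: "gprob (pairs V) p (\<lambda>E. E \<inter> Z = H \<and> S (out (E - Z))) = a * gprob (pairs V) p (\<lambda>E. S (out (E - Z)))"
    unfolding a_def by (rule gprob_pattern[OF finX ZV H])
  \<comment> \<open>Second comparison, between the circuits avoiding \<open>W\<close> and all short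
    circuits. A circuit meeting the fixed set \<open>W\<close> has more edges than vertices outside
    \<open>W\<close>, so one exists with probability of order \<open>1 / n\<close> only.\<close>
  have "\<bar>gprob (pairs V) p (\<lambda>E. S (out (E - Z))) - gprob (pairs V) p (\<lambda>E. S (short_circuits K E))\<bar>
      \<le> gprob (pairs V) p (\<lambda>E. \<exists>M. M \<subseteq> {1..n} \<and> card M \<le> K \<and> card (M - W) + 1 \<le> card (induced (E \<inter> pairs {1..n}) M))"
  proof (rule gprob_diff_le[OF p(1,2)])
    fix E assume E: "E \<subseteq> pairs V"
      and nb: "\<not> (\<exists>M. M \<subseteq> {1..n} \<and> card M \<le> K \<and> card (M - W) + 1 \<le> card (induced (E \<inter> pairs {1..n}) M))"
    have EV: "E \<inter> pairs {1..n} = E" using E by (auto simp: V_def)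
    have "M \<inter> W = {}" if M: "M \<in> short_circuits K E" for M
    proof (rule ccontr)
      assume ne: "M \<inter> W \<noteq> {}"
      have "M \<subseteq> V" using M short_circuits_subset_Pow[OF E, of K] by auto
      moreover have cM: "card M \<le> K" "card M \<le> card (induced E M)" "finite M"
        using M by (auto simp: short_circuits_def circuit_def)
      moreover have "card (M - W) < card M" using ne cM(3) by (intro psubset_card_mono) auto
      ultimately show False using nb unfolding EV V_def by fastforce
    qed
    then have "out E = short_circuits K E" by (auto simp: out_def)
    then show "S (out (E - Z)) \<longleftrightarrow> S (short_circuits K E)" unfolding out by simp
  qed
  also have "\<dots> \<le> fm_const (card W) K c / n"
    using rg_prob_excess_le[OF c W, of "pairs {1..n}" K] unfolding rg by simp
  finally have 3: "\<bar>gprob (pairs V) p (\<lambda>E. S (out (E - Z))) - gprob (pairs V) p (\<lambda>E. S (short_circuits K E))\<bar>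
      \<le> fm_const (card W) K c / n" .
  have "\<bar>a * gprob (pairs V) p (\<lambda>E. S (out (E - Z))) - a * gprob (pairs V) p (\<lambda>E. S (short_circuits K E))\<bar>
      \<le> a * (fm_const (card W) K c / n)"
    unfolding right_diff_distrib[symmetric] abs_mult abs_of_nonneg[OF a0] by (rule mult_left_mono[OF 3 a0])
  then have "\<bar>gprob (pairs V) p (\<lambda>E. E \<inter> Z = H \<and> Q E) - a * gprob (pairs V) p (\<lambda>E. S (short_circuits K E))\<bar>
      \<le> a * (fm_const (card W) K c / n) + a * (fm_const (card W) K c / n)"
    using 1 2 by linarith
  then show ?thesis unfolding rg a_def[symmetric] p_def[symmetric] by (simp add: algebra_simps)
qed

text \<open>By minimality the part of \<open>M\<close> inside \<open>W\<close> spans fewer edges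
  than it has vertices, so the other edges outnumber the vertices outside \<open>W\<close>.\<close>

lemma excess_of_crossing_circuit:
  assumes "simple E" "circuit E M" "M \<inter> W \<noteq> {}" "\<not> M \<subseteq> W"
    and Z: "\<And>e. e \<in> E \<Longrightarrow> e \<subseteq> M \<Longrightarrow> \<not> e \<subseteq> W \<Longrightarrow> e \<notin> Z"
  shows "card (M - W) + 1 \<le> card (induced (E - Z) M)"
proof -
  have M: "finite M" "card M \<le> card (induced E M)" using assms(2) by (auto simp: circuit_def)
  have "card (induced E (M \<inter> W)) < card (M \<inter> W)"
  proof -
    have "M \<inter> W \<subset> M" using assms(4) by auto
    then show ?thesis using assms(2,3) by (simp add: circuit_def)
  qed
  moreover have "induced E M \<subseteq> induced E (M \<inter> W) \<union> induced (E - Z) M"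
    using Z by (auto simp: induced_def)
  then have "card (induced E M) \<le> card (induced E (M \<inter> W) \<union> induced (E - Z) M)"
    using M(1) by (intro card_mono) auto
  moreover note card_Un_le[of "induced E (M \<inter> W)" "induced (E - Z) M"]
  moreover have "card M = card (M \<inter> W) + card (M - W)"
    using card_Un_disjoint[of "M \<inter> W" "M - W"] M(1) by (simp add: Int_Diff_Un Int_Diff_disjoint)
  ultimately show ?thesis using M(2) by linarith
qed

section \<open>Poisson limit of the number of short circuits\<close>

text \<open>The exact expectation, for finite \<open>n\<close>, of the number of small sets inducing
  a member of \<open>circuits_on\<close>.\<close>

definition circ_mean_n :: "real \<Rightarrow> nat \<Rightarrow> nat \<Rightarrow> real" where
  "circ_mean_n c K n = (\<Sum>k\<le>K. real (n choose k) * (real (ncirc k) * ((c / n) ^ k * (1 - c / n) ^ ((k choose 2) - k))))"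

lemma sum_small_sets:
  fixes g :: "nat \<Rightarrow> real"
  shows "(\<Sum>M\<in>{M. M \<subseteq> {1..n} \<and> card M \<le> K}. g (card M)) = (\<Sum>k\<le>K. real (n choose k) * g k)"
proof -
  let ?\<M> = "{M. M \<subseteq> {1..n} \<and> card M \<le> K}"
  have fin: "finite ?\<M>" by (rule finite_subset[of _ "Pow {1..n}"]) auto
  have "(\<Sum>M\<in>?\<M>. g (card M)) = (\<Sum>k\<le>K. \<Sum>M\<in>{M \<in> ?\<M>. card M = k}. g (card M))"
    by (rule sum.group[symmetric]) (use fin in auto)
  also have "\<dots> = (\<Sum>k\<le>K. real (n choose k) * g k)"
  proof (rule sum.cong[OF refl])
    fix k assume "k \<in> {..K}"
    then have "{M \<in> ?\<M>. card M = k} = {M. M \<subseteq> {1..n} \<and> card M = k}" by auto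
    then have "card {M \<in> ?\<M>. card M = k} = n choose k" using n_subsets[of "{1..n}" k] by simp
    then show "(\<Sum>M\<in>{M \<in> ?\<M>. card M = k}. g (card M)) = real (n choose k) * g k" by simp
  qed
  finally show ?thesis .
qed

lemma circ_mean_n_tendsto: "(\<lambda>n. circ_mean_n c K n) \<longlonglongrightarrow> circ_mean c K"
proof -
  have "(\<lambda>n. \<Sum>k\<le>K. (real (n choose k) * (c / n) ^ k) * real (ncirc k) * (1 - c / n) ^ ((k choose 2) - k)) \<longlonglongrightarrow>
      (\<Sum>k\<le>K. c ^ k / fact k * real (ncirc k) * 1)"
    by (intro tendsto_sum tendsto_mult choose_power_tendsto one_minus_power_tendsto tendsto_const)
  then show ?thesis unfolding circ_mean_n_def circ_mean_def by (simp add: algebra_simps)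
qed

lemma circ_mean_n_bounds:
  assumes "0 < c" "c \<le> real n"
  shows "0 \<le> circ_mean_n c K n" "circ_mean_n c K n \<le> circ_mean c K"
proof -
  note p = edge_prob_bounds[OF assms]
  show "0 \<le> circ_mean_n c K n" unfolding circ_mean_n_def
    using p by (intro sum_nonneg mult_nonneg_nonneg zero_le_power) auto
  have "real (n choose k) * (real (ncirc k) * ((c / n) ^ k * (1 - c / n) ^ ((k choose 2) - k)))
      \<le> c ^ k * real (ncirc k) / fact k" for k
  proof -
    have "(1 - c / n) ^ ((k choose 2) - k) \<le> 1" using p by (intro power_le_one) auto
    moreover have "0 \<le> (real (n choose k) * (c / n) ^ k) * real (ncirc k)"
      using p by (intro mult_nonneg_nonneg zero_le_power) auto
    ultimately have "(real (n choose k) * (c / n) ^ k) * real (ncirc k) * (1 - c / n) ^ ((k choose 2) - k)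
        \<le> (real (n choose k) * (c / n) ^ k) * real (ncirc k)" by (rule mult_left_le)
    also have "\<dots> \<le> c ^ k / fact k * real (ncirc k)"
      using choose_power_le[OF assms(1) p(3)] by (intro mult_right_mono) auto
    finally show ?thesis by (simp add: algebra_simps)
  qed
  then show "circ_mean_n c K n \<le> circ_mean c K" unfolding circ_mean_n_def circ_mean_def by (rule sum_mono)
qed

text \<open>Once \<open>M\<close> induces the cycle \<open>F\<close>, any other short circuit either
  avoids \<open>M\<close> or crosses its boundary. The second case is negligible, so off it exactly
  one circuit is removed from the count.\<close>

lemma rg_prob_one_circuit:
  assumes c: "0 < c" "c \<le> real n" and M: "M \<subseteq> {1..n}" "card M \<le> K" and F: "F \<in> circuits_on M"
  shows "\<bar>rg_prob c n (\<lambda>E. E \<inter> pairs M = F \<and> card (short_circuits K E) = Suc j) -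
      (c / n) ^ card M * (1 - c / n) ^ ((card M choose 2) - card M) * rg_prob c n (\<lambda>E. card (short_circuits K E) = j)\<bar>
    \<le> (c / n) ^ card M * (1 - c / n) ^ ((card M choose 2) - card M) * (2 * fm_const (card M) K c / n)"
proof -
  have finM: "finite M" by (rule finite_subset[OF M(1)]) simp
  have Fp: "F \<subseteq> pairs M" and cF: "card F = card M" and circF: "circuit F M"
    using F by (auto simp: circuits_on_def)
  have cards: "card (pairs M - F) = (card M choose 2) - card M"
    using Fp finM by (subst card_Diff_subset) (auto simp: card_pairs cF finite_subset)
  have "\<bar>rg_prob c n (\<lambda>E. E \<inter> pairs M = F \<and> card (short_circuits K E) = Suc j) -
      (c / n) ^ card F * (1 - c / n) ^ card (pairs M - F) * rg_prob c n (\<lambda>E. card (short_circuits K E) = j)\<bar>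
    \<le> (c / n) ^ card F * (1 - c / n) ^ card (pairs M - F) * (2 * fm_const (card M) K c / n)"
  proof (rule rg_pattern_estimate[OF c M(1), where S = "\<lambda>X. card X = j"])
    show "pairs M \<subseteq> pairs {1..n}" using M(1) by (auto simp: pairs_def)
    show "e \<inter> M \<noteq> {}" if "e \<in> pairs M" for e
    proof -
      have "e \<noteq> {}" "e \<subseteq> M" using that by (auto simp: pairs_def)
      then show ?thesis by auto
    qed
    show "F \<subseteq> pairs M" by (rule Fp)
    fix E assume E: "E \<subseteq> pairs {1..n}" "E \<inter> pairs M = F"
      "\<not> (\<exists>M'. M' \<subseteq> {1..n} \<and> card M' \<le> K \<and> card (M' - M) + 1 \<le> card (induced (E - pairs M) M'))"
    note sE = simple_pairs[OF E(1)]
    have iE: "induced E M = F" using induced_eq_Int_pairs[OF sE, of M] E(2) by simp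
    have cM: "circuit E M" using circuit_induced[of M M E] iE circF by simp
    have sc: "short_circuits K E = insert M {M' \<in> short_circuits K E. M' \<inter> M = {}}"
    proof (intro equalityI subsetI)
      fix M' assume M': "M' \<in> short_circuits K E"
      show "M' \<in> insert M {M' \<in> short_circuits K E. M' \<inter> M = {}}"
      proof (rule ccontr)
        assume "\<not> ?thesis"
        then have ne: "M' \<noteq> M" "M' \<inter> M \<noteq> {}" using M' by auto
        have circ': "circuit E M'" "card M' \<le> K" using M' by (auto simp: short_circuits_def)
        have "\<not> M' \<subset> M"
        proof
          assume "M' \<subset> M"
          then have "card (induced E M') < card M'" using cM ne(2) by (auto simp: circuit_def)
          then show False using circ'(1) by (simp add: circuit_def)
        qed
        then have "\<not> M' \<subseteq> M" using ne(1) by auto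
        then have "card (M' - M) + 1 \<le> card (induced (E - pairs M) M')"
          using excess_of_crossing_circuit[OF sE circ'(1) ne(2)] by (auto simp: pairs_def)
        moreover have "M' \<subseteq> {1..n}" using M' short_circuits_subset_Pow[OF E(1), of K] by auto
        ultimately show False using E(3) circ'(2) by blast
      qed
    next
      fix M' assume "M' \<in> insert M {M' \<in> short_circuits K E. M' \<inter> M = {}}"
      then show "M' \<in> short_circuits K E" using cM M(2) by (auto simp: short_circuits_def)
    qed
    have "finite {M' \<in> short_circuits K E. M' \<inter> M = {}}"
      using finite_short_circuits[OF E(1)] by simp
    moreover have "M \<notin> {M' \<in> short_circuits K E. M' \<inter> M = {}}" using circF by (auto simp: circuit_def)
    ultimately have "card (short_circuits K E) = Suc (card {M' \<in> short_circuits K E. M' \<inter> M = {}})"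
      by (subst sc) (rule card_insert_disjoint)
    then show "card (short_circuits K E) = Suc j \<longleftrightarrow> card {M' \<in> short_circuits K E. M' \<inter> M = {}} = j" by simp
  qed
  then show ?thesis unfolding cF cards .
qed

text \<open>Size biasing: removing a uniformly chosen circuit from a graph with \<open>Suc j\<close> short circuits
  leaves, up to negligible events, a graph with \<open>j\<close> of them.\<close>

lemma circuit_count_recurrence:
  assumes c: "0 < c" "c \<le> real n"
  shows "\<bar>real (Suc j) * rg_prob c n (\<lambda>E. card (short_circuits K E) = Suc j) -
      circ_mean_n c K n * rg_prob c n (\<lambda>E. card (short_circuits K E) = j)\<bar>
    \<le> (circ_mean c K * (2 * fm_const K K c) + real (Suc j) * fm_const 0 K c) / n"
proof -
  define V where "V = {1..n}"
  define p where "p = c / real n"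
  define X where "X = pairs V"
  define \<M> where "\<M> = {M. M \<subseteq> V \<and> card M \<le> K}"
  define a where "a M = p ^ card M * (1 - p) ^ ((card M choose 2) - card M)" for M :: "nat set"
  define P where "P j = rg_prob c n (\<lambda>E. card (short_circuits K E) = j)" for j
  define T where "T M F = gprob X p (\<lambda>E. E \<inter> pairs M = F \<and> card (short_circuits K E) = Suc j)" for M F
  define B where "B E \<longleftrightarrow> (\<exists>M. M \<subseteq> V \<and> card M \<le> K \<and> card (M - {}) + 1 \<le> card (induced (E \<inter> X) M))" for E
  note p = edge_prob_bounds[OF c, folded p_def]
  have rg: "rg_prob c n R = gprob X p R" for R by (simp add: rg_prob_def V_def p_def X_def)
  have finV: "finite V" by (simp add: V_def)
  have fin\<M>: "finite \<M>" unfolding \<M>_def by (rule finite_subset[of _ "Pow V"]) (auto simp: finV)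
  have finM: "finite M" if "M \<in> \<M>" for M using that finV by (intro finite_subset[of M V]) (auto simp: \<M>_def)
  have a0: "0 \<le> a M" for M unfolding a_def using p by (intro mult_nonneg_nonneg zero_le_power) auto
  have mean: "circ_mean_n c K n = (\<Sum>M\<in>\<M>. \<Sum>F\<in>circuits_on M. a M)"
  proof -
    have "(\<Sum>M\<in>\<M>. \<Sum>F\<in>circuits_on M. a M) = (\<Sum>M\<in>\<M>. real (ncirc (card M)) * a M)"
      by (intro sum.cong refl) (simp add: card_circuits_on finM)
    also have "\<dots> = (\<Sum>k\<le>K. real (n choose k) * (real (ncirc k) * (p ^ k * (1 - p) ^ ((k choose 2) - k))))"
      unfolding \<M>_def V_def a_def by (rule sum_small_sets)
    finally show ?thesis by (simp add: circ_mean_n_def p_def)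
  qed
  have T: "\<bar>T M F - a M * P j\<bar> \<le> a M * (2 * fm_const K K c / n)" if M: "M \<in> \<M>" and F: "F \<in> circuits_on M" for M F
  proof -
    have "\<bar>T M F - a M * P j\<bar> \<le> a M * (2 * fm_const (card M) K c / n)"
      unfolding T_def a_def P_def p_def X_def V_def rg_prob_def[symmetric]
      using M F by (intro rg_prob_one_circuit[OF c]) (auto simp: \<M>_def V_def)
    also have "\<dots> \<le> a M * (2 * fm_const K K c / n)"
      using M p(3) fm_const_mono[OF c(1), of "card M" K K]
      by (intro mult_left_mono a0 divide_right_mono) (auto simp: \<M>_def)
    finally show ?thesis .
  qed
  have "\<bar>(\<Sum>M\<in>\<M>. \<Sum>F\<in>circuits_on M. T M F) - circ_mean_n c K n * P j\<bar>
      = \<bar>\<Sum>M\<in>\<M>. \<Sum>F\<in>circuits_on M. T M F - a M * P j\<bar>"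
    unfolding mean by (simp add: sum_subtractf sum_distrib_right mult.assoc)
  also have "\<dots> \<le> (\<Sum>M\<in>\<M>. \<Sum>F\<in>circuits_on M. a M * (2 * fm_const K K c / n))"
    by (intro order.trans[OF sum_abs] sum_mono T)
  also have "\<dots> = circ_mean_n c K n * (2 * fm_const K K c / n)"
    unfolding mean sum_distrib_right ..
  also have "\<dots> \<le> circ_mean c K * (2 * fm_const K K c / n)"
    using circ_mean_n_bounds[OF c, of K] fm_const_nonneg[OF c(1), of K K] p(3) by (intro mult_right_mono) auto
  finally have 1: "\<bar>(\<Sum>M\<in>\<M>. \<Sum>F\<in>circuits_on M. T M F) - circ_mean_n c K n * P j\<bar>
    \<le> circ_mean c K * (2 * fm_const K K c / n)" .
  \<comment> \<open>\<open>N'\<close> counts only the sets inducing a pattern from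
    \<open>circuits_on\<close>, so that summing over \<open>F\<close> is summing over disjoint
    events. It differs from the number of short circuits only on the excess event
    \<open>B\<close>.\<close>
  define N' where "N' E = (\<Sum>M\<in>\<M>. of_bool (induced E M \<in> circuits_on M) :: real)" for E :: "nat set set"
  have sumT: "(\<Sum>M\<in>\<M>. \<Sum>F\<in>circuits_on M. T M F) =
      gexp X p (\<lambda>E. N' E * of_bool (card (short_circuits K E) = Suc j))"
  proof -
    have "(\<Sum>F\<in>circuits_on M. T M F) =
        gexp X p (\<lambda>E. of_bool (induced E M \<in> circuits_on M) * of_bool (card (short_circuits K E) = Suc j))"
      if M: "M \<in> \<M>" for M
    proof -
      have "(\<Sum>F\<in>circuits_on M. T M F) =
          gprob X p (\<lambda>E. \<exists>F\<in>circuits_on M. E \<inter> pairs M = F \<and> card (short_circuits K E) = Suc j)"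
        unfolding T_def by (rule gprob_disjoint_Bex[symmetric]) (use finite_circuits_on[OF finM[OF M]] in auto)
      also have "\<dots> = gexp X p (\<lambda>E. of_bool (induced E M \<in> circuits_on M) * of_bool (card (short_circuits K E) = Suc j))"
        unfolding gprob_def X_def
      proof (rule gexp_cong)
        fix E assume "E \<subseteq> pairs V"
        then have "induced E M = E \<inter> pairs M" by (intro induced_eq_Int_pairs simple_pairs)
        then show "of_bool (\<exists>F\<in>circuits_on M. E \<inter> pairs M = F \<and> card (short_circuits K E) = Suc j) =
          (of_bool (induced E M \<in> circuits_on M) * of_bool (card (short_circuits K E) = Suc j) :: real)"
          by simp
      qed
      finally show ?thesis .
    qed
    then have "(\<Sum>M\<in>\<M>. \<Sum>F\<in>circuits_on M. T M F) = (\<Sum>M\<in>\<M>.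
        gexp X p (\<lambda>E. of_bool (induced E M \<in> circuits_on M) * of_bool (card (short_circuits K E) = Suc j)))"
      by (rule sum.cong[OF refl])
    then show ?thesis unfolding N'_def sum_distrib_right gexp_sum .
  qed
  have N': "0 \<le> real (card (short_circuits K E)) - N' E" "\<not> B E \<Longrightarrow> N' E = real (card (short_circuits K E))"
    "0 \<le> N' E" if E: "E \<subseteq> X" for E
  proof -
    note sE = simple_pairs[OF E[unfolded X_def]]
    have sc: "short_circuits K E = {M \<in> \<M>. circuit E M}"
      using short_circuits_subset_Pow[OF E[unfolded X_def], of K] by (auto simp: short_circuits_def \<M>_def)
    have N'c: "N' E = real (card {M \<in> \<M>. induced E M \<in> circuits_on M})"
      unfolding N'_def using fin\<M> by (simp add: of_bool_def sum.If_cases Int_def)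
    have "{M \<in> \<M>. induced E M \<in> circuits_on M} \<subseteq> short_circuits K E"
      unfolding sc using circuit_iff_circuits_on[OF sE finM] by blast
    then have "card {M \<in> \<M>. induced E M \<in> circuits_on M} \<le> card (short_circuits K E)"
      using fin\<M> sc by (intro card_mono) auto
    then show "0 \<le> real (card (short_circuits K E)) - N' E" unfolding N'c by simp
    show "0 \<le> N' E" unfolding N'c by simp
    assume nB: "\<not> B E"
    have "card (induced E M) \<le> card M" if "M \<in> \<M>" for M
    proof -
      have "E \<inter> X = E" using E by auto
      then show ?thesis using nB that unfolding B_def \<M>_def by fastforce
    qed
    then have "{M \<in> \<M>. induced E M \<in> circuits_on M} = short_circuits K E"
      unfolding sc using circuit_iff_circuits_on[OF sE finM] by blast
    then show "N' E = real (card (short_circuits K E))" unfolding N'c by simp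
  qed
  have "real (Suc j) * P (Suc j) - gexp X p (\<lambda>E. N' E * of_bool (card (short_circuits K E) = Suc j)) =
      gexp X p (\<lambda>E. (real (card (short_circuits K E)) - N' E) * of_bool (card (short_circuits K E) = Suc j))"
    unfolding P_def rg gprob_def gexp_cmult[symmetric] gexp_diff[symmetric]
    by (rule gexp_cong) (simp add: algebra_simps)
  also have "\<bar>\<dots>\<bar> \<le> gexp X p (\<lambda>E. \<bar>(real (card (short_circuits K E)) - N' E) * of_bool (card (short_circuits K E) = Suc j)\<bar>)"
    by (rule gexp_abs_le[OF p(1,2)])
  also have "\<dots> \<le> gexp X p (\<lambda>E. real (Suc j) * of_bool (B E))"
  proof (rule gexp_mono[OF p(1,2)])
    fix E assume E: "E \<subseteq> X"
    show "\<bar>(real (card (short_circuits K E)) - N' E) * of_bool (card (short_circuits K E) = Suc j)\<bar>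
      \<le> real (Suc j) * of_bool (B E)"
      using N'[OF E] by (cases "B E"; cases "card (short_circuits K E) = Suc j") auto
  qed
  also have "\<dots> = real (Suc j) * rg_prob c n B" unfolding gexp_cmult rg gprob_def ..
  also have "\<dots> \<le> real (Suc j) * (fm_const 0 K c / n)"
    unfolding B_def V_def X_def using rg_prob_excess_le[OF c, of "{}" "pairs {1..n}" K] by (intro mult_left_mono) auto
  finally have "\<bar>real (Suc j) * P (Suc j) - (\<Sum>M\<in>\<M>. \<Sum>F\<in>circuits_on M. T M F)\<bar> \<le> real (Suc j) * (fm_const 0 K c / n)"
    unfolding sumT .
  with 1 have "\<bar>real (Suc j) * P (Suc j) - circ_mean_n c K n * P j\<bar>
      \<le> circ_mean c K * (2 * fm_const K K c / n) + real (Suc j) * (fm_const 0 K c / n)" by linarith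
  then show ?thesis unfolding P_def by (simp add: add_divide_distrib)
qed

text \<open>A union bound over the cycle patterns that a circuit must contain. It holds for every
  \<open>n \<ge> c\<close> and gives tightness of the count.\<close>

lemma rg_exp_circuit_count_le:
  assumes c: "0 < c" "c \<le> real n"
  shows "gexp (pairs {1..n}) (c / n) (\<lambda>E. real (card (short_circuits K E))) \<le> circ_mean c K"
proof -
  define V where "V = {1..n}"
  define p where "p = c / real n"
  define \<M> where "\<M> = {M. M \<subseteq> V \<and> card M \<le> K}"
  note p = edge_prob_bounds[OF c, folded p_def]
  have finV: "finite V" by (simp add: V_def)
  have fin\<M>: "finite \<M>" unfolding \<M>_def by (rule finite_subset[of _ "Pow V"]) (auto simp: finV)
  have finM: "finite M" if "M \<in> \<M>" for M using that finV by (intro finite_subset[of M V]) (auto simp: \<M>_def)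
  have "gexp (pairs V) p (\<lambda>E. real (card (short_circuits K E))) \<le>
      gexp (pairs V) p (\<lambda>E. \<Sum>M\<in>\<M>. \<Sum>F\<in>circuits_on M. of_bool (F \<subseteq> E))"
  proof (rule gexp_mono[OF p(1,2)])
    fix E assume E: "E \<subseteq> pairs V"
    have sc: "short_circuits K E = {M \<in> \<M>. circuit E M}"
      using short_circuits_subset_Pow[OF E, of K] by (auto simp: short_circuits_def \<M>_def)
    have "real (card (short_circuits K E)) = (\<Sum>M\<in>\<M>. of_bool (circuit E M))"
      unfolding sc using fin\<M> by (simp add: of_bool_def sum.If_cases Int_def)
    also have "\<dots> \<le> (\<Sum>M\<in>\<M>. \<Sum>F\<in>circuits_on M. of_bool (F \<subseteq> E))"
    proof (rule sum_mono)
      fix M assume M: "M \<in> \<M>"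
      show "of_bool (circuit E M) \<le> (\<Sum>F\<in>circuits_on M. of_bool (F \<subseteq> E) :: real)"
      proof (cases "circuit E M")
        case True
        then obtain F where F: "F \<in> circuits_on M" "F \<subseteq> E"
          using circuit_contains_circuits_on[OF simple_pairs[OF E]] by blast
        then show ?thesis
          using member_le_sum[of F "circuits_on M" "\<lambda>F. of_bool (F \<subseteq> E) :: real"] finite_circuits_on[OF finM[OF M]] True
          by auto
      qed (simp add: sum_nonneg)
    qed
    finally show "real (card (short_circuits K E)) \<le> (\<Sum>M\<in>\<M>. \<Sum>F\<in>circuits_on M. of_bool (F \<subseteq> E))" .
  qed
  also have "\<dots> = (\<Sum>M\<in>\<M>. \<Sum>F\<in>circuits_on M. gprob (pairs V) p (\<lambda>E. F \<subseteq> E))"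
    unfolding gexp_sum gprob_def ..
  also have "\<dots> = (\<Sum>M\<in>\<M>. \<Sum>F\<in>circuits_on M. p ^ card M)"
  proof (intro sum.cong refl)
    fix M F assume M: "M \<in> \<M>" and F: "F \<in> circuits_on M"
    have "F \<subseteq> pairs V" using M F by (auto simp: \<M>_def circuits_on_def pairs_def)
    then show "gprob (pairs V) p (\<lambda>E. F \<subseteq> E) = p ^ card M"
      using F finV by (simp add: gprob_superset circuits_on_def)
  qed
  also have "\<dots> = (\<Sum>M\<in>\<M>. real (ncirc (card M)) * p ^ card M)"
    by (intro sum.cong refl) (simp add: card_circuits_on finM)
  also have "\<dots> = (\<Sum>k\<le>K. real (n choose k) * (real (ncirc k) * p ^ k))"
    unfolding \<M>_def V_def by (rule sum_small_sets)
  also have "\<dots> \<le> circ_mean c K"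
    unfolding circ_mean_def
  proof (rule sum_mono)
    fix k
    have "real (n choose k) * p ^ k * real (ncirc k) \<le> c ^ k / fact k * real (ncirc k)"
      unfolding p_def using choose_power_le[OF c(1) p(3)] by (intro mult_right_mono) auto
    then show "real (n choose k) * (real (ncirc k) * p ^ k) \<le> c ^ k * real (ncirc k) / fact k"
      by (simp add: algebra_simps)
  qed
  finally show ?thesis by (simp add: V_def p_def)
qed

text \<open>Iterating the recurrence expresses all probabilities through that of having no short
  circuit, which is still unknown at this point.\<close>

lemma circuit_count_vs_zero:
  assumes c: "0 < c"
  shows "(\<lambda>n. rg_prob c n (\<lambda>E. card (short_circuits K E) = j) -
     circ_mean c K ^ j / fact j * rg_prob c n (\<lambda>E. card (short_circuits K E) = 0)) \<longlonglongrightarrow> 0"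
proof (induction j)
  case (Suc j)
  define P where "P j n = rg_prob c n (\<lambda>E. card (short_circuits K E) = j)" for j n
  let ?L = "circ_mean c K"
  have bd: "eventually (\<lambda>n. norm (P i n) \<le> 1) sequentially" for i
    using eventually_c_le[of c] by eventually_elim (use rg_prob_bounds[OF c] in \<open>auto simp: P_def\<close>)
  have "(\<lambda>n. real (Suc j) * P (Suc j) n - circ_mean_n c K n * P j n) \<longlonglongrightarrow> 0"
  proof (rule Lim_null_comparison)
    show "eventually (\<lambda>n. norm (real (Suc j) * P (Suc j) n - circ_mean_n c K n * P j n) \<le>
        (?L * (2 * fm_const K K c) + real (Suc j) * fm_const 0 K c) / real n) sequentially"
      using eventually_c_le[of c]
      by eventually_elim (use circuit_count_recurrence[OF c, of _ j K] in \<open>auto simp: P_def\<close>)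
  qed (rule const_over_n_tendsto)
  moreover have "(\<lambda>n. (circ_mean_n c K n - ?L) * P j n) \<longlonglongrightarrow> 0"
  proof (rule Lim_null_comparison)
    show "eventually (\<lambda>n. norm ((circ_mean_n c K n - ?L) * P j n) \<le> \<bar>circ_mean_n c K n - ?L\<bar>) sequentially"
      using bd[of j] by eventually_elim (simp add: abs_mult mult_left_le)
    show "(\<lambda>n. \<bar>circ_mean_n c K n - ?L\<bar>) \<longlonglongrightarrow> 0"
      using circ_mean_n_tendsto[of c K] by (simp add: tendsto_rabs_zero LIM_zero)
  qed
  moreover have "(\<lambda>n. ?L * (P j n - ?L ^ j / fact j * P 0 n)) \<longlonglongrightarrow> ?L * 0"
    using Suc.IH unfolding P_def by (intro tendsto_mult tendsto_const)
  ultimately have "(\<lambda>n. ((real (Suc j) * P (Suc j) n - circ_mean_n c K n * P j n) + (circ_mean_n c K n - ?L) * P j n +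
      ?L * (P j n - ?L ^ j / fact j * P 0 n)) / real (Suc j)) \<longlonglongrightarrow> (0 + 0 + ?L * 0) / real (Suc j)"
    by (intro tendsto_divide tendsto_add tendsto_const) auto
  moreover have "((real (Suc j) * P (Suc j) n - circ_mean_n c K n * P j n) + (circ_mean_n c K n - ?L) * P j n +
      ?L * (P j n - ?L ^ j / fact j * P 0 n)) / real (Suc j) = P (Suc j) n - ?L ^ Suc j / fact (Suc j) * P 0 n" for n
  proof -
    have "(real (Suc j) * P (Suc j) n - circ_mean_n c K n * P j n) + (circ_mean_n c K n - ?L) * P j n +
      ?L * (P j n - ?L ^ j / fact j * P 0 n) = real (Suc j) * P (Suc j) n - ?L ^ Suc j / fact j * P 0 n"
      by (simp add: algebra_simps)
    moreover have "?L ^ Suc j / fact j * P 0 n / real (Suc j) = ?L ^ Suc j / fact (Suc j) * P 0 n"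
      by (simp add: fact_Suc mult.commute)
    ultimately show ?thesis by (simp only: diff_divide_distrib) simp
  qed
  ultimately have "(\<lambda>n. P (Suc j) n - ?L ^ Suc j / fact (Suc j) * P 0 n) \<longlonglongrightarrow> (0 + 0 + ?L * 0) / real (Suc j)"
    by (simp only:)
  then show ?case unfolding P_def by (simp only: mult_zero_right add_0 div_0)
qed simp

text \<open>The missing probability of no circuit is found by normalisation: the probabilities up to
  \<open>J\<close> sum to 1 with an error of at most \<open>L / real (Suc J)\<close> by Markov's
  inequality, and asymptotically they are \<open>P 0\<close> times a partial sum of the exponential
  series. No moments beyond the first are needed.\<close>

theorem circuit_count_tendsto_Poisson:
  assumes c: "0 < c"
  shows "(\<lambda>n. rg_prob c n (\<lambda>E. card (short_circuits K E) = j)) \<longlonglongrightarrow>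
    exp (- circ_mean c K) * circ_mean c K ^ j / fact j"
proof -
  define P where "P j n = rg_prob c n (\<lambda>E. card (short_circuits K E) = j)" for j n
  define L where "L = circ_mean c K"
  have L0: "0 \<le> L" using circ_mean_nonneg[OF c] by (simp add: L_def)
  have part: "\<bar>(\<Sum>j\<le>J. P j n) - 1\<bar> \<le> L / real (Suc J)" if n: "c \<le> real n" for n J
  proof -
    note p = edge_prob_bounds[OF c n]
    have "(\<Sum>j\<le>J. P j n) = gprob (pairs {1..n}) (c / n) (\<lambda>E. \<exists>j\<in>{..J}. card (short_circuits K E) = j)"
      unfolding P_def rg_prob_def by (rule gprob_disjoint_Bex[symmetric]) auto
    also have "\<dots> = gprob (pairs {1..n}) (c / n) (\<lambda>E. \<not> (real (Suc J) \<le> real (card (short_circuits K E))))"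
      by (rule gprob_cong) auto
    also have "\<dots> = 1 - gprob (pairs {1..n}) (c / n) (\<lambda>E. real (Suc J) \<le> real (card (short_circuits K E)))"
      by (rule gprob_not) simp
    finally have "(\<Sum>j\<le>J. P j n) - 1 = - gprob (pairs {1..n}) (c / n) (\<lambda>E. real (Suc J) \<le> real (card (short_circuits K E)))"
      by simp
    moreover have "gprob (pairs {1..n}) (c / n) (\<lambda>E. real (Suc J) \<le> real (card (short_circuits K E))) \<le> L / real (Suc J)"
    proof -
      have "gprob (pairs {1..n}) (c / n) (\<lambda>E. real (Suc J) \<le> real (card (short_circuits K E))) \<le>
          gexp (pairs {1..n}) (c / n) (\<lambda>E. real (card (short_circuits K E))) / real (Suc J)"
        by (rule gprob_Markov[OF p(1,2)]) auto
      also have "\<dots> \<le> L / real (Suc J)"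
        unfolding L_def by (intro divide_right_mono rg_exp_circuit_count_le[OF c n]) simp
      finally show ?thesis .
    qed
    moreover have "0 \<le> gprob (pairs {1..n}) (c / n) (\<lambda>E. real (Suc J) \<le> real (card (short_circuits K E)))"
      by (rule gprob_nonneg[OF p(1,2)])
    ultimately show ?thesis by linarith
  qed
  have diff: "(\<lambda>n. (\<Sum>j\<le>J. P j n - L ^ j / fact j * P 0 n)) \<longlonglongrightarrow> 0" for J
  proof -
    have "(\<lambda>n. (\<Sum>j\<le>J. P j n - L ^ j / fact j * P 0 n)) \<longlonglongrightarrow> (\<Sum>j\<le>J. 0)"
      unfolding P_def L_def by (intro tendsto_sum circuit_count_vs_zero[OF c])
    then show ?thesis by (simp only: sum.neutral_const)
  qed
  have "(\<lambda>n. P 0 n * exp L) \<longlonglongrightarrow> 1"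
  proof (rule tendsto_approx)
    fix e :: real assume e: "0 < e"
    have "(\<lambda>J. L / real (Suc J)) \<longlonglongrightarrow> 0" by (rule LIMSEQ_Suc[OF const_over_n_tendsto])
    then have "eventually (\<lambda>J. L / real (Suc J) < e / 2) sequentially" by (rule order_tendstoD) (use e in simp)
    moreover have "(\<lambda>J. \<Sum>j\<le>J. L ^ j / fact j) \<longlonglongrightarrow> exp L"
      using exp_converges[of L] unfolding sums_def_le by (simp add: divide_inverse_commute)
    then have "eventually (\<lambda>J. \<bar>(\<Sum>j\<le>J. L ^ j / fact j) - exp L\<bar> < e / 2) sequentially"
      using tendstoD[of _ "exp L" sequentially "e / 2"] e by (simp add: dist_real_def)
    ultimately have "eventually (\<lambda>J. L / real (Suc J) < e / 2 \<and> \<bar>(\<Sum>j\<le>J. L ^ j / fact j) - exp L\<bar> < e / 2) sequentially"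
      by eventually_elim simp
    then have "\<exists>J. L / real (Suc J) < e / 2 \<and> \<bar>(\<Sum>j\<le>J. L ^ j / fact j) - exp L\<bar> < e / 2"
      by (rule eventually_happens'[OF sequentially_bot])
    then obtain J where J: "L / real (Suc J) < e / 2" "\<bar>(\<Sum>j\<le>J. L ^ j / fact j) - exp L\<bar> < e / 2"
      by blast
    \<comment> \<open>\<open>?y\<close> tends to 1 and differs from \<open>P 0 n * exp L\<close> by
      two tails, that of the exponential series and that of the circuit count. The choice of
      \<open>J\<close> makes both smaller than \<open>e / 2\<close>.\<close>
    let ?y = "\<lambda>n. 1 - (\<Sum>j\<le>J. P j n - L ^ j / fact j * P 0 n)"
    have "?y \<longlonglongrightarrow> 1 - 0" by (intro tendsto_diff tendsto_const diff)
    moreover have "eventually (\<lambda>n. \<bar>P 0 n * exp L - ?y n\<bar> \<le> e) sequentially"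
      using eventually_c_le[of c]
    proof eventually_elim
      case (elim n)
      have eq: "P 0 n * exp L - ?y n = P 0 n * (exp L - (\<Sum>j\<le>J. L ^ j / fact j)) + ((\<Sum>j\<le>J. P j n) - 1)"
        by (simp add: sum_subtractf sum_distrib_left algebra_simps)
      have "\<bar>P 0 n * (exp L - (\<Sum>j\<le>J. L ^ j / fact j))\<bar> \<le> 1 * \<bar>exp L - (\<Sum>j\<le>J. L ^ j / fact j)\<bar>"
        unfolding abs_mult using rg_prob_bounds[OF c elim] by (intro mult_right_mono) (auto simp: P_def)
      moreover have "\<bar>exp L - (\<Sum>j\<le>J. L ^ j / fact j)\<bar> < e / 2" using J(2) by (simp only: abs_minus_commute)
      moreover have "\<bar>(\<Sum>j\<le>J. P j n) - 1\<bar> < e / 2" using part[OF elim, of J] J(1) by (rule le_less_trans)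
      moreover have "\<bar>A + B\<bar> \<le> e" if "\<bar>A\<bar> \<le> 1 * u" "u < e / 2" "\<bar>B\<bar> < e / 2" for A B u
        using that by linarith
      ultimately show ?case unfolding eq by blast
    qed
    ultimately show "\<exists>y l. y \<longlonglongrightarrow> l \<and> \<bar>l - 1\<bar> \<le> e \<and> eventually (\<lambda>n. \<bar>P 0 n * exp L - y n\<bar> \<le> e) sequentially"
      using e by (intro exI[of _ ?y] exI[of _ 1]) simp
  qed
  then have "(\<lambda>n. (P 0 n * exp L) * exp (- L)) \<longlonglongrightarrow> 1 * exp (- L)" by (intro tendsto_mult tendsto_const)
  then have "P 0 \<longlonglongrightarrow> exp (- L)" by (simp add: mult.assoc exp_minus_inverse)
  then have "(\<lambda>n. (P j n - L ^ j / fact j * P 0 n) + L ^ j / fact j * P 0 n) \<longlonglongrightarrow> 0 + L ^ j / fact j * exp (- L)"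
    using circuit_count_vs_zero[OF c, of K j] unfolding P_def L_def by (intro tendsto_add tendsto_mult tendsto_const)
  then show ?thesis unfolding P_def L_def by (simp add: mult.commute)
qed

section \<open>Law of the core\<close>

definition core_graphs :: "nat \<Rightarrow> nat \<Rightarrow> 'a set \<Rightarrow> 'a set set set" where
  "core_graphs K r W = {H. H \<subseteq> pairs W \<and> card H = card W \<and> core_verts K (Suc r) H = W}"

text \<open>The core has radius \<open>Suc r\<close> and its interior radius \<open>r\<close>. Only
  interior vertices have all their edges prescribed, so each of them, and no vertex of the last
  layer, contributes a factor \<open>exp (- c)\<close> for its absent edges to the outside. The
  first factor is the probability of no further short circuit.\<close>

definition core_weight :: "real \<Rightarrow> nat \<Rightarrow> nat \<Rightarrow> (nat set set \<Rightarrow> bool) \<Rightarrow> nat \<Rightarrow> real" where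
  "core_weight c K r Q m = exp (- circ_mean c K) * (c ^ m / fact m *
     (\<Sum>H\<in>{H \<in> core_graphs K r {1..m}. Q H}. exp (- c * real (card (core_verts K r H)))))"

lemma finite_core_graphs: "finite W \<Longrightarrow> finite (core_graphs K r W)"
  by (rule finite_subset[of _ "Pow (pairs W)"]) (auto simp: core_graphs_def)

lemma core_verts_Suc: "core_verts K r E \<subseteq> core_verts K (Suc r) E"
  by (auto simp: core_verts_def)

lemma card_cross_edges:
  assumes "finite I" "finite U" "I \<inter> U = {}"
  shows "card ((\<lambda>(u, v). {u, v}) ` (I \<times> U)) = card I * card U"
proof -
  have "inj_on (\<lambda>(u, v). {u, v}) (I \<times> U)"
    using assms(3) by (auto simp: inj_on_def doubleton_eq_iff)
  then show ?thesis by (simp add: card_image card_cartesian_product)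
qed

text \<open>By \<open>core_eq_iff\<close> the event prescribes the pairs inside \<open>W\<close>,
  forbids those from the interior to the complement, and demands that no short circuit leaves
  \<open>W\<close>. The first two conditions form a pattern. Up to crossing circuits the third
  concerns circuits avoiding \<open>W\<close>, and \<open>rg_pattern_estimate\<close>
  applies.\<close>

lemma rg_core_eq_estimate:
  assumes c: "0 < c" "c \<le> real n" and W: "W \<subseteq> {1..n}" and H: "H \<in> core_graphs K r W"
  defines "a \<equiv> (c / n) ^ card W * (1 - c / n) ^ (((card W choose 2) - card W) + card (core_verts K r H) * (n - card W))"
  shows "\<bar>rg_prob c n (\<lambda>E. core_verts K (Suc r) E = W \<and> core K (Suc r) E = H) -
      a * rg_prob c n (\<lambda>E. short_circuits K E = {})\<bar> \<le> a * (2 * fm_const (card W) K c / n)"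
proof -
  define V where "V = {1..n}"
  define I where "I = core_verts K r H"
  define X where "X = (\<lambda>(u, v). {u, v}) ` (I \<times> (V - W))"
  define Z where "Z = pairs W \<union> X"
  have Hp: "H \<subseteq> pairs W" and cH: "card H = card W" and cvH: "core_verts K (Suc r) H = W"
    using H by (auto simp: core_graphs_def)
  have IW: "I \<subseteq> W" unfolding I_def using core_verts_Suc[of K r H] cvH by simp
  have WV: "W \<subseteq> V" using W by (simp add: V_def)
  have finV: "finite V" "card V = n" by (simp_all add: V_def)
  have finW: "finite W" by (rule finite_subset[OF WV finV(1)])
  have finI: "finite I" by (rule finite_subset[OF IW finW])
  have XV: "X \<subseteq> pairs V"
  proof
    fix e assume "e \<in> X"
    then obtain u v where "e = {u, v}" "u \<in> I" "v \<in> V - W" by (auto simp: X_def)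
    then show "e \<in> pairs V" using IW WV by (auto simp: pairs_def card_insert_if)
  qed
  have XW: "X \<inter> pairs W = {}" by (auto simp: X_def pairs_def)
  have ZV: "Z \<subseteq> pairs {1..n}" using XV WV unfolding Z_def V_def by (auto simp: pairs_def)
  have HZ: "H \<subseteq> Z" using Hp by (auto simp: Z_def)
  have ZW: "e \<inter> W \<noteq> {}" if "e \<in> Z" for e
  proof (cases "e \<in> X")
    case True
    then show ?thesis using IW by (auto simp: X_def)
  next
    case False
    then have "e \<subseteq> W" "e \<noteq> {}" using that by (auto simp: Z_def pairs_def)
    then show ?thesis by auto
  qed
  have cX: "card X = card I * (n - card W)"
  proof -
    have "card (V - W) = n - card W" using card_Diff_subset[OF finW WV] finV by simp
    moreover have "I \<inter> (V - W) = {}" using IW by auto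
    ultimately show ?thesis unfolding X_def using card_cross_edges[OF finI, of "V - W"] finV by simp
  qed
  have cZ: "card (Z - H) = ((card W choose 2) - card W) + card I * (n - card W)"
  proof -
    have "Z - H = (pairs W - H) \<union> X" using Hp XW by (auto simp: Z_def)
    moreover have "card ((pairs W - H) \<union> X) = card (pairs W - H) + card X"
      using finW XW finite_subset[OF XV] finV by (intro card_Un_disjoint) auto
    moreover have "card (pairs W - H) = (card W choose 2) - card W"
      using card_Diff_subset[OF finite_subset[OF Hp] Hp] finW by (simp add: card_pairs cH)
    ultimately show ?thesis by (simp add: cX)
  qed
  have ev: "core_verts K (Suc r) E = W \<and> core K (Suc r) E = H \<longleftrightarrow>
      E \<inter> Z = H \<and> (\<forall>S\<in>short_circuits K E. S \<subseteq> W)" if E: "E \<subseteq> pairs V" for E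
  proof -
    have iE: "induced E W = E \<inter> pairs W" by (rule induced_eq_Int_pairs[OF simple_pairs[OF E]])
    have "(\<forall>u\<in>I. \<forall>v. {u, v} \<in> E \<longrightarrow> v \<in> W) \<longleftrightarrow> E \<inter> X = {}"
    proof
      assume l: "\<forall>u\<in>I. \<forall>v. {u, v} \<in> E \<longrightarrow> v \<in> W"
      show "E \<inter> X = {}" using l by (auto simp: X_def)
    next
      assume l: "E \<inter> X = {}"
      show "\<forall>u\<in>I. \<forall>v. {u, v} \<in> E \<longrightarrow> v \<in> W"
      proof (intro ballI allI impI, rule ccontr)
        fix u v assume h: "u \<in> I" "{u, v} \<in> E" "v \<notin> W"
        have "v \<in> V" using h(2) E by (auto simp: pairs_def)
        then have "{u, v} \<in> X" unfolding X_def using h(1,3) by (intro image_eqI[of _ _ "(u, v)"]) auto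
        then show False using l h(2) by blast
      qed
    qed
    moreover have "E \<inter> Z = H \<longleftrightarrow> E \<inter> pairs W = H \<and> E \<inter> X = {}"
      using Hp XW unfolding Z_def by blast
    ultimately show ?thesis
      unfolding core_eq_iff[OF simple_pairs[OF E] cvH] iE I_def[symmetric] by blast
  qed
  have "rg_prob c n (\<lambda>E. core_verts K (Suc r) E = W \<and> core K (Suc r) E = H) =
      rg_prob c n (\<lambda>E. E \<inter> Z = H \<and> (\<forall>S\<in>short_circuits K E. S \<subseteq> W))"
    unfolding rg_prob_def by (rule gprob_cong) (rule ev[unfolded V_def])
  moreover have "\<bar>rg_prob c n (\<lambda>E. E \<inter> Z = H \<and> (\<forall>S\<in>short_circuits K E. S \<subseteq> W)) -
      (c / n) ^ card H * (1 - c / n) ^ card (Z - H) * rg_prob c n (\<lambda>E. short_circuits K E = {})\<bar>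
    \<le> (c / n) ^ card H * (1 - c / n) ^ card (Z - H) * (2 * fm_const (card W) K c / n)"
  proof (rule rg_pattern_estimate[OF c W ZV ZW HZ, where S = "\<lambda>X. X = {}"])
    fix E assume E: "E \<subseteq> pairs {1..n}" "E \<inter> Z = H"
      "\<not> (\<exists>M. M \<subseteq> {1..n} \<and> card M \<le> K \<and> card (M - W) + 1 \<le> card (induced (E - Z) M))"
    note sE = simple_pairs[OF E(1)]
    show "(\<forall>S\<in>short_circuits K E. S \<subseteq> W) \<longleftrightarrow> {M \<in> short_circuits K E. M \<inter> W = {}} = {}"
    proof
      assume l: "\<forall>S\<in>short_circuits K E. S \<subseteq> W"
      have "M \<inter> W \<noteq> {}" if M: "M \<in> short_circuits K E" for M
      proof -
        have "M \<noteq> {}" using M by (auto simp: short_circuits_def circuit_def)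
        moreover have "M \<subseteq> W" using l M by blast
        ultimately show ?thesis by auto
      qed
      then show "{M \<in> short_circuits K E. M \<inter> W = {}} = {}" by blast
    next
      assume l: "{M \<in> short_circuits K E. M \<inter> W = {}} = {}"
      show "\<forall>S\<in>short_circuits K E. S \<subseteq> W"
      proof (rule ballI, rule ccontr)
        fix M assume M: "M \<in> short_circuits K E" "\<not> M \<subseteq> W"
        have cM: "circuit E M" "card M \<le> K" using M(1) by (auto simp: short_circuits_def)
        have "M \<inter> W \<noteq> {}" using l M(1) by blast
        then have "card (M - W) + 1 \<le> card (induced (E - Z) M)"
        proof (rule excess_of_crossing_circuit[OF sE cM(1) _ M(2)])
          fix e assume e: "e \<in> E" "\<not> e \<subseteq> W"
          show "e \<notin> Z"
          proof
            assume "e \<in> Z"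
            then have "e \<in> H" using e(1) E(2) by blast
            then show False using e(2) Hp by (auto simp: pairs_def)
          qed
        qed
        moreover have "M \<subseteq> {1..n}" using M(1) short_circuits_subset_Pow[OF E(1), of K] by blast
        ultimately show False using E(3) cM(2) by blast
      qed
    qed
  qed
  ultimately show ?thesis unfolding a_def cH cZ I_def[symmetric] by (simp only:)
qed

text \<open>Sum over the \<open>n choose m\<close> positions of the core; isomorphism invariance
  makes all positions contribute alike. The errors are relative to the main terms and therefore
  still vanish after summation.\<close>

lemma rg_core_law:
  assumes c: "0 < c" and Q: "\<And>f H. bij f \<Longrightarrow> Q (img f H) \<longleftrightarrow> Q H"
  shows "(\<lambda>n. rg_prob c n (\<lambda>E. card (core_verts K (Suc r) E) = m \<and> card (core K (Suc r) E) = m \<and> Q (core K (Suc r) E)))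
    \<longlonglongrightarrow> core_weight c K r Q m"
proof -
  define A where "A W = {H \<in> core_graphs K r W. Q H}" for W
  define ex where "ex n H = (c / real n) ^ m *
    (1 - c / real n) ^ (((m choose 2) - m) + card (core_verts K r H) * (n - m))" for n and H :: "nat set set"
  define P where "P n = rg_prob c n (\<lambda>E. card (core_verts K (Suc r) E) = m \<and> card (core K (Suc r) E) = m \<and> Q (core K (Suc r) E))" for n
  define q where "q n = rg_prob c n (\<lambda>E. short_circuits K E = {})" for n
  define S where "S n = real (n choose m) * (\<Sum>H\<in>A {1..m}. ex n H)" for n
  have finA: "finite (A W)" if "finite W" for W using finite_core_graphs[OF that] by (simp add: A_def)
  have transport: "(\<Sum>H\<in>A W. ex n H) = (\<Sum>H\<in>A {1..m}. ex n H)" if W: "finite W" "card W = m" for W n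
  proof -
    have "card {1..m} = card W" using W(2) by simp
    then obtain f where f: "bij f" "f ` {1..m} = W"
      using ex_bij_image[OF finite_atLeastAtMost W(1)] by blast
    have "bij_betw (img f) (A {1..m}) (A (f ` {1..m}))"
    proof -
      have "A U = {H. H \<subseteq> pairs U \<and> card H = card U \<and> core_verts K (Suc r) H = U \<and> Q H}" for U
        by (auto simp: A_def core_graphs_def)
      moreover have "bij_betw (img f) {H. H \<subseteq> pairs {1..m} \<and> card H = card {1..m} \<and> core_verts K (Suc r) H = {1..m} \<and> Q H}
         {H. H \<subseteq> pairs (f ` {1..m}) \<and> card H = card (f ` {1..m}) \<and> core_verts K (Suc r) H = f ` {1..m} \<and> Q H}"
        by (rule img_bij_betw[OF f(1)])
          (simp add: card_img card_image_bij core_verts_img Q f(1) inj_image_eq_iff[OF bij_is_inj])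
      ultimately show ?thesis by (simp only:)
    qed
    moreover have "ex n (img f H) = ex n H" for H
      by (simp add: ex_def core_verts_img f(1) card_image_bij)
    ultimately show ?thesis
      using sum.reindex_bij_betw[of "img f" "A {1..m}" "A (f ` {1..m})" "ex n"] unfolding f(2) by simp
  qed
  have est: "\<bar>P n - S n * q n\<bar> \<le> S n * (2 * fm_const m K c / n)" if n: "c \<le> real n" for n
  proof -
    define \<W> where "\<W> = {W. W \<subseteq> {1..n} \<and> card W = m}"
    have finWW: "finite \<W>" unfolding \<W>_def by (rule finite_subset[of _ "Pow {1..n}"]) auto
    have finW: "finite W" if "W \<in> \<W>" for W using that by (intro finite_subset[of W "{1..n}"]) (auto simp: \<W>_def)
    have cW: "real (card \<W>) = real (n choose m)" using n_subsets[of "{1..n}" m] by (simp add: \<W>_def)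
    define R where "R W H = rg_prob c n (\<lambda>E. core_verts K (Suc r) E = W \<and> core K (Suc r) E = H)" for W H
    have "P n = rg_prob c n (\<lambda>E. \<exists>x\<in>Sigma \<W> A. core_verts K (Suc r) E = fst x \<and> core K (Suc r) E = snd x)"
      unfolding P_def rg_prob_def
    proof (rule gprob_cong)
      fix E assume E: "E \<subseteq> pairs {1..n}"
      let ?W = "core_verts K (Suc r) E" and ?H = "core K (Suc r) E"
      note sE = simple_pairs[OF E]
      have 1: "?W \<subseteq> {1..n}" by (rule core_verts_subset[OF E])
      have 2: "?H \<subseteq> pairs ?W" unfolding core_def by (rule induced_pairs[OF sE])
      have 3: "core_verts K (Suc r) ?H = ?W" by (rule core_verts_core[OF sE])
      show "(card ?W = m \<and> card ?H = m \<and> Q ?H) \<longleftrightarrow> (\<exists>x\<in>Sigma \<W> A. ?W = fst x \<and> ?H = snd x)"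
      proof
        assume h: "card ?W = m \<and> card ?H = m \<and> Q ?H"
        have "(?W, ?H) \<in> Sigma \<W> A" using h 1 2 3 by (simp add: \<W>_def A_def core_graphs_def)
        then show "\<exists>x\<in>Sigma \<W> A. ?W = fst x \<and> ?H = snd x" by force
      next
        assume "\<exists>x\<in>Sigma \<W> A. ?W = fst x \<and> ?H = snd x"
        then obtain W H where h: "W \<in> \<W>" "H \<in> A W" "?W = W" "?H = H" by auto
        then show "card ?W = m \<and> card ?H = m \<and> Q ?H" by (simp add: \<W>_def A_def core_graphs_def)
      qed
    qed
    also have "\<dots> = (\<Sum>x\<in>Sigma \<W> A. R (fst x) (snd x))"
      unfolding R_def rg_prob_def
    proof (rule gprob_disjoint_Bex)
      show "finite (Sigma \<W> A)" by (rule finite_SigmaI[OF finWW finA[OF finW]])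
    qed (simp add: prod_eq_iff)
    also have "\<dots> = (\<Sum>W\<in>\<W>. \<Sum>H\<in>A W. R W H)"
    proof -
      have "(\<Sum>W\<in>\<W>. \<Sum>H\<in>A W. R W H) = (\<Sum>(W, H)\<in>Sigma \<W> A. R W H)"
        by (rule sum.Sigma[OF finWW]) (intro ballI finA finW)
      then show ?thesis by (simp only: split_def)
    qed
    finally have P: "P n = (\<Sum>W\<in>\<W>. \<Sum>H\<in>A W. R W H)" .
    have S: "S n = (\<Sum>W\<in>\<W>. \<Sum>H\<in>A W. ex n H)"
    proof -
      have "(\<Sum>W\<in>\<W>. \<Sum>H\<in>A W. ex n H) = (\<Sum>W\<in>\<W>. \<Sum>H\<in>A {1..m}. ex n H)"
      proof (rule sum.cong[OF refl])
        fix W assume W: "W \<in> \<W>"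
        show "(\<Sum>H\<in>A W. ex n H) = (\<Sum>H\<in>A {1..m}. ex n H)"
          by (rule transport[OF finW[OF W]]) (use W in \<open>simp add: \<W>_def\<close>)
      qed
      then show ?thesis unfolding S_def by (simp add: cW)
    qed
    have R: "\<bar>R W H - ex n H * q n\<bar> \<le> ex n H * (2 * fm_const m K c / n)" if "W \<in> \<W>" "H \<in> A W" for W H
      using rg_core_eq_estimate[OF c n, of W H K r] that unfolding R_def ex_def q_def by (auto simp: \<W>_def A_def)
    have "\<bar>P n - S n * q n\<bar> = \<bar>\<Sum>W\<in>\<W>. \<Sum>H\<in>A W. R W H - ex n H * q n\<bar>"
      unfolding P S by (simp add: sum_subtractf sum_distrib_right)
    also have "\<dots> \<le> (\<Sum>W\<in>\<W>. \<Sum>H\<in>A W. ex n H * (2 * fm_const m K c / n))"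
      by (intro order.trans[OF sum_abs] sum_mono R)
    also have "\<dots> = S n * (2 * fm_const m K c / n)" unfolding S sum_distrib_right ..
    finally show ?thesis .
  qed
  have Slim: "S \<longlonglongrightarrow> c ^ m / fact m * (\<Sum>H\<in>A {1..m}. exp (- c * real (card (core_verts K r H))))"
  proof -
    have "(\<lambda>n. (real (n choose m) * (c / real n) ^ m) * (\<Sum>H\<in>A {1..m}.
        (1 - c / real n) ^ (((m choose 2) - m) + card (core_verts K r H) * (n - m)))) \<longlonglongrightarrow>
        c ^ m / fact m * (\<Sum>H\<in>A {1..m}. exp (- c * real (card (core_verts K r H))))"
      by (intro tendsto_mult tendsto_sum choose_power_tendsto one_minus_power_diff_tendsto)
    then show ?thesis unfolding S_def ex_def sum_distrib_left[symmetric] mult.assoc .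
  qed
  have qlim: "q \<longlonglongrightarrow> exp (- circ_mean c K)"
  proof -
    have "q = (\<lambda>n. rg_prob c n (\<lambda>E. card (short_circuits K E) = 0))"
      unfolding q_def rg_prob_def
    proof (rule ext, rule gprob_cong)
      fix n :: nat and E assume "E \<subseteq> pairs {1..n}"
      then have "finite (short_circuits K E)" by (rule finite_short_circuits) simp
      then show "short_circuits K E = {} \<longleftrightarrow> card (short_circuits K E) = 0" by (simp add: card_eq_0_iff)
    qed
    then show ?thesis using circuit_count_tendsto_Poisson[OF c, of K 0] by simp
  qed
  have "(\<lambda>n. S n * (2 * fm_const m K c / n)) \<longlonglongrightarrow>
      c ^ m / fact m * (\<Sum>H\<in>A {1..m}. exp (- c * real (card (core_verts K r H)))) * 0"
    by (intro tendsto_mult Slim const_over_n_tendsto)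
  then have "(\<lambda>n. S n * (2 * fm_const m K c / n)) \<longlonglongrightarrow> 0" by simp
  then have "(\<lambda>n. P n - S n * q n) \<longlonglongrightarrow> 0"
  proof (rule Lim_null_comparison[rotated])
    show "eventually (\<lambda>n. norm (P n - S n * q n) \<le> S n * (2 * fm_const m K c / n)) sequentially"
      using eventually_c_le[of c] by eventually_elim (use est in simp)
  qed
  then have "(\<lambda>n. (P n - S n * q n) + S n * q n) \<longlonglongrightarrow>
      0 + c ^ m / fact m * (\<Sum>H\<in>A {1..m}. exp (- c * real (card (core_verts K r H)))) * exp (- circ_mean c K)"
    by (intro tendsto_add tendsto_mult Slim qlim)
  then show ?thesis unfolding P_def core_weight_def A_def by (simp add: mult.commute)
qed

section \<open>Tightness of the core size\<close>

fun path_edges :: "'a \<Rightarrow> 'a list \<Rightarrow> 'a set set" where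
  "path_edges y [] = {}"
| "path_edges y (z # zs) = insert {y, z} (path_edges z zs)"

lemma path_edges_snoc: "path_edges y (zs @ [v]) = insert {last (y # zs), v} (path_edges y zs)"
  by (induction zs arbitrary: y) auto

lemma path_edges_bound:
  assumes "e \<in> path_edges y zs"
  shows "e \<subseteq> insert y (set zs) \<and> e \<inter> set zs \<noteq> {}"
  using assms by (induction zs arbitrary: y) auto

lemma finite_path_edges: "finite (path_edges y zs)"
  by (induction zs arbitrary: y) auto

lemma card_path_edges: "distinct (y # zs) \<Longrightarrow> card (path_edges y zs) = length zs"
proof (induction zs arbitrary: y)
  case (Cons z zs)
  have "{y, z} \<notin> path_edges z zs" using path_edges_bound[of "{y, z}" z zs] Cons.prems by auto
  then show ?case using Cons by (simp add: finite_path_edges)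
qed simp

lemma path_edges_pairs: "distinct (y # zs) \<Longrightarrow> insert y (set zs) \<subseteq> V \<Longrightarrow> path_edges y zs \<subseteq> pairs V"
  by (induction zs arbitrary: y) (auto simp: pairs_def)

text \<open>The path leaves \<open>M\<close> at once and does not return, so its edges are disjoint
  from those of a cycle on \<open>M\<close> and the probabilities multiply.\<close>

lemma nbhd_path:
  assumes "v \<in> nbhd E k M"
  shows "\<exists>y\<in>M. \<exists>zs. distinct zs \<and> set zs \<inter> M = {} \<and> set zs \<subseteq> nbhd E k M \<and> length zs \<le> k \<and>
    path_edges y zs \<subseteq> E \<and> last (y # zs) = v"
  using assms
proof (induction k arbitrary: v)
  case 0
  then show ?case by (intro bexI[of _ v] exI[of _ "[]"]) auto
next
  case (Suc k)
  show ?case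
  proof (cases "v \<in> nbhd E k M")
    case True
    from Suc.IH[OF this] obtain y zs where h: "y \<in> M" "distinct zs" "set zs \<inter> M = {}" "set zs \<subseteq> nbhd E k M"
      "length zs \<le> k" "path_edges y zs \<subseteq> E" "last (y # zs) = v" by blast
    then show ?thesis by (intro bexI[of _ y] exI[of _ zs]) auto
  next
    case False
    with Suc.prems obtain u where u: "u \<in> nbhd E k M" "{u, v} \<in> E" by auto
    from Suc.IH[OF u(1)] obtain y zs where h: "y \<in> M" "distinct zs" "set zs \<inter> M = {}" "set zs \<subseteq> nbhd E k M"
      "length zs \<le> k" "path_edges y zs \<subseteq> E" "last (y # zs) = u" by blast
    have v: "v \<notin> set zs" "v \<notin> M" using False h(4) subset_nbhd[of M E k] by auto
    have "path_edges y (zs @ [v]) \<subseteq> E" using h(6,7) u(2) by (simp only: path_edges_snoc) simp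
    then show ?thesis using h v u Suc.prems by (intro bexI[of _ y] exI[of _ "zs @ [v]"]) auto
  qed
qed

lemma nbhd_Union: "nbhd E k (\<Union>\<S>) = (\<Union>M\<in>\<S>. nbhd E k M)"
  by (induction k) auto

text \<open>Bounds the expected number of triples of a short cycle, a vertex on it and a path of
  length at most \<open>r\<close> starting there; the endpoints of such paths cover the
  core.\<close>

definition tail_const :: "real \<Rightarrow> nat \<Rightarrow> nat \<Rightarrow> real" where
  "tail_const c K r = (\<Sum>k\<le>K. real k * (c ^ k * real (ncirc k) / fact k)) * (\<Sum>l\<le>r. c ^ l)"

lemma rg_exp_core_size_le:
  assumes c: "0 < c" "c \<le> real n"
  shows "gexp (pairs {1..n}) (c / n) (\<lambda>E. real (card (core_verts K r E))) \<le> tail_const c K r"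
proof -
  define V where "V = {1..n}"
  define p where "p = c / real n"
  define \<M> where "\<M> = {M. M \<subseteq> V \<and> card M \<le> K}"
  define L where "L M = {zs. distinct zs \<and> set zs \<subseteq> V - M \<and> length zs \<le> r}" for M
  note p = edge_prob_bounds[OF c, folded p_def]
  have finV: "finite V" "card V = n" by (simp_all add: V_def)
  have fin\<M>: "finite \<M>" unfolding \<M>_def by (rule finite_subset[of _ "Pow V"]) (auto simp: finV)
  have finM: "finite M" if "M \<in> \<M>" for M using that finV by (intro finite_subset[of M V]) (auto simp: \<M>_def)
  have finall: "finite {zs. set zs \<subseteq> V \<and> length zs \<le> r}" by (rule finite_lists_length_le[OF finV(1)])
  have finL: "finite (L M)" for M by (rule finite_subset[OF _ finall]) (auto simp: L_def)
  have "gexp (pairs V) p (\<lambda>E. real (card (core_verts K r E))) \<le>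
      gexp (pairs V) p (\<lambda>E. \<Sum>M\<in>\<M>. \<Sum>F\<in>circuits_on M. \<Sum>y\<in>M. \<Sum>zs\<in>L M. of_bool (F \<union> path_edges y zs \<subseteq> E))"
  proof (rule gexp_mono[OF p(1,2)])
    fix E assume E: "E \<subseteq> pairs V"
    have sub: "short_circuits K E \<subseteq> \<M>"
      using short_circuits_subset_Pow[OF E, of K] by (auto simp: short_circuits_def \<M>_def)
    have ball: "real (card (nbhd E r M)) \<le> (\<Sum>F\<in>circuits_on M. \<Sum>y\<in>M. \<Sum>zs\<in>L M. of_bool (F \<union> path_edges y zs \<subseteq> E))"
      if M: "M \<in> short_circuits K E" for M
    proof -
      have MM: "M \<in> \<M>" "M \<subseteq> V" using sub M by (auto simp: \<M>_def)
      obtain F where F: "F \<in> circuits_on M" "F \<subseteq> E"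
        using circuit_contains_circuits_on[OF simple_pairs[OF E], of M] M by (auto simp: short_circuits_def)
      define D where "D = {x \<in> M \<times> L M. path_edges (fst x) (snd x) \<subseteq> E}"
      have finD: "finite D" using finM[OF MM(1)] finL by (simp add: D_def)
      have "nbhd E r M \<subseteq> (\<lambda>x. last (fst x # snd x)) ` D"
      proof
        fix v assume v: "v \<in> nbhd E r M"
        obtain y zs where h: "y \<in> M" "distinct zs" "set zs \<inter> M = {}" "set zs \<subseteq> nbhd E r M"
          "length zs \<le> r" "path_edges y zs \<subseteq> E" "last (y # zs) = v" using nbhd_path[OF v] by blast
        have "set zs \<subseteq> V - M" using h(3,4) nbhd_subset_verts[OF MM(2) E, of r] by auto
        then have "(y, zs) \<in> D" using h by (simp add: D_def L_def)
        then show "v \<in> (\<lambda>x. last (fst x # snd x)) ` D" using h(7) by force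
      qed
      then have "card (nbhd E r M) \<le> card D" using finD by (meson card_image_le card_mono finite_imageI le_trans)
      then have "real (card (nbhd E r M)) \<le> real (card D)" by simp
      also have "\<dots> = (\<Sum>x\<in>M \<times> L M. of_bool (path_edges (fst x) (snd x) \<subseteq> E))"
        using finM[OF MM(1)] finL by (simp add: D_def of_bool_def sum.If_cases Int_def)
      also have "\<dots> = (\<Sum>y\<in>M. \<Sum>zs\<in>L M. of_bool (path_edges y zs \<subseteq> E))"
        by (simp add: sum.cartesian_product split_def)
      also have "\<dots> = (\<Sum>y\<in>M. \<Sum>zs\<in>L M. of_bool (F \<union> path_edges y zs \<subseteq> E))"
        using F(2) by simp
      also have "\<dots> \<le> (\<Sum>F\<in>circuits_on M. \<Sum>y\<in>M. \<Sum>zs\<in>L M. of_bool (F \<union> path_edges y zs \<subseteq> E))"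
        by (rule member_le_sum[OF F(1)]) (auto intro!: sum_nonneg finite_circuits_on finM MM)
      finally show ?thesis .
    qed
    have "real (card (core_verts K r E)) \<le> (\<Sum>M\<in>short_circuits K E. real (card (nbhd E r M)))"
    proof -
      have "card (core_verts K r E) \<le> (\<Sum>M\<in>short_circuits K E. card (nbhd E r M))"
        unfolding core_verts_def cyc_def nbhd_Union
        by (rule card_UN_le) (rule finite_subset[OF sub fin\<M>])
      then show ?thesis by (metis of_nat_le_iff of_nat_sum)
    qed
    also have "\<dots> \<le> (\<Sum>M\<in>short_circuits K E. \<Sum>F\<in>circuits_on M. \<Sum>y\<in>M. \<Sum>zs\<in>L M. of_bool (F \<union> path_edges y zs \<subseteq> E))"
      by (rule sum_mono) (rule ball)
    also have "\<dots> \<le> (\<Sum>M\<in>\<M>. \<Sum>F\<in>circuits_on M. \<Sum>y\<in>M. \<Sum>zs\<in>L M. of_bool (F \<union> path_edges y zs \<subseteq> E))"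
      by (rule sum_mono2[OF fin\<M> sub]) (auto intro!: sum_nonneg)
    finally show "real (card (core_verts K r E)) \<le> \<dots>" .
  qed
  also have "\<dots> = (\<Sum>M\<in>\<M>. \<Sum>F\<in>circuits_on M. \<Sum>y\<in>M. \<Sum>zs\<in>L M. gprob (pairs V) p (\<lambda>E. F \<union> path_edges y zs \<subseteq> E))"
    unfolding gexp_sum gprob_def ..
  also have "\<dots> = (\<Sum>M\<in>\<M>. \<Sum>F\<in>circuits_on M. \<Sum>y\<in>M. \<Sum>zs\<in>L M. p ^ card M * p ^ length zs)"
  proof (intro sum.cong refl)
    fix M F y zs assume h: "M \<in> \<M>" "F \<in> circuits_on M" "y \<in> M" "zs \<in> L M"
    have MV: "M \<subseteq> V" using h(1) by (auto simp: \<M>_def)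
    have F: "F \<subseteq> pairs M" "card F = card M" using h(2) by (auto simp: circuits_on_def)
    have zs: "distinct zs" "set zs \<subseteq> V - M" using h(4) by (auto simp: L_def)
    have d: "distinct (y # zs)" using zs h(3) by auto
    have FV: "F \<subseteq> pairs V" using F(1) MV by (auto simp: pairs_def)
    have pV: "path_edges y zs \<subseteq> pairs V" using path_edges_pairs[OF d] zs(2) h(3) MV by auto
    have "F \<inter> path_edges y zs = {}"
    proof (rule equals0I)
      fix e assume e: "e \<in> F \<inter> path_edges y zs"
      have "e \<subseteq> M" using e F(1) by (auto simp: pairs_def)
      moreover have "e \<inter> set zs \<noteq> {}" using e path_edges_bound[of e y zs] by blast
      ultimately show False using zs(2) by blast
    qed
    then have "card (F \<union> path_edges y zs) = card M + length zs"
      using card_Un_disjoint[of F "path_edges y zs"] finite_subset[OF FV] finV F(2) card_path_edges[OF d]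
      by (simp add: finite_path_edges)
    then show "gprob (pairs V) p (\<lambda>E. F \<union> path_edges y zs \<subseteq> E) = p ^ card M * p ^ length zs"
      using gprob_superset[of "pairs V" "F \<union> path_edges y zs" p] finV FV pV by (simp add: power_add)
  qed
  also have "\<dots> \<le> (\<Sum>M\<in>\<M>. \<Sum>F\<in>circuits_on M. \<Sum>y\<in>M. p ^ card M * (\<Sum>l\<le>r. c ^ l))"
  proof (intro sum_mono)
    fix M F y
    have "(\<Sum>zs\<in>L M. p ^ card M * p ^ length zs) = p ^ card M * (\<Sum>zs\<in>L M. p ^ length zs)"
      by (simp add: sum_distrib_left)
    also have "(\<Sum>zs\<in>L M. p ^ length zs) \<le> (\<Sum>zs\<in>{zs. set zs \<subseteq> V \<and> length zs \<le> r}. p ^ length zs)"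
      using p(1) by (intro sum_mono2 finall) (auto simp: L_def)
    also have "\<dots> = (\<Sum>l\<le>r. \<Sum>zs\<in>{zs \<in> {zs. set zs \<subseteq> V \<and> length zs \<le> r}. length zs = l}. p ^ length zs)"
      by (rule sum.group[symmetric]) (use finall in auto)
    also have "\<dots> = (\<Sum>l\<le>r. c ^ l)"
    proof (rule sum.cong[OF refl])
      fix l assume "l \<in> {..r}"
      then have "{zs \<in> {zs. set zs \<subseteq> V \<and> length zs \<le> r}. length zs = l} = {zs. set zs \<subseteq> V \<and> length zs = l}" by auto
      then have "(\<Sum>zs\<in>{zs \<in> {zs. set zs \<subseteq> V \<and> length zs \<le> r}. length zs = l}. p ^ length zs) = real (n ^ l) * p ^ l"
        using card_lists_length_eq[OF finV(1), of l] finV(2) by simp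
      also have "\<dots> = c ^ l" using p(3) by (simp add: p_def power_divide)
      finally show "(\<Sum>zs\<in>{zs \<in> {zs. set zs \<subseteq> V \<and> length zs \<le> r}. length zs = l}. p ^ length zs) = c ^ l" .
    qed
    finally show "(\<Sum>zs\<in>L M. p ^ card M * p ^ length zs) \<le> p ^ card M * (\<Sum>l\<le>r. c ^ l)"
      using p(1) by (simp add: mult_left_mono)
  qed
  also have "\<dots> = (\<Sum>M\<in>\<M>. real (ncirc (card M)) * (real (card M) * (p ^ card M * (\<Sum>l\<le>r. c ^ l))))"
    by (intro sum.cong refl) (simp add: card_circuits_on finM)
  also have "\<dots> = (\<Sum>k\<le>K. real (n choose k) * (real (ncirc k) * (real k * (p ^ k * (\<Sum>l\<le>r. c ^ l)))))"
    unfolding \<M>_def V_def by (rule sum_small_sets)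
  also have "\<dots> \<le> (\<Sum>k\<le>K. real k * (c ^ k * real (ncirc k) / fact k) * (\<Sum>l\<le>r. c ^ l))"
  proof (rule sum_mono)
    fix k
    have "real (n choose k) * p ^ k * (real (ncirc k) * (real k * (\<Sum>l\<le>r. c ^ l))) \<le>
        c ^ k / fact k * (real (ncirc k) * (real k * (\<Sum>l\<le>r. c ^ l)))"
      unfolding p_def using choose_power_le[OF c(1) p(3)] c(1)
      by (intro mult_right_mono mult_nonneg_nonneg sum_nonneg) auto
    then show "real (n choose k) * (real (ncirc k) * (real k * (p ^ k * (\<Sum>l\<le>r. c ^ l)))) \<le>
        real k * (c ^ k * real (ncirc k) / fact k) * (\<Sum>l\<le>r. c ^ l)"
      by (simp add: algebra_simps)
  qed
  also have "\<dots> = tail_const c K r" unfolding tail_const_def sum_distrib_right ..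
  finally show ?thesis by (simp add: V_def p_def)
qed

section \<open>Limits of properties of the core\<close>

text \<open>No candidate for the limit is available in advance. Comparing two truncations of the
  same sequence shows that the truncated limits \<open>S\<close> are Cauchy, and their limit is the
  one wanted.\<close>

lemma tendsto_of_partial_limits:
  fixes x S B :: "nat \<Rightarrow> real"
  assumes y: "\<And>M. y M \<longlonglongrightarrow> S M" and z: "\<And>M. z M \<longlonglongrightarrow> 0"
    and le: "\<And>M. eventually (\<lambda>n. \<bar>x n - y M n\<bar> \<le> B M + z M n) sequentially"
    and B: "B \<longlonglongrightarrow> 0"
  shows "\<exists>l. x \<longlonglongrightarrow> l \<and> (\<forall>M. \<bar>l - S M\<bar> \<le> B M)"
proof -
  have SS: "\<bar>S M - S M'\<bar> \<le> B M + B M'" for M M'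
  proof (rule tendsto_le[OF sequentially_bot])
    show "(\<lambda>n. \<bar>y M n - y M' n\<bar>) \<longlonglongrightarrow> \<bar>S M - S M'\<bar>" by (intro tendsto_rabs tendsto_diff y)
    have "(\<lambda>n. (B M + z M n) + (B M' + z M' n)) \<longlonglongrightarrow> (B M + 0) + (B M' + 0)"
      by (intro tendsto_add tendsto_const z)
    then show "(\<lambda>n. (B M + z M n) + (B M' + z M' n)) \<longlonglongrightarrow> B M + B M'" by simp
    show "eventually (\<lambda>n. \<bar>y M n - y M' n\<bar> \<le> (B M + z M n) + (B M' + z M' n)) sequentially"
      using le[of M] le[of M'] by eventually_elim linarith
  qed
  have "Cauchy S"
  proof (rule metric_CauchyI)
    fix e :: real assume "0 < e"
    then have "eventually (\<lambda>M. B M < e / 2) sequentially" by (intro order_tendstoD(2)[OF B]) simp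
    then obtain M0 where M0: "\<forall>M\<ge>M0. B M < e / 2" by (auto simp: eventually_sequentially)
    show "\<exists>M. \<forall>m\<ge>M. \<forall>n\<ge>M. dist (S m) (S n) < e"
    proof (intro exI[of _ M0] allI impI)
      fix m n assume "M0 \<le> m" "M0 \<le> n"
      then have "B m < e / 2" "B n < e / 2" using M0 by auto
      then show "dist (S m) (S n) < e" using SS[of m n] by (simp add: dist_real_def)
    qed
  qed
  then obtain l where l: "S \<longlonglongrightarrow> l" using Cauchy_convergent_iff convergentD by blast
  have x: "x \<longlonglongrightarrow> l"
  proof (rule tendsto_approx)
    fix e :: real assume e: "0 < e"
    have "eventually (\<lambda>M. B M < e / 2) sequentially" using e by (intro order_tendstoD(2)[OF B]) simp
    moreover have "eventually (\<lambda>M. dist (S M) l < e) sequentially" using e by (rule tendstoD[OF l])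
    ultimately have "eventually (\<lambda>M. B M < e / 2 \<and> dist (S M) l < e) sequentially" by eventually_elim simp
    then have "\<exists>M. B M < e / 2 \<and> dist (S M) l < e" by (rule eventually_happens'[OF sequentially_bot])
    then obtain M where M: "B M < e / 2" "dist (S M) l < e" by blast
    have "eventually (\<lambda>n. z M n < e / 2) sequentially" using e by (intro order_tendstoD(2)[OF z]) simp
    with le[of M] have "eventually (\<lambda>n. \<bar>x n - y M n\<bar> \<le> e) sequentially"
      by eventually_elim (use M(1) in linarith)
    then show "\<exists>y l'. y \<longlonglongrightarrow> l' \<and> \<bar>l' - l\<bar> \<le> e \<and> eventually (\<lambda>n. \<bar>x n - y n\<bar> \<le> e) sequentially"
      using y[of M] M(2) by (intro exI[of _ "y M"] exI[of _ "S M"]) (auto simp: dist_real_def)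
  qed
  have "\<bar>l - S M\<bar> \<le> B M" for M
  proof (rule tendsto_le[OF sequentially_bot])
    show "(\<lambda>n. \<bar>x n - y M n\<bar>) \<longlonglongrightarrow> \<bar>l - S M\<bar>" by (intro tendsto_rabs tendsto_diff y x)
    have "(\<lambda>n. B M + z M n) \<longlonglongrightarrow> B M + 0" by (intro tendsto_add tendsto_const z)
    then show "(\<lambda>n. B M + z M n) \<longlonglongrightarrow> B M" by simp
    show "eventually (\<lambda>n. \<bar>x n - y M n\<bar> \<le> B M + z M n) sequentially" by (rule le)
  qed
  with x show ?thesis by blast
qed

text \<open>Cores with more than \<open>M\<close> vertices are rare by Markov's inequality, and
  smaller ones have as many edges as vertices up to an excess event. What remains is a finite sum of
  the laws above. The explicit error bound is part of the conclusion because it must survive the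
  later limits in \<open>K\<close> and \<open>r\<close>.\<close>

theorem core_property_limit:
  assumes c: "0 < c" and Q: "\<And>f H. bij f \<Longrightarrow> Q (img f H) \<longleftrightarrow> Q H"
  shows "\<exists>l. (\<lambda>n. rg_prob c n (\<lambda>E. Q (core K (Suc r) E))) \<longlonglongrightarrow> l \<and>
    (\<forall>M. \<bar>l - (\<Sum>m\<le>M. core_weight c K r Q m)\<bar> \<le> tail_const c K (Suc r) / real (Suc M))"
proof (rule tendsto_of_partial_limits)
  let ?R = "\<lambda>m E. card (core_verts K (Suc r) E) = m \<and> card (core K (Suc r) E) = m \<and> Q (core K (Suc r) E)"
  fix M
  show "(\<lambda>n. \<Sum>m\<le>M. rg_prob c n (?R m)) \<longlonglongrightarrow> (\<Sum>m\<le>M. core_weight c K r Q m)"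
    by (intro tendsto_sum rg_core_law[OF c Q])
  show "(\<lambda>n. fm_const 0 M c / real n) \<longlonglongrightarrow> 0" by (rule const_over_n_tendsto)
  show "eventually (\<lambda>n. \<bar>rg_prob c n (\<lambda>E. Q (core K (Suc r) E)) - (\<Sum>m\<le>M. rg_prob c n (?R m))\<bar> \<le>
      tail_const c K (Suc r) / real (Suc M) + fm_const 0 M c / real n) sequentially"
    using eventually_c_le[of c]
  proof eventually_elim
    case (elim n)
    let ?X = "pairs {1..n}" and ?p = "c / real n"
    let ?big = "\<lambda>E. real (Suc M) \<le> real (card (core_verts K (Suc r) E))"
    let ?exc = "\<lambda>E. \<exists>W. W \<subseteq> {1..n} \<and> card W \<le> M \<and> card (W - {}) + 1 \<le> card (induced (E \<inter> ?X) W)"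
    note p = edge_prob_bounds[OF c elim]
    have "(\<Sum>m\<le>M. rg_prob c n (?R m)) = gprob ?X ?p (\<lambda>E. \<exists>m\<in>{..M}. ?R m E)"
      unfolding rg_prob_def by (rule gprob_disjoint_Bex[symmetric]) auto
    then have "\<bar>rg_prob c n (\<lambda>E. Q (core K (Suc r) E)) - (\<Sum>m\<le>M. rg_prob c n (?R m))\<bar> =
        \<bar>gprob ?X ?p (\<lambda>E. Q (core K (Suc r) E)) - gprob ?X ?p (\<lambda>E. \<exists>m\<in>{..M}. ?R m E)\<bar>"
      by (simp add: rg_prob_def)
    also have "\<dots> \<le> gprob ?X ?p (\<lambda>E. ?big E \<or> ?exc E)"
    proof (rule gprob_diff_le[OF p(1,2)])
      fix E assume E: "E \<subseteq> ?X" and nb: "\<not> (?big E \<or> ?exc E)"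
      let ?W = "core_verts K (Suc r) E"
      have WM: "card ?W \<le> M" using nb by simp
      have WV: "?W \<subseteq> {1..n}" by (rule core_verts_subset[OF E])
      have EX: "E \<inter> ?X = E" using E by auto
      have "card (core K (Suc r) E) \<le> card ?W"
        using nb WM WV unfolding EX core_def by fastforce
      moreover have "card ?W \<le> card (core K (Suc r) E)" by (rule card_core_verts_le[OF E]) simp
      ultimately show "Q (core K (Suc r) E) \<longleftrightarrow> (\<exists>m\<in>{..M}. ?R m E)" using WM by auto
    qed
    also have "\<dots> \<le> gprob ?X ?p ?big + gprob ?X ?p ?exc" by (rule gprob_Un_le[OF p(1,2)])
    also have "gprob ?X ?p ?big \<le> tail_const c K (Suc r) / real (Suc M)"
    proof -
      have "gprob ?X ?p ?big \<le> gexp ?X ?p (\<lambda>E. real (card (core_verts K (Suc r) E))) / real (Suc M)"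
        by (rule gprob_Markov[OF p(1,2)]) auto
      also have "\<dots> \<le> tail_const c K (Suc r) / real (Suc M)"
        by (intro divide_right_mono rg_exp_core_size_le[OF c elim]) simp
      finally show ?thesis .
    qed
    also have "gprob ?X ?p ?exc \<le> fm_const 0 M c / real n"
      using rg_prob_excess_le[OF c elim, of "{}" ?X M] unfolding rg_prob_def by simp
    finally show ?case by simp
  qed
next
  show "(\<lambda>M. tail_const c K (Suc r) / real (Suc M)) \<longlonglongrightarrow> 0"
    by (rule LIMSEQ_Suc[OF const_over_n_tendsto])
qed

section \<open>Tree components and the convergence law\<close>

lemma treelike_connected: "treelike W T \<Longrightarrow> S \<subset> W \<Longrightarrow> S \<noteq> {} \<Longrightarrow> \<exists>u\<in>S. \<exists>v\<in>W - S. {u, v} \<in> T"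
  by (simp add: treelike_def)

lemma treelike_img:
  assumes f: "bij f" and T: "treelike W T"
  shows "treelike (f ` W) (img f T)"
  unfolding treelike_def
proof (intro conjI allI impI)
  show "finite (f ` W)" "f ` W \<noteq> {}" using T by (auto simp: treelike_def)
  show "img f T \<subseteq> pairs (f ` W)" using T by (simp add: img_subset_pairs[OF f] treelike_def)
next
  fix S assume S: "S \<subseteq> f ` W" "S \<noteq> {}"
  then obtain U where U: "U \<subseteq> W" "S = f ` U" by (elim subset_imageE)
  have "card (induced T U) < card U" using T U S(2) by (simp add: treelike_def)
  then show "card (induced (img f T) S) < card S"
    unfolding U(2) img_induced[OF f] by (simp only: card_img[OF f] card_image_bij[OF f])
next
  fix S assume S: "S \<subset> f ` W \<and> S \<noteq> {}"
  then have "S \<subseteq> f ` W" by auto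
  then obtain U where U: "U \<subseteq> W" "S = f ` U" by (elim subset_imageE)
  have "U \<subset> W" "U \<noteq> {}" using S U by auto
  from treelike_connected[OF T this] obtain u v where uv: "u \<in> U" "v \<in> W - U" "{u, v} \<in> T" by blast
  have "f v \<notin> f ` U" using uv(2) f by (auto simp: bij_def inj_eq)
  then show "\<exists>u\<in>S. \<exists>v\<in>f ` W - S. {u, v} \<in> img f T"
    using uv U(2) img_pair_mem_iff[OF f, of u v T] by (intro bexI[of _ "f u"] bexI[of _ "f v"]) auto
qed

lemma lty_singleton_img: "bij f \<Longrightarrow> lty j (img f T) {} [j \<mapsto> f b] = lty j T {} [j \<mapsto> b]"
proof -
  assume f: "bij f"
  have "map_option f \<circ> [j \<mapsto> b] = [j \<mapsto> f b]" by auto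
  then show ?thesis using lty_img[OF f, of j T "{}" "[j \<mapsto> b]"] by simp
qed

section \<open>Second moment of the number of tree components\<close>

text \<open>Prescribing these edges fixes the graph on \<open>W\<close> and at the same time makes
  \<open>W\<close> isolated.\<close>

definition star_edges :: "'a set \<Rightarrow> 'a set \<Rightarrow> 'a set set" where
  "star_edges V W = {e \<in> pairs V. e \<inter> W \<noteq> {}}"

lemma card_star_edges:
  assumes "W \<subseteq> V" "finite V"
  shows "card (star_edges V W) = (card W choose 2) + card W * (card V - card W)"
proof -
  let ?X = "(\<lambda>(u, v). {u, v}) ` (W \<times> (V - W))"
  have finW: "finite W" by (rule finite_subset[OF assms])
  have "star_edges V W = pairs W \<union> ?X"
  proof (intro equalityI subsetI)
    fix e assume e: "e \<in> star_edges V W"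
    show "e \<in> pairs W \<union> ?X"
    proof (cases "e \<subseteq> W")
      case False
      obtain x y where xy: "e = {x, y}" using e by (auto simp: star_edges_def pairs_def card_2_iff)
      obtain u v where "e = {u, v}" "u \<in> W" "v \<notin> W"
        using e False xy by (auto simp: star_edges_def insert_commute)
      then have "e \<in> ?X" using e by (intro image_eqI[of _ _ "(u, v)"]) (auto simp: star_edges_def pairs_def)
      then show ?thesis by simp
    qed (use e in \<open>auto simp: star_edges_def pairs_def\<close>)
  next
    fix e assume "e \<in> pairs W \<union> ?X"
    then show "e \<in> star_edges V W"
    proof
      assume "e \<in> pairs W"
      moreover from this have "e \<noteq> {}" by (auto simp: pairs_def)
      ultimately show ?thesis using assms(1) by (auto simp: star_edges_def pairs_def)
    next
      assume "e \<in> ?X"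
      then obtain u v where "e = {u, v}" "u \<in> W" "v \<in> V - W" by auto
      then show ?thesis using assms(1) by (auto simp: star_edges_def pairs_def card_insert_if)
    qed
  qed
  moreover have "card (pairs W \<union> ?X) = card (pairs W) + card ?X"
    using finW assms(2) by (intro card_Un_disjoint) (auto simp: pairs_def)
  moreover have "card ?X = card W * (card V - card W)"
    using card_cross_edges[OF finW, of "V - W"] assms card_Diff_subset[OF finW assms(1)] by simp
  ultimately show ?thesis by (simp add: card_pairs finW)
qed

lemma tree_component_props:
  assumes E: "E \<subseteq> pairs V" and W: "W \<subseteq> V" and H: "H \<subseteq> pairs W" and e: "E \<inter> star_edges V W = H"
  shows "induced E W = H" "isolated E W"
proof -
  have sub: "pairs W \<subseteq> star_edges V W"
  proof
    fix e assume "e \<in> pairs W"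
    moreover from this have "e \<noteq> {}" by (auto simp: pairs_def)
    ultimately show "e \<in> star_edges V W" using W by (auto simp: star_edges_def pairs_def)
  qed
  have "induced E W = E \<inter> pairs W" by (rule induced_eq_Int_pairs[OF simple_pairs[OF E]])
  then show "induced E W = H" using sub H e by blast
  show "isolated E W" unfolding isolated_def
  proof (intro ballI allI impI)
    fix u v assume "u \<in> W" "{u, v} \<in> E"
    then have "{u, v} \<in> H" using E e by (auto simp: star_edges_def)
    then show "v \<in> W" using H by (auto simp: pairs_def)
  qed
qed

text \<open>Two different sets that overlap cannot both carry the tree as a component, since a
  connected set leaving the other would need an edge out of it. For disjoint sets the two patterns
  are independent except that the at most \<open>t * t\<close> pairs between them are counted twice,
  whence the factor \<open>(1 - p) ^ (t * t)\<close>. One bijection \<open>F W\<close> per vertex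
  set is enough because only a lower bound for the number of copies is wanted.\<close>

lemma tree_component_moments:
  fixes W\<^sub>0 :: "nat set"
  assumes c: "0 < c" "c < real n" and T: "treelike W\<^sub>0 T\<^sub>0"
  assumes F: "\<And>W. W \<subseteq> {1..n} \<Longrightarrow> card W = card W\<^sub>0 \<Longrightarrow> bij (F W) \<and> F W ` W\<^sub>0 = W"
  defines "t \<equiv> card W\<^sub>0" and "e \<equiv> card T\<^sub>0" and "p \<equiv> c / real n"
  defines "\<W> \<equiv> {W. W \<subseteq> {1..n} \<and> card W = t}"
  defines "g \<equiv> p ^ e * (1 - p) ^ ((t choose 2) + t * (n - t) - e)"
  defines "\<mu> \<equiv> real (n choose t) * g"
  defines "Y \<equiv> \<lambda>E. \<Sum>W\<in>\<W>. of_bool (E \<inter> star_edges {1..n} W = img (F W) T\<^sub>0) :: real"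
  shows "gexp (pairs {1..n}) p Y = \<mu>"
    and "gexp (pairs {1..n}) p (\<lambda>E. Y E ^ 2) \<le> \<mu> + \<mu>\<^sup>2 / (1 - p) ^ (t * t)"
proof -
  define V where "V = {1..n}"
  define Z where "Z W = star_edges V W" for W
  define H where "H W = img (F W) T\<^sub>0" for W
  have finV: "finite V" "card V = n" by (simp_all add: V_def)
  have finX: "finite (pairs V)" using finV by simp
  have p: "0 \<le> p" "p < 1" "p \<le> 1" using c by (auto simp: p_def)
  have W: "W \<subseteq> V" "card W = t" "finite W" "H W \<subseteq> pairs W" "card (H W) = e" "H W \<subseteq> Z W" "Z W \<subseteq> pairs V"
    "card (Z W - H W) = (t choose 2) + t * (n - t) - e" "finite (Z W)"
    if "W \<in> \<W>" for W
  proof -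
    show WV: "W \<subseteq> V" and cW: "card W = t" using that by (auto simp: \<W>_def V_def)
    show finW: "finite W" by (rule finite_subset[OF WV finV(1)])
    have f: "bij (F W)" "F W ` W\<^sub>0 = W" using F[of W] WV cW by (auto simp: V_def t_def)
    show HW: "H W \<subseteq> pairs W"
      using T img_subset_pairs[OF f(1), of T\<^sub>0 W\<^sub>0] f(2) by (simp add: H_def treelike_def)
    show cH: "card (H W) = e" by (simp add: H_def card_img f(1) e_def)
    show HZ: "H W \<subseteq> Z W"
    proof
      fix a assume "a \<in> H W"
      then have a: "a \<subseteq> W" "card a = 2" using HW by (auto simp: pairs_def)
      then have "a \<noteq> {}" by auto
      then show "a \<in> Z W" using a WV by (auto simp: Z_def star_edges_def pairs_def)
    qed
    show ZV: "Z W \<subseteq> pairs V" by (auto simp: Z_def star_edges_def)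
    show finZ: "finite (Z W)" by (rule finite_subset[OF ZV finX])
    show "card (Z W - H W) = (t choose 2) + t * (n - t) - e"
      using card_Diff_subset[OF finite_subset[OF HZ finZ] HZ] card_star_edges[OF WV finV(1)]
      by (simp add: cH cW finV(2) Z_def)
  qed
  have card\<W>: "real (card \<W>) = real (n choose t)" using n_subsets[of "{1..n}" t] by (simp add: \<W>_def)
  have one: "gprob (pairs V) p (\<lambda>E. E \<inter> Z W = H W) = g" if "W \<in> \<W>" for W
    using gprob_pattern'[OF finX W(7,6)[OF that], of p] W(5,8)[OF that] by (simp add: g_def)
  have Y: "Y E = (\<Sum>W\<in>\<W>. of_bool (E \<inter> Z W = H W))" for E by (simp add: Y_def Z_def H_def V_def)
  show "gexp (pairs {1..n}) p Y = \<mu>"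
  proof -
    have "gexp (pairs V) p Y = (\<Sum>W\<in>\<W>. gprob (pairs V) p (\<lambda>E. E \<inter> Z W = H W))"
      unfolding gprob_def gexp_sum[symmetric] by (rule gexp_cong) (rule Y)
    also have "\<dots> = (\<Sum>W\<in>\<W>. g)" by (rule sum.cong[OF refl]) (rule one)
    finally show ?thesis by (simp add: \<mu>_def card\<W> V_def)
  qed
  have g0: "0 \<le> g" unfolding g_def using p by (intro mult_nonneg_nonneg zero_le_power) auto
  have d: "0 < 1 - p" using p by simp
  have two: "gprob (pairs V) p (\<lambda>E. E \<inter> Z W = H W \<and> E \<inter> Z W' = H W') \<le>
      of_bool (W = W') * g + g\<^sup>2 / (1 - p) ^ (t * t)" if WW: "W \<in> \<W>" "W' \<in> \<W>" for W W'
  proof (cases "W = W'")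
    case True
    then show ?thesis using one[OF WW(1)] g0 d by simp
  next
    case False
    show ?thesis
    proof (cases "W \<inter> W' = {}")
      case overlap: False
      have no: "\<not> (E \<inter> Z W = H W \<and> E \<inter> Z W' = H W')" if E: "E \<subseteq> pairs V" for E
      proof
        assume h: "E \<inter> Z W = H W \<and> E \<inter> Z W' = H W'"
        have i1: "induced E W = H W"
          by (rule tree_component_props(1)[OF E W(1)[OF WW(1)] W(4)[OF WW(1)]]) (use h in \<open>simp add: Z_def\<close>)
        have i2: "isolated E W'"
          by (rule tree_component_props(2)[OF E W(1)[OF WW(2)] W(4)[OF WW(2)]]) (use h in \<open>simp add: Z_def\<close>)
        have f: "bij (F W)" "F W ` W\<^sub>0 = W" using F[of W] W(1,2)[OF WW(1)] by (auto simp: V_def t_def)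
        have tree: "treelike W (H W)" using treelike_img[OF f(1) T] f(2) by (simp add: H_def)
        have "\<not> W \<subseteq> W'"
        proof
          assume "W \<subseteq> W'"
          then have "W = W'" using card_subset_eq[OF W(3)[OF WW(2)], of W] W(2)[OF WW(1)] W(2)[OF WW(2)] by simp
          then show False using False by simp
        qed
        then have "W \<inter> W' \<subset> W" by auto
        from treelike_connected[OF tree this overlap] obtain u v
          where uv: "u \<in> W \<inter> W'" "v \<in> W - W \<inter> W'" "{u, v} \<in> H W" by blast
        have "{u, v} \<in> E" using uv(3) i1 by (auto simp: induced_def)
        then have "v \<in> W'" using i2 uv(1) by (auto simp: isolated_def)
        then show False using uv(2) by blast
      qed
      have "gprob (pairs V) p (\<lambda>E. E \<inter> Z W = H W \<and> E \<inter> Z W' = H W') = gprob (pairs V) p (\<lambda>_. False)"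
        by (rule gprob_cong) (simp add: no)
      also have "\<dots> = 0" by (simp add: gprob_def gexp_def)
      finally show ?thesis using g0 d by simp
    next
      case disj: True
      let ?Z = "Z W \<union> Z W'" and ?H = "H W \<union> H W'"
      let ?z = "(t choose 2) + t * (n - t) - e"
      have dZ: "a \<notin> Z W'" if "a \<in> H W" for a
        using that W(4)[OF WW(1)] disj by (auto simp: pairs_def Z_def star_edges_def)
      have dZ': "a \<notin> Z W" if "a \<in> H W'" for a
        using that W(4)[OF WW(2)] disj by (auto simp: pairs_def Z_def star_edges_def)
      have HH: "H W \<inter> H W' = {}" using dZ W(6)[OF WW(2)] by blast
      have fin: "finite (H W)" "finite (H W')"
        by (rule finite_subset[OF W(6)[OF WW(1)] W(9)[OF WW(1)]], rule finite_subset[OF W(6)[OF WW(2)] W(9)[OF WW(2)]])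
      have "gprob (pairs V) p (\<lambda>E. E \<inter> Z W = H W \<and> E \<inter> Z W' = H W') \<le> gprob (pairs V) p (\<lambda>E. E \<inter> ?Z = ?H)"
        by (rule gprob_mono[OF p(1,3)]) blast
      also have "\<dots> = p ^ card ?H * (1 - p) ^ card (?Z - ?H)"
        by (rule gprob_pattern'[OF finX]) (use W(6,7)[OF WW(1)] W(6,7)[OF WW(2)] in auto)
      also have "card ?H = e + e" using card_Un_disjoint[OF fin HH] W(5)[OF WW(1)] W(5)[OF WW(2)] by simp
      also have "p ^ (e + e) * (1 - p) ^ card (?Z - ?H) \<le> g\<^sup>2 / (1 - p) ^ (t * t)"
      proof -
        have "card (Z W \<inter> Z W') \<le> card ((\<lambda>(u, v). {u, v}) ` (W \<times> W'))"
        proof (rule card_mono)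
          show "finite ((\<lambda>(u, v). {u, v}) ` (W \<times> W'))" using W(3)[OF WW(1)] W(3)[OF WW(2)] by simp
          show "Z W \<inter> Z W' \<subseteq> (\<lambda>(u, v). {u, v}) ` (W \<times> W')"
          proof
            fix a assume a: "a \<in> Z W \<inter> Z W'"
            then obtain u v where uv: "u \<in> a" "u \<in> W" "v \<in> a" "v \<in> W'" by (auto simp: Z_def star_edges_def)
            have "u \<noteq> v" using uv disj by auto
            moreover have "card a = 2" using a by (auto simp: Z_def star_edges_def pairs_def)
            ultimately have "a = {u, v}" using uv(1,3) by (auto simp: card_2_iff)
            then show "a \<in> (\<lambda>(u, v). {u, v}) ` (W \<times> W')" using uv by (intro image_eqI[of _ _ "(u, v)"]) auto
          qed
        qed
        also have "\<dots> = t * t"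
          using card_cross_edges[OF W(3)[OF WW(1)] W(3)[OF WW(2)] disj] W(2)[OF WW(1)] W(2)[OF WW(2)] by simp
        finally have cZZ: "card (Z W \<inter> Z W') \<le> t * t" .
        have A: "Z W - H W = (Z W - H W - Z W') \<union> (Z W \<inter> Z W')" using dZ by auto
        have B: "?Z - ?H = (Z W - H W - Z W') \<union> (Z W' - H W')" using dZ dZ' by auto
        have "card (Z W - H W) = card (Z W - H W - Z W') + card (Z W \<inter> Z W')"
          by (subst A, rule card_Un_disjoint) (use W(9)[OF WW(1)] in auto)
        moreover have "card (?Z - ?H) = card (Z W - H W - Z W') + card (Z W' - H W')"
          by (subst B, rule card_Un_disjoint) (use W(9)[OF WW(1)] W(9)[OF WW(2)] in auto)
        ultimately have card: "card (?Z - ?H) + card (Z W \<inter> Z W') = ?z + ?z"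
          using W(8)[OF WW(1)] W(8)[OF WW(2)] by simp
        have "(1 - p) ^ card (?Z - ?H) * (1 - p) ^ (t * t) \<le> (1 - p) ^ card (?Z - ?H) * (1 - p) ^ card (Z W \<inter> Z W')"
          using cZZ d p by (intro mult_left_mono power_decreasing) auto
        also have "\<dots> = (1 - p) ^ (?z + ?z)" unfolding power_add[symmetric] card ..
        finally have "p ^ (e + e) * ((1 - p) ^ card (?Z - ?H) * (1 - p) ^ (t * t)) \<le> p ^ (e + e) * (1 - p) ^ (?z + ?z)"
          using p by (intro mult_left_mono) auto
        also have "\<dots> = g\<^sup>2" unfolding g_def power2_eq_square by (simp add: power_add algebra_simps)
        finally show ?thesis using d by (simp add: pos_le_divide_eq mult.assoc)
      qed
      finally show ?thesis using False by simp
    qed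
  qed
  have fin\<W>: "finite \<W>" unfolding \<W>_def by (rule finite_subset[of _ "Pow {1..n}"]) auto
  have "gexp (pairs V) p (\<lambda>E. Y E ^ 2) =
      (\<Sum>W\<in>\<W>. \<Sum>W'\<in>\<W>. gprob (pairs V) p (\<lambda>E. E \<inter> Z W = H W \<and> E \<inter> Z W' = H W'))"
    unfolding gprob_def gexp_sum[symmetric]
    by (rule gexp_cong) (simp only: Y power2_eq_square sum_product of_bool_conj)
  also have "\<dots> \<le> (\<Sum>W\<in>\<W>. \<Sum>W'\<in>\<W>. of_bool (W = W') * g + g\<^sup>2 / (1 - p) ^ (t * t))"
    by (intro sum_mono two)
  also have "\<dots> = (\<Sum>W\<in>\<W>. g + real (card \<W>) * (g\<^sup>2 / (1 - p) ^ (t * t)))"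
  proof (rule sum.cong[OF refl])
    fix W assume W: "W \<in> \<W>"
    have "(\<Sum>W'\<in>\<W>. of_bool (W = W') * g) = (\<Sum>W'\<in>\<W>. if W = W' then g else 0)"
      by (rule sum.cong) auto
    then show "(\<Sum>W'\<in>\<W>. of_bool (W = W') * g + g\<^sup>2 / (1 - p) ^ (t * t)) = g + real (card \<W>) * (g\<^sup>2 / (1 - p) ^ (t * t))"
      using W fin\<W> by (simp add: sum.distrib)
  qed
  also have "\<dots> = \<mu> + \<mu>\<^sup>2 / (1 - p) ^ (t * t)"
    unfolding \<mu>_def sum_constant card\<W> by (simp add: power2_eq_square algebra_simps)
  finally show "gexp (pairs {1..n}) p (\<lambda>E. Y E ^ 2) \<le> \<mu> + \<mu>\<^sup>2 / (1 - p) ^ (t * t)" by (simp add: V_def)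
qed

text \<open>A tree has fewer edges than vertices. The factor \<open>n ^ t\<close> from the choice of
  the vertices meets at most \<open>t - 1\<close> factors \<open>c / n\<close>, so at least one
  factor \<open>n\<close> survives; the expression \<open>?L\<close> is the remaining convergent
  part for \<open>e = t - 1\<close>.\<close>

lemma tree_component_mean_at_top:
  assumes c: "0 < c" and e: "e < t"
  shows "filterlim (\<lambda>n. real (n choose t) * ((c / real n) ^ e * (1 - c / real n) ^ ((t choose 2) + t * (n - t) - e))) at_top sequentially"
proof -
  let ?L = "\<lambda>n. (1 / c) * ((real (n choose t) * (c / real n) ^ t) * (1 - c / real n) ^ ((t choose 2) + t * (n - t)))"
  have "?L \<longlonglongrightarrow> (1 / c) * ((c ^ t / fact t) * exp (- c * real t))"
    by (intro tendsto_mult tendsto_const choose_power_tendsto one_minus_power_diff_tendsto)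
  moreover have "0 < (1 / c) * ((c ^ t / fact t) * exp (- c * real t))" using c by simp
  ultimately have "filterlim (\<lambda>n. ?L n * real n) at_top sequentially"
    by (rule filterlim_tendsto_pos_mult_at_top[OF _ _ filterlim_real_sequentially])
  then show ?thesis
  proof (rule filterlim_at_top_mono)
    show "eventually (\<lambda>n. ?L n * real n \<le> real (n choose t) * ((c / real n) ^ e *
        (1 - c / real n) ^ ((t choose 2) + t * (n - t) - e))) sequentially"
      using eventually_c_le[of c]
    proof eventually_elim
      case (elim n)
      note p = edge_prob_bounds[OF c elim]
      let ?p = "c / real n" and ?x = "(t choose 2) + t * (n - t)"
      have "?L n * real n = real (n choose t) * (?p ^ (t - 1) * (1 - ?p) ^ ?x)"
      proof -
        have "?p ^ t = ?p * ?p ^ (t - 1)" using e by (metis Suc_diff_1 gr_implies_not0 neq0_conv power_Suc)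
        then show ?thesis using c p(3) by (simp add: field_simps)
      qed
      also have "\<dots> \<le> real (n choose t) * (?p ^ e * (1 - ?p) ^ (?x - e))"
        using p e by (intro mult_left_mono mult_mono power_decreasing) auto
      finally show ?case .
    qed
  qed
qed

text \<open>Chebyshev's inequality. As soon as the mean is at least \<open>2 * q + 1\<close>,
  falling to \<open>q\<close> is a deviation of at least half the mean, which explains the constant
  4. The relative variance is at most \<open>inverse (\<mu> n) + d n\<close>, where
  \<open>d n\<close> accounts for the doubly counted pairs. Copies with a common vertex coincide,
  being connected, isolated and of equal size.\<close>

lemma tree_components_tendsto:
  fixes W\<^sub>0 :: "nat set"
  assumes c: "0 < c" and T: "treelike W\<^sub>0 T\<^sub>0"
  shows "(\<lambda>n. rg_prob c n (\<lambda>E. \<exists>\<W>. card \<W> = Suc q \<and> disjoint \<W> \<and> (\<forall>W\<in>\<W>. W \<subseteq> {1..n} \<and> isolated E W \<and>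
    (\<exists>f. bij f \<and> f ` W\<^sub>0 = W \<and> induced E W = img f T\<^sub>0)))) \<longlonglongrightarrow> 1"
proof -
  define t where "t = card W\<^sub>0"
  define e where "e = card T\<^sub>0"
  define many where "many n E \<longleftrightarrow> (\<exists>\<W>. card \<W> = Suc q \<and> disjoint \<W> \<and> (\<forall>W\<in>\<W>. W \<subseteq> {1..n} \<and> isolated E W \<and>
    (\<exists>f. bij f \<and> f ` W\<^sub>0 = W \<and> induced E W = img f T\<^sub>0)))" for n :: nat and E
  have fin0: "finite W\<^sub>0" "T\<^sub>0 \<subseteq> pairs W\<^sub>0" using T by (auto simp: treelike_def)
  have et: "e < t"
  proof -
    have "card (induced T\<^sub>0 W\<^sub>0) < card W\<^sub>0" using T by (simp add: treelike_def)
    then show ?thesis using induced_all[OF fin0(2)] by (simp add: e_def t_def)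
  qed
  have "\<exists>f. bij f \<and> f ` W\<^sub>0 = W" if "finite W" "card W = card W\<^sub>0" for W :: "nat set"
    using ex_bij_image[OF fin0(1) that(1)] that(2) by simp
  then obtain F where F: "\<And>W :: nat set. finite W \<Longrightarrow> card W = card W\<^sub>0 \<Longrightarrow> bij (F W) \<and> F W ` W\<^sub>0 = W" by metis
  have F': "bij (F W) \<and> F W ` W\<^sub>0 = W" if "W \<subseteq> {1..n}" "card W = card W\<^sub>0" for W and n :: nat
    by (rule F[OF finite_subset[OF that(1)] that(2)]) simp
  define \<mu> where "\<mu> n = real (n choose t) * ((c / real n) ^ e * (1 - c / real n) ^ ((t choose 2) + t * (n - t) - e))" for n
  have \<mu>: "filterlim \<mu> at_top sequentially" unfolding \<mu>_def by (rule tree_component_mean_at_top[OF c et])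
  define d where "d n = 1 / (1 - c / real n) ^ (t * t) - 1" for n
  have "d \<longlonglongrightarrow> 1 / 1 - 1" unfolding d_def by (intro tendsto_intros one_minus_power_tendsto) simp
  then have d: "d \<longlonglongrightarrow> 0" by simp
  have "(\<lambda>n. 1 - rg_prob c n (many n)) \<longlonglongrightarrow> 0"
  proof (rule Lim_null_comparison)
    have "(\<lambda>n. inverse (\<mu> n)) \<longlonglongrightarrow> 0" by (rule tendsto_inverse_0_at_top[OF \<mu>])
    then have "(\<lambda>n. 4 * (inverse (\<mu> n) + d n)) \<longlonglongrightarrow> 4 * (0 + 0)" by (intro tendsto_mult tendsto_add tendsto_const d)
    then show "(\<lambda>n. 4 * (inverse (\<mu> n) + d n)) \<longlonglongrightarrow> 0" by simp
    have ev1: "eventually (\<lambda>n. 2 * real q + 1 \<le> \<mu> n) sequentially"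
      using \<mu> unfolding filterlim_at_top by blast
    show "eventually (\<lambda>n. norm (1 - rg_prob c n (many n)) \<le> 4 * (inverse (\<mu> n) + d n)) sequentially"
      using eventually_c_le[of "c + 1"] ev1
    proof eventually_elim
      case (elim n)
      have cn: "c < real n" "c \<le> real n" using elim by auto
      define p where "p = c / real n"
      define X where "X = pairs {1..n}"
      note p = edge_prob_bounds[OF c cn(2), folded p_def]
      define \<W> where "\<W> = {W. W \<subseteq> {1..n} \<and> card W = t}"
      define Y where "Y E = (\<Sum>W\<in>\<W>. of_bool (E \<inter> star_edges {1..n} W = img (F W) T\<^sub>0) :: real)" for E
      have finX: "finite X" by (simp add: X_def)
      have fin\<W>: "finite \<W>" unfolding \<W>_def by (rule finite_subset[of _ "Pow {1..n}"]) auto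
      note mom = tree_component_moments[OF c cn(1) T F', folded t_def e_def]
      have m1: "gexp X p Y = \<mu> n"
        unfolding X_def p_def Y_def \<mu>_def \<W>_def by (rule mom(1))
      have m2: "gexp X p (\<lambda>E. Y E ^ 2) \<le> \<mu> n + (\<mu> n)\<^sup>2 / (1 - p) ^ (t * t)"
        unfolding X_def p_def Y_def \<mu>_def \<W>_def by (rule mom(2))
      have good: "many n E" if E: "E \<subseteq> X" and YE: "real q < Y E" for E
      proof -
        define G where "G = {W \<in> \<W>. E \<inter> star_edges {1..n} W = img (F W) T\<^sub>0}"
        have "Y E = real (card G)" unfolding Y_def G_def using fin\<W> by (simp add: of_bool_def sum.If_cases Int_def)
        then have "Suc q \<le> card G" using YE by simp
        then obtain G' where G': "G' \<subseteq> G" "card G' = Suc q" by (metis obtain_subset_with_card_n)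
        have props: "W \<subseteq> {1..n} \<and> card W = t \<and> isolated E W \<and> bij (F W) \<and> F W ` W\<^sub>0 = W \<and> induced E W = img (F W) T\<^sub>0"
          if "W \<in> G'" for W
        proof -
          have h: "W \<subseteq> {1..n}" "card W = t" "E \<inter> star_edges {1..n} W = img (F W) T\<^sub>0"
            using subsetD[OF G'(1) that] by (simp_all add: G_def \<W>_def)
          have f: "bij (F W)" "F W ` W\<^sub>0 = W" using F'[OF h(1)] h(2) by (auto simp: t_def)
          have "img (F W) T\<^sub>0 \<subseteq> pairs W" using fin0(2) img_subset_pairs[OF f(1), of T\<^sub>0 W\<^sub>0] f(2) by simp
          from tree_component_props[OF E[unfolded X_def] h(1) this h(3)] h f show ?thesis by simp
        qed
        have "disjoint G'"
        proof (rule disjointI)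
          fix W W' assume WW: "W \<in> G'" "W' \<in> G'" "W \<noteq> W'"
          note h = props[OF WW(1)] and h' = props[OF WW(2)]
          show "W \<inter> W' = {}"
          proof (rule ccontr)
            assume ne: "W \<inter> W' \<noteq> {}"
            have tree: "treelike W (induced E W)" using treelike_img[of "F W", OF _ T] h by simp
            have finW': "finite W'" using h' by (intro finite_subset[of W' "{1..n}"]) auto
            have "\<not> W \<subseteq> W'"
            proof
              assume "W \<subseteq> W'"
              then have "W = W'" using card_subset_eq[OF finW', of W] h h' by simp
              then show False using WW(3) by simp
            qed
            then have "W \<inter> W' \<subset> W" by auto
            from treelike_connected[OF tree this ne] obtain u v
              where uv: "u \<in> W \<inter> W'" "v \<in> W - W \<inter> W'" "{u, v} \<in> induced E W" by blast
            have "{u, v} \<in> E" using uv(3) by (auto simp: induced_def)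
            then have "v \<in> W'" using h' uv(1) by (auto simp: isolated_def)
            then show False using uv(2) by blast
          qed
        qed
        then show ?thesis unfolding many_def using G'(2) props by blast
      qed
      have "1 - rg_prob c n (many n) = gprob X p (\<lambda>E. \<not> many n E)"
        unfolding rg_prob_def X_def p_def by (rule gprob_not[symmetric]) simp
      also have "\<dots> \<le> gprob X p (\<lambda>E. (\<mu> n - real q)\<^sup>2 \<le> (Y E - \<mu> n)\<^sup>2)"
      proof (rule gprob_mono[OF p(1,2)])
        fix E assume "E \<subseteq> X" "\<not> many n E"
        then have "Y E \<le> real q" using good[of E] by (meson not_le)
        then have "\<mu> n - real q \<le> \<mu> n - Y E" "0 \<le> \<mu> n - real q" using elim(2) by auto
        then have "(\<mu> n - real q)\<^sup>2 \<le> (\<mu> n - Y E)\<^sup>2" by (intro power_mono) auto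
        then show "(\<mu> n - real q)\<^sup>2 \<le> (Y E - \<mu> n)\<^sup>2" by (simp add: power2_commute)
      qed
      also have "\<dots> \<le> gexp X p (\<lambda>E. (Y E - \<mu> n)\<^sup>2) / (\<mu> n - real q)\<^sup>2"
        by (rule gprob_Markov[OF p(1,2)]) (use elim(2) in auto)
      also have "gexp X p (\<lambda>E. (Y E - \<mu> n)\<^sup>2) \<le> \<mu> n + (\<mu> n)\<^sup>2 * d n"
      proof -
        have "gexp X p (\<lambda>E. (Y E - \<mu> n)\<^sup>2) = gexp X p (\<lambda>E. (Y E ^ 2 - (2 * \<mu> n) * Y E) + (\<mu> n)\<^sup>2 * 1)"
          by (rule gexp_cong) (simp add: power2_eq_square algebra_simps)
        also have "\<dots> = gexp X p (\<lambda>E. Y E ^ 2) - 2 * \<mu> n * gexp X p Y + (\<mu> n)\<^sup>2"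
          unfolding gexp_add gexp_diff gexp_cmult gexp_one[OF finX] by simp
        also have "\<dots> \<le> \<mu> n + (\<mu> n)\<^sup>2 / (1 - p) ^ (t * t) - (\<mu> n)\<^sup>2" using m2 unfolding m1 by (simp add: power2_eq_square)
        also have "\<dots> = \<mu> n + (\<mu> n)\<^sup>2 * d n" by (simp add: d_def p_def algebra_simps)
        finally show ?thesis .
      qed
      also have "(\<mu> n + (\<mu> n)\<^sup>2 * d n) / (\<mu> n - real q)\<^sup>2 \<le> (\<mu> n + (\<mu> n)\<^sup>2 * d n) / (\<mu> n / 2)\<^sup>2"
      proof (rule divide_left_mono)
        show "(\<mu> n / 2)\<^sup>2 \<le> (\<mu> n - real q)\<^sup>2" using elim(2) by (intro power_mono) auto
        have "1 - c / real n \<le> 1" "0 < 1 - c / real n" using c cn by auto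
        then have "(1 - c / real n) ^ (t * t) \<le> 1" "0 < (1 - c / real n) ^ (t * t)" by (auto intro: power_le_one)
        then have "0 \<le> d n" unfolding d_def by (simp add: field_simps)
        then show "0 \<le> \<mu> n + (\<mu> n)\<^sup>2 * d n" using elim(2) by auto
        show "0 < (\<mu> n - real q)\<^sup>2 * (\<mu> n / 2)\<^sup>2" using elim(2) by simp
      qed
      also have "\<dots> = 4 * (inverse (\<mu> n) + d n)"
        using elim(2) by (simp add: field_simps power2_eq_square)
      finally have "1 - rg_prob c n (many n) \<le> 4 * (inverse (\<mu> n) + d n)" by (simp add: divide_right_mono)
      moreover have "0 \<le> 1 - rg_prob c n (many n)" using rg_prob_bounds(2)[OF c cn(2)] by simp
      ultimately show ?case by simp
    qed
  qed
  then have "(\<lambda>n. 1 - (1 - rg_prob c n (many n))) \<longlonglongrightarrow> 1 - 0" by (intro tendsto_diff tendsto_const)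
  then show ?thesis unfolding many_def by simp
qed

text \<open>There are only finitely many tree types, so one representative tree per type and a union
  bound suffice.\<close>

lemma not_rich_tendsto:
  assumes c: "0 < c"
  shows "(\<lambda>n. rg_prob c n (\<lambda>E. \<not> rich q {1..n} E)) \<longlonglongrightarrow> 0"
proof -
  define I where "I = Sigma {..<q} tree_types"
  have finI: "finite I" unfolding I_def by (intro finite_SigmaI finite_tree_types) simp
  have "\<forall>x\<in>I. \<exists>y. treelike (fst y) (fst (snd y) :: nat set set) \<and> snd (snd y) \<in> fst y \<and>
      snd x = lty (fst x) (fst (snd y)) {} [fst x \<mapsto> snd (snd y)]"
  proof
    fix x assume "x \<in> I"
    then have "snd x \<in> tree_types (fst x)" by (auto simp: I_def)
    then obtain W and T :: "nat set set" and b where "treelike W T" "b \<in> W" "snd x = lty (fst x) T {} [fst x \<mapsto> b]"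
      unfolding tree_types_def by blast
    then show "\<exists>y. treelike (fst y) (fst (snd y) :: nat set set) \<and> snd (snd y) \<in> fst y \<and>
      snd x = lty (fst x) (fst (snd y)) {} [fst x \<mapsto> snd (snd y)]" by (intro exI[of _ "(W, T, b)"]) simp
  qed
  from bchoice[OF this] obtain Y where Y: "\<forall>x\<in>I. treelike (fst (Y x)) (fst (snd (Y x)) :: nat set set) \<and>
      snd (snd (Y x)) \<in> fst (Y x) \<and> snd x = lty (fst x) (fst (snd (Y x))) {} [fst x \<mapsto> snd (snd (Y x))]" ..
  define W\<^sub>0 T\<^sub>0 b\<^sub>0 where "W\<^sub>0 x = fst (Y x)" and "T\<^sub>0 x = fst (snd (Y x))" and "b\<^sub>0 x = snd (snd (Y x))" for x
  have T: "treelike (W\<^sub>0 x) (T\<^sub>0 x) \<and> b\<^sub>0 x \<in> W\<^sub>0 x \<and> snd x = lty (fst x) (T\<^sub>0 x) {} [fst x \<mapsto> b\<^sub>0 x]" if "x \<in> I" for x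
    using bspec[OF Y that] unfolding W\<^sub>0_def T\<^sub>0_def b\<^sub>0_def .
  define many where "many x n E \<longleftrightarrow> (\<exists>\<W>. card \<W> = Suc q \<and> disjoint \<W> \<and> (\<forall>W\<in>\<W>. W \<subseteq> {1..n} \<and> isolated E W \<and>
    (\<exists>f. bij f \<and> f ` W\<^sub>0 x = W \<and> induced E W = img f (T\<^sub>0 x))))" for x and n :: nat and E
  have sub: "rich q {1..n} E" if "\<forall>x\<in>I. many x n E" for n E
    unfolding rich_def
  proof (intro allI impI ballI)
    fix j \<tau> assume "j < q" "\<tau> \<in> tree_types j"
    then have x: "(j, \<tau>) \<in> I" by (simp add: I_def)
    note Tx = T[OF x, unfolded fst_conv snd_conv]
    from that x have m: "many (j, \<tau>) n E" by blast
    obtain \<W> where W: "card \<W> = Suc q" "disjoint \<W>" "\<forall>W\<in>\<W>. W \<subseteq> {1..n} \<and> isolated E W \<and>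
      (\<exists>f. bij f \<and> f ` W\<^sub>0 (j, \<tau>) = W \<and> induced E W = img f (T\<^sub>0 (j, \<tau>)))"
      using m[unfolded many_def] by (elim exE conjE) (rule that)
    have "W \<subseteq> {1..n} \<and> isolated E W \<and> treelike W (induced E W) \<and> (\<exists>b\<in>W. lty j (induced E W) {} [j \<mapsto> b] = \<tau>)"
      if WW: "W \<in> \<W>" for W
    proof -
      from bspec[OF W(3) WW] obtain f where h: "W \<subseteq> {1..n}" "isolated E W" "bij f" "f ` W\<^sub>0 (j, \<tau>) = W"
        "induced E W = img f (T\<^sub>0 (j, \<tau>))" by blast
      have "treelike (f ` W\<^sub>0 (j, \<tau>)) (img f (T\<^sub>0 (j, \<tau>)))" by (rule treelike_img[OF h(3) conjunct1[OF Tx]])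
      then have "treelike W (induced E W)" unfolding h(4,5) .
      moreover have "f (b\<^sub>0 (j, \<tau>)) \<in> W" using Tx h(4) by blast
      moreover have "lty j (induced E W) {} [j \<mapsto> f (b\<^sub>0 (j, \<tau>))] = \<tau>"
        unfolding h(5) lty_singleton_img[OF h(3)] using Tx by simp
      ultimately show ?thesis using h(1,2) by blast
    qed
    then show "\<exists>\<W>. card \<W> = Suc q \<and> disjoint \<W> \<and> (\<forall>W\<in>\<W>. W \<subseteq> {1..n} \<and> isolated E W \<and>
       treelike W (induced E W) \<and> (\<exists>b\<in>W. lty j (induced E W) {} [j \<mapsto> b] = \<tau>))"
      using W(1,2) by blast
  qed
  show ?thesis
  proof (rule Lim_null_comparison)
    have "(\<lambda>n. \<Sum>x\<in>I. 1 - rg_prob c n (many x n)) \<longlonglongrightarrow> (\<Sum>x\<in>I. 1 - 1)"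
    proof (intro tendsto_sum tendsto_diff tendsto_const)
      fix x assume x: "x \<in> I"
      have "many x n = (\<lambda>E. \<exists>\<W>. card \<W> = Suc q \<and> disjoint \<W> \<and> (\<forall>W\<in>\<W>. W \<subseteq> {1..n} \<and> isolated E W \<and>
          (\<exists>f. bij f \<and> f ` W\<^sub>0 x = W \<and> induced E W = img f (T\<^sub>0 x))))" for n
        by (rule ext) (rule many_def)
      then show "(\<lambda>n. rg_prob c n (many x n)) \<longlonglongrightarrow> 1"
        using tree_components_tendsto[OF c conjunct1[OF T[OF x]], of q] by (simp only:)
    qed
    then show "(\<lambda>n. \<Sum>x\<in>I. 1 - rg_prob c n (many x n)) \<longlonglongrightarrow> 0" by simp
    show "eventually (\<lambda>n. norm (rg_prob c n (\<lambda>E. \<not> rich q {1..n} E)) \<le> (\<Sum>x\<in>I. 1 - rg_prob c n (many x n))) sequentially"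
      using eventually_c_le[of c]
    proof eventually_elim
      case (elim n)
      note p = edge_prob_bounds[OF c elim]
      have "rg_prob c n (\<lambda>E. \<not> rich q {1..n} E) \<le> rg_prob c n (\<lambda>E. \<exists>x\<in>I. \<not> many x n E)"
        unfolding rg_prob_def
      proof (rule gprob_mono[OF p(1,2)])
        fix E assume "\<not> rich q {1..n} E"
        then show "\<exists>x\<in>I. \<not> many x n E" using sub[of n E] by blast
      qed
      also have "\<dots> \<le> (\<Sum>x\<in>I. rg_prob c n (\<lambda>E. \<not> many x n E))"
        unfolding rg_prob_def by (rule gprob_Bex_le[OF finI p(1,2)])
      also have "\<dots> = (\<Sum>x\<in>I. 1 - rg_prob c n (many x n))"
        unfolding rg_prob_def by (intro sum.cong refl gprob_not) simp
      finally show ?case using rg_prob_bounds(1)[OF c elim, of "\<lambda>E. \<not> rich q {1..n} E"] by simp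
    qed
  qed
qed

section \<open>Convergence law\<close>

text \<open>On rich graphs a sentence is a property of \<open>gtype\<close>, hence of every
  sufficiently large core; \<open>Good\<close> collects the types of the rich models. The order of
  quantifiers matters: \<open>q\<close>, \<open>K\<close> and \<open>Good\<close> depend on the
  sentence alone, so the same property of cores serves all larger \<open>L\<close> and
  \<open>r\<close>.\<close>

theorem sentence_limit:
  assumes "sentence \<phi>"
  shows "\<exists>q K Good. \<forall>c>0. \<forall>L\<ge>K. \<forall>r. 2 ^ q \<le> Suc r \<longrightarrow> (\<exists>l. prob_models c \<phi> \<longlonglongrightarrow> l \<and>
    (\<forall>M. \<bar>l - (\<Sum>m\<le>M. core_weight c L r (\<lambda>H. gtype q K H \<in> Good) m)\<bar> \<le> tail_const c L (Suc r) / real (Suc M)))"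
proof -
  define q where "q = qrank \<phi>"
  define K where "K = (2 :: nat) ^ Suc q"
  define Good where "Good = {gtype q K E |V (E :: nat set set). finite V \<and> E \<subseteq> pairs V \<and> rich q V E \<and> models V E \<phi>}"
  have main: "models V E \<phi> \<longleftrightarrow> gtype q K E \<in> Good" if "finite V" "E \<subseteq> pairs V" "rich q V E" for V and E :: "nat set set"
  proof
    assume "models V E \<phi>"
    then show "gtype q K E \<in> Good" using that unfolding Good_def by blast
  next
    assume "gtype q K E \<in> Good"
    then obtain V' and E' :: "nat set set" where h: "gtype q K E = gtype q K E'" "finite V'" "E' \<subseteq> pairs V'" "rich q V' E'" "models V' E' \<phi>"
      unfolding Good_def by blast
    have "models V E \<phi> \<longleftrightarrow> models V' E' \<phi>"
      by (rule models_eq_if_gtype_eq[OF that(2,1,3) h(3,2,4) _ _ assms h(1)]) (simp_all add: K_def q_def)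
    then show "models V E \<phi>" using h(5) by simp
  qed
  show ?thesis
  proof (rule exI[of _ q], rule exI[of _ K], rule exI[of _ Good], intro allI impI)
    fix c :: real and L r assume c: "0 < c" and L: "K \<le> L" and r: "2 ^ q \<le> Suc r"
    define R where "R n = rg_prob c n (\<lambda>E. gtype q K (core L (Suc r) E) \<in> Good)" for n
    have "\<exists>l. R \<longlonglongrightarrow> l \<and>
      (\<forall>M. \<bar>l - (\<Sum>m\<le>M. core_weight c L r (\<lambda>H. gtype q K H \<in> Good) m)\<bar> \<le> tail_const c L (Suc r) / real (Suc M))"
      unfolding R_def by (rule core_property_limit[OF c]) (simp add: gtype_img)
    then obtain l where l: "R \<longlonglongrightarrow> l"
      "\<forall>M. \<bar>l - (\<Sum>m\<le>M. core_weight c L r (\<lambda>H. gtype q K H \<in> Good) m)\<bar> \<le> tail_const c L (Suc r) / real (Suc M)" by blast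
    have "(\<lambda>n. prob_models c \<phi> n - R n) \<longlonglongrightarrow> 0"
    proof (rule Lim_null_comparison[OF _ not_rich_tendsto[OF c, of q]])
      show "eventually (\<lambda>n. norm (prob_models c \<phi> n - R n) \<le> rg_prob c n (\<lambda>E. \<not> rich q {1..n} E)) sequentially"
        using eventually_c_le[of c]
      proof eventually_elim
        case (elim n)
        note p = edge_prob_bounds[OF c elim]
        have "\<bar>rg_prob c n (\<lambda>E. models {1..n} E \<phi>) - R n\<bar> \<le> rg_prob c n (\<lambda>E. \<not> rich q {1..n} E)"
          unfolding rg_prob_def R_def
        proof (rule gprob_diff_le[OF p(1,2)])
          fix E assume E: "E \<subseteq> pairs {1..n}" "\<not> \<not> rich q {1..n} E"
          have "gtype q K (core L (Suc r) E) = gtype q K E" by (rule gtype_core[OF simple_pairs[OF E(1)] L r])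
          then show "models {1..n} E \<phi> \<longleftrightarrow> gtype q K (core L (Suc r) E) \<in> Good"
            using main[of "{1..n}" E] E by simp
        qed
        then show ?case using prob_models_eq_rg_prob[OF c elim, of \<phi>] by simp
      qed
    qed
    then have "(\<lambda>n. (prob_models c \<phi> n - R n) + R n) \<longlonglongrightarrow> 0 + l" by (intro tendsto_add l(1))
    then have "prob_models c \<phi> \<longlonglongrightarrow> l" by simp
    with l(2) show "\<exists>l. prob_models c \<phi> \<longlonglongrightarrow> l \<and>
      (\<forall>M. \<bar>l - (\<Sum>m\<le>M. core_weight c L r (\<lambda>H. gtype q K H \<in> Good) m)\<bar> \<le> tail_const c L (Suc r) / real (Suc M))" by blast
  qed
qed

section \<open>Sentences describing the core\<close>

text \<open>Definability by a formula with free variables in \<open>A\<close>. Closure properties of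
  this predicate replace the explicit construction of formulas, and bound variables are handled
  through the assignment.\<close>

definition dfn :: "nat set \<Rightarrow> (nat set \<Rightarrow> nat set set \<Rightarrow> (nat \<Rightarrow> nat) \<Rightarrow> bool) \<Rightarrow> bool" where
  "dfn A P \<longleftrightarrow> (\<exists>\<phi>. free_vars \<phi> \<subseteq> A \<and>
     (\<forall>V E \<rho>. simple E \<longrightarrow> (sat V (\<lambda>u v. {u, v} \<in> E) \<rho> \<phi> \<longleftrightarrow> P V E \<rho>)))"

lemma dfnI:
  assumes "free_vars \<phi> \<subseteq> A" "\<And>V E \<rho>. simple E \<Longrightarrow> sat V (\<lambda>u v. {u, v} \<in> E) \<rho> \<phi> \<longleftrightarrow> P V E \<rho>"
  shows "dfn A P"
  unfolding dfn_def using assms by (intro exI[of _ \<phi>]) simp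

lemma dfnE:
  assumes "dfn A P"
  obtains \<phi> where "free_vars \<phi> \<subseteq> A" "\<And>V E \<rho>. simple E \<Longrightarrow> sat V (\<lambda>u v. {u, v} \<in> E) \<rho> \<phi> \<longleftrightarrow> P V E \<rho>"
  using assms unfolding dfn_def by auto

lemma dfn_cong:
  assumes "dfn A P" "\<And>V E \<rho>. simple E \<Longrightarrow> P V E \<rho> \<longleftrightarrow> Q V E \<rho>"
  shows "dfn A Q"
  using assms(1) by (rule dfnE) (rule dfnI, auto simp: assms(2))

lemma dfn_mono: "dfn A P \<Longrightarrow> A \<subseteq> B \<Longrightarrow> dfn B P"
  unfolding dfn_def by (meson order_trans)

lemma dfn_eq: "x \<in> A \<Longrightarrow> y \<in> A \<Longrightarrow> dfn A (\<lambda>V E \<rho>. \<rho> x = \<rho> y)"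
  by (rule dfnI[of "Eq x y"]) auto

lemma dfn_adj: "x \<in> A \<Longrightarrow> y \<in> A \<Longrightarrow> dfn A (\<lambda>V E \<rho>. {\<rho> x, \<rho> y} \<in> E)"
  by (rule dfnI[of "Adj x y"]) auto

lemma dfn_not: "dfn A P \<Longrightarrow> dfn A (\<lambda>V E \<rho>. \<not> P V E \<rho>)"
  by (erule dfnE) (rule dfnI[of "Neg _"], auto)

lemma dfn_conj: "dfn A P \<Longrightarrow> dfn A Q \<Longrightarrow> dfn A (\<lambda>V E \<rho>. P V E \<rho> \<and> Q V E \<rho>)"
proof -
  assume "dfn A P" "dfn A Q"
  then obtain \<phi> \<psi> where "free_vars \<phi> \<subseteq> A" "free_vars \<psi> \<subseteq> A"
    "\<And>V E \<rho>. simple E \<Longrightarrow> sat V (\<lambda>u v. {u, v} \<in> E) \<rho> \<phi> \<longleftrightarrow> P V E \<rho>"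
    "\<And>V E \<rho>. simple E \<Longrightarrow> sat V (\<lambda>u v. {u, v} \<in> E) \<rho> \<psi> \<longleftrightarrow> Q V E \<rho>"
    unfolding dfn_def by auto
  then show ?thesis by (intro dfnI[of "Conj \<phi> \<psi>"]) auto
qed

lemma dfn_ex:
  assumes "dfn (insert x A) P"
  shows "dfn A (\<lambda>V E \<rho>. \<exists>v\<in>V. P V E (\<rho>(x := v)))"
proof -
  obtain \<phi> where \<phi>: "free_vars \<phi> \<subseteq> insert x A"
    "\<And>V E \<rho>. simple E \<Longrightarrow> sat V (\<lambda>u v. {u, v} \<in> E) \<rho> \<phi> \<longleftrightarrow> P V E \<rho>"
    using assms unfolding dfn_def by auto
  show ?thesis by (rule dfnI[of "fo.Ex x \<phi>"]) (use \<phi> in auto)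
qed

lemma dfn_True: "dfn A (\<lambda>V E \<rho>. True)"
  by (rule dfnI[of "Neg (Conj (fo.Ex 0 (Eq 0 0)) (Neg (fo.Ex 0 (Eq 0 0))))"]) auto

lemma dfn_iff_const: "dfn A P \<Longrightarrow> dfn A (\<lambda>V E \<rho>. P V E \<rho> \<longleftrightarrow> b)"
  using dfn_not by (cases b) auto

lemma dfn_Ball: "finite X \<Longrightarrow> (\<And>x. x \<in> X \<Longrightarrow> dfn A (P x)) \<Longrightarrow> dfn A (\<lambda>V E \<rho>. \<forall>x\<in>X. P x V E \<rho>)"
proof (induction X rule: finite_induct)
  case empty
  show ?case by (rule dfn_cong[OF dfn_True]) simp
next
  case (insert x X)
  have "dfn A (\<lambda>V E \<rho>. P x V E \<rho> \<and> (\<forall>x\<in>X. P x V E \<rho>))" using insert by (intro dfn_conj) auto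
  then show ?case by (rule dfn_cong) simp
qed

lemma dfn_Bex: "finite X \<Longrightarrow> (\<And>x. x \<in> X \<Longrightarrow> dfn A (P x)) \<Longrightarrow> dfn A (\<lambda>V E \<rho>. \<exists>x\<in>X. P x V E \<rho>)"
  by (rule dfn_cong[OF dfn_not[OF dfn_Ball[of X A "\<lambda>x V E \<rho>. \<not> P x V E \<rho>"]]]) (auto intro: dfn_not)

lemma dfn_ex_many:
  assumes "finite B" "A \<inter> B = {}" "dfn (A \<union> B) P"
  shows "dfn A (\<lambda>V E \<rho>. \<exists>g. (\<forall>i\<in>B. g i \<in> V) \<and> P V E (\<lambda>i. if i \<in> B then g i else \<rho> i))"
  using assms
proof (induction B arbitrary: A rule: finite_induct)
  case empty
  have "dfn A P" using empty by simp
  then show ?case by (rule dfn_cong) simp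
next
  case (insert x B)
  have "dfn (insert x A) (\<lambda>V E \<rho>. \<exists>g. (\<forall>i\<in>B. g i \<in> V) \<and> P V E (\<lambda>i. if i \<in> B then g i else \<rho> i))"
    using insert by (intro insert.IH) auto
  from dfn_ex[OF this] show ?case
  proof (rule dfn_cong)
    fix V E \<rho>
    show "(\<exists>v\<in>V. \<exists>g. (\<forall>i\<in>B. g i \<in> V) \<and> P V E (\<lambda>i. if i \<in> B then g i else (\<rho>(x := v)) i)) \<longleftrightarrow>
      (\<exists>g. (\<forall>i\<in>insert x B. g i \<in> V) \<and> P V E (\<lambda>i. if i \<in> insert x B then g i else \<rho> i))"
    proof
      assume "\<exists>v\<in>V. \<exists>g. (\<forall>i\<in>B. g i \<in> V) \<and> P V E (\<lambda>i. if i \<in> B then g i else (\<rho>(x := v)) i)"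
      then obtain v g where vg: "v \<in> V" "\<forall>i\<in>B. g i \<in> V" "P V E (\<lambda>i. if i \<in> B then g i else (\<rho>(x := v)) i)" by blast
      have "(\<lambda>i. if i \<in> insert x B then (g(x := v)) i else \<rho> i) = (\<lambda>i. if i \<in> B then g i else (\<rho>(x := v)) i)"
        using insert.hyps by auto
      then show "\<exists>g. (\<forall>i\<in>insert x B. g i \<in> V) \<and> P V E (\<lambda>i. if i \<in> insert x B then g i else \<rho> i)"
        using vg insert.hyps by (intro exI[of _ "g(x := v)"]) auto
    next
      assume "\<exists>g. (\<forall>i\<in>insert x B. g i \<in> V) \<and> P V E (\<lambda>i. if i \<in> insert x B then g i else \<rho> i)"
      then obtain g where g: "\<forall>i\<in>insert x B. g i \<in> V" "P V E (\<lambda>i. if i \<in> insert x B then g i else \<rho> i)" by blast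
      have "(\<lambda>i. if i \<in> insert x B then g i else \<rho> i) = (\<lambda>i. if i \<in> B then g i else (\<rho>(x := g x)) i)"
        by auto
      then show "\<exists>v\<in>V. \<exists>g. (\<forall>i\<in>B. g i \<in> V) \<and> P V E (\<lambda>i. if i \<in> B then g i else (\<rho>(x := v)) i)"
        using g by (intro bexI[of _ "g x"] exI[of _ g]) auto
    qed
  qed
qed

text \<open>A finite tuple has only finitely many equality and adjacency patterns. A property
  depending on the pattern alone is the disjunction of the patterns in which it occurs.\<close>

lemma dfn_pattern:
  assumes A: "finite A"
    and P: "\<And>E \<rho> E' \<rho>'. simple E \<Longrightarrow> simple E' \<Longrightarrow> (\<And>i j. i \<in> A \<Longrightarrow> j \<in> A \<Longrightarrow> \<rho> i = \<rho> j \<longleftrightarrow> \<rho>' i = \<rho>' j) \<Longrightarrow>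
      (\<And>i j. i \<in> A \<Longrightarrow> j \<in> A \<Longrightarrow> {\<rho> i, \<rho> j} \<in> E \<longleftrightarrow> {\<rho>' i, \<rho>' j} \<in> E') \<Longrightarrow> P E \<rho> \<Longrightarrow> P E' \<rho>'"
  shows "dfn A (\<lambda>V E \<rho>. P E \<rho>)"
proof -
  define pat where "pat E \<rho> = ({x \<in> A \<times> A. \<rho> (fst x) = \<rho> (snd x)}, {x \<in> A \<times> A. {\<rho> (fst x), \<rho> (snd x)} \<in> E})"
    for E :: "nat set set" and \<rho> :: "nat \<Rightarrow> nat"
  define PP where "PP = {pat E \<rho> |E \<rho>. simple E \<and> P E \<rho>}"
  have fin: "finite PP"
  proof (rule finite_subset)
    show "PP \<subseteq> Pow (A \<times> A) \<times> Pow (A \<times> A)" by (auto simp: PP_def pat_def)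
  qed (use A in simp)
  have "dfn A (\<lambda>V E \<rho>. \<exists>w\<in>PP. \<forall>x\<in>A \<times> A. (\<rho> (fst x) = \<rho> (snd x) \<longleftrightarrow> x \<in> fst w) \<and> ({\<rho> (fst x), \<rho> (snd x)} \<in> E \<longleftrightarrow> x \<in> snd w))"
    using A by (intro dfn_Bex[OF fin] dfn_Ball dfn_conj dfn_iff_const dfn_eq dfn_adj) auto
  then show ?thesis
  proof (rule dfn_cong)
    fix V and E :: "nat set set" and \<rho> :: "nat \<Rightarrow> nat" assume E: "simple E"
    show "(\<exists>w\<in>PP. \<forall>x\<in>A \<times> A. (\<rho> (fst x) = \<rho> (snd x) \<longleftrightarrow> x \<in> fst w) \<and> ({\<rho> (fst x), \<rho> (snd x)} \<in> E \<longleftrightarrow> x \<in> snd w)) \<longleftrightarrow> P E \<rho>"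
    proof
      assume "P E \<rho>"
      then have "pat E \<rho> \<in> PP" using E unfolding PP_def by blast
      then show "\<exists>w\<in>PP. \<forall>x\<in>A \<times> A. (\<rho> (fst x) = \<rho> (snd x) \<longleftrightarrow> x \<in> fst w) \<and> ({\<rho> (fst x), \<rho> (snd x)} \<in> E \<longleftrightarrow> x \<in> snd w)"
        by (rule bexI[rotated]) (simp add: pat_def)
    next
      assume "\<exists>w\<in>PP. \<forall>x\<in>A \<times> A. (\<rho> (fst x) = \<rho> (snd x) \<longleftrightarrow> x \<in> fst w) \<and> ({\<rho> (fst x), \<rho> (snd x)} \<in> E \<longleftrightarrow> x \<in> snd w)"
      then obtain w where w: "w \<in> PP" and h: "\<And>x. x \<in> A \<times> A \<Longrightarrow> (\<rho> (fst x) = \<rho> (snd x) \<longleftrightarrow> x \<in> fst w) \<and> ({\<rho> (fst x), \<rho> (snd x)} \<in> E \<longleftrightarrow> x \<in> snd w)"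
        by blast
      from w obtain E0 \<rho>0 where 0: "w = pat E0 \<rho>0" "simple E0" "P E0 \<rho>0" unfolding PP_def by blast
      show "P E \<rho>"
      proof (rule P[OF 0(2) E _ _ 0(3)])
        fix i j assume ij: "i \<in> A" "j \<in> A"
        show "\<rho>0 i = \<rho>0 j \<longleftrightarrow> \<rho> i = \<rho> j" "{\<rho>0 i, \<rho>0 j} \<in> E0 \<longleftrightarrow> {\<rho> i, \<rho> j} \<in> E"
          using h[of "(i, j)"] ij by (auto simp: 0(1) pat_def)
      qed
    qed
  qed
qed

lemma dfn_circuit:
  assumes "finite A"
  shows "dfn A (\<lambda>V E \<rho>. circuit E (\<rho> ` A))"
proof (rule dfn_pattern[OF assms])
  fix E E' :: "nat set set" and \<rho> \<rho>' :: "nat \<Rightarrow> nat"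
  assume sE: "simple E" "simple E'" and eq: "\<And>i j. i \<in> A \<Longrightarrow> j \<in> A \<Longrightarrow> \<rho> i = \<rho> j \<longleftrightarrow> \<rho>' i = \<rho>' j"
    and adj: "\<And>i j. i \<in> A \<Longrightarrow> j \<in> A \<Longrightarrow> {\<rho> i, \<rho> j} \<in> E \<longleftrightarrow> {\<rho>' i, \<rho>' j} \<in> E'" and c: "circuit E (\<rho> ` A)"
  \<comment> \<open>The tuple may repeat vertices. Since both tuples have the same repetitions,
    \<open>g\<close> does not depend on the chosen index and is injective.\<close>
  define g where "g x = \<rho>' (SOME i. i \<in> A \<and> \<rho> i = x)" for x
  have g: "g (\<rho> i) = \<rho>' i" if "i \<in> A" for i
  proof -
    have "(SOME k. k \<in> A \<and> \<rho> k = \<rho> i) \<in> A \<and> \<rho> (SOME k. k \<in> A \<and> \<rho> k = \<rho> i) = \<rho> i"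
      by (rule someI[of _ i]) (use that in simp)
    then show ?thesis unfolding g_def using eq[OF _ that] by blast
  qed
  have "inj_on g (\<rho> ` A)" by (rule inj_onI) (use g eq in auto)
  then obtain f where f: "bij f" "\<forall>x\<in>\<rho> ` A. f x = g x" using extend_to_bij[of "\<rho> ` A" g] assms by auto
  have fr: "f (\<rho> i) = \<rho>' i" if "i \<in> A" for i using f(2) g that by simp
  have im: "f ` \<rho> ` A = \<rho>' ` A" by (auto simp: fr image_image)
  have "induced E' (\<rho>' ` A) = img f (induced E (\<rho> ` A))"
  proof (intro equalityI subsetI)
    fix e assume e: "e \<in> induced E' (\<rho>' ` A)"
    then obtain x y where xy: "e = {x, y}" using sE(2) by (auto simp: simple_def induced_def card_2_iff)
    then obtain i j where ij: "i \<in> A" "j \<in> A" "x = \<rho>' i" "y = \<rho>' j" using e by (auto simp: induced_def)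
    then have "{\<rho> i, \<rho> j} \<in> E" using adj[OF ij(1,2)] e xy by (auto simp: induced_def)
    then have "{\<rho> i, \<rho> j} \<in> induced E (\<rho> ` A)" using ij by (auto simp: induced_def)
    moreover have "e = f ` {\<rho> i, \<rho> j}" using ij xy fr by simp
    ultimately show "e \<in> img f (induced E (\<rho> ` A))" by (rule rev_image_eqI)
  next
    fix e assume "e \<in> img f (induced E (\<rho> ` A))"
    then obtain a where a: "a \<in> induced E (\<rho> ` A)" "e = f ` a" by auto
    then obtain x y where xy: "a = {x, y}" using sE(1) by (auto simp: simple_def induced_def card_2_iff)
    then obtain i j where ij: "i \<in> A" "j \<in> A" "x = \<rho> i" "y = \<rho> j" using a by (auto simp: induced_def)
    then have "{\<rho>' i, \<rho>' j} \<in> E'" using adj[OF ij(1,2)] a xy by (auto simp: induced_def)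
    then show "e \<in> induced E' (\<rho>' ` A)" using a(2) xy ij fr by (auto simp: induced_def)
  qed
  moreover have "circuit (img f (induced E (\<rho> ` A))) (f ` \<rho> ` A)"
    using c by (simp only: circuit_img[OF f(1)] circuit_induced[OF order.refl])
  ultimately have "circuit (induced E' (\<rho>' ` A)) (\<rho>' ` A)" by (simp only: im)
  then show "circuit E' (\<rho>' ` A)" by (simp only: circuit_induced[OF order.refl])
qed

section \<open>A sentence for an isomorphism type of the core\<close>

text \<open>The three clauses are the conditions of \<open>core_eq_iff\<close>, expressed by
  finitely many vertices. The values of \<open>h\<close> may coincide, so \<open>K\<close> variables
  cover the circuits of all sizes up to \<open>K\<close>.\<close>

definition core_copy :: "nat \<Rightarrow> nat \<Rightarrow> nat set set \<Rightarrow> nat \<Rightarrow> nat set \<Rightarrow> nat set set \<Rightarrow> (nat \<Rightarrow> nat) \<Rightarrow> bool" where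
  "core_copy K r H m V E g \<longleftrightarrow>
     (\<forall>i\<in>{1..m}. \<forall>j\<in>{1..m}. (g i = g j \<longleftrightarrow> i = j) \<and> ({g i, g j} \<in> E \<longleftrightarrow> {i, j} \<in> H)) \<and>
     \<not> (\<exists>y\<in>V. (\<forall>i\<in>{1..m}. y \<noteq> g i) \<and> (\<exists>i\<in>core_verts K r H. {g i, y} \<in> E)) \<and>
     \<not> (\<exists>h. (\<forall>k\<in>{m + 1..m + K}. h k \<in> V) \<and> circuit E (h ` {m + 1..m + K}) \<and>
           (\<exists>k\<in>{m + 1..m + K}. \<forall>i\<in>{1..m}. h k \<noteq> g i))"

lemma core_copy_cong:
  assumes h: "\<And>i. i \<in> {1..m} \<Longrightarrow> g i = f i" and I: "core_verts K r H \<subseteq> {1..m}"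
  shows "core_copy K r H m V E g \<longleftrightarrow> core_copy K r H m V E f"
proof -
  have 1: "(\<forall>i\<in>{1..m}. \<forall>j\<in>{1..m}. (g i = g j \<longleftrightarrow> i = j) \<and> ({g i, g j} \<in> E \<longleftrightarrow> {i, j} \<in> H)) \<longleftrightarrow>
      (\<forall>i\<in>{1..m}. \<forall>j\<in>{1..m}. (f i = f j \<longleftrightarrow> i = j) \<and> ({f i, f j} \<in> E \<longleftrightarrow> {i, j} \<in> H))"
    by (rule ball_cong[OF refl], rule ball_cong[OF refl]) (simp only: h)
  have 2: "(\<forall>i\<in>{1..m}. y \<noteq> g i) \<longleftrightarrow> (\<forall>i\<in>{1..m}. y \<noteq> f i)" for y
    by (rule ball_cong[OF refl]) (simp only: h)
  have 3: "(\<exists>i\<in>core_verts K r H. {g i, y} \<in> E) \<longleftrightarrow> (\<exists>i\<in>core_verts K r H. {f i, y} \<in> E)" for y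
    by (rule bex_cong[OF refl]) (simp only: h[OF subsetD[OF I]])
  show ?thesis unfolding core_copy_def 1 2 3 ..
qed

text \<open>Only the values of \<open>g\<close> on \<open>{1..m}\<close> matter, so \<open>g\<close>
  can be replaced by a bijection of the whole vertex type. For a bijection the clauses translate one
  by one into \<open>core_eq_iff\<close> for the image of \<open>H\<close>.\<close>

lemma core_copy_iff:
  assumes H: "H \<in> core_graphs K r {1..m}" and E: "E \<subseteq> pairs V" and fin: "finite V"
  shows "(\<exists>g. (\<forall>i\<in>{1..m}. g i \<in> V) \<and> core_copy K r H m V E g) \<longleftrightarrow> (\<exists>f. bij f \<and> core K (Suc r) E = img f H)"
proof -
  define B where "B = {1..m}"
  define C where "C = {m + 1..m + K}"
  define I where "I = core_verts K r H"
  have finB: "finite B" by (simp add: B_def)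
  have HB: "H \<subseteq> pairs B" "core_verts K (Suc r) H = B" using H by (auto simp: core_graphs_def B_def)
  have IB: "I \<subseteq> B" unfolding I_def using core_verts_Suc[of K r H] HB(2) by simp
  have sE: "simple E" by (rule simple_pairs[OF E])
  have main: "((\<forall>i\<in>B. f i \<in> V) \<and> core_copy K r H m V E f) \<longleftrightarrow>
      core_verts K (Suc r) E = f ` B \<and> core K (Suc r) E = img f H" if f: "bij f" for f
  proof -
    have inj: "f x = f y \<longleftrightarrow> x = y" for x y using f by (simp add: bij_def inj_eq)
    have W: "core_verts K (Suc r) (img f H) = f ` B" by (simp only: core_verts_img[OF f] HB(2))
    have I': "core_verts K r (img f H) = f ` I" by (simp only: core_verts_img[OF f] I_def)
    have 1: "(\<forall>i\<in>B. \<forall>j\<in>B. (f i = f j \<longleftrightarrow> i = j) \<and> ({f i, f j} \<in> E \<longleftrightarrow> {i, j} \<in> H)) \<longleftrightarrow> induced E (f ` B) = img f H"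
    proof
      assume a: "\<forall>i\<in>B. \<forall>j\<in>B. (f i = f j \<longleftrightarrow> i = j) \<and> ({f i, f j} \<in> E \<longleftrightarrow> {i, j} \<in> H)"
      show "induced E (f ` B) = img f H"
      proof (intro equalityI subsetI)
        fix e assume e: "e \<in> induced E (f ` B)"
        then obtain x y where xy: "e = {x, y}" using sE by (auto simp: simple_def induced_def card_2_iff)
        then obtain i j where ij: "i \<in> B" "j \<in> B" "x = f i" "y = f j" using e by (auto simp: induced_def)
        then have "{i, j} \<in> H" using a e xy by (auto simp: induced_def)
        moreover have "e = f ` {i, j}" using xy ij by simp
        ultimately show "e \<in> img f H" by (rule rev_image_eqI)
      next
        fix e assume "e \<in> img f H"
        then obtain b where b: "b \<in> H" "e = f ` b" by auto
        then have "b \<in> pairs B" using HB(1) by auto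
        then obtain i j where ij: "b = {i, j}" "i \<in> B" "j \<in> B" by (auto simp: pairs_def card_2_iff)
        then have "{f i, f j} \<in> E" using a b by simp
        then show "e \<in> induced E (f ` B)" using b ij by (auto simp: induced_def)
      qed
    next
      assume a: "induced E (f ` B) = img f H"
      have "{f i, f j} \<in> E \<longleftrightarrow> {i, j} \<in> H" if "i \<in> B" "j \<in> B" for i j
      proof -
        have "{f i, f j} \<in> E \<longleftrightarrow> {f i, f j} \<in> induced E (f ` B)" using that by (auto simp: induced_def)
        then show ?thesis unfolding a img_pair_mem_iff[OF f] .
      qed
      then show "\<forall>i\<in>B. \<forall>j\<in>B. (f i = f j \<longleftrightarrow> i = j) \<and> ({f i, f j} \<in> E \<longleftrightarrow> {i, j} \<in> H)" using inj by blast
    qed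
    have 2: "\<not> (\<exists>y\<in>V. (\<forall>i\<in>B. y \<noteq> f i) \<and> (\<exists>i\<in>I. {f i, y} \<in> E)) \<longleftrightarrow> (\<forall>u\<in>f ` I. \<forall>v. {u, v} \<in> E \<longrightarrow> v \<in> f ` B)"
    proof -
      have "v \<in> V" if "{u, v} \<in> E" for u v using that E by (auto simp: pairs_def)
      then show ?thesis by blast
    qed
    have 3: "\<not> (\<exists>h. (\<forall>k\<in>C. h k \<in> V) \<and> circuit E (h ` C) \<and> (\<exists>k\<in>C. \<forall>i\<in>B. h k \<noteq> f i)) \<longleftrightarrow>
        (\<forall>S\<in>short_circuits K E. S \<subseteq> f ` B)"
    proof
      assume a: "\<not> (\<exists>h. (\<forall>k\<in>C. h k \<in> V) \<and> circuit E (h ` C) \<and> (\<exists>k\<in>C. \<forall>i\<in>B. h k \<noteq> f i))"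
      show "\<forall>S\<in>short_circuits K E. S \<subseteq> f ` B"
      proof
        fix S assume S: "S \<in> short_circuits K E"
        have cS: "circuit E S" "card S \<le> K" "finite S" "S \<noteq> {}" using S by (auto simp: short_circuits_def circuit_def)
        have SV: "S \<subseteq> V" using S short_circuits_subset_Pow[OF E, of K] by blast
        have "card S \<le> card C" using cS(2) by (simp add: C_def)
        then obtain D where D: "D \<subseteq> C" "card D = card S" by (metis obtain_subset_with_card_n)
        have "finite D" by (rule finite_subset[OF D(1)]) (simp add: C_def)
        then obtain b where b: "bij_betw b D S" using D(2) cS(3) finite_same_card_bij by blast
        obtain s where s: "s \<in> S" using cS(4) by blast
        \<comment> \<open>Variables beyond the \<open>card S\<close> needed ones repeat a fixed
          vertex of \<open>S\<close>.\<close>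
        define h where "h k = (if k \<in> D then b k else s)" for k
        have hC: "h ` C = S"
        proof (intro equalityI subsetI)
          fix x assume "x \<in> h ` C"
          then show "x \<in> S" using b s by (auto simp: h_def bij_betw_def split: if_splits)
        next
          fix x assume "x \<in> S"
          then obtain k where "k \<in> D" "x = b k" using b by (auto simp: bij_betw_def)
          then show "x \<in> h ` C" using D(1) by (intro image_eqI[of _ _ k]) (auto simp: h_def)
        qed
        have hV: "\<forall>k\<in>C. h k \<in> V" using SV hC by blast
        have "circuit E (h ` C)" unfolding hC by (rule cS(1))
        then have "\<not> (\<exists>k\<in>C. \<forall>i\<in>B. h k \<noteq> f i)" using a hV by blast
        then show "S \<subseteq> f ` B" unfolding hC[symmetric] by blast
      qed
    next
      assume a: "\<forall>S\<in>short_circuits K E. S \<subseteq> f ` B"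
      show "\<not> (\<exists>h. (\<forall>k\<in>C. h k \<in> V) \<and> circuit E (h ` C) \<and> (\<exists>k\<in>C. \<forall>i\<in>B. h k \<noteq> f i))"
      proof
        assume "\<exists>h. (\<forall>k\<in>C. h k \<in> V) \<and> circuit E (h ` C) \<and> (\<exists>k\<in>C. \<forall>i\<in>B. h k \<noteq> f i)"
        then obtain h k where h: "circuit E (h ` C)" "k \<in> C" "\<forall>i\<in>B. h k \<noteq> f i" by blast
        have "card (h ` C) \<le> card C" by (rule card_image_le) (simp add: C_def)
        then have "h ` C \<in> short_circuits K E" using h(1) by (simp add: short_circuits_def C_def)
        then have "h ` C \<subseteq> f ` B" by (rule bspec[OF a])
        then have "h k \<in> f ` B" by (rule subsetD) (rule imageI[OF h(2)])
        then show False using h(3) by blast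
      qed
    qed
    have "core_copy K r H m V E f \<longleftrightarrow> induced E (f ` B) = img f H \<and> (\<forall>u\<in>f ` I. \<forall>v. {u, v} \<in> E \<longrightarrow> v \<in> f ` B) \<and>
        (\<forall>S\<in>short_circuits K E. S \<subseteq> f ` B)"
      unfolding core_copy_def B_def[symmetric] C_def[symmetric] I_def[symmetric] 1 2 3 ..
    also have "\<dots> \<longleftrightarrow> core_verts K (Suc r) E = f ` B \<and> core K (Suc r) E = img f H"
      unfolding core_eq_iff[OF sE W] I' ..
    finally have cc: "core_copy K r H m V E f \<longleftrightarrow> core_verts K (Suc r) E = f ` B \<and> core K (Suc r) E = img f H" .
    have "\<forall>i\<in>B. f i \<in> V" if "core_verts K (Suc r) E = f ` B"
      using core_verts_subset[OF E, of K "Suc r"] that by blast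
    then show ?thesis unfolding cc by blast
  qed
  have copy_cong: "core_copy K r H m V E g \<longleftrightarrow> core_copy K r H m V E f" if "\<And>i. i \<in> B \<Longrightarrow> g i = f i" for f g
    using IB that by (intro core_copy_cong) (simp_all only: I_def B_def)
  show ?thesis unfolding B_def[symmetric]
  proof
    assume "\<exists>g. (\<forall>i\<in>B. g i \<in> V) \<and> core_copy K r H m V E g"
    then obtain g where g: "\<forall>i\<in>B. g i \<in> V" "core_copy K r H m V E g" by blast
    have "\<forall>i\<in>B. \<forall>j\<in>B. (g i = g j \<longleftrightarrow> i = j) \<and> ({g i, g j} \<in> E \<longleftrightarrow> {i, j} \<in> H)"
      using g(2) unfolding core_copy_def B_def[symmetric] by (rule conjunct1)
    then have "inj_on g B" by (simp add: inj_on_def)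
    then obtain f where f: "bij f" "\<forall>i\<in>B. f i = g i" using extend_to_bij[OF finB] by blast
    have "core_copy K r H m V E f" using g(2) copy_cong[of g f] f(2) by simp
    then show "\<exists>f. bij f \<and> core K (Suc r) E = img f H"
    proof -
      have "\<forall>i\<in>B. f i \<in> V" using f(2) g(1) by simp
      from conjI[OF this \<open>core_copy K r H m V E f\<close>]
      have "core K (Suc r) E = img f H" unfolding main[OF f(1)] by (rule conjunct2)
      then show ?thesis using f(1) by blast
    qed
  next
    assume "\<exists>f. bij f \<and> core K (Suc r) E = img f H"
    then obtain f where f: "bij f" "core K (Suc r) E = img f H" by blast
    have "core_verts K (Suc r) E = core_verts K (Suc r) (core K (Suc r) E)" by (rule core_verts_core[OF sE, symmetric])
    also have "\<dots> = f ` B" unfolding f(2) by (simp only: core_verts_img[OF f(1)] HB(2))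
    finally show "\<exists>g. (\<forall>i\<in>B. g i \<in> V) \<and> core_copy K r H m V E g" using main[OF f(1)] f(2) by blast
  qed
qed

lemma dfn_core_copy:
  assumes "core_verts K r H \<subseteq> {1..m}"
  shows "dfn {1..m} (core_copy K r H m)"
proof -
  define B where "B = {1..m}"
  define C where "C = {m + 1..m + K}"
  define I where "I = core_verts K r H"
  let ?y = "m + K + 1"
  have fin: "finite B" "finite C" "finite I" using assms finite_subset[of I B] by (auto simp: B_def C_def I_def)
  have IB: "I \<subseteq> B" using assms by (simp add: I_def B_def)
  have disj: "B \<inter> C = {}" "?y \<notin> B" by (auto simp: B_def C_def)
  have 1: "dfn B (\<lambda>V E \<rho>. \<forall>i\<in>B. \<forall>j\<in>B. (\<rho> i = \<rho> j \<longleftrightarrow> i = j) \<and> ({\<rho> i, \<rho> j} \<in> E \<longleftrightarrow> {i, j} \<in> H))"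
    by (intro dfn_Ball dfn_conj dfn_iff_const dfn_eq dfn_adj fin)
  have "dfn (insert ?y B) (\<lambda>V E \<rho>. (\<forall>i\<in>B. \<not> \<rho> ?y = \<rho> i) \<and> (\<exists>i\<in>I. {\<rho> i, \<rho> ?y} \<in> E))"
    using IB by (intro dfn_Ball dfn_Bex dfn_conj dfn_not dfn_eq dfn_adj fin) auto
  from dfn_not[OF dfn_ex[OF this]]
  have 2: "dfn B (\<lambda>V E \<rho>. \<not> (\<exists>y\<in>V. (\<forall>i\<in>B. y \<noteq> \<rho> i) \<and> (\<exists>i\<in>I. {\<rho> i, y} \<in> E)))"
  proof (rule dfn_cong)
    fix V E and \<rho> :: "nat \<Rightarrow> nat"
    have "(\<rho>(?y := y)) i = \<rho> i" if "i \<in> B" for i y using that disj(2) by auto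
    moreover have "(\<rho>(?y := y)) i = \<rho> i" if "i \<in> I" for i y using that IB disj(2) by auto
    ultimately show "(\<not> (\<exists>v\<in>V. (\<forall>i\<in>B. \<not> (\<rho>(?y := v)) ?y = (\<rho>(?y := v)) i) \<and> (\<exists>i\<in>I. {(\<rho>(?y := v)) i, (\<rho>(?y := v)) ?y} \<in> E))) \<longleftrightarrow>
      (\<not> (\<exists>y\<in>V. (\<forall>i\<in>B. y \<noteq> \<rho> i) \<and> (\<exists>i\<in>I. {\<rho> i, y} \<in> E)))"
      by (simp only: fun_upd_same cong: ball_cong bex_cong)
  qed
  have "dfn (B \<union> C) (\<lambda>V E \<rho>. circuit E (\<rho> ` C) \<and> (\<exists>k\<in>C. \<forall>i\<in>B. \<not> \<rho> k = \<rho> i))"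
    using fin by (intro dfn_conj dfn_mono[OF dfn_circuit] dfn_Bex dfn_Ball dfn_not dfn_eq) auto
  from dfn_not[OF dfn_ex_many[OF fin(2) disj(1) this]]
  have 3: "dfn B (\<lambda>V E \<rho>. \<not> (\<exists>h. (\<forall>k\<in>C. h k \<in> V) \<and> circuit E (h ` C) \<and> (\<exists>k\<in>C. \<forall>i\<in>B. h k \<noteq> \<rho> i)))"
  proof (rule dfn_cong)
    fix V E and \<rho> :: "nat \<Rightarrow> nat"
    have a: "(if i \<in> C then h i else \<rho> i) = \<rho> i" if "i \<in> B" for i h using that disj(1) by auto
    have b: "(\<lambda>i. if i \<in> C then h i else \<rho> i) ` C = h ` C" for h by auto
    have "(\<exists>k\<in>C. \<forall>i\<in>B. \<not> (if k \<in> C then h k else \<rho> k) = (if i \<in> C then h i else \<rho> i)) \<longleftrightarrow> (\<exists>k\<in>C. \<forall>i\<in>B. h k \<noteq> \<rho> i)" for h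
      by (simp add: a cong: ball_cong bex_cong)
    then show "(\<not> (\<exists>g. (\<forall>i\<in>C. g i \<in> V) \<and> circuit E ((\<lambda>i. if i \<in> C then g i else \<rho> i) ` C) \<and>
        (\<exists>k\<in>C. \<forall>i\<in>B. \<not> (if k \<in> C then g k else \<rho> k) = (if i \<in> C then g i else \<rho> i)))) \<longleftrightarrow>
      (\<not> (\<exists>h. (\<forall>k\<in>C. h k \<in> V) \<and> circuit E (h ` C) \<and> (\<exists>k\<in>C. \<forall>i\<in>B. h k \<noteq> \<rho> i)))"
      by (simp only: b)
  qed
  show ?thesis
    using dfn_conj[OF 1 dfn_conj[OF 2 3]]
    unfolding B_def[symmetric] by (rule dfn_cong) (simp only: core_copy_def B_def C_def I_def)
qed

theorem ex_core_sentence: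
  fixes \<A> :: "nat set set set"
  assumes fin: "finite \<A>" and \<A>: "\<And>H. H \<in> \<A> \<Longrightarrow> \<exists>m. H \<in> core_graphs K r {1..m}"
  shows "\<exists>\<phi>. sentence \<phi> \<and> (\<forall>V (E :: nat set set). finite V \<longrightarrow> E \<subseteq> pairs V \<longrightarrow>
    (models V E \<phi> \<longleftrightarrow> (\<exists>H\<in>\<A>. \<exists>f. bij f \<and> core K (Suc r) E = img f H)))"
proof -
  obtain m where m: "\<And>H. H \<in> \<A> \<Longrightarrow> H \<in> core_graphs K r {1..m H}" using \<A> by metis
  have "dfn {} (\<lambda>V E \<rho>. \<exists>H\<in>\<A>. \<exists>g. (\<forall>i\<in>{1..m H}. g i \<in> V) \<and>
      core_copy K r H (m H) V E (\<lambda>i. if i \<in> {1..m H} then g i else \<rho> i))"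
  proof (rule dfn_Bex[OF fin], rule dfn_ex_many)
    fix H assume H: "H \<in> \<A>"
    have "core_verts K r H \<subseteq> {1..m H}" using m[OF H] core_verts_Suc[of K r H] by (auto simp: core_graphs_def)
    then show "dfn ({} \<union> {1..m H}) (core_copy K r H (m H))" using dfn_core_copy by simp
  qed auto
  then obtain \<phi> where \<phi>: "free_vars \<phi> \<subseteq> {}" "\<And>V E \<rho>. simple E \<Longrightarrow> sat V (\<lambda>u v. {u, v} \<in> E) \<rho> \<phi> \<longleftrightarrow>
      (\<exists>H\<in>\<A>. \<exists>g. (\<forall>i\<in>{1..m H}. g i \<in> V) \<and> core_copy K r H (m H) V E (\<lambda>i. if i \<in> {1..m H} then g i else \<rho> i))"
    unfolding dfn_def by auto
  have "models V E \<phi> \<longleftrightarrow> (\<exists>H\<in>\<A>. \<exists>f. bij f \<and> core K (Suc r) E = img f H)" if V: "finite V" "E \<subseteq> pairs V" for V and E :: "nat set set"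
  proof -
    have key: "(\<exists>g. (\<forall>i\<in>{1..m H}. g i \<in> V) \<and> core_copy K r H (m H) V E (\<lambda>i. if i \<in> {1..m H} then g i else \<rho> i)) \<longleftrightarrow>
        (\<exists>f. bij f \<and> core K (Suc r) E = img f H)" if H: "H \<in> \<A>" for H \<rho>
    proof -
      have "(\<exists>g. (\<forall>i\<in>{1..m H}. g i \<in> V) \<and> core_copy K r H (m H) V E (\<lambda>i. if i \<in> {1..m H} then g i else \<rho> i)) \<longleftrightarrow>
        (\<exists>g. (\<forall>i\<in>{1..m H}. g i \<in> V) \<and> core_copy K r H (m H) V E g)" (is "?L \<longleftrightarrow> ?R")
      proof
        assume ?L
        then obtain g where g: "\<forall>i\<in>{1..m H}. g i \<in> V" "core_copy K r H (m H) V E (\<lambda>i. if i \<in> {1..m H} then g i else \<rho> i)" by blast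
        show ?R by (rule exI[of _ "\<lambda>i. if i \<in> {1..m H} then g i else \<rho> i"]) (use g in simp)
      next
        assume ?R
        then obtain g where g: "\<forall>i\<in>{1..m H}. g i \<in> V" "core_copy K r H (m H) V E g" by blast
        have I: "core_verts K r H \<subseteq> {1..m H}" using m[OF H] core_verts_Suc[of K r H] by (auto simp: core_graphs_def)
        have "core_copy K r H (m H) V E (\<lambda>i. if i \<in> {1..m H} then g i else \<rho> i) \<longleftrightarrow> core_copy K r H (m H) V E g"
          by (rule core_copy_cong[OF _ I]) (rule if_P)
        then show ?L using g by blast
      qed
      also have "\<dots> \<longleftrightarrow> (\<exists>f. bij f \<and> core K (Suc r) E = img f H)" by (rule core_copy_iff[OF m[OF H] V(2,1)])
      finally show ?thesis .
    qed
    have "sat V (\<lambda>u v. {u, v} \<in> E) \<rho> \<phi> \<longleftrightarrow> (\<exists>H\<in>\<A>. \<exists>f. bij f \<and> core K (Suc r) E = img f H)" for \<rho>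
      unfolding \<phi>(2)[OF simple_pairs[OF V(2)]] by (rule bex_cong[OF refl]) (rule key)
    then show ?thesis by (simp add: models_def)
  qed
  then show ?thesis using \<phi>(1) by (intro exI[of _ \<phi>]) (auto simp: sentence_def)
qed

section \<open>Counting circuits and fragments\<close>

text \<open>The handshake identity, used to turn minimum degree two into degree exactly two.\<close>

lemma sum_degrees:
  assumes "finite N" "F \<subseteq> pairs N"
  shows "(\<Sum>v\<in>N. card {e \<in> F. v \<in> e}) = 2 * card F"
proof -
  have finF: "finite F" by (rule finite_subset[OF assms(2)]) (simp add: assms(1))
  have "(\<Sum>v\<in>N. card {e \<in> F. v \<in> e}) = (\<Sum>v\<in>N. \<Sum>e\<in>F. of_bool (v \<in> e))"
    using finF by (simp add: of_bool_def sum.If_cases Int_def)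
  also have "\<dots> = (\<Sum>e\<in>F. \<Sum>v\<in>N. of_bool (v \<in> e))" by (rule sum.swap)
  also have "\<dots> = (\<Sum>e\<in>F. 2)"
  proof (rule sum.cong[OF refl])
    fix e assume "e \<in> F"
    then have e: "e \<subseteq> N" "card e = 2" using assms(2) by (auto simp: pairs_def)
    then have "N \<inter> e = e" by auto
    then show "(\<Sum>v\<in>N. of_bool (v \<in> e)) = (2 :: nat)"
      using assms(1) e by (simp add: of_bool_def sum.If_cases)
  qed
  finally show ?thesis by simp
qed

lemma circuit_card_ge2:
  assumes "simple F" "circuit F S"
  shows "2 \<le> card S"
proof (rule ccontr)
  assume "\<not> 2 \<le> card S"
  moreover have S: "finite S" "S \<noteq> {}" "card S \<le> card (induced F S)" using assms(2) by (auto simp: circuit_def)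
  ultimately have c1: "card S = 1" using card_0_eq[of S] by linarith
  have "induced F S = {}"
  proof (rule equals0I)
    fix e assume e: "e \<in> induced F S"
    then have "card e = 2" "e \<subseteq> S" using assms(1) by (auto simp: induced_def simple_def)
    then have "2 \<le> card S" using card_mono[OF S(1), of e] by simp
    then show False using c1 by simp
  qed
  then show False using S c1 by simp
qed

text \<open>Removing \<open>s\<close> lowers the number of induced edges from at least
  \<open>card S\<close> to at most \<open>card S - 2\<close>, by minimality.\<close>

lemma circuit_degree_ge2:
  assumes F: "simple F" and S: "circuit F S" "s \<in> S"
  shows "2 \<le> card {e \<in> induced F S. s \<in> e}"
proof -
  have fin: "finite S" and cS: "card S \<le> card (induced F S)" using S by (auto simp: circuit_def)
  have c2: "2 \<le> card S" by (rule circuit_card_ge2[OF F S(1)])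
  have c': "card (S - {s}) = card S - 1" using fin S(2) by simp
  then have "card (S - {s}) \<noteq> 0" using c2 by simp
  then have "S - {s} \<noteq> {}" by (intro notI) (simp only: card.empty)
  moreover have "S - {s} \<subset> S" using S(2) by auto
  ultimately have "card (induced F (S - {s})) < card (S - {s})" using S(1) by (simp add: circuit_def)
  moreover have "induced F S = {e \<in> induced F S. s \<in> e} \<union> induced F (S - {s})" by (auto simp: induced_def)
  from arg_cong[where f = card, OF this]
  have "card (induced F S) \<le> card {e \<in> induced F S. s \<in> e} + card (induced F (S - {s}))"
    by (rule ord_eq_le_trans) (rule card_Un_le)
  ultimately show ?thesis using cS c' c2 by linarith
qed

text \<open>All degrees are at least two and their average is two.\<close>

lemma circuit_degree:
  assumes F: "F \<in> circuits_on N" "finite N" and v: "v \<in> N"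
  shows "card {e \<in> F. v \<in> e} = 2"
proof -
  have Fp: "F \<subseteq> pairs N" "card F = card N" "circuit F N" using F by (auto simp: circuits_on_def)
  have "2 \<le> card {e \<in> F. w \<in> e}" if "w \<in> N" for w
    using circuit_degree_ge2[OF simple_pairs[OF Fp(1)] Fp(3) that] induced_all[OF Fp(1)] by simp
  moreover have "(\<Sum>w\<in>N. 2) = (\<Sum>w\<in>N. card {e \<in> F. w \<in> e})" using sum_degrees[OF F(2) Fp(1)] Fp(2) by simp
  ultimately show ?thesis using sum_mono_inv[of "\<lambda>_. 2" N "\<lambda>w. card {e \<in> F. w \<in> e}" v] v F(2) by auto
qed

text \<open>A vertex \<open>z\<close> of a circuit can be contracted: its two edges are replaced by one edge joining its
  neighbours. Conversely every edge of a circuit can be subdivided by a new vertex.\<close>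

definition subdivide :: "'a \<Rightarrow> 'a set set \<Rightarrow> 'a set \<Rightarrow> 'a set set" where
  "subdivide z F e = (F - {e}) \<union> (\<lambda>x. {z, x}) ` e"

text \<open>For a proper subset containing \<open>z\<close>, the new vertex brings two edges only if
  both ends of \<open>e\<close> are present, and then \<open>e\<close> itself has been
  removed.\<close>

lemma subdivide_circuits_on:
  assumes F: "F \<in> circuits_on M" and fin: "finite M" and z: "z \<notin> M" and e: "e \<in> F"
  shows "subdivide z F e \<in> circuits_on (insert z M)"
proof -
  have Fp: "F \<subseteq> pairs M" "card F = card M" and circ: "circuit F M" using F by (auto simp: circuits_on_def)
  have ep: "e \<subseteq> M" "card e = 2" using Fp(1) e by (auto simp: pairs_def)
  have fine: "finite e" using ep(2) card.infinite by fastforce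
  have finF: "finite F" by (rule finite_subset[OF Fp(1)]) (simp add: fin)
  let ?N = "(\<lambda>x. {z, x}) ` e"
  have zF: "z \<notin> f" if "f \<in> F" for f using that Fp(1) z by (auto simp: pairs_def)
  have injz: "inj_on (\<lambda>x. {z, x}) A" for A by (rule inj_onI) (auto simp: doubleton_eq_iff)
  have cN: "card ?N = 2" using card_image[OF injz, of e] ep(2) by simp
  have disj: "(F - {e}) \<inter> ?N = {}" using zF by auto
  have sub: "subdivide z F e \<subseteq> pairs (insert z M)"
    using Fp(1) ep(1) z by (auto simp: subdivide_def pairs_def card_insert_if)
  have card: "card (subdivide z F e) = card (insert z M)"
  proof -
    have "card (subdivide z F e) = card (F - {e}) + card ?N"
      unfolding subdivide_def using finF fine disj by (intro card_Un_disjoint) auto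
    also have "card (F - {e}) = card M - 1" using e finF Fp(2) by simp
    also have "card M \<ge> 1" using e finF Fp(2) by (auto simp: Suc_le_eq card_gt_0_iff simp flip: Fp(2))
    then have "card M - 1 + card ?N = card (insert z M)" using cN fin z by simp
    finally show ?thesis .
  qed
  have "circuit (subdivide z F e) (insert z M)"
    unfolding circuit_def
  proof (intro conjI allI impI)
    show "card (insert z M) \<le> card (induced (subdivide z F e) (insert z M))"
      using card by (simp add: induced_all[OF sub])
  next
    fix T assume T: "T \<subset> insert z M \<and> T \<noteq> {}"
    have finT: "finite T" using T fin by (intro finite_subset[of T "insert z M"]) auto
    have less: "card (induced F U) < card U" if "U \<subset> M" "U \<noteq> {}" for U
      using circ that by (simp add: circuit_def)
    show "card (induced (subdivide z F e) T) < card T"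
    proof (cases "z \<in> T")
      case False
      then have TM: "T \<subseteq> M" using T by auto
      have i: "induced (subdivide z F e) T = induced F T - {e}"
        using False by (auto simp: induced_def subdivide_def)
      show ?thesis
      proof (cases "T = M")
        case True
        have "induced F T = F" unfolding True by (rule induced_all[OF Fp(1)])
        then have "card (induced (subdivide z F e) T) = card M - 1" unfolding i using e finF Fp(2) by simp
        moreover have "card M \<ge> 1" using e finF Fp(2) by (auto simp: Suc_le_eq card_gt_0_iff simp flip: Fp(2))
        ultimately show ?thesis using True by simp
      next
        case ne: False
        have "card (induced F T - {e}) \<le> card (induced F T)" using finT by (intro card_mono) auto
        also have "\<dots> < card T" using TM ne T by (intro less) auto
        finally show ?thesis unfolding i .
      qed
    next
      case True
      define U where "U = T - {z}"
      have U: "U \<subset> M" "finite U" using T True z finT by (auto simp: U_def)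
      have cT: "card T = Suc (card U)" unfolding U_def by (rule card_Suc_Diff1[OF finT True, symmetric])
      have i: "induced (subdivide z F e) T \<subseteq> (induced F U - {e}) \<union> (\<lambda>x. {z, x}) ` (e \<inter> U)"
        using True zF ep(1) z by (auto simp: induced_def subdivide_def U_def)
      have finI: "finite (induced F U)" using U(2) by simp
      have "card (induced (subdivide z F e) T) \<le> card ((induced F U - {e}) \<union> (\<lambda>x. {z, x}) ` (e \<inter> U))"
        by (rule card_mono[OF _ i]) (use finI fine in simp)
      also have "\<dots> \<le> card (induced F U - {e}) + card ((\<lambda>x. {z, x}) ` (e \<inter> U))" by (rule card_Un_le)
      also have "card ((\<lambda>x. {z, x}) ` (e \<inter> U)) = card (e \<inter> U)" by (rule card_image[OF injz])
      finally have le: "card (induced (subdivide z F e) T) \<le> card (induced F U - {e}) + card (e \<inter> U)" .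
      show ?thesis
      proof (cases "U = {}")
        case True
        then have "induced F U = {}" using induced_empty[OF simple_pairs[OF Fp(1)]] by simp
        then show ?thesis using le True cT by simp
      next
        case ne: False
        have l: "card (induced F U) < card U" by (rule less[OF U(1) ne])
        show ?thesis
        proof (cases "e \<subseteq> U")
          case True
          then have "e \<in> induced F U" using e by (simp add: induced_def)
          then have "card (induced F U - {e}) = card (induced F U) - 1" "1 \<le> card (induced F U)"
            using finI by (auto simp: Suc_le_eq card_gt_0_iff)
          moreover have "e \<inter> U = e" using True by auto
          ultimately show ?thesis using le l cT ep(2) by simp
        next
          case False
          have "card (e \<inter> U) < card e" using False fine by (intro psubset_card_mono) auto
          moreover have "card (induced F U - {e}) \<le> card (induced F U)" using finI by (intro card_mono) auto
          ultimately show ?thesis using le l cT ep(2) by linarith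
        qed
      qed
    qed
  qed (use fin in auto)
  then show ?thesis using sub card by (simp add: circuits_on_def)
qed

definition nbrs :: "'a \<Rightarrow> 'a set set \<Rightarrow> 'a set" where
  "nbrs z F = {x. {z, x} \<in> F}"

text \<open>On at least four vertices the neighbours of \<open>z\<close> are not adjacent, since the
  triangle would be a proper subset with as many edges as vertices. For a triangle itself the
  contraction would produce a double edge, hence the assumption on \<open>card M\<close>.\<close>

lemma contract_circuits_on:
  assumes F: "F \<in> circuits_on (insert z M)" and fin: "finite M" and z: "z \<notin> M" and M3: "3 \<le> card M"
  shows "{f \<in> F. z \<notin> f} \<union> {nbrs z F} \<in> circuits_on M" "nbrs z F \<notin> F" "(\<lambda>x. {z, x}) ` nbrs z F = {f \<in> F. z \<in> f}"
proof -
  let ?e = "nbrs z F"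
  have Fp: "F \<subseteq> pairs (insert z M)" "card F = Suc (card M)" and circ: "circuit F (insert z M)"
    using F fin z by (auto simp: circuits_on_def)
  have finF: "finite F" by (rule finite_subset[OF Fp(1)]) (simp add: fin)
  have injz: "inj_on (\<lambda>x. {z, x}) A" for A by (rule inj_onI) (auto simp: doubleton_eq_iff)
  show im: "(\<lambda>x. {z, x}) ` ?e = {f \<in> F. z \<in> f}"
  proof (intro equalityI subsetI)
    fix f assume f: "f \<in> {f \<in> F. z \<in> f}"
    then have "card f = 2" using Fp(1) by (auto simp: pairs_def)
    then obtain x y where "f = {x, y}" by (auto simp: card_2_iff)
    then obtain w where "f = {z, w}" using f by (auto simp: insert_commute)
    then show "f \<in> (\<lambda>x. {z, x}) ` ?e" using f by (auto simp: nbrs_def)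
  qed (auto simp: nbrs_def)
  have deg: "card {f \<in> F. z \<in> f} = 2" by (rule circuit_degree[OF F]) (use fin in auto)
  have ce: "card ?e = 2" using card_image[OF injz, of ?e] im deg by simp
  have fine: "finite ?e" using ce card.infinite by fastforce
  have eM: "?e \<subseteq> M"
  proof
    fix x assume "x \<in> ?e"
    then have "{z, x} \<in> pairs (insert z M)" using Fp(1) by (auto simp: nbrs_def)
    then show "x \<in> M" by (auto simp: pairs_def card_insert_if split: if_splits)
  qed
  have less: "card (induced F T) < card T" if "T \<subset> insert z M" "T \<noteq> {}" for T
    using circ that by (simp add: circuit_def)
  have finz: "finite {f \<in> F. z \<in> f}" using finF by simp
  show eF: "?e \<notin> F"
  proof
    assume a: "?e \<in> F"
    have ze: "z \<notin> ?e" using eM z by auto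
    have ci: "card (insert z ?e) = 3" using ze fine ce by simp
    have "insert z ?e \<noteq> insert z M"
    proof
      assume "insert z ?e = insert z M"
      then have "card (insert z M) = 3" using ci by simp
      then show False using M3 fin z by simp
    qed
    then have "insert z ?e \<subset> insert z M" using eM by auto
    then have "card (induced F (insert z ?e)) < 3" using less[of "insert z ?e"] ci by simp
    moreover have "insert ?e {f \<in> F. z \<in> f} \<subseteq> induced F (insert z ?e)"
      using a im by (auto simp: induced_def)
    then have "card (insert ?e {f \<in> F. z \<in> f}) \<le> card (induced F (insert z ?e))"
      using fine by (intro card_mono) auto
    moreover have "card (insert ?e {f \<in> F. z \<in> f}) = 3" using ze finz deg by simp
    ultimately show False by simp
  qed
  let ?G = "{f \<in> F. z \<notin> f}"
  have cG: "card ?G = card M - 1"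
  proof -
    have "F = ?G \<union> {f \<in> F. z \<in> f}" by auto
    from arg_cong[where f = card, OF this] have "card F = card (?G \<union> {f \<in> F. z \<in> f})" .
    also have "\<dots> = card ?G + card {f \<in> F. z \<in> f}" using finF by (intro card_Un_disjoint) auto
    finally show ?thesis using deg Fp(2) by simp
  qed
  have sub: "?G \<union> {?e} \<subseteq> pairs M" using Fp(1) eM ce by (auto simp: pairs_def)
  have card: "card (?G \<union> {?e}) = card M" using eF finF cG M3 by simp
  have "circuit (?G \<union> {?e}) M" unfolding circuit_def
  proof (intro conjI allI impI)
    show "M \<noteq> {}" using M3 by auto
    show "card M \<le> card (induced (?G \<union> {?e}) M)" by (simp only: induced_all[OF sub] card order.refl)
  next
    fix T assume T: "T \<subset> M \<and> T \<noteq> {}"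
    have zT: "z \<notin> T" using T z by auto
    have finT: "finite T" using T fin by (intro finite_subset[of T M]) auto
    show "card (induced (?G \<union> {?e}) T) < card T"
    proof (cases "?e \<subseteq> T")
      case False
      have "induced (?G \<union> {?e}) T \<subseteq> induced F T" using False by (auto simp: induced_def)
      then have "card (induced (?G \<union> {?e}) T) \<le> card (induced F T)" using finT by (intro card_mono) auto
      also have "\<dots> < card T" using T by (intro less) auto
      finally show ?thesis .
    next
      case True
      have "insert z T \<subset> insert z M" using T z by auto
      then have l: "card (induced F (insert z T)) < card T + 1" using less[of "insert z T"] zT finT by simp
      have "induced F T \<inter> {f \<in> F. z \<in> f} = {}" using zT by (auto simp: induced_def)
      then have "card (induced F T \<union> {f \<in> F. z \<in> f}) = card (induced F T) + 2"
        using card_Un_disjoint[of "induced F T" "{f \<in> F. z \<in> f}"] finT finz deg by simp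
      moreover have "induced F T \<union> {f \<in> F. z \<in> f} \<subseteq> induced F (insert z T)"
        using True im by (auto simp: induced_def)
      then have "card (induced F T \<union> {f \<in> F. z \<in> f}) \<le> card (induced F (insert z T))"
        using finT by (intro card_mono) auto
      moreover have "card (induced (?G \<union> {?e}) T) \<le> card (insert ?e (induced F T))"
        using finT by (intro card_mono) (auto simp: induced_def)
      moreover have "card (insert ?e (induced F T)) \<le> Suc (card (induced F T))" by (rule card_insert_le_m1) auto
      ultimately show ?thesis using l by linarith
    qed
  qed (use fin in auto)
  then show "?G \<union> {?e} \<in> circuits_on M" using sub card by (simp add: circuits_on_def)
qed

text \<open>Subdivision and contraction are mutually inverse, and a circuit on \<open>M\<close>
  offers \<open>card M\<close> edges for subdivision.\<close>

lemma card_circuits_on_insert: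
  assumes fin: "finite M" and z: "z \<notin> M" and M3: "3 \<le> card M"
  shows "card (circuits_on (insert z M)) = card M * card (circuits_on M)"
proof -
  have zF: "z \<notin> f" if "f \<in> F" "F \<in> circuits_on M" for f F using that z by (auto simp: circuits_on_def pairs_def)
  have "bij_betw (\<lambda>(F, e). subdivide z F e) (Sigma (circuits_on M) (\<lambda>F. F)) (circuits_on (insert z M))"
  proof (rule bij_betw_byWitness[where f' = "\<lambda>F. ({f \<in> F. z \<notin> f} \<union> {nbrs z F}, nbrs z F)"])
    show "\<forall>a\<in>Sigma (circuits_on M) (\<lambda>F. F). (\<lambda>F. ({f \<in> F. z \<notin> f} \<union> {nbrs z F}, nbrs z F)) (case a of (F, e) \<Rightarrow> subdivide z F e) = a"
    proof
      fix a assume "a \<in> Sigma (circuits_on M) (\<lambda>F. F)"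
      then obtain F e where a: "a = (F, e)" and F: "F \<in> circuits_on M" and e: "e \<in> F" by (elim SigmaE)
      note zz = zF[OF _ F]
      have ze: "z \<notin> e" by (rule zz[OF e])
      have "nbrs z (subdivide z F e) = e"
      proof (intro equalityI subsetI)
        fix x assume "x \<in> nbrs z (subdivide z F e)"
        then have "{z, x} \<in> F \<or> (\<exists>y\<in>e. {z, x} = {z, y})" by (auto simp: nbrs_def subdivide_def)
        then show "x \<in> e" using zz ze by (auto simp: doubleton_eq_iff)
      qed (auto simp: nbrs_def subdivide_def)
      moreover have "{f \<in> subdivide z F e. z \<notin> f} \<union> {e} = F" using zz e by (auto simp: subdivide_def)
      ultimately show "(\<lambda>F. ({f \<in> F. z \<notin> f} \<union> {nbrs z F}, nbrs z F)) (case a of (F, e) \<Rightarrow> subdivide z F e) = a"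
        unfolding a prod.case by (simp only:)
    qed
    show "\<forall>F\<in>circuits_on (insert z M). (case ({f \<in> F. z \<notin> f} \<union> {nbrs z F}, nbrs z F) of (F, e) \<Rightarrow> subdivide z F e) = F"
    proof
      fix F assume F: "F \<in> circuits_on (insert z M)"
      note c = contract_circuits_on[OF F fin z M3]
      have "({f \<in> F. z \<notin> f} \<union> {nbrs z F}) - {nbrs z F} = {f \<in> F. z \<notin> f}" using c(2) by auto
      then show "(case ({f \<in> F. z \<notin> f} \<union> {nbrs z F}, nbrs z F) of (F, e) \<Rightarrow> subdivide z F e) = F"
        unfolding subdivide_def prod.case c(3) by auto
    qed
    show "(\<lambda>(F, e). subdivide z F e) ` Sigma (circuits_on M) (\<lambda>F. F) \<subseteq> circuits_on (insert z M)"
    proof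
      fix G assume "G \<in> (\<lambda>(F, e). subdivide z F e) ` Sigma (circuits_on M) (\<lambda>F. F)"
      then obtain F e where "G = subdivide z F e" "F \<in> circuits_on M" "e \<in> F" by (elim imageE SigmaE) simp
      then show "G \<in> circuits_on (insert z M)" using subdivide_circuits_on[OF _ fin z] by (simp only:)
    qed
    show "(\<lambda>F. ({f \<in> F. z \<notin> f} \<union> {nbrs z F}, nbrs z F)) ` circuits_on (insert z M) \<subseteq> Sigma (circuits_on M) (\<lambda>F. F)"
    proof (rule image_subsetI)
      fix F assume F: "F \<in> circuits_on (insert z M)"
      show "({f \<in> F. z \<notin> f} \<union> {nbrs z F}, nbrs z F) \<in> Sigma (circuits_on M) (\<lambda>F. F)"
        by (rule SigmaI[OF contract_circuits_on(1)[OF F fin z M3]]) (rule UnI2, rule singletonI)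
    qed
  qed
  from bij_betw_same_card[OF this, symmetric]
  have "card (circuits_on (insert z M)) = card (Sigma (circuits_on M) (\<lambda>F. F))" .
  also have "\<dots> = (\<Sum>F\<in>circuits_on M. card F)"
  proof (rule card_SigmaI[OF finite_circuits_on[OF fin]], rule ballI)
    fix F assume "F \<in> circuits_on M"
    then have "F \<subseteq> pairs M" by (simp add: circuits_on_def)
    then show "finite F" by (rule finite_subset) (simp add: fin)
  qed
  also have "\<dots> = (\<Sum>F\<in>circuits_on M. card M)" by (rule sum.cong[OF refl]) (auto simp: circuits_on_def)
  finally show ?thesis by (simp add: mult.commute)
qed

lemma ncirc_Suc: "3 \<le> k \<Longrightarrow> ncirc (Suc k) = k * ncirc k"
  using card_circuits_on_insert[of "{1..k}" "Suc k"]
  by (simp add: ncirc_def atLeastAtMostSuc_conv)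

section \<open>Number of labelled cycles\<close>

lemma ncirc_small: "k < 3 \<Longrightarrow> ncirc k = 0"
proof -
  assume k: "k < 3"
  have "F \<notin> circuits_on {1..k}" for F :: "nat set set"
  proof
    assume F: "F \<in> circuits_on {1..k}"
    then have "circuit F {1..k}" "F \<subseteq> pairs {1..k}" "card F = k" by (auto simp: circuits_on_def)
    then have "k \<le> k choose 2" "k \<noteq> 0"
      using card_mono[of "pairs {1..k}" F] by (auto simp: card_pairs circuit_def)
    then show False using k by (auto simp: less_Suc_eq numeral_3_eq_3 choose_two)
  qed
  then have "circuits_on {1..k} = {}" by (simp only: set_eq_iff empty_iff not_False_eq_True simp_thms)
  then show ?thesis by (simp only: ncirc_def card.empty)
qed

lemma ncirc_3: "ncirc 3 = 1"
proof -
  let ?M = "{1..3 :: nat}"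
  have cM: "card ?M = 3" by simp
  have cp: "card (pairs ?M) = 3" by (simp add: card_pairs choose_two)
  have "circuits_on ?M = {pairs ?M}"
  proof (intro equalityI subsetI)
    fix F assume "F \<in> circuits_on ?M"
    then have "F \<subseteq> pairs ?M" "card F = 3" by (auto simp: circuits_on_def)
    then have "F = pairs ?M" using card_subset_eq[of "pairs ?M" F] cp by simp
    then show "F \<in> {pairs ?M}" by simp
  next
    fix F assume "F \<in> {pairs ?M}"
    have "circuit (pairs ?M) ?M" unfolding circuit_def
    proof (intro conjI allI impI)
      show "card ?M \<le> card (induced (pairs ?M) ?M)" using cp by (simp only: induced_all[OF order.refl] cM)
    next
      fix T assume T: "T \<subset> ?M \<and> T \<noteq> {}"
      have finT: "finite T" using T by (intro finite_subset[of T ?M]) auto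
      have "card T < 3" using T psubset_card_mono[of ?M T] cM by simp
      moreover have "0 < card T" using T finT by (simp add: card_gt_0_iff)
      ultimately have "card T choose 2 < card T" by (auto simp: less_Suc_eq numeral_3_eq_3 choose_two)
      moreover have "induced (pairs ?M) T = pairs T" using T by (auto simp: induced_def pairs_def)
      ultimately show "card (induced (pairs ?M) T) < card T" by (simp add: card_pairs finT)
    qed auto
    then show "F \<in> circuits_on ?M" using \<open>F \<in> {pairs ?M}\<close> cp cM by (simp add: circuits_on_def)
  qed
  then show ?thesis by (simp add: ncirc_def)
qed

lemma ncirc_eq: "3 \<le> k \<Longrightarrow> 2 * ncirc k = fact (k - 1)"
proof (induction k rule: nat_induct_at_least)
  case base
  then show ?case by (simp add: ncirc_3 numeral_2_eq_2)
next
  case (Suc k)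
  have "2 * ncirc (Suc k) = k * (2 * ncirc k)" using ncirc_Suc[OF Suc.hyps] by simp
  also have "\<dots> = k * fact (k - 1)" using Suc.IH by simp
  also have "\<dots> = fact k" using Suc.hyps by (cases k) auto
  finally show ?case by simp
qed

lemma circ_term: "c ^ k * real (ncirc k) / fact k = (if 3 \<le> k then c ^ k / (2 * real k) else 0)"
proof (cases "3 \<le> k")
  case True
  have "2 * real (ncirc k) = fact (k - 1)" using ncirc_eq[OF True] by (metis of_nat_fact of_nat_mult of_nat_numeral)
  moreover have "fact k = real k * fact (k - 1)" using True by (simp add: fact_reduce)
  ultimately show ?thesis using True by (simp add: field_simps)
qed (simp add: ncirc_small)

text \<open>Graphs with as many edges as vertices in which every vertex is joined to a circuit by a path,
  i.e. the disjoint unions of unicyclic graphs.\<close>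

definition frag :: "'a set \<Rightarrow> 'a set set set" where
  "frag W = {H. H \<subseteq> pairs W \<and> card H = card W \<and> (\<exists>r. nbhd H r (cyc (card W) H) = W)}"

lemma finite_frag: "finite W \<Longrightarrow> finite (frag W)"
  by (rule finite_subset[of _ "Pow (pairs W)"]) (auto simp: frag_def)

lemma card_frag:
  fixes W :: "nat set"
  assumes "finite W"
  shows "card (frag W) = card (frag {1..card W})"
proof -
  obtain f where f: "bij f" "f ` {1..card W} = W" using ex_bij_image[of "{1..card W}" W] assms by auto
  have "bij_betw (img f) (frag {1..card W}) (frag (f ` {1..card W}))"
    unfolding frag_def
  proof (rule img_bij_betw[OF f(1)])
    fix H :: "nat set set"
    have "nbhd (img f H) r (cyc k (img f H)) = f ` U \<longleftrightarrow> nbhd H r (cyc k H) = U" for r k U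
      by (simp only: cyc_img[OF f(1)] nbhd_img[OF f(1)] inj_image_eq_iff[OF bij_is_inj[OF f(1)]])
    then show "card (img f H) = card (f ` {1..card W}) \<and> (\<exists>r. nbhd (img f H) r (cyc (card (f ` {1..card W})) (img f H)) = f ` {1..card W}) \<longleftrightarrow>
      card H = card {1..card W} \<and> (\<exists>r. nbhd H r (cyc (card {1..card W}) H) = {1..card W})"
      by (simp only: card_img[OF f(1)] card_image_bij[OF f(1)])
  qed
  then show ?thesis unfolding f(2) by (simp add: bij_betw_same_card)
qed

lemma cyc_large:
  assumes "H \<subseteq> pairs W" "finite W" "card W \<le> K"
  shows "cyc K H = cyc (card W) H"
proof -
  have "card S \<le> card W" if "circuit H S" for S
  proof (rule card_mono[OF assms(2)])
    have "\<Union>H \<subseteq> W" using assms(1) by (auto simp: pairs_def)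
    then show "S \<subseteq> W" using circuit_subset[OF simple_pairs[OF assms(1)] that] by auto
  qed
  then have "short_circuits K H = short_circuits (card W) H"
    unfolding short_circuits_def using assms(3) by fastforce
  then show ?thesis by (simp add: cyc_def)
qed

lemma core_graphs_subset_frag:
  assumes "finite W" "card W \<le> K"
  shows "core_graphs K r W \<subseteq> frag W"
proof
  fix H assume H: "H \<in> core_graphs K r W"
  then have "H \<subseteq> pairs W" "card H = card W" "nbhd H (Suc r) (cyc K H) = W"
    by (auto simp: core_graphs_def core_verts_def)
  then have "nbhd H (Suc r) (cyc (card W) H) = W" using cyc_large[of H W K] assms by simp
  then show "H \<in> frag W" using \<open>H \<subseteq> pairs W\<close> \<open>card H = card W\<close> unfolding frag_def by blast
qed

text \<open>Finitely many graphs on at most \<open>M\<close> vertices need only finitely many radii.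
  Beyond these the interior fills the whole graph, so every vertex contributes a factor
  \<open>exp (- c)\<close> and the weight of a core depends on its size alone.\<close>

lemma frag_eq_core_graphs:
  fixes M :: nat
  shows "\<exists>R. \<forall>r\<ge>R. \<forall>m\<le>M. \<forall>K\<ge>m. core_graphs K r {1..m} = frag {1..m} \<and> (\<forall>H\<in>frag {1..m}. core_verts K r H = {1..m})"
proof -
  have "\<forall>x\<in>Sigma {..M} (\<lambda>m. frag {1..m}). \<exists>r. nbhd (snd x) r (cyc (fst x) (snd x)) = {1..fst x}"
    by (auto simp: frag_def)
  from bchoice[OF this] obtain \<rho> where \<rho>: "\<forall>x\<in>Sigma {..M} (\<lambda>m. frag {1..m}). nbhd (snd x) (\<rho> x) (cyc (fst x) (snd x)) = {1..fst x}" ..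
  \<comment> \<open>The sum serves as a common upper bound of the radii.\<close>
  define R where "R = (\<Sum>x\<in>Sigma {..M} (\<lambda>m. frag {1..m}). \<rho> x)"
  have fin: "finite (Sigma {..M} (\<lambda>m. frag {1..m :: nat}))" by (intro finite_SigmaI finite_frag) auto
  have cv: "core_verts K r H = {1..m}" if r: "R \<le> r" and m: "m \<le> M" "m \<le> K" and H: "H \<in> frag {1..m}" for r m K H
  proof -
    have x: "(m, H) \<in> Sigma {..M} (\<lambda>m. frag {1..m})" using m H by simp
    have Hp: "H \<subseteq> pairs {1..m}" using H by (simp add: frag_def)
    have "\<rho> (m, H) \<le> R" unfolding R_def by (rule member_le_sum[OF x _ fin]) simp
    then have "nbhd H (\<rho> (m, H)) (cyc m H) \<subseteq> nbhd H r (cyc m H)" using r by (intro nbhd_increasing) simp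
    then have "{1..m} \<subseteq> nbhd H r (cyc m H)" using bspec[OF \<rho> x] by simp
    moreover have "nbhd H r (cyc m H) \<subseteq> {1..m}" by (intro nbhd_subset_verts cyc_subset_verts Hp)
    moreover have "cyc K H = cyc m H" using cyc_large[OF Hp, of K] m by simp
    ultimately show ?thesis by (simp add: core_verts_def)
  qed
  show ?thesis
  proof (rule exI[of _ R], intro allI impI conjI)
    fix r m K assume h: "R \<le> r" "m \<le> M" "m \<le> K"
    show "\<forall>H\<in>frag {1..m}. core_verts K r H = {1..m}" using cv[OF h] by blast
    show "core_graphs K r {1..m} = frag {1..m}"
    proof (rule equalityI)
      show "core_graphs K r {1..m} \<subseteq> frag {1..m}" by (rule core_graphs_subset_frag) (use h in auto)
      show "frag {1..m} \<subseteq> core_graphs K r {1..m}"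
      proof
        fix H assume H: "H \<in> frag {1..m}"
        have "core_verts K (Suc r) H = {1..m}" by (rule cv[OF _ h(2,3) H]) (use h(1) in simp)
        then show "H \<in> core_graphs K r {1..m}" using H by (simp add: core_graphs_def frag_def)
      qed
    qed
  qed
qed

section \<open>Growth of the number of fragments\<close>

lemma frag_attach_leaf:
  assumes fin: "finite N" and z: "z \<in> N" and v: "v \<in> N - {z}" and H: "H \<in> frag (N - {z})"
  shows "insert {v, z} H \<in> frag N"
proof -
  let ?F = "insert {v, z} H"
  have Hp: "H \<subseteq> pairs (N - {z})" "card H = card (N - {z})" using H by (auto simp: frag_def)
  obtain r where r: "nbhd H r (cyc (card (N - {z})) H) = N - {z}" using H by (auto simp: frag_def)
  have finH: "finite H" by (rule finite_subset[OF Hp(1)]) (simp add: fin)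
  have zH: "z \<notin> f" if "f \<in> H" for f using that Hp(1) by (auto simp: pairs_def)
  have Fp: "?F \<subseteq> pairs N" using Hp(1) z v by (auto simp: pairs_def)
  have "{v, z} \<notin> H" using zH by blast
  then have cF: "card ?F = card N" using finH Hp(2) card_Suc_Diff1[OF fin z] by simp
  have cyc: "cyc (card (N - {z})) H \<subseteq> cyc (card N) ?F"
  proof -
    have "S \<in> short_circuits (card N) ?F" if S: "S \<in> short_circuits (card (N - {z})) H" for S
    proof -
      have circ: "circuit H S" "card S \<le> card (N - {z})" using S by (auto simp: short_circuits_def)
      have "S \<subseteq> N - {z}" using short_circuits_subset_Pow[OF Hp(1)] S by blast
      then have "induced ?F S = induced H S" by (auto simp: induced_def)
      then have "circuit ?F S" using circ(1) circuit_induced[of S S ?F] circuit_induced[of S S H] by simp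
      moreover have "card S \<le> card N" using circ(2) card_mono[OF fin, of "N - {z}"] by auto
      ultimately show ?thesis by (simp add: short_circuits_def)
    qed
    then show ?thesis unfolding cyc_def by blast
  qed
  have "N - {z} \<subseteq> nbhd ?F r (cyc (card N) ?F)"
  proof -
    have "nbhd H r (cyc (card (N - {z})) H) \<subseteq> nbhd ?F r (cyc (card (N - {z})) H)" by (rule nbhd_mono_edges) auto
    also have "\<dots> \<subseteq> nbhd ?F r (cyc (card N) ?F)" by (rule nbhd_mono[OF cyc])
    finally show ?thesis using r by simp
  qed
  then have "N \<subseteq> nbhd ?F (Suc r) (cyc (card N) ?F)" using v by auto
  moreover have "nbhd ?F (Suc r) (cyc (card N) ?F) \<subseteq> N" by (intro nbhd_subset_verts cyc_subset_verts Fp)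
  ultimately show ?thesis using Fp cF unfolding frag_def by blast
qed

text \<open>A nonempty fragment contains a circuit, and a vertex on it has degree at least
  two.\<close>

lemma frag_leaves:
  assumes fin: "finite N" and ne: "N \<noteq> {}" and F: "F \<in> frag N"
  shows "card {z \<in> N. card {f \<in> F. z \<in> f} = 1} \<le> card N - 1"
proof -
  have Fp: "F \<subseteq> pairs N" using F by (simp add: frag_def)
  obtain r where r: "nbhd F r (cyc (card N) F) = N" using F by (auto simp: frag_def)
  have "cyc (card N) F \<noteq> {}" using r ne by auto
  then obtain S s where S: "circuit F S" "s \<in> S" by (auto simp: cyc_def short_circuits_def)
  have sN: "s \<in> N" using circuit_subset[OF simple_pairs[OF Fp] S(1)] S(2) Fp by (auto simp: pairs_def)
  have finF: "finite F" by (rule finite_subset[OF Fp]) (simp add: fin)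
  have "2 \<le> card {e \<in> induced F S. s \<in> e}" by (rule circuit_degree_ge2[OF simple_pairs[OF Fp] S])
  also have "\<dots> \<le> card {f \<in> F. s \<in> f}" using finF by (intro card_mono) (auto simp: induced_def)
  finally have "{z \<in> N. card {f \<in> F. z \<in> f} = 1} \<subseteq> N - {s}" by auto
  then have "card {z \<in> N. card {f \<in> F. z \<in> f} = 1} \<le> card (N - {s})" using fin by (intro card_mono) auto
  then show ?thesis using fin sN by simp
qed

definition nfrag :: "nat \<Rightarrow> nat" where
  "nfrag m = card (frag {1..m})"

lemma nfrag_0: "nfrag 0 = 1"
proof -
  have "frag {1..0 :: nat} = {{}}"
  proof (intro equalityI subsetI)
    fix H :: "nat set set" assume "H \<in> {{}}"
    moreover have "cyc 0 ({} :: nat set set) = {}" by (auto simp: cyc_def short_circuits_def circuit_def)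
    ultimately show "H \<in> frag {1..0}" by (simp add: frag_def)
  next
    fix H :: "nat set set" assume "H \<in> frag {1..0}"
    then have "H \<subseteq> pairs {}" by (simp add: frag_def)
    then show "H \<in> {{}}" by (auto simp: pairs_def)
  qed
  then show ?thesis by (simp add: nfrag_def)
qed

text \<open>Double counting of pairs of a fragment on \<open>Suc m\<close> vertices and a leaf
  \<open>z\<close> of it. Attaching \<open>z\<close> at one of the \<open>m\<close> other vertices
  produces \<open>Suc m * m * nfrag m\<close> pairs injectively, whereas each fragment has at most
  \<open>m\<close> leaves. The factor \<open>m\<close> cancels, which requires
  \<open>1 \<le> m\<close>.\<close>

lemma nfrag_Suc_ge:
  assumes "1 \<le> m"
  shows "Suc m * nfrag m \<le> nfrag (Suc m)"
proof -
  define N where "N = {1..Suc m}"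
  have finN: "finite N" "card N = Suc m" "N \<noteq> {}" by (auto simp: N_def)
  define D where "D = Sigma N (\<lambda>z. (N - {z}) \<times> frag (N - {z}))"
  define D' where "D' = Sigma (frag N) (\<lambda>F. {z \<in> N. card {f \<in> F. z \<in> f} = 1})"
  have "card D = (\<Sum>z\<in>N. card ((N - {z}) \<times> frag (N - {z})))"
    unfolding D_def using finN by (intro card_SigmaI) (auto intro: finite_frag)
  also have "\<dots> = (\<Sum>z\<in>N. m * nfrag m)"
  proof (rule sum.cong[OF refl])
    fix z assume "z \<in> N"
    then have c: "card (N - {z}) = m" using finN by simp
    have "card (frag (N - {z})) = nfrag m" using card_frag[of "N - {z}"] finN c by (simp add: nfrag_def)
    then show "card ((N - {z}) \<times> frag (N - {z})) = m * nfrag m" using c by (simp add: card_cartesian_product)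
  qed
  finally have cD: "card D = Suc m * (m * nfrag m)" using finN(2) by simp
  have finD': "finite D'" unfolding D'_def using finN by (intro finite_SigmaI finite_frag) auto
  have "card D' = (\<Sum>F\<in>frag N. card {z \<in> N. card {f \<in> F. z \<in> f} = 1})"
    unfolding D'_def using finN by (intro card_SigmaI) (auto intro: finite_frag)
  also have "\<dots> \<le> (\<Sum>F\<in>frag N. m)" using frag_leaves[OF finN(1,3)] finN(2) by (intro sum_mono) simp
  finally have cD': "card D' \<le> nfrag (Suc m) * m" by (simp add: nfrag_def N_def)
  let ?g = "\<lambda>(z, v, H). (insert {v, z} H, z)"
  have Hz: "z \<notin> f" if "H \<in> frag (N - {z})" "f \<in> H" for z H f using that by (auto simp: frag_def pairs_def)
  have "inj_on ?g D"
  proof (rule inj_onI)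
    fix x y assume xy: "x \<in> D" "y \<in> D" "?g x = ?g y"
    obtain z v H where x: "x = (z, v, H)" by (metis prod_cases3)
    obtain z' v' H' where y: "y = (z', v', H')" by (metis prod_cases3)
    have zz: "z' = z" and eq: "insert {v, z} H = insert {v', z} H'" using xy(3) x y by auto
    have h: "H \<in> frag (N - {z})" "H' \<in> frag (N - {z})" "v \<noteq> z" using xy x y zz by (auto simp: D_def)
    have "H = {f \<in> insert {v, z} H. z \<notin> f}" using Hz[OF h(1)] by auto
    also have "\<dots> = {f \<in> insert {v', z} H'. z \<notin> f}" unfolding eq ..
    also have "\<dots> = H'" using Hz[OF h(2)] by auto
    finally have "H = H'" .
    moreover have "{v, z} \<in> insert {v', z} H'" using eq by blast
    then have "{v, z} = {v', z}" using Hz[OF h(2)] by blast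
    then have "v = v'" using h(3) by (auto simp: doubleton_eq_iff)
    ultimately show "x = y" using x y zz by simp
  qed
  moreover have "?g ` D \<subseteq> D'"
  proof
    fix w assume "w \<in> ?g ` D"
    then obtain z v H where w: "w = (insert {v, z} H, z)" and h: "z \<in> N" "v \<in> N - {z}" "H \<in> frag (N - {z})"
      by (auto simp: D_def)
    have "{f \<in> insert {v, z} H. z \<in> f} = {{v, z}}" using Hz[OF h(3)] by auto
    then show "w \<in> D'" using w h frag_attach_leaf[OF finN(1) h] by (simp add: D'_def)
  qed
  ultimately have "card D \<le> card D'" using finD' by (rule card_inj_on_le)
  then have "m * (Suc m * nfrag m) \<le> m * nfrag (Suc m)" using cD cD' by (simp add: algebra_simps)
  then show ?thesis using assms by simp
qed

text \<open>Coefficients of the exponential generating function of unicyclic unions. Its value at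
  \<open>c * exp (- c)\<close> is the reciprocal of \<open>frag_free_prob c\<close>, as
  \<open>udens_sums\<close> shows.\<close>

definition udens :: "nat \<Rightarrow> real" where
  "udens m = real (nfrag m) / fact m"

lemma udens_0: "udens 0 = 1"
  by (simp add: udens_def nfrag_0)

lemma udens_nonneg: "0 \<le> udens m"
  by (simp add: udens_def)

text \<open>The restriction to \<open>1 \<le> m\<close> is essential: the empty graph gives
  \<open>udens 0 = 1\<close>, while no fragment has one or two vertices.\<close>

lemma udens_mono:
  assumes "1 \<le> m" "m \<le> n"
  shows "udens m \<le> udens n"
  using assms(2)
proof (induction n rule: dec_induct)
  case (step n)
  have "Suc n * nfrag n \<le> nfrag (Suc n)" by (rule nfrag_Suc_ge) (use step.hyps assms(1) in simp)
  then have "real (Suc n) * real (nfrag n) \<le> real (nfrag (Suc n))" by (metis of_nat_le_iff of_nat_mult)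
  then have "real (Suc n) * real (nfrag n) / fact (Suc n) \<le> udens (Suc n)" unfolding udens_def by (rule divide_right_mono) simp
  moreover have "real (Suc n) * real (nfrag n) / fact (Suc n) = udens n" by (simp add: udens_def)
  ultimately show ?case using step.IH by simp
qed simp

section \<open>The threshold function\<close>

definition frag_free_prob :: "real \<Rightarrow> real" where
  "frag_free_prob c = exp (c / 2 + c\<^sup>2 / 4) * sqrt (1 - c)"

text \<open>The square of \<open>frag_free_prob\<close> is smooth on the whole line, so its
  monotonicity and its intermediate values can be treated without regard to the singularity of the
  root at 1.\<close>

definition thr_sq :: "real \<Rightarrow> real" where
  "thr_sq c = exp (c + c\<^sup>2 / 2) * (1 - c)"

lemma thr_sq_eq:
  assumes "c \<le> 1"
  shows "(frag_free_prob c)\<^sup>2 = thr_sq c"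
proof -
  have "(exp (c / 2 + c\<^sup>2 / 4))\<^sup>2 = exp (c + c\<^sup>2 / 2)"
    by (simp add: power2_eq_square flip: exp_add)
  then show ?thesis using assms by (simp add: frag_free_prob_def thr_sq_def power_mult_distrib)
qed

lemma thr_sq_less:
  assumes "0 \<le> a" "a < b"
  shows "thr_sq b < thr_sq a"
proof (rule DERIV_neg_imp_decreasing_open[OF assms(2)])
  fix x assume x: "a < x" "x < b"
  have "(thr_sq has_real_derivative (exp (x + x\<^sup>2 / 2) * (1 + x) * (1 - x) - exp (x + x\<^sup>2 / 2))) (at x)"
    unfolding thr_sq_def[abs_def] by (auto intro!: derivative_eq_intros simp: power2_eq_square)
  moreover have "exp (x + x\<^sup>2 / 2) * (1 + x) * (1 - x) - exp (x + x\<^sup>2 / 2) = - (x\<^sup>2 * exp (x + x\<^sup>2 / 2))"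
    by (simp add: algebra_simps power2_eq_square)
  moreover have "- (x\<^sup>2 * exp (x + x\<^sup>2 / 2)) < 0" using x assms by simp
  ultimately show "\<exists>y. (thr_sq has_real_derivative y) (at x) \<and> y < 0" by metis
qed (auto simp: thr_sq_def[abs_def] intro!: continuous_intros)

lemma frag_free_prob_pos: "c < 1 \<Longrightarrow> 0 < frag_free_prob c"
  by (simp add: frag_free_prob_def)

lemma frag_free_prob_less_iff:
  assumes "c \<le> 1"
  shows "1 / 2 < frag_free_prob c \<longleftrightarrow> 1 / 4 < thr_sq c"
proof -
  have p: "0 \<le> frag_free_prob c" using assms by (simp add: frag_free_prob_def)
  have "1 / 2 < frag_free_prob c \<longleftrightarrow> (1 / 2)\<^sup>2 < (frag_free_prob c)\<^sup>2" using p by (metis abs_of_nonneg abs_square_less_1 less_eq_real_def half_gt_zero_iff zero_less_one power2_less_imp_less power_strict_mono zero_less_numeral pos2)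
  moreover have "(1 / 2 :: real)\<^sup>2 = 1 / 4" by (simp add: power2_eq_square)
  ultimately show ?thesis by (simp only: thr_sq_eq[OF assms])
qed

lemma threshold_eq_iff:
  assumes "0 < c"
  shows "threshold_eq c \<longleftrightarrow> thr_sq c = 1 / 4"
proof (cases "c \<le> 1")
  case True
  have p: "0 \<le> frag_free_prob c" using True by (simp add: frag_free_prob_def)
  have "frag_free_prob c = 1 / 2 \<longleftrightarrow> (frag_free_prob c)\<^sup>2 = (1 / 2)\<^sup>2" using p by (subst power2_eq_iff_nonneg) auto
  moreover have "(1 / 2 :: real)\<^sup>2 = 1 / 4" by (simp add: power2_eq_square)
  ultimately show ?thesis unfolding threshold_eq_def frag_free_prob_def[symmetric] by (simp only: thr_sq_eq[OF True])
next
  case False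
  then have "sqrt (1 - c) < 0" by simp
  then have "exp (c / 2 + c\<^sup>2 / 4) * sqrt (1 - c) < 0" by (simp add: mult_less_0_iff)
  moreover have "thr_sq c < 0" using False by (simp add: thr_sq_def mult_less_0_iff)
  ultimately show ?thesis by (simp add: threshold_eq_def)
qed

section \<open>Numerical location of the threshold\<close>

lemma thr_sq_93: "1 / 4 < thr_sq (93 / 100)"
proof -
  \<comment> \<open>Half of the exponent \<open>93 / 100 + (93 / 100)\<^sup>2 / 2\<close>. Applied
    to the full exponent the quadratic Taylor bound would be too weak; after halving and squaring it
    is sufficient.\<close>
  let ?y = "136245 / 200000 :: real"
  have "1 + ?y + ?y\<^sup>2 / 2 \<le> exp ?y" by (rule exp_lower_Taylor_quadratic) simp
  then have "191 / 100 \<le> exp ?y" by (simp add: power2_eq_square)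
  then have "(191 / 100)\<^sup>2 \<le> (exp ?y)\<^sup>2" by (intro power_mono) auto
  moreover have "(exp ?y)\<^sup>2 = exp (136245 / 100000)" by (simp add: power2_eq_square flip: exp_add)
  ultimately have "(191 / 100)\<^sup>2 \<le> exp (136245 / 100000 :: real)" by (simp only:)
  then show ?thesis by (simp add: thr_sq_def power2_eq_square)
qed

lemma thr_sq_94: "thr_sq (94 / 100) < 1 / 4"
proof -
  \<comment> \<open>The exponent is \<open>13818 / 10000\<close>. Splitting off \<open>exp 1\<close>
    leaves an argument at most 1, as \<open>exp_bound\<close> requires.\<close>
  let ?y = "3818 / 10000 :: real"
  have "exp ?y \<le> 1 + ?y + ?y\<^sup>2" by (rule exp_bound) auto
  then have "exp 1 * exp ?y \<le> 272 / 100 * (1 + ?y + ?y\<^sup>2)" using e_less_272 by (intro mult_mono) auto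
  moreover have "exp 1 * exp ?y = exp (13818 / 10000)" by (simp flip: exp_add)
  ultimately show ?thesis by (simp add: thr_sq_def power2_eq_square)
qed

lemma thr_sq_root: "\<exists>c\<ge>93 / 100. c < 94 / 100 \<and> thr_sq c = 1 / 4"
proof -
  have "\<exists>c\<ge>93 / 100. c \<le> 94 / 100 \<and> thr_sq c = 1 / 4"
    by (rule IVT2') (use thr_sq_93 thr_sq_94 in \<open>auto simp: thr_sq_def[abs_def] intro!: continuous_intros\<close>)
  then obtain c where "93 / 100 \<le> c" "c \<le> 94 / 100" "thr_sq c = 1 / 4" by blast
  moreover have "c \<noteq> 94 / 100" using thr_sq_94 calculation(3) by (metis less_irrefl)
  ultimately show ?thesis by (intro exI[of _ c]) auto
qed

lemma threshold_unique: "\<exists>!c. 0 < c \<and> threshold_eq c"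
proof -
  obtain c where c: "93 / 100 \<le> c" "thr_sq c = 1 / 4" using thr_sq_root by blast
  show ?thesis
  proof (rule ex1I[of _ c])
    show "0 < c \<and> threshold_eq c" using c by (simp add: threshold_eq_iff)
    fix d assume d: "0 < d \<and> threshold_eq d"
    then have "thr_sq d = 1 / 4" using threshold_eq_iff[of d] by simp
    then show "d = c" using thr_sq_less[of c d] thr_sq_less[of d c] c d by (cases d c rule: linorder_cases) auto
  qed
qed

lemma c0_props: "93 / 100 \<le> c\<^sub>0" "c\<^sub>0 < 94 / 100" "thr_sq c\<^sub>0 = 1 / 4"
proof -
  obtain c where c: "93 / 100 \<le> c" "c < 94 / 100" "thr_sq c = 1 / 4" using thr_sq_root by blast
  have "0 < c \<and> threshold_eq c" using c by (simp add: threshold_eq_iff)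
  then have "c\<^sub>0 = c" unfolding c\<^sub>0_def by (rule the1_equality[OF threshold_unique])
  then show "93 / 100 \<le> c\<^sub>0" "c\<^sub>0 < 94 / 100" "thr_sq c\<^sub>0 = 1 / 4" using c by auto
qed

lemma frag_free_prob_threshold:
  assumes "0 < c" "c < 1"
  shows "1 / 2 < frag_free_prob c \<longleftrightarrow> c < c\<^sub>0"
proof -
  have "1 / 4 < thr_sq c \<longleftrightarrow> c < c\<^sub>0"
    using thr_sq_less[of c c\<^sub>0] thr_sq_less[of c\<^sub>0 c] c0_props assms by (cases c c\<^sub>0 rule: linorder_cases) auto
  then show ?thesis using frag_free_prob_less_iff[of c] assms by simp
qed

section \<open>Size of the mean number of short circuits\<close>

text \<open>The mean is half the series of \<open>- ln (1 - c)\<close> without its terms of order 1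
  and 2, as no cycle has fewer than three vertices. The omitted terms are
  \<open>c / 2 + c\<^sup>2 / 4\<close>, the logarithm becomes the square root.\<close>

lemma circ_mean_tendsto:
  assumes "0 < c" "c < 1"
  shows "(\<lambda>K. exp (- circ_mean c K)) \<longlonglongrightarrow> frag_free_prob c"
proof -
  have "(\<lambda>n. - ((- (- c)) ^ n) / real n) sums ln (1 + - c)" by (rule ln_series') (use assms in auto)
  then have "(\<lambda>n. - (c ^ n / real n)) sums ln (1 - c)" by simp
  from sums_mult[OF this, of "- 1 / 2"] have "(\<lambda>n. c ^ n / (2 * real n)) sums (- (ln (1 - c) / 2))" by simp
  moreover have "(\<lambda>n. if n \<in> {1, 2} then c ^ n / (2 * real n) else 0) sums (\<Sum>n\<in>{1, 2}. c ^ n / (2 * real n))"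
    by (rule sums_If_finite_set) simp
  ultimately have "(\<lambda>n. c ^ n / (2 * real n) - (if n \<in> {1, 2} then c ^ n / (2 * real n) else 0)) sums
    (- (ln (1 - c) / 2) - (\<Sum>n\<in>{1, 2}. c ^ n / (2 * real n)))" by (rule sums_diff)
  moreover have "c ^ n / (2 * real n) - (if n \<in> {1, 2} then c ^ n / (2 * real n) else 0) = c ^ n * real (ncirc n) / fact n" for n
  proof -
    consider "n = 0" | "n = 1" | "n = 2" | "3 \<le> n" by linarith
    then show ?thesis unfolding circ_term by cases auto
  qed
  ultimately have "(\<lambda>n. c ^ n * real (ncirc n) / fact n) sums (- (ln (1 - c) / 2) - (c / 2 + c\<^sup>2 / 4))"
    by simp
  then have "circ_mean c \<longlonglongrightarrow> - (ln (1 - c) / 2) - (c / 2 + c\<^sup>2 / 4)"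
    unfolding sums_def_le circ_mean_def[abs_def] .
  then have "(\<lambda>K. exp (- circ_mean c K)) \<longlonglongrightarrow> exp (- (- (ln (1 - c) / 2) - (c / 2 + c\<^sup>2 / 4)))"
    by (intro tendsto_intros)
  moreover have "ln (1 - c) / 2 = ln (sqrt (1 - c))" using assms by (simp add: ln_sqrt)
  then have "exp (- (- (ln (1 - c) / 2) - (c / 2 + c\<^sup>2 / 4))) = frag_free_prob c"
    using assms by (simp add: exp_add frag_free_prob_def)
  ultimately show ?thesis by simp
qed

text \<open>The factor \<open>k\<close> for the starting vertex cancels the \<open>k\<close> in
  \<open>c ^ k / (2 * k)\<close>, so both sums are dominated by geometric series. The bound is
  uniform in \<open>K\<close> and \<open>r\<close>, which is what lets them grow.\<close>

lemma tail_const_le: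
  assumes "0 < c" "c < 1"
  shows "tail_const c K r \<le> 1 / (1 - c)\<^sup>2"
proof -
  have g: "(\<Sum>l\<le>n. c ^ l) \<le> 1 / (1 - c)" for n
    using assms by (simp add: sum_gp0 divide_right_mono)
  have "(\<Sum>k\<le>K. real k * (c ^ k * real (ncirc k) / fact k)) \<le> (\<Sum>k\<le>K. c ^ k)"
    using assms by (intro sum_mono) (simp add: circ_term)
  then have "tail_const c K r \<le> 1 / (1 - c) * (1 / (1 - c))"
    unfolding tail_const_def using g assms by (intro mult_mono order_trans[OF _ g] sum_nonneg) (auto simp: circ_term)
  then show ?thesis by (simp add: power2_eq_square)
qed

text \<open>From \<open>k = 3\<close> on, twice the terms dominate the harmonic series.\<close>

lemma circ_mean_unbounded:
  assumes "1 \<le> c"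
  shows "\<exists>K. B \<le> circ_mean c K"
proof (rule ccontr)
  assume "\<not> (\<exists>K. B \<le> circ_mean c K)"
  then have "(\<Sum>k\<le>K. c ^ k * real (ncirc k) / fact k) \<le> B" for K
    unfolding circ_mean_def by (meson linear)
  then have "summable (\<lambda>k. c ^ k * real (ncirc k) / fact k)"
    using assms by (intro bounded_imp_summable) auto
  then have "summable (\<lambda>k. 2 * (c ^ k * real (ncirc k) / fact k))" by (rule summable_mult)
  then have "summable (\<lambda>k. inverse (real k))"
  proof (rule summable_comparison_test'[where N = 3])
    fix k :: nat assume k: "3 \<le> k"
    have "1 \<le> c ^ k" using assms by simp
    then have "inverse (real k) \<le> c ^ k / real k" by (simp add: divide_inverse mult_le_cancel_right1)
    then show "norm (inverse (real k)) \<le> 2 * (c ^ k * real (ncirc k) / fact k)" using k by (simp add: circ_term)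
  qed
  then show False using not_summable_harmonic[where ?'a = real] by simp
qed

text \<open>Beyond the mean the atoms decrease. Below the mean, consecutive atoms have ratio at
  least \<open>\<Lambda> / (\<Lambda> + L)\<close> for the next \<open>L\<close> steps, so
  \<open>L\<close> successive atoms are at least half as large as the first of them; their sum is at
  most 1, which bounds it by \<open>2 / L\<close>. This is cruder than the true order but avoids
  Stirling's formula.\<close>

lemma Poisson_atom_le:
  assumes L: "0 < L" and \<Lambda>: "2 * (real L)\<^sup>2 \<le> \<Lambda>"
  shows "exp (- \<Lambda>) * \<Lambda> ^ j / fact j \<le> 2 / real L"
proof -
  have \<Lambda>0: "0 < \<Lambda>" using L \<Lambda> by (smt (verit) of_nat_0_less_iff zero_less_power)
  define q where "q j = \<Lambda> ^ j / fact j" for j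
  have q_Suc: "q (Suc j) = q j * (\<Lambda> / real (Suc j))" for j by (simp add: q_def mult.commute)
  have q0: "0 \<le> q j" for j using \<Lambda>0 by (simp add: q_def)
  have "q j \<le> exp \<Lambda> * (2 / real L)" for j
  proof (induction j)
    case (Suc j)
    show ?case
    proof (cases "\<Lambda> \<le> real (Suc j)")
      case True
      then have "q (Suc j) \<le> q j * 1" unfolding q_Suc using q0[of j] by (intro mult_left_mono) auto
      then show ?thesis using Suc by simp
    next
      case False
      define a where "a = \<Lambda> / (\<Lambda> + real L)"
      define j' where "j' = Suc j"
      have a01: "0 < a" "a \<le> 1" using \<Lambda>0 by (auto simp: a_def)
      have ge: "q j' * a ^ i \<le> q (j' + i)" if "i \<le> L" for i
        using that
      proof (induction i)
        case (Suc i)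
        have "a \<le> \<Lambda> / real (Suc (j' + i))" unfolding a_def
          using False Suc.prems \<Lambda>0 by (intro divide_left_mono mult_pos_pos) (auto simp: j'_def)
        then have "q j' * a ^ i * a \<le> q (j' + i) * (\<Lambda> / real (Suc (j' + i)))"
          using Suc q0 a01 by (intro mult_mono) auto
        then show ?case using q_Suc[of "j' + i"] by (simp add: mult.assoc mult.commute[of a])
      qed simp
      \<comment> \<open>The hypothesis enters here, in the form
        \<open>L\<^sup>2 / (\<Lambda> + L) \<le> 1 / 2\<close>.\<close>
      have "1 / 2 \<le> 1 + real L * (- real L / (\<Lambda> + real L))"
        using \<Lambda> \<Lambda>0 by (simp add: field_simps power2_eq_square)
      also have "\<dots> \<le> (1 + - real L / (\<Lambda> + real L)) ^ L"
        using \<Lambda>0 by (intro Bernoulli_inequality) (simp add: field_simps)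
      also have "1 + - real L / (\<Lambda> + real L) = a" using \<Lambda>0 by (simp add: a_def field_simps)
      finally have aL: "1 / 2 \<le> a ^ L" .
      have "q j' * (1 / 2) \<le> q (j' + i)" if "i < L" for i
      proof -
        have "a ^ L \<le> a ^ i" using that a01 by (intro power_decreasing) auto
        then have "q j' * (1 / 2) \<le> q j' * a ^ i" using aL q0 by (intro mult_left_mono) auto
        also have "\<dots> \<le> q (j' + i)" using that by (intro ge) simp
        finally show ?thesis .
      qed
      then have "(\<Sum>i<L. q j' * (1 / 2)) \<le> (\<Sum>i<L. q (j' + i))" by (intro sum_mono) auto
      also have "\<dots> = sum q ((\<lambda>i. j' + i) ` {..<L})" by (subst sum.reindex) auto
      also have "\<dots> \<le> (\<Sum>i. q i)"
      proof (rule sum_le_suminf)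
        show "summable q" using summable_exp_generic[of \<Lambda>] by (simp add: q_def[abs_def] field_simps)
      qed (use q0 in auto)
      also have "\<dots> = exp \<Lambda>" by (simp add: exp_def q_def field_simps)
      finally show ?thesis using L by (simp add: j'_def field_simps)
    qed
  next
    case 0
    have "real L \<le> 2 * (real L)\<^sup>2" using L mult_left_mono[of 1 "real L" "real L"] by (simp add: power2_eq_square)
    also have "\<dots> \<le> \<Lambda>" by (rule \<Lambda>)
    also have "\<dots> \<le> exp \<Lambda>" using exp_ge_add_one_self[of \<Lambda>] by linarith
    finally show ?case using L by (simp add: q_def field_simps)
  qed
  from this[of j] show ?thesis by (simp add: q_def exp_minus field_simps)
qed

section \<open>Sets of subset sums\<close>

text \<open>Items are taken as long as the remaining amount exceeds \<open>e\<close>. No item is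
  larger than \<open>e\<close>, so the amount never becomes negative.\<close>

lemma finite_subset_sum_approx:
  fixes w :: "'i \<Rightarrow> real"
  assumes "finite B" "\<And>i. i \<in> B \<Longrightarrow> 0 \<le> w i \<and> w i \<le> e" "0 \<le> e" "0 \<le> y" "y \<le> sum w B + e"
  shows "\<exists>A\<subseteq>B. \<bar>y - sum w A\<bar> \<le> e"
  using assms
proof (induction B arbitrary: y rule: finite_induct)
  case (insert i B)
  show ?case
  proof (cases "y \<le> e")
    case True
    then show ?thesis using insert.prems by (intro exI[of _ "{}"]) auto
  next
    case False
    have i: "0 \<le> w i" "w i \<le> e" using insert.prems(1)[of i] by auto
    have "\<exists>A\<subseteq>B. \<bar>(y - w i) - sum w A\<bar> \<le> e"
      by (rule insert.IH) (use insert.prems(1) insert.prems(2-) insert.hyps False i in \<open>simp_all del: insert_iff add: insertI2\<close>)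
    then obtain A where A: "A \<subseteq> B" "\<bar>(y - w i) - sum w A\<bar> \<le> e" by blast
    have "finite A" by (rule finite_subset[OF A(1) insert.hyps(1)])
    moreover have "i \<notin> A" using A(1) insert.hyps(2) by auto
    ultimately have "sum w (insert i A) = w i + sum w A" by simp
    then show ?thesis using A by (intro exI[of _ "insert i A"]) auto
  qed
qed (auto intro: exI[of _ "{}"])

text \<open>Kakeya's condition: if no weight exceeds the total of the strictly smaller ones, then a greedy
  choice of a subset never leaves more than the unused weights can still fill.\<close>

lemma Kakeya_finite:
  fixes w :: "'i \<Rightarrow> real"
  assumes sum: "(w has_sum t) J" and pos: "\<And>i. i \<in> J \<Longrightarrow> 0 < w i"
    and kak: "\<And>i. i \<in> J \<Longrightarrow> w i \<le> infsum w {j \<in> J. w j < w i}"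
    and y: "0 \<le> y" "y \<le> t" and B: "finite B" "B \<subseteq> J"
  shows "\<exists>A\<subseteq>B. 0 \<le> y - sum w A \<and> y - sum w A \<le> t - sum w B"
  using B
proof (induction "card B" arbitrary: B)
  case 0
  then show ?case using y by (intro exI[of _ "{}"]) auto
next
  case (Suc n)
  then have "B \<noteq> {}" by auto
  \<comment> \<open>The smallest weight is decided last. All strictly smaller weights then lie
    outside \<open>B\<close>, and Kakeya's condition bounds \<open>w i\<close> by what is left
    there.\<close>
  then obtain i where i: "i \<in> B" "\<And>j. j \<in> B \<Longrightarrow> w i \<le> w j"
    using ex_min_if_finite[of "w ` B"] Suc.prems(1) by (metis (no_types, lifting) arg_min_least arg_min_if_finite(1))
  define B' where "B' = B - {i}"
  have B': "finite B'" "B' \<subseteq> J" "i \<notin> B'" "B = insert i B'" "n = card B'" using Suc i by (auto simp: B'_def)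
  from Suc.hyps(1)[OF B'(5) B'(1,2)] obtain A where A: "A \<subseteq> B'" "0 \<le> y - sum w A" "y - sum w A \<le> t - sum w B'" by blast
  have sB: "sum w B = w i + sum w B'" using B' by simp
  show ?case
  proof (cases "y - sum w A \<le> t - sum w B")
    case True
    then show ?thesis using A B'(4) by (intro exI[of _ A]) auto
  next
    case False
    have iJ: "i \<in> J" using i(1) Suc.prems(2) by auto
    have sm: "w summable_on S" if "S \<subseteq> J" for S
      using sum that by (meson has_sum_imp_summable summable_on_subset_banach)
    have "w i \<le> infsum w {j \<in> J. w j < w i}" by (rule kak[OF iJ])
    also have "\<dots> \<le> infsum w (J - B)"
    proof (rule infsum_mono2)
      show "{j \<in> J. w j < w i} \<subseteq> J - B" using i(2) by (auto simp: not_le[symmetric])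
      show "0 \<le> w x" if "x \<in> J - B - {j \<in> J. w j < w i}" for x using that pos[of x] by auto
    qed (auto intro: sm)
    also have "\<dots> = infsum w J - infsum w B" by (rule infsum_Diff) (use Suc.prems sm in auto)
    also have "\<dots> = t - sum w B" using sum Suc.prems(1) by (simp add: infsumI)
    finally have "w i \<le> t - sum w B" .
    then have "w i \<le> y - sum w A" using False by linarith
    moreover have "finite A" "i \<notin> A" using A(1) B' by (auto intro: finite_subset[OF A(1)])
    then have "sum w (insert i A) = w i + sum w A" by simp
    ultimately show ?thesis using A B'(4) sB by (intro exI[of _ "insert i A"]) auto
  qed
qed

lemma Kakeya_dense:
  fixes w :: "'i \<Rightarrow> real"
  assumes sum: "(w has_sum t) J" and pos: "\<And>i. i \<in> J \<Longrightarrow> 0 < w i"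
    and kak: "\<And>i. i \<in> J \<Longrightarrow> w i \<le> infsum w {j \<in> J. w j < w i}"
    and y: "0 \<le> y" "y \<le> t" and e: "0 < e"
  shows "\<exists>A\<subseteq>J. finite A \<and> \<bar>y - sum w A\<bar> \<le> e"
proof -
  obtain B where B: "finite B" "B \<subseteq> J" "dist (sum w B) t \<le> e" using has_sum_finite_approximation[OF sum e] by blast
  from Kakeya_finite[OF sum pos kak y B(1,2)] obtain A
    where A: "A \<subseteq> B" "0 \<le> y - sum w A" "y - sum w A \<le> t - sum w B" by blast
  have "finite A" by (rule finite_subset[OF A(1) B(1)])
  then show ?thesis using A B by (intro exI[of _ A]) (auto simp: dist_real_def)
qed

text \<open>Weights are bounded by their level but not ordered by it, so they are measured against
  the geometric scale. If \<open>P * x ^ Suc k' < w i \<le> P * x ^ k'\<close>, then every weight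
  from level \<open>Suc k'\<close> on is strictly smaller than \<open>w i\<close>, and the tail
  condition yields Kakeya's condition. Weights above \<open>P * x ^ m\<close> occur only below level
  \<open>m\<close>; these finitely many are chosen freely, and each choice shifts the interval
  filled by the others.\<close>

lemma closure_subset_sums:
  fixes w :: "'i \<Rightarrow> real" and lev :: "'i \<Rightarrow> nat"
  assumes sum: "(w has_sum 1) I" and pos: "\<And>i. i \<in> I \<Longrightarrow> 0 < w i"
    and le: "\<And>i. i \<in> I \<Longrightarrow> w i \<le> P * x ^ lev i"
    and fin: "\<And>k. finite {i \<in> I. lev i < k}" and x: "0 < x" "x < 1" and P: "0 < P"
    and tail: "\<And>k. m \<le> k \<Longrightarrow> P * x ^ k \<le> infsum w {i \<in> I. Suc k \<le> lev i}"
    and sub: "\<And>l. l \<in> L \<Longrightarrow> \<exists>A\<subseteq>I. l = infsum w A"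
    and sup: "\<And>A. finite A \<Longrightarrow> A \<subseteq> I \<Longrightarrow> sum w A \<in> closure L"
  shows "\<exists>F t. finite F \<and> 0 < t \<and> closure L = (\<Union>A\<in>Pow F. {sum w A..sum w A + t}) \<and> (m = 0 \<longrightarrow> F = {} \<and> t = 1)"
proof -
  define F where "F = {i \<in> I. P * x ^ m < w i}"
  define t where "t = 1 - sum w F"
  have pw: "P * x ^ j \<le> P * x ^ i" if "i \<le> j" for i j
    using that x P by (intro mult_left_mono power_decreasing) auto
  have Flev: "lev i < m" if "i \<in> F" for i
  proof (rule ccontr)
    assume "\<not> lev i < m"
    then have "P * x ^ lev i \<le> P * x ^ m" by (intro pw) simp
    then show False using le[of i] that by (auto simp: F_def)
  qed
  have "F \<subseteq> {i \<in> I. lev i < m}" using Flev by (auto simp: F_def)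
  then have finF: "finite F" by (rule finite_subset[OF _ fin])
  have FI: "F \<subseteq> I" by (auto simp: F_def)
  have sm: "w summable_on S" if "S \<subseteq> I" for S
    using sum that by (meson has_sum_imp_summable summable_on_subset_banach)
  have sumJ: "(w has_sum t) (I - F)"
    unfolding t_def by (rule has_sum_Diff[OF sum has_sum_finite[OF finF] FI])
  have "P * x ^ m \<le> infsum w {i \<in> I. Suc m \<le> lev i}" by (rule tail) simp
  also have "\<dots> \<le> infsum w (I - F)"
  proof (rule infsum_mono2)
    show "{i \<in> I. Suc m \<le> lev i} \<subseteq> I - F" using Flev by fastforce
    show "0 \<le> w i" if "i \<in> I - F - {i \<in> I. Suc m \<le> lev i}" for i using that pos[of i] by auto
  qed (auto intro: sm)
  also have "\<dots> = t" using sumJ by (rule infsumI)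
  finally have t: "0 < t" using P x by (smt (verit) mult_pos_pos zero_less_power)
  have kak: "w i \<le> infsum w {j \<in> I - F. w j < w i}" if i: "i \<in> I - F" for i
  proof -
    have wi: "0 < w i" "w i \<le> P * x ^ m" using i pos[of i] by (auto simp: F_def)
    have "\<exists>k. x ^ k < w i / P" by (rule real_arch_pow_inv) (use wi P x in auto)
    then have ex: "\<exists>k. P * x ^ k < w i" using P by (auto simp: field_simps)
    define k where "k = (LEAST k. P * x ^ k < w i)"
    have k: "P * x ^ k < w i" unfolding k_def by (rule LeastI_ex[OF ex])
    have "m < k"
    proof (rule ccontr)
      assume "\<not> m < k"
      then have "P * x ^ m \<le> P * x ^ k" by (intro pw) simp
      then show False using k wi by simp
    qed
    then obtain k' where k': "k = Suc k'" "m \<le> k'" by (cases k) auto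
    have "w i \<le> P * x ^ k'" using not_less_Least[of k' "\<lambda>k. P * x ^ k < w i"] k' by (auto simp: k_def[symmetric])
    also have "\<dots> \<le> infsum w {j \<in> I. Suc k' \<le> lev j}" by (rule tail[OF k'(2)])
    also have "\<dots> \<le> infsum w {j \<in> I - F. w j < w i}"
    proof (rule infsum_mono2)
      show "{j \<in> I. Suc k' \<le> lev j} \<subseteq> {j \<in> I - F. w j < w i}"
      proof
        fix j assume j: "j \<in> {j \<in> I. Suc k' \<le> lev j}"
        then have "P * x ^ lev j \<le> P * x ^ k" using k' by (intro pw) simp
        then have "w j < w i" using le[of j] j k by simp
        moreover have "j \<notin> F" using Flev[of j] j k' by auto
        ultimately show "j \<in> {j \<in> I - F. w j < w i}" using j by simp
      qed
      show "0 \<le> w j" if "j \<in> {j \<in> I - F. w j < w i} - {j \<in> I. Suc k' \<le> lev j}" for j using that pos[of j] by auto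
    qed (auto intro: sm)
    finally show ?thesis .
  qed
  have cl: "closure L = (\<Union>A\<in>Pow F. {sum w A..sum w A + t})"
  proof (rule equalityI)
    show "closure L \<subseteq> (\<Union>A\<in>Pow F. {sum w A..sum w A + t})"
    proof (rule closure_minimal)
      show "closed (\<Union>A\<in>Pow F. {sum w A..sum w A + t})" using finF by (intro closed_UN) auto
      show "L \<subseteq> (\<Union>A\<in>Pow F. {sum w A..sum w A + t})"
      proof
        fix l assume "l \<in> L"
        then obtain A where A: "A \<subseteq> I" "l = infsum w A" using sub by blast
        have "infsum w ((A \<inter> F) \<union> (A - F)) = infsum w (A \<inter> F) + infsum w (A - F)"
          using A FI by (intro infsum_Un_disjoint sm) auto
        moreover have "(A \<inter> F) \<union> (A - F) = A" by auto
        ultimately have "l = sum w (A \<inter> F) + infsum w (A - F)" using A(2) finF by simp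
        moreover have "0 \<le> infsum w (A - F)"
        proof (rule infsum_nonneg)
          fix i assume "i \<in> A - F"
          then show "0 \<le> w i" using pos[of i] A(1) by auto
        qed
        moreover have "infsum w (A - F) \<le> infsum w (I - F)"
        proof (rule infsum_mono2)
          show "A - F \<subseteq> I - F" using A(1) by auto
          show "0 \<le> w i" if "i \<in> I - F - (A - F)" for i using that pos[of i] by auto
        qed (use A(1) in \<open>auto intro: sm\<close>)
        ultimately have "l \<in> {sum w (A \<inter> F)..sum w (A \<inter> F) + t}" using infsumI[OF sumJ] by auto
        then show "l \<in> (\<Union>A\<in>Pow F. {sum w A..sum w A + t})" by (rule UN_I[rotated]) auto
      qed
    qed
    show "(\<Union>A\<in>Pow F. {sum w A..sum w A + t}) \<subseteq> closure L"
    proof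
      fix y assume "y \<in> (\<Union>A\<in>Pow F. {sum w A..sum w A + t})"
      then obtain A where A: "A \<subseteq> F" "0 \<le> y - sum w A" "y - sum w A \<le> t" by auto
      have finA: "finite A" by (rule finite_subset[OF A(1) finF])
      \<comment> \<open>\<open>sup\<close> places the finite sums only in the closure of
        \<open>L\<close>, so the approximation takes place one closure further out.\<close>
      have "y \<in> closure (closure L)"
        unfolding closure_approachable[of y "closure L"]
      proof (intro allI impI)
        fix e :: real assume "0 < e"
        then have "0 < e / 2" by simp
        from Kakeya_dense[OF sumJ _ kak A(2,3) this] obtain B
          where B: "B \<subseteq> I - F" "finite B" "\<bar>y - sum w A - sum w B\<bar> \<le> e / 2" using pos by auto
        have "sum w (A \<union> B) = sum w A + sum w B" using A B finA by (intro sum.union_disjoint) auto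
        moreover have "sum w (A \<union> B) \<in> closure L" using A B finA FI by (intro sup) auto
        ultimately show "\<exists>z\<in>closure L. dist z y < e" using B(3) \<open>0 < e\<close>
          by (intro bexI[of _ "sum w (A \<union> B)"]) (auto simp: dist_real_def abs_if split: if_splits)
      qed
      then show "y \<in> closure L" by simp
    qed
  qed
  have F0: "F = {}" if "m = 0" using Flev that by auto
  then have "m = 0 \<longrightarrow> F = {} \<and> t = 1" by (simp add: t_def)
  then show ?thesis using finF t cl by blast
qed

section \<open>Isomorphism classes of cores\<close>

text \<open>The edges of a core determine its vertices by \<open>core_verts_core\<close>, so it
  suffices to let bijections of the whole type act on edge sets.\<close>

definition iso :: "nat set set \<Rightarrow> nat set set \<Rightarrow> bool" where
  "iso H H' \<longleftrightarrow> (\<exists>f. bij f \<and> H' = img f H)"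

lemma iso_refl: "iso H H"
  unfolding iso_def by (rule exI[of _ id]) (simp only: bij_id img_id simp_thms)

lemma iso_sym: "iso H H' \<Longrightarrow> iso H' H"
  unfolding iso_def by (elim exE conjE, rule_tac x = "inv f" in exI) (simp only: bij_imp_bij_inv img_inv simp_thms)

lemma iso_trans: "iso H H' \<Longrightarrow> iso H' H'' \<Longrightarrow> iso H H''"
  unfolding iso_def by (elim exE conjE, rule_tac x = "fa \<circ> f" in exI) (simp only: bij_comp img_comp simp_thms)

lemma iso_card: "iso H H' \<Longrightarrow> card H' = card H"
  unfolding iso_def by (elim exE conjE) (simp only: card_img)

lemma iso_img: "bij f \<Longrightarrow> iso H (img f H)"
  unfolding iso_def by blast

definition iso_rel :: "nat set set set \<Rightarrow> (nat set set \<times> nat set set) set" where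
  "iso_rel G = {(H, H'). H \<in> G \<and> H' \<in> G \<and> iso H H'}"

lemma equiv_iso_rel: "equiv G (iso_rel G)"
proof (rule equivI)
  show "sym (iso_rel G)" by (rule symI) (simp add: iso_rel_def iso_sym)
  show "trans (iso_rel G)" by (rule transI) (auto simp: iso_rel_def intro: iso_trans)
qed (auto simp: iso_rel_def refl_on_def iso_refl)

definition classes :: "(nat \<Rightarrow> nat set set set) \<Rightarrow> (nat \<times> nat set set set) set" where
  "classes G = Sigma UNIV (\<lambda>m. G m // iso_rel (G m))"

lemma class_subset: "(m, C) \<in> classes G \<Longrightarrow> C \<subseteq> G m"
  unfolding classes_def by (auto dest: in_quotient_imp_subset[OF equiv_iso_rel])

lemma class_nonempty: "(m, C) \<in> classes G \<Longrightarrow> C \<noteq> {}"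
  unfolding classes_def by (auto dest: in_quotient_imp_non_empty[OF equiv_iso_rel])

lemma class_iso: "(m, C) \<in> classes G \<Longrightarrow> H \<in> C \<Longrightarrow> H' \<in> C \<Longrightarrow> iso H H'"
  using in_quotient_imp_in_rel[OF equiv_iso_rel, of C "G m" H H'] by (simp add: classes_def iso_rel_def)

lemma class_closed: "(m, C) \<in> classes G \<Longrightarrow> H \<in> C \<Longrightarrow> H' \<in> G m \<Longrightarrow> iso H H' \<Longrightarrow> H' \<in> C"
  using in_quotient_imp_closed[OF equiv_iso_rel, of C "G m" H H'] class_subset[of m C G]
  by (auto simp: classes_def iso_rel_def)

lemma ex_class: "H \<in> G m \<Longrightarrow> \<exists>C. (m, C) \<in> classes G \<and> H \<in> C"
  using quotientI[of H "G m" "iso_rel (G m)"] by (intro exI[of _ "iso_rel (G m) `` {H}"]) (auto simp: classes_def iso_rel_def iso_refl)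

lemma class_disjoint: "(m, C) \<in> classes G \<Longrightarrow> (m, D) \<in> classes G \<Longrightarrow> C \<noteq> D \<Longrightarrow> C \<inter> D = {}"
  using quotient_disj[OF equiv_iso_rel, of C "G m" D] by (simp add: classes_def)

lemma finite_classes_le:
  assumes "\<And>m. finite (G m)"
  shows "finite {i \<in> classes G. fst i \<le> M}"
proof -
  have "{i \<in> classes G. fst i \<le> M} = Sigma {..M} (\<lambda>m. G m // iso_rel (G m))" by (auto simp: classes_def)
  moreover have "finite (G m // iso_rel (G m))" for m
    using assms by (intro finite_quotient) (auto simp: iso_rel_def)
  ultimately show ?thesis by simp
qed

text \<open>The number of edges recovers the level, so isomorphic graphs in different levels cannot
  interfere.\<close>

lemma classes_Union:
  assumes card: "\<And>m H. H \<in> G m \<Longrightarrow> card H = m" and A: "A \<subseteq> classes G"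
  shows "{H \<in> G m. \<exists>H'\<in>\<Union>(snd ` A). iso H' H} = \<Union>{C. (m, C) \<in> A}"
proof (intro equalityI subsetI)
  fix H assume "H \<in> {H \<in> G m. \<exists>H'\<in>\<Union>(snd ` A). iso H' H}"
  then obtain k C H' where h: "H \<in> G m" "(k, C) \<in> A" "H' \<in> C" "iso H' H" by auto
  have kC: "(k, C) \<in> classes G" using A h(2) by blast
  then have "card H' = k" using card[of H' k] class_subset[OF kC] h(3) by auto
  then have km: "k = m" using card[OF h(1)] iso_card[OF h(4)] by simp
  then have "H \<in> C" using class_closed[OF kC h(3) _ h(4)] h(1) by simp
  then show "H \<in> \<Union>{C. (m, C) \<in> A}" using h(2) km by blast
next
  fix H assume "H \<in> \<Union>{C. (m, C) \<in> A}"
  then obtain C where C: "(m, C) \<in> A" "H \<in> C" by blast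
  then have "H \<in> G m" using class_subset[of m C G] A by blast
  moreover have "H \<in> \<Union>(snd ` A)" using C by force
  ultimately show "H \<in> {H \<in> G m. \<exists>H'\<in>\<Union>(snd ` A). iso H' H}" using iso_refl[of H] by blast
qed

lemma invariant_Union:
  assumes "\<And>f H. bij f \<Longrightarrow> Q (img f H) \<longleftrightarrow> Q H"
  shows "{H \<in> G m. Q H} = \<Union>{C. (m, C) \<in> {i \<in> classes G. \<forall>H\<in>snd i. Q H}}"
proof (intro equalityI subsetI)
  fix H assume H: "H \<in> {H \<in> G m. Q H}"
  then obtain C where C: "(m, C) \<in> classes G" "H \<in> C" using ex_class[of H G m] by auto
  have "Q H'" if "H' \<in> C" for H'
    using class_iso[OF C that] assms H unfolding iso_def by auto
  then show "H \<in> \<Union>{C. (m, C) \<in> {i \<in> classes G. \<forall>H\<in>snd i. Q H}}" using C by auto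
next
  fix H assume "H \<in> \<Union>{C. (m, C) \<in> {i \<in> classes G. \<forall>H\<in>snd i. Q H}}"
  then show "H \<in> {H \<in> G m. Q H}" using class_subset[of m _ G] by fastforce
qed

lemma sum_Union_classes:
  fixes h :: "nat set set \<Rightarrow> real"
  assumes "finite (G m)" "A \<subseteq> classes G"
  shows "(\<Sum>H\<in>\<Union>{C. (m, C) \<in> A}. h H) = (\<Sum>C\<in>{C. (m, C) \<in> A}. \<Sum>H\<in>C. h H)"
proof -
  have sub: "C \<subseteq> G m" if "(m, C) \<in> A" for C using class_subset[of m C G] assms(2) that by blast
  have "\<forall>C\<in>{C. (m, C) \<in> A}. finite C" using sub assms(1) by (auto intro: finite_subset[OF sub])
  moreover have "\<forall>C\<in>{C. (m, C) \<in> A}. \<forall>D\<in>{C. (m, C) \<in> A}. C \<noteq> D \<longrightarrow> C \<inter> D = {}"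
    using class_disjoint[of m _ G] assms(2) by blast
  ultimately show ?thesis using sum.Union_disjoint[of "{C. (m, C) \<in> A}" h] by simp
qed

section \<open>Weights of isomorphism classes of cores\<close>

definition class_weight :: "real \<Rightarrow> nat \<Rightarrow> nat \<Rightarrow> nat \<times> nat set set set \<Rightarrow> real" where
  "class_weight c K r i = exp (- circ_mean c K) * (c ^ fst i / fact (fst i) *
     (\<Sum>H\<in>snd i. exp (- c * real (card (core_verts K r H)))))"

abbreviation core_classes :: "nat \<Rightarrow> nat \<Rightarrow> (nat \<times> nat set set set) set" where
  "core_classes K r \<equiv> classes (\<lambda>m. core_graphs K r {1..m})"

lemma card_core_graphs: "H \<in> core_graphs K r {1..m} \<Longrightarrow> card H = m"
  by (simp add: core_graphs_def)

lemma sum_core_weight_classes: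
  assumes A: "A \<subseteq> core_classes K r" "finite A" "fst ` A \<subseteq> {..M}"
    and Q: "\<And>m. m \<le> M \<Longrightarrow> {H \<in> core_graphs K r {1..m}. Q H} = \<Union>{C. (m, C) \<in> A}"
  shows "(\<Sum>m\<le>M. core_weight c K r Q m) = sum (class_weight c K r) A"
proof -
  have "core_weight c K r Q m = (\<Sum>i\<in>{i \<in> A. fst i = m}. class_weight c K r i)" if m: "m \<le> M" for m
  proof -
    let ?h = "\<lambda>H. exp (- c * real (card (core_verts K r H)))"
    have "(\<Sum>H\<in>\<Union>{C. (m, C) \<in> A}. ?h H) = (\<Sum>C\<in>{C. (m, C) \<in> A}. \<Sum>H\<in>C. ?h H)"
      by (rule sum_Union_classes[OF _ A(1)]) (simp add: finite_core_graphs)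
    moreover have "{i \<in> A. fst i = m} = Pair m ` {C. (m, C) \<in> A}" by auto
    then have "(\<Sum>i\<in>{i \<in> A. fst i = m}. class_weight c K r i) = (\<Sum>C\<in>{C. (m, C) \<in> A}. class_weight c K r (m, C))"
      by (simp add: sum.reindex inj_on_def)
    ultimately show ?thesis
      unfolding core_weight_def Q[OF m] by (simp add: class_weight_def sum_distrib_left)
  qed
  then have "(\<Sum>m\<le>M. core_weight c K r Q m) = (\<Sum>m\<le>M. \<Sum>i\<in>{i \<in> A. fst i = m}. class_weight c K r i)"
    by (intro sum.cong) auto
  also have "\<dots> = sum (class_weight c K r) A" by (rule sum.group[OF A(2) _ A(3)]) simp
  finally show ?thesis .
qed

text \<open>Once \<open>M\<close> exceeds all levels occurring in \<open>A\<close>, the partial sums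
  are constant, and the vanishing error bound identifies the limit.\<close>

lemma core_class_limit:
  assumes c: "0 < c" and A: "finite A" "A \<subseteq> core_classes K r"
  shows "(\<lambda>n. rg_prob c n (\<lambda>E. \<exists>H\<in>\<Union>(snd ` A). iso H (core K (Suc r) E))) \<longlonglongrightarrow> sum (class_weight c K r) A"
proof -
  define Q where "Q H \<longleftrightarrow> (\<exists>H'\<in>\<Union>(snd ` A). iso H' H)" for H
  have "Q (img f H) \<longleftrightarrow> Q H" if "bij f" for f H
    unfolding Q_def using iso_img[OF that, of H] iso_trans iso_sym by meson
  from core_property_limit[OF c this, of K r] obtain l
    where l: "(\<lambda>n. rg_prob c n (\<lambda>E. Q (core K (Suc r) E))) \<longlonglongrightarrow> l"
      and est: "\<And>M. \<bar>l - (\<Sum>m\<le>M. core_weight c K r Q m)\<bar> \<le> tail_const c K (Suc r) / real (Suc M)" by blast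
  obtain M0 where M0: "fst ` A \<subseteq> {..M0}" using finite_nat_iff_bounded_le[of "fst ` A"] A(1) by auto
  have "\<bar>l - sum (class_weight c K r) A\<bar> \<le> tail_const c K (Suc r) / real (Suc M)" if M: "M0 \<le> M" for M
  proof -
    have "(\<Sum>m\<le>M. core_weight c K r Q m) = sum (class_weight c K r) A"
    proof (rule sum_core_weight_classes[OF A(2,1)])
      show "fst ` A \<subseteq> {..M}" using M0 M by auto
      show "{H \<in> core_graphs K r {1..m}. Q H} = \<Union>{C. (m, C) \<in> A}" for m
        unfolding Q_def by (rule classes_Union[OF card_core_graphs A(2)])
    qed
    then show ?thesis using est[of M] by simp
  qed
  moreover have "(\<lambda>M. tail_const c K (Suc r) / real (Suc M)) \<longlonglongrightarrow> 0"
    using LIMSEQ_Suc[OF lim_const_over_n] .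
  ultimately have "\<bar>l - sum (class_weight c K r) A\<bar> \<le> 0"
    by (intro LIMSEQ_le_const[where X = "\<lambda>M. tail_const c K (Suc r) / real (Suc M)"]) blast+
  then show ?thesis using l by (simp add: Q_def)
qed

lemma limit_prob_eqI: "prob_models c \<phi> \<longlonglongrightarrow> l \<Longrightarrow> limit_prob c \<phi> = l"
  unfolding limit_prob_def by (rule limI)

text \<open>For fixed \<open>K\<close> and \<open>r\<close> one sentence describes any finite set of
  isomorphism types of the core, so these sums are attained exactly and not only
  approximated.\<close>

lemma sum_class_weight_in_limit_probs:
  assumes c: "0 < c" and A: "finite A" "A \<subseteq> core_classes K r"
  shows "sum (class_weight c K r) A \<in> limit_probs c"
proof -
  have fin: "finite (\<Union>(snd ` A))"
  proof (rule finite_Union)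
    fix C assume "C \<in> snd ` A"
    then obtain m where "(m, C) \<in> A" by auto
    then have "C \<subseteq> core_graphs K r {1..m}" using class_subset[of m C] A(2) by blast
    then show "finite C" by (rule finite_subset) (simp add: finite_core_graphs)
  qed (use A(1) in simp)
  have lev: "\<exists>m. H \<in> core_graphs K r {1..m}" if H: "H \<in> \<Union>(snd ` A)" for H
  proof -
    obtain m C where "(m, C) \<in> A" "H \<in> C" using H by auto
    then show ?thesis using class_subset[of m C] A(2) by blast
  qed
  have "\<exists>\<phi>. sentence \<phi> \<and> (\<forall>V (E :: nat set set). finite V \<longrightarrow> E \<subseteq> pairs V \<longrightarrow>
      (models V E \<phi> \<longleftrightarrow> (\<exists>H\<in>\<Union>(snd ` A). iso H (core K (Suc r) E))))"
    unfolding iso_def by (rule ex_core_sentence[OF fin]) (rule lev)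
  then obtain \<phi> where \<phi>: "sentence \<phi>"
    and m: "\<forall>V (E :: nat set set). finite V \<longrightarrow> E \<subseteq> pairs V \<longrightarrow>
      (models V E \<phi> \<longleftrightarrow> (\<exists>H\<in>\<Union>(snd ` A). iso H (core K (Suc r) E)))"
    by (elim exE conjE) (rule that)
  have "prob_models c \<phi> n = rg_prob c n (\<lambda>E. \<exists>H\<in>\<Union>(snd ` A). iso H (core K (Suc r) E))" if n: "c \<le> real n" for n
    unfolding prob_models_eq_rg_prob[OF c n] rg_prob_def by (rule gprob_cong) (rule m[rule_format], simp_all)
  then have "eventually (\<lambda>n. rg_prob c n (\<lambda>E. \<exists>H\<in>\<Union>(snd ` A). iso H (core K (Suc r) E)) = prob_models c \<phi> n) sequentially"
    by (intro eventually_mono[OF eventually_c_le[of c]]) simp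
  then have "prob_models c \<phi> \<longlonglongrightarrow> sum (class_weight c K r) A"
    by (rule Lim_transform_eventually[OF core_class_limit[OF c A]])
  from limit_prob_eqI[OF this] have "sum (class_weight c K r) A = limit_prob c \<phi>" by simp
  then show ?thesis unfolding limit_probs_def by (intro CollectI exI[of _ \<phi>] conjI \<phi>)
qed

text \<open>The limit theorem for the property that always holds: no mass escapes, and the missing
  part of a truncation is controlled explicitly.\<close>

lemma core_weight_True_sum:
  assumes c: "0 < c"
  shows "\<bar>1 - (\<Sum>m\<le>M. core_weight c K r (\<lambda>_. True) m)\<bar> \<le> tail_const c K (Suc r) / real (Suc M)"
proof -
  obtain l where l: "(\<lambda>n. rg_prob c n (\<lambda>E. True)) \<longlonglongrightarrow> l"
      and est: "\<And>M. \<bar>l - (\<Sum>m\<le>M. core_weight c K r (\<lambda>_. True) m)\<bar> \<le> tail_const c K (Suc r) / real (Suc M)"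
    using core_property_limit[OF c, of "\<lambda>_. True" K r] by auto
  have "rg_prob c n (\<lambda>E. True) = 1" for n unfolding rg_prob_def by (rule gprob_True) simp
  then have "(\<lambda>n. 1) \<longlonglongrightarrow> l" using l by (simp only:)
  then have "l = 1" using LIMSEQ_unique[OF tendsto_const] by blast
  then show ?thesis using est by simp
qed

lemma sentence_convergent:
  assumes "0 < c" "sentence \<phi>"
  shows "\<exists>l. prob_models c \<phi> \<longlonglongrightarrow> l"
proof -
  obtain q K Good where "\<forall>c>0. \<forall>L\<ge>K. \<forall>r. 2 ^ q \<le> Suc r \<longrightarrow> (\<exists>l. prob_models c \<phi> \<longlonglongrightarrow> l \<and>
    (\<forall>M. \<bar>l - (\<Sum>m\<le>M. core_weight c L r (\<lambda>H. gtype q K H \<in> Good) m)\<bar> \<le> tail_const c L (Suc r) / real (Suc M)))"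
    using sentence_limit[OF assms(2)] by blast
  from this[rule_format, OF assms(1) order.refl, of "2 ^ q"] show ?thesis by auto
qed

lemma limit_probs_subset: "0 < c \<Longrightarrow> limit_probs c \<subseteq> {0..1}"
proof
  fix l assume c: "0 < c" and "l \<in> limit_probs c"
  then obtain \<phi> where \<phi>: "sentence \<phi>" "l = limit_prob c \<phi>" by (auto simp: limit_probs_def)
  obtain l' where l': "prob_models c \<phi> \<longlonglongrightarrow> l'" using sentence_convergent[OF c \<phi>(1)] by blast
  then have "l = l'" using limit_prob_eqI \<phi>(2) by simp
  moreover have "0 \<le> l'" by (rule LIMSEQ_le_const[OF l']) (auto simp: prob_models_def)
  moreover have "l' \<le> 1" by (rule LIMSEQ_le_const2[OF l']) (auto simp: prob_models_def)
  ultimately show "l \<in> {0..1}" by simp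
qed

section \<open>Above the threshold for the giant component\<close>

text \<open>Isomorphic cores have equally many short circuits, so each class lies inside one event
  of the Poisson law.\<close>

lemma class_weight_le_Poisson:
  assumes c: "0 < c" and i: "i \<in> core_classes K r"
  shows "\<exists>j. class_weight c K r i \<le> exp (- circ_mean c K) * circ_mean c K ^ j / fact j"
proof -
  obtain m C where mC: "i = (m, C)" by fastforce
  have C: "(m, C) \<in> core_classes K r" using i mC by simp
  obtain H0 where H0: "H0 \<in> C" using class_nonempty[OF C] by blast
  define j where "j = card (short_circuits K H0)"
  have key: "card (short_circuits K E) = j" if E: "E \<subseteq> pairs {1..n}" and H: "H \<in> C" "iso H (core K (Suc r) E)" for E H and n :: nat
  proof -
    have "iso H0 (core K (Suc r) E)" using iso_trans[OF class_iso[OF C H0 H(1)] H(2)] .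
    then obtain f where f: "bij f" "core K (Suc r) E = img f H0" unfolding iso_def by blast
    have "cyc K E \<subseteq> core_verts K (Suc r) E" unfolding core_verts_def by (rule subset_nbhd)
    then have "{S \<in> short_circuits K E. S \<subseteq> core_verts K (Suc r) E} = short_circuits K E"
      by (auto simp: cyc_def)
    then have "short_circuits K E = short_circuits K (core K (Suc r) E)"
      unfolding core_def short_circuits_induced[OF simple_pairs[OF E]] by simp
    then show ?thesis by (simp only: f(2) short_circuits_img[OF f(1)] card_img[OF f(1)] j_def)
  qed
  have "sum (class_weight c K r) {i} \<le> exp (- circ_mean c K) * circ_mean c K ^ j / fact j"
  proof (rule LIMSEQ_le[OF core_class_limit[OF c] circuit_count_tendsto_Poisson[OF c]])
    obtain N where N: "c \<le> real N" using real_arch_simple by blast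
    have "rg_prob c n (\<lambda>E. \<exists>H\<in>\<Union>(snd ` {i}). iso H (core K (Suc r) E)) \<le> rg_prob c n (\<lambda>E. card (short_circuits K E) = j)"
      if n: "N \<le> n" for n
    proof -
      have cn: "c \<le> real n" using N n by linarith
      show ?thesis unfolding rg_prob_def
        by (rule gprob_mono[OF edge_prob_bounds(1,2)[OF c cn]]) (use key mC in auto)
    qed
    then show "\<exists>N. \<forall>n\<ge>N. rg_prob c n (\<lambda>E. \<exists>H\<in>\<Union>(snd ` {i}). iso H (core K (Suc r) E)) \<le> rg_prob c n (\<lambda>E. card (short_circuits K E) = j)"
      by blast
  qed (use i in auto)
  then show ?thesis by auto
qed

lemma class_weight_nonneg: "0 < c \<Longrightarrow> 0 \<le> class_weight c K r i"
  unfolding class_weight_def by (intro mult_nonneg_nonneg sum_nonneg) auto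

text \<open>For \<open>c \<ge> 1\<close> the expected number of circuits of length at most \<open>K\<close> is unbounded in \<open>K\<close>, so
  every isomorphism type of the core has small probability.\<close>

theorem closure_limit_probs_supercritical:
  assumes c: "1 \<le> c"
  shows "closure (limit_probs c) = {0..1}"
proof (rule equalityI)
  have c0: "0 < c" using c by simp
  show "closure (limit_probs c) \<subseteq> {0..1}" by (rule closure_minimal[OF limit_probs_subset[OF c0]]) simp
  show "{0..1} \<subseteq> closure (limit_probs c)"
  proof
    fix y :: real assume y: "y \<in> {0..1}"
    show "y \<in> closure (limit_probs c)" unfolding closure_approachable
    proof (intro allI impI)
      fix e :: real assume e: "0 < e"
      obtain L where L: "4 / e < real L" using reals_Archimedean2 by blast
      have L0: "0 < L" using L e by (metis divide_pos_pos less_trans of_nat_0_less_iff zero_less_numeral)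
      have Le: "2 / real L \<le> e / 2" using L L0 e by (simp add: field_simps)
      obtain K where K: "2 * (real L)\<^sup>2 \<le> circ_mean c K" using circ_mean_unbounded[OF c] by blast
      obtain M where M: "tail_const c K 1 * 2 / e < real M" using reals_Archimedean2 by blast
      have Me: "tail_const c K 1 / real (Suc M) \<le> e / 2" using M e by (simp add: field_simps)
      \<comment> \<open>Interior radius 0 suffices, as already the number of short circuits makes
        every class small. The cores of size at most \<open>M\<close> carry all but
        \<open>e / 2\<close> of the mass.\<close>
      define B where "B = {i \<in> core_classes K 0. fst i \<le> M}"
      have finB: "finite B" unfolding B_def by (rule finite_classes_le) (simp add: finite_core_graphs)
      have "(\<Sum>m\<le>M. core_weight c K 0 (\<lambda>_. True) m) = sum (class_weight c K 0) B"
      proof (rule sum_core_weight_classes[OF _ finB])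
        fix m assume m: "m \<le> M"
        have "{H \<in> core_graphs K 0 {1..m}. True} = \<Union>{C. (m, C) \<in> {i \<in> core_classes K 0. \<forall>H\<in>snd i. True}}"
          by (rule invariant_Union) simp
        also have "{C. (m, C) \<in> {i \<in> core_classes K 0. \<forall>H\<in>snd i. True}} = {C. (m, C) \<in> B}" using m by (auto simp: B_def)
        finally show "{H \<in> core_graphs K 0 {1..m}. True} = \<Union>{C. (m, C) \<in> B}" .
      qed (auto simp: B_def)
      then have "1 \<le> sum (class_weight c K 0) B + e / 2"
        using core_weight_True_sum[OF c0, of K 0 M] Me unfolding One_nat_def by linarith
      then have yB: "y \<le> sum (class_weight c K 0) B + e / 2" using y by auto
      have w: "0 \<le> class_weight c K 0 i \<and> class_weight c K 0 i \<le> e / 2" if i: "i \<in> B" for i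
      proof -
        have "i \<in> core_classes K 0" using i by (simp add: B_def)
        then obtain j where "class_weight c K 0 i \<le> exp (- circ_mean c K) * circ_mean c K ^ j / fact j"
          using class_weight_le_Poisson[OF c0] by blast
        also have "\<dots> \<le> 2 / real L" by (rule Poisson_atom_le[OF L0 K])
        finally show ?thesis using Le class_weight_nonneg[OF c0] by auto
      qed
      have "\<exists>A\<subseteq>B. \<bar>y - sum (class_weight c K 0) A\<bar> \<le> e / 2"
        by (rule finite_subset_sum_approx[OF finB w _ _ yB]) (use e y in auto)
      then obtain A where A: "A \<subseteq> B" "\<bar>y - sum (class_weight c K 0) A\<bar> \<le> e / 2" by blast
      have "sum (class_weight c K 0) A \<in> limit_probs c"
        by (rule sum_class_weight_in_limit_probs[OF c0 finite_subset[OF A(1) finB]]) (use A(1) in \<open>auto simp: B_def\<close>)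
      then show "\<exists>z\<in>limit_probs c. dist z y < e"
        using A(2) e by (intro bexI[of _ "sum (class_weight c K 0) A"]) (auto simp: dist_real_def abs_if split: if_splits)
    qed
  qed
qed

section \<open>Below the threshold for the giant component\<close>

abbreviation frag_classes :: "(nat \<times> nat set set set) set" where
  "frag_classes \<equiv> classes (\<lambda>m. frag {1..m})"

text \<open>By orbit counting, \<open>real (card (snd i)) / fact (fst i)\<close> is the reciprocal
  of the number of automorphisms.\<close>

definition frag_weight :: "real \<Rightarrow> nat \<times> nat set set set \<Rightarrow> real" where
  "frag_weight c i = frag_free_prob c * ((c * exp (- c)) ^ fst i * (real (card (snd i)) / fact (fst i)))"

lemma core_weight_frag:
  assumes "core_graphs K r {1..m} = frag {1..m}" "\<forall>H\<in>frag {1..m}. core_verts K r H = {1..m}"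
  shows "core_weight c K r Q m = exp (- circ_mean c K) * ((c * exp (- c)) ^ m * (real (card {H \<in> frag {1..m}. Q H}) / fact m))"
proof -
  have "(\<Sum>H\<in>{H \<in> frag {1..m}. Q H}. exp (- c * real (card (core_verts K r H)))) = (\<Sum>H\<in>{H \<in> frag {1..m}. Q H}. exp (- c) ^ m)"
    using assms(2) by (intro sum.cong) (auto simp: mult.commute simp flip: exp_of_nat_mult)
  then show ?thesis unfolding core_weight_def assms(1) by (simp add: power_mult_distrib)
qed

section \<open>Limit law on fragments\<close>

text \<open>Two limits in sequence. For fixed \<open>M\<close>, a large radius turns the cores of
  size at most \<open>M\<close> into all fragments of that size, and \<open>L\<close> tends to
  infinity, which replaces \<open>exp (- circ_mean c L)\<close> by \<open>frag_free_prob c\<close>.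
  The error \<open>D / real (Suc M)\<close> depends neither on \<open>L\<close> nor on the radius,
  so \<open>M\<close> may tend to infinity afterwards.\<close>

lemma sums_frag_weights:
  assumes c: "0 < c" "c < 1"
    and est: "\<And>L r M. K \<le> L \<Longrightarrow> r0 \<le> r \<Longrightarrow> \<bar>l - (\<Sum>m\<le>M. core_weight c L r Q m)\<bar> \<le> tail_const c L (Suc r) / real (Suc M)"
  shows "(\<lambda>m. frag_free_prob c * ((c * exp (- c)) ^ m * (real (card {H \<in> frag {1..m}. Q H}) / fact m))) sums l"
proof -
  define g where "g m = (c * exp (- c)) ^ m * (real (card {H \<in> frag {1..m}. Q H}) / fact m)" for m
  define D where "D = 1 / (1 - c)\<^sup>2"
  have bound: "\<bar>l - frag_free_prob c * (\<Sum>m\<le>M. g m)\<bar> \<le> D / real (Suc M)" for M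
  proof -
    from frag_eq_core_graphs[of M] obtain R where R: "\<forall>r\<ge>R. \<forall>m\<le>M. \<forall>K\<ge>m.
      core_graphs K r {1..m} = frag {1..m} \<and> (\<forall>H\<in>frag {1..m}. core_verts K r H = {1..m})" ..
    have bd: "\<bar>l - exp (- circ_mean c L) * (\<Sum>m\<le>M. g m)\<bar> \<le> D / real (Suc M)" if L: "max K M \<le> L" for L
    proof -
      define r where "r = max R r0"
      have "core_weight c L r Q m = exp (- circ_mean c L) * g m" if m: "m \<le> M" for m
      proof -
        have "R \<le> r" "m \<le> L" using m L by (auto simp: r_def)
        note RL = R[rule_format, OF this(1) m this(2)]
        show ?thesis unfolding g_def by (rule core_weight_frag[OF conjunct1[OF RL] conjunct2[OF RL]])
      qed
      then have "(\<Sum>m\<le>M. core_weight c L r Q m) = exp (- circ_mean c L) * (\<Sum>m\<le>M. g m)"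
        by (simp add: sum_distrib_left)
      moreover have "\<bar>l - (\<Sum>m\<le>M. core_weight c L r Q m)\<bar> \<le> tail_const c L (Suc r) / real (Suc M)"
        using L by (intro est) (auto simp: r_def)
      moreover have "tail_const c L (Suc r) / real (Suc M) \<le> D / real (Suc M)"
        unfolding D_def by (intro divide_right_mono tail_const_le c) simp
      ultimately show ?thesis by simp
    qed
    have lim: "(\<lambda>L. \<bar>l - exp (- circ_mean c L) * (\<Sum>m\<le>M. g m)\<bar>) \<longlonglongrightarrow> \<bar>l - frag_free_prob c * (\<Sum>m\<le>M. g m)\<bar>"
      by (intro tendsto_intros circ_mean_tendsto c)
    show ?thesis by (rule LIMSEQ_le_const2[OF lim], rule exI[of _ "max K M"], intro allI impI) (rule bd)
  qed
  have "(\<lambda>M. D / real (Suc M)) \<longlonglongrightarrow> 0" using LIMSEQ_Suc[OF lim_const_over_n] .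
  then have "(\<lambda>M. frag_free_prob c * (\<Sum>m\<le>M. g m) - l) \<longlonglongrightarrow> 0"
    by (rule Lim_null_comparison[rotated]) (use bound in \<open>auto simp: abs_minus_commute\<close>)
  then have "(\<lambda>M. frag_free_prob c * (\<Sum>m\<le>M. g m)) \<longlonglongrightarrow> l" by (simp add: LIM_zero_iff)
  then show ?thesis unfolding sums_def_le g_def[symmetric] by (simp add: sum_distrib_left)
qed

lemma udens_sums:
  assumes c: "0 < c" "c < 1"
  shows "(\<lambda>m. frag_free_prob c * ((c * exp (- c)) ^ m * udens m)) sums 1"
proof -
  have "(\<lambda>m. frag_free_prob c * ((c * exp (- c)) ^ m * (real (card {H \<in> frag {1..m}. True}) / fact m))) sums 1"
    by (rule sums_frag_weights[OF c, of 0 0]) (rule core_weight_True_sum[OF c(1)])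
  then show ?thesis by (simp add: udens_def nfrag_def)
qed

text \<open>\<open>Q\<close> must be the same for all \<open>L\<close> and \<open>r\<close>. It is
  membership of the type in \<open>Good\<close>, computed with the parameters of the sentence
  itself.\<close>

lemma sentence_sums:
  assumes c: "0 < c" "c < 1" and \<phi>: "sentence \<phi>"
  shows "\<exists>Q. (\<forall>f H. bij f \<longrightarrow> (Q (img f H) \<longleftrightarrow> Q H)) \<and>
    (\<lambda>m. frag_free_prob c * ((c * exp (- c)) ^ m * (real (card {H \<in> frag {1..m}. Q H}) / fact m))) sums limit_prob c \<phi>"
proof -
  obtain q K Good where h: "\<forall>c>0. \<forall>L\<ge>K. \<forall>r. 2 ^ q \<le> Suc r \<longrightarrow> (\<exists>l. prob_models c \<phi> \<longlonglongrightarrow> l \<and>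
    (\<forall>M. \<bar>l - (\<Sum>m\<le>M. core_weight c L r (\<lambda>H. gtype q K H \<in> Good) m)\<bar> \<le> tail_const c L (Suc r) / real (Suc M)))"
    using sentence_limit[OF \<phi>] by blast
  have "(\<lambda>m. frag_free_prob c * ((c * exp (- c)) ^ m * (real (card {H \<in> frag {1..m}. gtype q K H \<in> Good}) / fact m))) sums limit_prob c \<phi>"
  proof (rule sums_frag_weights[OF c, of K "2 ^ q"])
    fix L r M :: nat assume L: "K \<le> L" "2 ^ q \<le> r"
    have "2 ^ q \<le> Suc r" using L(2) by simp
    from h[rule_format, OF c(1) L(1) this] obtain l where l: "prob_models c \<phi> \<longlonglongrightarrow> l"
      and est: "\<forall>M. \<bar>l - (\<Sum>m\<le>M. core_weight c L r (\<lambda>H. gtype q K H \<in> Good) m)\<bar> \<le> tail_const c L (Suc r) / real (Suc M)" by blast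
    show "\<bar>limit_prob c \<phi> - (\<Sum>m\<le>M. core_weight c L r (\<lambda>H. gtype q K H \<in> Good) m)\<bar> \<le> tail_const c L (Suc r) / real (Suc M)"
      unfolding limit_prob_eqI[OF l] using est by blast
  qed
  then show ?thesis by (intro exI[of _ "\<lambda>H. gtype q K H \<in> Good"]) (simp add: gtype_img)
qed

lemma sum_frag_weight_level:
  assumes "A \<subseteq> frag_classes"
  shows "(\<Sum>C\<in>{C. (m, C) \<in> A}. frag_weight c (m, C)) =
    frag_free_prob c * ((c * exp (- c)) ^ m * (real (card (\<Union>{C. (m, C) \<in> A})) / fact m))"
proof -
  have "(\<Sum>H\<in>\<Union>{C. (m, C) \<in> A}. 1 :: real) = (\<Sum>C\<in>{C. (m, C) \<in> A}. \<Sum>H\<in>C. 1)"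
    by (rule sum_Union_classes[OF _ assms]) (simp add: finite_frag)
  then show ?thesis by (simp add: frag_weight_def sum_distrib_left sum_divide_distrib)
qed

lemma frag_weight_nonneg: "0 < c \<Longrightarrow> c < 1 \<Longrightarrow> 0 \<le> frag_weight c i"
  unfolding frag_weight_def using frag_free_prob_pos[of c] by simp

lemma frag_weight_pos:
  assumes "0 < c" "c < 1" "i \<in> frag_classes"
  shows "0 < frag_weight c i"
proof -
  obtain m C where i: "i = (m, C)" by fastforce
  have C: "(m, C) \<in> frag_classes" using assms(3) i by simp
  have "finite C" by (rule finite_subset[OF class_subset[OF C]]) (simp add: finite_frag)
  then have "0 < card C" using class_nonempty[OF C] by (simp add: card_gt_0_iff)
  then show ?thesis using assms frag_free_prob_pos[of c] by (simp add: frag_weight_def i)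
qed

lemma has_sum_frag_weight:
  assumes c: "0 < c" "c < 1" and A: "A \<subseteq> frag_classes"
    and s: "(\<lambda>m. frag_free_prob c * ((c * exp (- c)) ^ m * (real (card (\<Union>{C. (m, C) \<in> A})) / fact m))) sums l"
  shows "(frag_weight c has_sum l) A"
proof -
  let ?g = "\<lambda>m. frag_free_prob c * ((c * exp (- c)) ^ m * (real (card (\<Union>{C. (m, C) \<in> A})) / fact m))"
  have fin: "finite {C. (m, C) \<in> A}" for m
  proof (rule finite_subset)
    show "{C. (m, C) \<in> A} \<subseteq> snd ` {i \<in> frag_classes. fst i \<le> m}" using A by force
    show "finite (snd ` {i \<in> frag_classes. fst i \<le> m})" by (intro finite_imageI finite_classes_le finite_frag) simp
  qed
  have inner: "((\<lambda>C. frag_weight c (m, C)) has_sum ?g m) {C. (m, C) \<in> A}" for m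
    unfolding sum_frag_weight_level[OF A, symmetric] by (rule has_sum_finite[OF fin])
  have g0: "0 \<le> ?g m" for m using c frag_free_prob_pos[of c] by simp
  have g: "(?g has_sum l) UNIV" by (rule sums_nonneg_imp_has_sum_strong[OF s]) (use g0 in simp)
  have "frag_weight c summable_on Sigma UNIV (\<lambda>m. {C. (m, C) \<in> A})"
    by (rule summable_on_SigmaI[OF inner has_sum_imp_summable[OF g] frag_weight_nonneg[OF c]])
  from has_sum_SigmaI[OF inner g this] have "(frag_weight c has_sum l) (Sigma UNIV (\<lambda>m. {C. (m, C) \<in> A}))" .
  moreover have "Sigma UNIV (\<lambda>m. {C. (m, C) \<in> A}) = A" by auto
  ultimately show ?thesis by simp
qed

lemma has_sum_frag_weight_invariant:
  assumes c: "0 < c" "c < 1" and Q: "\<And>f H. bij f \<Longrightarrow> Q (img f H) \<longleftrightarrow> Q H"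
    and s: "(\<lambda>m. frag_free_prob c * ((c * exp (- c)) ^ m * (real (card {H \<in> frag {1..m}. Q H}) / fact m))) sums l"
  shows "(frag_weight c has_sum l) {i \<in> frag_classes. \<forall>H\<in>snd i. Q H}"
proof (rule has_sum_frag_weight[OF c])
  show "(\<lambda>m. frag_free_prob c * ((c * exp (- c)) ^ m *
      (real (card (\<Union>{C. (m, C) \<in> {i \<in> frag_classes. \<forall>H\<in>snd i. Q H}})) / fact m))) sums l"
    using s by (simp only: invariant_Union[where G = "\<lambda>m. frag {1..m}", OF Q])
qed auto

lemma has_sum_frag_weight_all:
  assumes c: "0 < c" "c < 1"
  shows "(frag_weight c has_sum 1) frag_classes"
proof -
  have "(frag_weight c has_sum 1) {i \<in> frag_classes. \<forall>H\<in>snd i. True}"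
    by (rule has_sum_frag_weight_invariant[OF c]) (use udens_sums[OF c] in \<open>simp_all add: udens_def nfrag_def\<close>)
  then show ?thesis by simp
qed

section \<open>Single weights and tails\<close>

text \<open>An isomorphism between two fragments on \<open>V\<close> maps \<open>V\<close> onto
  itself, because the edges determine the vertices; so a class lies in one orbit of the permutations
  of \<open>V\<close>.\<close>

lemma frag_class_card_le:
  assumes "(m, C) \<in> frag_classes"
  shows "card C \<le> fact m"
proof -
  define V where "V = {1..m}"
  have V: "finite V" "card V = m" by (auto simp: V_def)
  obtain H0 where H0: "H0 \<in> C" using class_nonempty[OF assms] by blast
  have CV: "C \<subseteq> frag V" using class_subset[OF assms] by (simp add: V_def)
  have "C \<subseteq> (\<lambda>g. img g H0) ` {g. g permutes V}"
  proof
    fix H assume H: "H \<in> C"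
    obtain f where f: "bij f" "H = img f H0" using class_iso[OF assms H0 H] unfolding iso_def by blast
    have H0p: "H0 \<subseteq> pairs V" and Hp: "H \<subseteq> pairs V" using CV H0 H by (auto simp: frag_def)
    obtain r where r: "nbhd H0 r (cyc m H0) = V" using CV H0 V(2) by (auto simp: frag_def)
    have "nbhd H r (cyc m H) = f ` V" unfolding f(2) cyc_img[OF f(1)] nbhd_img[OF f(1)] r ..
    moreover have "nbhd H r (cyc m H) \<subseteq> V" by (intro nbhd_subset_verts cyc_subset_verts Hp)
    ultimately have "f ` V \<subseteq> V" by simp
    moreover have inj: "inj_on f V" using bij_is_inj[OF f(1)] by (rule inj_on_subset) simp
    ultimately have fV: "f ` V = V" using V(1) by (intro card_subset_eq) (auto simp: card_image)
    define g where "g x = (if x \<in> V then f x else x)" for x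
    have "bij_betw f V V" using inj fV by (simp add: bij_betw_def)
    then have "bij_betw g V V" by (rule bij_betw_cong[THEN iffD1, rotated]) (simp add: g_def)
    then have "g permutes V" by (rule bij_imp_permutes) (simp add: g_def)
    moreover have "img g H0 = img f H0"
    proof (rule image_cong[OF refl])
      fix e assume "e \<in> H0"
      then have "e \<subseteq> V" using H0p by (auto simp: pairs_def)
      then show "g ` e = f ` e" by (intro image_cong) (auto simp: g_def)
    qed
    ultimately show "H \<in> (\<lambda>g. img g H0) ` {g. g permutes V}" using f(2) by (intro image_eqI[of _ _ g]) simp_all
  qed
  then have "card C \<le> card ((\<lambda>g. img g H0) ` {g. g permutes V})"
    by (intro card_mono finite_imageI finite_permutations V(1))
  also have "\<dots> \<le> card {g. g permutes V}" by (intro card_image_le finite_permutations V(1))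
  also have "\<dots> = fact m" by (rule card_permutations[OF V(2,1)])
  finally show ?thesis .
qed

lemma frag_weight_le:
  assumes c: "0 < c" "c < 1" and i: "i \<in> frag_classes"
  shows "frag_weight c i \<le> frag_free_prob c * (c * exp (- c)) ^ fst i"
proof -
  obtain m C where mC: "i = (m, C)" by fastforce
  have "card C \<le> fact m" using frag_class_card_le i mC by simp
  then have "real (card C) \<le> fact m" by (metis of_nat_fact of_nat_le_iff)
  then have "real (card C) / fact m \<le> 1" by simp
  then have "(c * exp (- c)) ^ m * (real (card C) / fact m) \<le> (c * exp (- c)) ^ m * 1"
    using c by (intro mult_left_mono) auto
  from mult_left_mono[OF this, of "frag_free_prob c"] show ?thesis
    unfolding frag_weight_def mC using frag_free_prob_pos[OF c(2)] by simp
qed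

lemma infsum_frag_weight_tail:
  assumes c: "0 < c" "c < 1"
  shows "infsum (frag_weight c) {i \<in> frag_classes. k \<le> fst i} =
    1 - (\<Sum>m<k. frag_free_prob c * ((c * exp (- c)) ^ m * udens m))"
proof -
  let ?A = "{i \<in> frag_classes. fst i < k}"
  have finC: "finite {C. (m, C) \<in> frag_classes}" for m
    by (rule finite_subset[of _ "snd ` {i \<in> frag_classes. fst i \<le> m}"])
      (force, intro finite_imageI finite_classes_le finite_frag, simp)
  have U: "\<Union>{C. (m, C) \<in> frag_classes} = frag {1..m}" for m :: nat
    using invariant_Union[of "\<lambda>_. True" "\<lambda>m. frag {1..m}" m] by simp
  have A: "?A = Sigma {..<k} (\<lambda>m. {C. (m, C) \<in> frag_classes})" by auto
  have "sum (frag_weight c) ?A = (\<Sum>m<k. \<Sum>C\<in>{C. (m, C) \<in> frag_classes}. frag_weight c (m, C))"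
    unfolding A using finC by (subst sum.Sigma) auto
  also have "\<dots> = (\<Sum>m<k. frag_free_prob c * ((c * exp (- c)) ^ m * udens m))"
    unfolding sum_frag_weight_level[OF order.refl] U by (simp add: udens_def nfrag_def)
  finally have sA: "sum (frag_weight c) ?A = (\<Sum>m<k. frag_free_prob c * ((c * exp (- c)) ^ m * udens m))" .
  have finA: "finite ?A" unfolding A using finC by auto
  have "(frag_weight c has_sum (1 - sum (frag_weight c) ?A)) (frag_classes - ?A)"
    by (rule has_sum_Diff[OF has_sum_frag_weight_all[OF c] has_sum_finite[OF finA]]) auto
  moreover have "frag_classes - ?A = {i \<in> frag_classes. k \<le> fst i}" by auto
  ultimately show ?thesis using sA by (simp add: infsumI)
qed

text \<open>Suppose \<open>udens\<close> is bounded by \<open>B\<close>. The total mass is 1 for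
  every \<open>c < 1\<close>, and \<open>c * exp (- c) \<le> exp (- 1)\<close> keeps the geometric
  series bounded, so \<open>frag_free_prob c\<close> is at least the fixed number
  \<open>d > 0\<close>. But \<open>frag_free_prob\<close> is continuous at 1 and vanishes
  there.\<close>

lemma udens_unbounded: "\<exists>m. B \<le> udens m"
proof (rule ccontr)
  assume "\<not> (\<exists>m. B \<le> udens m)"
  then have B: "udens m \<le> B" for m by (meson linear)
  have B1: "1 \<le> B" using B[of 0] by (simp add: udens_0)
  define d where "d = (1 - exp (- 1)) / B"
  have d: "0 < d" using B1 by (simp add: d_def)
  have ge: "d \<le> frag_free_prob c" if c: "0 < c" "c < 1" for c
  proof -
    let ?x = "c * exp (- c)"
    have "c \<le> exp (c - 1)" using exp_ge_add_one_self[of "c - 1"] by simp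
    then have "?x \<le> exp (c - 1) * exp (- c)" by (intro mult_right_mono) auto
    then have x1: "?x \<le> exp (- 1)" by (simp flip: exp_add)
    have e1: "exp (- 1) < (1 :: real)" by simp
    have x: "0 \<le> ?x" "?x < 1" using c x1 e1 by (simp, linarith)
    have S: "(\<lambda>m. frag_free_prob c * (?x ^ m * B)) sums (frag_free_prob c * (1 / (1 - ?x) * B))"
      using x by (intro sums_mult sums_mult2 geometric_sums) simp
    have le: "frag_free_prob c * (?x ^ m * udens m) \<le> frag_free_prob c * (?x ^ m * B)" for m
      using B x frag_free_prob_pos[OF c(2)] by (intro mult_left_mono) auto
    have "1 \<le> frag_free_prob c * (1 / (1 - ?x) * B)" by (rule sums_le[OF le udens_sums[OF c] S])
    also have "1 / (1 - ?x) * B \<le> 1 / (1 - exp (- 1)) * B"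
      using x1 e1 x B1 by (intro mult_right_mono divide_left_mono) auto
    finally have "1 \<le> frag_free_prob c * (1 / (1 - exp (- 1)) * B)" using frag_free_prob_pos[OF c(2)] by simp
    then show ?thesis using B1 e1 by (simp add: d_def field_simps)
  qed
  have "isCont frag_free_prob 1" unfolding frag_free_prob_def[abs_def] by (intro continuous_intros) auto
  \<comment> \<open>The shift by two keeps every term strictly between 0 and 1.\<close>
  moreover have "(\<lambda>n. 1 - 1 / real (Suc (Suc n))) \<longlonglongrightarrow> 1 - 0"
    by (intro tendsto_intros LIMSEQ_Suc[OF LIMSEQ_Suc[OF lim_const_over_n]])
  ultimately have "(\<lambda>n. frag_free_prob (1 - 1 / real (Suc (Suc n)))) \<longlonglongrightarrow> frag_free_prob 1"
    using isCont_tendsto_compose[of 1 frag_free_prob "\<lambda>n. 1 - 1 / real (Suc (Suc n))"] by simp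
  then have "d \<le> frag_free_prob 1"
    by (rule LIMSEQ_le_const) (intro exI[of _ 0] allI impI ge, simp_all)
  then show False using d by (simp add: frag_free_prob_def)
qed

text \<open>When the level rises by one, the left side shrinks exactly by the factor
  \<open>c * exp (- c)\<close>. The tail shrinks by no smaller factor, because \<open>udens\<close>
  is nondecreasing from 1 on. Thus level 0 decides, and there the claim is
  \<open>frag_free_prob c \<le> 1 - frag_free_prob c\<close>.\<close>

lemma frag_tail_ge:
  assumes c: "0 < c" "c < 1" and half: "frag_free_prob c \<le> 1 / 2"
  shows "frag_free_prob c * (c * exp (- c)) ^ k \<le> infsum (frag_weight c) {i \<in> frag_classes. Suc k \<le> fst i}"
proof -
  let ?x = "c * exp (- c)"
  define u where "u m = frag_free_prob c * (?x ^ m * udens m)" for m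
  have u: "u sums 1" unfolding u_def by (rule udens_sums[OF c])
  define T where "T k = 1 - (\<Sum>m<k. u m)" for k
  have T: "(\<lambda>n. u (n + k)) sums T k" for k unfolding T_def by (rule sums_split_initial_segment[OF u])
  have step: "?x * T (Suc k) \<le> T (Suc (Suc k))" for k
  proof (rule sums_le[OF _ sums_mult[OF T] T])
    fix n
    have "udens (n + Suc k) \<le> udens (n + Suc (Suc k))" by (rule udens_mono) auto
    then have "frag_free_prob c * (?x ^ (n + Suc (Suc k)) * udens (n + Suc k)) \<le> u (n + Suc (Suc k))"
      unfolding u_def using c frag_free_prob_pos[OF c(2)] by (intro mult_left_mono) auto
    then show "?x * u (n + Suc k) \<le> u (n + Suc (Suc k))" by (simp add: u_def mult_ac)
  qed
  have "frag_free_prob c * ?x ^ k \<le> T (Suc k)"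
  proof (induction k)
    case 0
    then show ?case using half by (simp add: T_def u_def udens_0)
  next
    case (Suc k)
    then have "?x * (frag_free_prob c * ?x ^ k) \<le> ?x * T (Suc k)" using c by (intro mult_left_mono) auto
    then show ?case using step[of k] by (simp add: mult_ac)
  qed
  then show ?thesis unfolding infsum_frag_weight_tail[OF c] T_def u_def .
qed

text \<open>Above the threshold probability a single level of the tail is enough, as soon as
  \<open>udens\<close> has exceeded \<open>1 / (c * exp (- c))\<close>.\<close>

lemma frag_tail_ge_eventually:
  assumes c: "0 < c" "c < 1"
  shows "\<exists>m. \<forall>k\<ge>m. frag_free_prob c * (c * exp (- c)) ^ k \<le> infsum (frag_weight c) {i \<in> frag_classes. Suc k \<le> fst i}"
proof -
  let ?x = "c * exp (- c)"
  have x: "0 < ?x" using c by simp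
  \<comment> \<open>The summand 1 excludes \<open>m0 = 0\<close>, where \<open>udens\<close> is 1
    and monotonicity does not apply.\<close>
  obtain m0 where m0: "1 / ?x + 1 \<le> udens m0" using udens_unbounded by blast
  have "1 \<le> m0" using m0 x by (cases m0) (auto simp: udens_0)
  have "frag_free_prob c * ?x ^ k \<le> infsum (frag_weight c) {i \<in> frag_classes. Suc k \<le> fst i}" if k: "m0 \<le> k" for k
  proof -
    define u where "u m = frag_free_prob c * (?x ^ m * udens m)" for m
    have u: "u sums 1" unfolding u_def by (rule udens_sums[OF c])
    have u0: "0 \<le> u m" for m using c frag_free_prob_pos[OF c(2)] udens_nonneg[of m] by (simp add: u_def)
    have "(\<Sum>m<Suc (Suc k). u m) \<le> suminf u" by (rule sum_le_suminf) (use u u0 in \<open>auto simp: sums_iff\<close>)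
    then have "u (Suc k) \<le> 1 - (\<Sum>m<Suc k. u m)" using u by (simp add: sums_iff)
    moreover have "frag_free_prob c * ?x ^ k \<le> u (Suc k)"
    proof -
      have "udens m0 \<le> udens (Suc k)" using k \<open>1 \<le> m0\<close> by (intro udens_mono) auto
      then have "1 / ?x \<le> udens (Suc k)" using m0 by linarith
      then have "1 \<le> ?x * udens (Suc k)" using x by (simp add: field_simps)
      then have "frag_free_prob c * ?x ^ k * 1 \<le> frag_free_prob c * ?x ^ k * (?x * udens (Suc k))"
        using c frag_free_prob_pos[OF c(2)] by (intro mult_left_mono) auto
      then show ?thesis by (simp add: u_def mult_ac)
    qed
    ultimately show ?thesis unfolding infsum_frag_weight_tail[OF c] u_def by linarith
  qed
  then show ?thesis by blast
qed

section \<open>Closure of the limit probabilities\<close>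

lemma limit_prob_eq_infsum:
  assumes c: "0 < c" "c < 1" and l: "l \<in> limit_probs c"
  shows "\<exists>A\<subseteq>frag_classes. l = infsum (frag_weight c) A"
proof -
  obtain \<phi> where \<phi>: "sentence \<phi>" "l = limit_prob c \<phi>" using l by (auto simp: limit_probs_def)
  obtain Q where Q: "\<And>f H. bij f \<Longrightarrow> Q (img f H) \<longleftrightarrow> Q H"
    and s: "(\<lambda>m. frag_free_prob c * ((c * exp (- c)) ^ m * (real (card {H \<in> frag {1..m}. Q H}) / fact m))) sums limit_prob c \<phi>"
    using sentence_sums[OF c \<phi>(1)] by blast
  from infsumI[OF has_sum_frag_weight_invariant[OF c Q s]] \<phi>(2)
  have "l = infsum (frag_weight c) {i \<in> frag_classes. \<forall>H\<in>snd i. Q H}" by simp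
  then show ?thesis by (intro exI[of _ "{i \<in> frag_classes. \<forall>H\<in>snd i. Q H}"]) auto
qed

text \<open>With circuits up to length \<open>L\<close> taken into account, the sum with
  \<open>exp (- circ_mean c L)\<close> in place of \<open>frag_free_prob c\<close> is an exact limit
  probability. The weights of the limit law arise only as \<open>L\<close> tends to infinity, hence
  the closure.\<close>

lemma sum_frag_weight_in_closure:
  assumes c: "0 < c" "c < 1" and A: "finite A" "A \<subseteq> frag_classes"
  shows "sum (frag_weight c) A \<in> closure (limit_probs c)"
proof -
  obtain M where M: "fst ` A \<subseteq> {..M}" using finite_nat_iff_bounded_le[of "fst ` A"] A(1) by auto
  from frag_eq_core_graphs[of M] obtain R where R: "\<forall>r\<ge>R. \<forall>m\<le>M. \<forall>K\<ge>m.
      core_graphs K r {1..m} = frag {1..m} \<and> (\<forall>H\<in>frag {1..m}. core_verts K r H = {1..m})" ..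
  define s where "s = (\<Sum>i\<in>A. (c * exp (- c)) ^ fst i * (real (card (snd i)) / fact (fst i)))"
  have mem: "exp (- circ_mean c L) * s \<in> limit_probs c" if L: "M \<le> L" for L
  proof -
    have RL: "core_graphs L R {1..m} = frag {1..m} \<and> (\<forall>H\<in>frag {1..m}. core_verts L R H = {1..m})" if m: "m \<le> M" for m
      by (rule R[rule_format, OF order.refl m order.trans[OF m L]])
    have lev: "fst i \<le> M" if "i \<in> A" for i using M that by auto
    have AL: "A \<subseteq> core_classes L R"
    proof
      fix i assume i: "i \<in> A"
      obtain m C where mC: "i = (m, C)" by fastforce
      then have "m \<le> M" using lev[OF i] by simp
      have "(m, C) \<in> frag_classes" using i mC A(2) by blast
      then show "i \<in> core_classes L R" unfolding mC classes_def by (simp only: conjunct1[OF RL[OF \<open>m \<le> M\<close>]] mem_Sigma_iff)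
    qed
    have "class_weight c L R i = exp (- circ_mean c L) * ((c * exp (- c)) ^ fst i * (real (card (snd i)) / fact (fst i)))" if i: "i \<in> A" for i
    proof -
      obtain m C where mC: "i = (m, C)" by fastforce
      have "(m, C) \<in> frag_classes" using i mC A(2) by blast
      then have "C \<subseteq> frag {1..m}" by (rule class_subset)
      have "m \<le> M" using lev[OF i] mC by simp
      have "(\<Sum>H\<in>C. exp (- c * real (card (core_verts L R H)))) = (\<Sum>H\<in>C. exp (- c) ^ m)"
      proof (intro sum.cong refl)
        fix H assume "H \<in> C"
        then have "H \<in> frag {1..m}" by (rule subsetD[OF \<open>C \<subseteq> frag {1..m}\<close>])
        then have "core_verts L R H = {1..m}" by (rule bspec[OF conjunct2[OF RL[OF \<open>m \<le> M\<close>]]])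
        then show "exp (- c * real (card (core_verts L R H))) = exp (- c) ^ m"
          by (simp add: mult.commute flip: exp_of_nat_mult)
      qed
      then show ?thesis by (simp add: class_weight_def mC power_mult_distrib)
    qed
    then have "sum (class_weight c L R) A = exp (- circ_mean c L) * s" by (simp add: s_def sum_distrib_left)
    then show ?thesis using sum_class_weight_in_limit_probs[OF c(1) A(1) AL] by simp
  qed
  have lim: "(\<lambda>L. exp (- circ_mean c (L + M)) * s) \<longlonglongrightarrow> frag_free_prob c * s"
    by (rule tendsto_mult[OF LIMSEQ_ignore_initial_segment[OF circ_mean_tendsto[OF c]] tendsto_const])
  have cl: "exp (- circ_mean c (L + M)) * s \<in> closure (limit_probs c)" for L
    by (rule subsetD[OF closure_subset mem[OF le_add2]])
  have "frag_free_prob c * s \<in> closure (limit_probs c)"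
    by (rule closed_sequentially[OF closed_closure cl lim])
  moreover have "frag_free_prob c * s = sum (frag_weight c) A"
    unfolding s_def sum_distrib_left by (rule sum.cong[OF refl]) (simp only: frag_weight_def)
  ultimately show ?thesis by (simp only:)
qed

lemma closure_limit_probs_subcritical:
  assumes c: "0 < c" "c < 1"
    and tail: "\<And>k. m \<le> k \<Longrightarrow> frag_free_prob c * (c * exp (- c)) ^ k \<le> infsum (frag_weight c) {i \<in> frag_classes. Suc k \<le> fst i}"
  shows "\<exists>F t. finite F \<and> 0 < t \<and> closure (limit_probs c) = (\<Union>A\<in>Pow F. {sum (frag_weight c) A..sum (frag_weight c) A + t})
    \<and> (m = 0 \<longrightarrow> F = {} \<and> t = 1)"
proof (rule closure_subset_sums[where I = frag_classes and lev = fst])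
  show "(frag_weight c has_sum 1) frag_classes" by (rule has_sum_frag_weight_all[OF c])
  show "0 < frag_weight c i" if "i \<in> frag_classes" for i by (rule frag_weight_pos[OF c that])
  show "frag_weight c i \<le> frag_free_prob c * (c * exp (- c)) ^ fst i" if "i \<in> frag_classes" for i
    by (rule frag_weight_le[OF c that])
  show "finite {i \<in> frag_classes. fst i < k}" for k
    by (rule finite_subset[OF _ finite_classes_le[where M = k]]) (auto intro: finite_frag)
  show "0 < c * exp (- c)" using c by simp
  have "c * exp (- c) < 1 * 1" using c by (intro mult_strict_mono) auto
  then show "c * exp (- c) < 1" by simp
  show "0 < frag_free_prob c" by (rule frag_free_prob_pos[OF c(2)])
  show "frag_free_prob c * (c * exp (- c)) ^ k \<le> infsum (frag_weight c) {i \<in> frag_classes. Suc k \<le> fst i}" if "m \<le> k" for k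
    by (rule tail[OF that])
  show "\<exists>A\<subseteq>frag_classes. l = infsum (frag_weight c) A" if "l \<in> limit_probs c" for l
    by (rule limit_prob_eq_infsum[OF c that])
  show "sum (frag_weight c) A \<in> closure (limit_probs c)" if "finite A" "A \<subseteq> frag_classes" for A
    by (rule sum_frag_weight_in_closure[OF c that])
qed

lemma finite_union_subcritical:
  assumes c: "0 < c" "c < 1"
  shows "finite_union_closed_intervals (closure (limit_probs c))"
proof -
  from frag_tail_ge_eventually[OF c] obtain m where m: "\<forall>k\<ge>m. frag_free_prob c * (c * exp (- c)) ^ k
    \<le> infsum (frag_weight c) {i \<in> frag_classes. Suc k \<le> fst i}" ..
  have "\<exists>F t. finite F \<and> 0 < t \<and> closure (limit_probs c) = (\<Union>A\<in>Pow F. {sum (frag_weight c) A..sum (frag_weight c) A + t})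
    \<and> (m = 0 \<longrightarrow> F = {} \<and> t = 1)"
    by (rule closure_limit_probs_subcritical[OF c]) (rule m[rule_format])
  then obtain F t where F: "finite F" "0 < t"
    "closure (limit_probs c) = (\<Union>A\<in>Pow F. {sum (frag_weight c) A..sum (frag_weight c) A + t})"
    by (elim exE conjE) (rule that)
  show ?thesis unfolding finite_union_closed_intervals_def
  proof (rule exI[of _ "(\<lambda>A. {sum (frag_weight c) A..sum (frag_weight c) A + t}) ` Pow F"], intro conjI ballI)
    show "finite ((\<lambda>A. {sum (frag_weight c) A..sum (frag_weight c) A + t}) ` Pow F)" using F(1) by simp
    show "closure (limit_probs c) = \<Union>((\<lambda>A. {sum (frag_weight c) A..sum (frag_weight c) A + t}) ` Pow F)" by (rule F(3))
    fix I assume "I \<in> (\<lambda>A. {sum (frag_weight c) A..sum (frag_weight c) A + t}) ` Pow F"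
    then obtain A where A: "I = {sum (frag_weight c) A..sum (frag_weight c) A + t}" by blast
    show "\<exists>a b. a < b \<and> I = {a..b}"
      by (rule exI[of _ "sum (frag_weight c) A"], rule exI[of _ "sum (frag_weight c) A + t"]) (use A F(2) in simp)
  qed
qed

lemma closure_limit_probs_half:
  assumes c: "0 < c" "c < 1" "frag_free_prob c \<le> 1 / 2"
  shows "closure (limit_probs c) = {0..1}"
proof -
  have "\<exists>F t. finite F \<and> 0 < t \<and> closure (limit_probs c) = (\<Union>A\<in>Pow F. {sum (frag_weight c) A..sum (frag_weight c) A + t})
    \<and> ((0 :: nat) = 0 \<longrightarrow> F = {} \<and> t = 1)"
    by (rule closure_limit_probs_subcritical[OF c(1,2)]) (rule frag_tail_ge[OF c])
  then obtain F t
    where "closure (limit_probs c) = (\<Union>A\<in>Pow F. {sum (frag_weight c) A..sum (frag_weight c) A + t})"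
      "(0 :: nat) = 0 \<longrightarrow> F = {} \<and> t = 1"
    by (elim exE conjE) (rule that)
  then show ?thesis by simp
qed

text \<open>The graph without circuits alone has limiting weight \<^term>\<open>frag_free_prob c\<close>, which cannot be
  split.\<close>

lemma limit_probs_gap:
  assumes c: "0 < c" "c < 1" "1 / 2 < frag_free_prob c"
  shows "\<exists>a\<in>{0..1}. \<exists>b\<in>{0..1}. a < b \<and> closure (limit_probs c) \<inter> {a..b} = {}"
proof -
  let ?p = "frag_free_prob c" and ?w = "frag_weight c"
  have sum: "(?w has_sum 1) frag_classes" by (rule has_sum_frag_weight_all[OF c(1,2)])
  have sm: "?w summable_on S" if "S \<subseteq> frag_classes" for S
    using sum that by (meson has_sum_imp_summable summable_on_subset_banach)
  have "card (frag {1..0 :: nat}) = 1" using nfrag_0 by (simp add: nfrag_def)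
  then obtain H where H: "frag {1..0 :: nat} = {H}" by (meson card_1_singletonE)
  then obtain C where C: "(0, C) \<in> frag_classes" "H \<in> C" using ex_class[of H "\<lambda>m. frag {1..m}" 0] by auto
  have "C \<subseteq> {H}" using class_subset[OF C(1)] H by simp
  then have "C = {H}" using C(2) by auto
  then have w0: "?w (0, C) = ?p" by (simp add: frag_weight_def)
  have split: "l \<le> 1 - ?p \<or> ?p \<le> l" if l: "l \<in> limit_probs c" for l
  proof -
    obtain A where A: "A \<subseteq> frag_classes" "l = infsum ?w A" using limit_prob_eq_infsum[OF c(1,2) l] by blast
    show ?thesis
    proof (cases "(0, C) \<in> A")
      case True
      have "sum ?w {(0, C)} \<le> infsum ?w A"
        by (rule finite_sum_le_infsum) (use True sm[OF A(1)] frag_weight_nonneg[OF c(1,2)] in auto)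
      then show ?thesis using w0 A(2) by simp
    next
      case False
      have "(?w has_sum (1 - sum ?w {(0, C)})) (frag_classes - {(0, C)})"
        by (rule has_sum_Diff[OF sum has_sum_finite]) (use C in auto)
      then have "infsum ?w (frag_classes - {(0, C)}) = 1 - ?p" using w0 by (simp add: infsumI)
      moreover have "infsum ?w A \<le> infsum ?w (frag_classes - {(0, C)})"
        by (rule infsum_mono2) (use A(1) False frag_weight_nonneg[OF c(1,2)] in \<open>auto intro!: sm\<close>)
      ultimately show ?thesis using A(2) by simp
    qed
  qed
  have p1: "?p \<le> 1"
  proof -
    have "sum ?w {(0, C)} \<le> 1"
      by (rule finite_sum_le_has_sum[OF sum]) (use C frag_weight_nonneg[OF c(1,2)] in auto)
    then show ?thesis using w0 by simp
  qed
  have sub: "closure (limit_probs c) \<subseteq> {..1 - ?p} \<union> {?p..}"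
    by (rule closure_minimal) (use split in \<open>auto intro!: closed_Un\<close>)
  \<comment> \<open>\<open>a\<close> and \<open>b\<close> divide the open interval from
    \<open>1 - ?p\<close> to \<open>?p\<close> into thirds.\<close>
  define a where "a = (2 - ?p) / 3"
  define b where "b = (1 + ?p) / 3"
  have ab: "1 - ?p < a" "a < b" "b < ?p" "0 \<le> a" "b \<le> 1" using c(3) p1 by (auto simp: a_def b_def)
  have "closure (limit_probs c) \<inter> {a..b} = {}"
  proof (rule equals0I)
    fix z assume "z \<in> closure (limit_probs c) \<inter> {a..b}"
    then show False using sub ab by auto
  qed
  then show ?thesis using ab by (intro bexI[of _ a] bexI[of _ b]) auto
qed

theorem theorem1:
  shows "(\<exists>!c. 0 < c \<and> threshold_eq c) \<and> 93 / 100 \<le> c\<^sub>0 \<and> c\<^sub>0 < 94 / 100 \<and>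
    (\<forall>c>0.
       (\<forall>\<phi>. sentence \<phi> \<longrightarrow> convergent (prob_models c \<phi>)) \<and>
       finite_union_closed_intervals (closure (limit_probs c)) \<and>
       (c\<^sub>0 \<le> c \<longrightarrow> closure (limit_probs c) = {0..1}) \<and>
       (c < c\<^sub>0 \<longrightarrow>
         (\<exists>a\<in>{0..1}. \<exists>b\<in>{0..1}. a < b \<and> closure (limit_probs c) \<inter> {a..b} = {})))"
proof (intro conjI allI impI)
  show "\<exists>!c. 0 < c \<and> threshold_eq c" by (rule threshold_unique)
  show "93 / 100 \<le> c\<^sub>0" "c\<^sub>0 < 94 / 100" by (rule c0_props)+
  fix c :: real assume c: "0 < c"
  show "convergent (prob_models c \<phi>)" if "sentence \<phi>" for \<phi>
    using sentence_convergent[OF c that] unfolding convergent_def .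
  show "finite_union_closed_intervals (closure (limit_probs c))"
  proof (cases "c < 1")
    case True
    then show ?thesis by (rule finite_union_subcritical[OF c])
  next
    case False
    then have "closure (limit_probs c) = {0..1}" by (intro closure_limit_probs_supercritical) simp
    moreover have "finite_union_closed_intervals {0..1}" unfolding finite_union_closed_intervals_def
    proof (rule exI[of _ "{{0..1}}"], intro conjI ballI)
      fix I :: "real set" assume I: "I \<in> {{0..1}}"
      show "\<exists>a b. a < b \<and> I = {a..b}" by (rule exI[of _ 0], rule exI[of _ 1]) (use I in simp)
    qed simp_all
    ultimately show ?thesis by simp
  qed
  show "closure (limit_probs c) = {0..1}" if "c\<^sub>0 \<le> c"
  proof (cases "c < 1")
    case True
    then show ?thesis using frag_free_prob_threshold[OF c True] that by (intro closure_limit_probs_half[OF c]) auto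
  next
    case False
    then show ?thesis by (intro closure_limit_probs_supercritical) simp
  qed
  show "\<exists>a\<in>{0..1}. \<exists>b\<in>{0..1}. a < b \<and> closure (limit_probs c) \<inter> {a..b} = {}" if "c < c\<^sub>0"
  proof -
    have c1: "c < 1" using that c0_props(2) by simp
    then show ?thesis using frag_free_prob_threshold[OF c c1] that by (intro limit_probs_gap[OF c]) auto
  qed
qed

end
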